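(* Let $\Omega\subset\mathbb{R}^n$ be open and bounded, and let $\rho$ be a kernel with compact support satisfying hypotheses (K0)-(K4) listed in the context and normalized by $\int_{\mathbb{R}^n}\rho\,dx=n$. Let $C:\mathbb{R}^{n\times n}_{\mathrm{sym}}\to\mathbb{R}^{n\times n}_{\mathrm{sym}}$ be a linear, symmetric, positive definite map, and let $f\in L^2(\Omega;\mathbb{R}^n)$. Then there exists a unique weak solution $v\in H^\rho_0(\Omega;\mathbb{R}^n)$ of $$-\operatorname{div}_\rho\big(C[D_{\rho,\mathrm{sym}}v]\big)=f\ \text{ in }\Omega,\qquad v=0\ \text{ on }\Omega^c,$$ that is, a unique $v\in H_0^\rho(\Omega;\mathbb{R}^n)$ with $$\int_{\mathbb{R}^n}C[D_{\rho,\mathrm{sym}}v]:D_{\rho,\mathrm{sym}}w\,dx=\int_{\Omega}f\cdot w\,dx\qquad\text{for all }w\in H_0^\rho(\Omega;\mathbb{R}^n).$$ Moreover, it is the unique minimizer over $H_0^\rho(\Omega;\mathbb{R}^n)$ of the functional $$E(v)=\frac12\int_{\mathbb{R}^n}C[D_{\rho,\mathrm{sym}}v]:D_{\rho,\mathrm{sym}}v\,dx-\int_\Omega f\cdot v\,dx.$$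
   Context: Hypotheses on the kernel. Since $\rho$ is radial we also write $\rho(x)=\rho(|x|)$. (K0) $\rho:\mathbb{R}^n\setminus\{0\}\to[0,\infty)$ is radial; $\rho\in L^1_{\mathrm{loc}}(\mathbb{R}^n)$ with $\int_{\mathbb{R}^n}\min\{1,|x|^{-1}\}\rho(x)\,dx<\infty$; and $\inf_{\overline{B(0,\varepsilon)}}\rho>0$ for some $\varepsilon>0$ (this $\varepsilon$ is fixed below). (K1) There is $\nu>0$ such that $f_\rho(r)=r^{n-2}\rho(r)$ and $r\mapsto r^\nu f_\rho(r)$ are decreasing (non-strictly) on $(0,\varepsilon)$. (K2) $f_\rho$ is smooth on $(0,\infty)$ and for every positive integer $k$ there is $C(k)>0$ with $\left|\frac{d^k f_\rho}{dr^k}(r)\right|\le C(k)r^{-k}f_\rho(r)$ for $r\in(0,\varepsilon)$. (K3) There is $s\in(0,1)$ such that $r\mapsto r^{n+s-1}\rho(r)$ is almost decreasing on $(0,\varepsilon)$. (K4) There is $t\in(0,1)$ such that $r\mapsto r^{n+t-1}\rho(r)$ is almost increasing on $(0,\varepsilon)$. A function $h$ is almost decreasing if there is $C>0$ with $h(a)\ge C\,h(b)$ whenever $a\le b$; almost increasing if there is $C>0$ with $h(a)\le C\,h(b)$ whenever $a\le b$. Nonlocal operators. For $u\in C_c^\infty(\mathbb{R}^n;\mathbb{R}^n)$, $D_\rho u(x)=\int_{\mathbb{R}^n}\frac{u(x)-u(y)}{|x-y|}\otimes\frac{x-y}{|x-y|}\rho(x-y)\,dy\in\mathbb{R}^{n\times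 n}$. For $\Phi\in C_c^\infty(\mathbb{R}^n;\mathbb{R}^{n\times n})$, $\operatorname{div}_\rho\Phi(x)=\int_{\mathbb{R}^n}\frac{\Phi(x)-\Phi(y)}{|x-y|}\frac{x-y}{|x-y|}\rho(x-y)\,dy$. $D_{\rho,\mathrm{sym}}u=\tfrac12(D_\rho u+(D_\rho u)^T)$. Spaces. $H^{\rho}(\mathbb{R}^n;\mathbb{R}^n)=\{u\in L^2(\mathbb{R}^n;\mathbb{R}^n): D_\rho u\in L^2(\mathbb{R}^n;\mathbb{R}^{n\times n})\}$ with norm $\|u\|_{L^2}+\|D_\rho u\|_{L^2}$, where $D_\rho u$ is understood in the weak sense ($\int D_\rho u:\Phi\,dx=-\int u\cdot\operatorname{div}_\rho\Phi\,dx$ for all $\Phi\in C_c^\infty(\mathbb{R}^n;\mathbb{R}^{n\times n})$); equivalently, it is the closure of $C_c^\infty(\mathbb{R}^n;\mathbb{R}^n)$ in this norm. $H_0^\rho(\Omega;\mathbb{R}^n)=\{u\in H^\rho(\mathbb{R}^n;\mathbb{R}^n):u=0\text{ a.e. in }\Omega^c\}$. $C$ symmetric means $C[M]:N=M:C[N]$; positive definite means $C[M]:M>0$ for all nonzero $M\in\mathbb{R}^{n\times n}_{\mathrm{sym}}$. Here $A:B=\sum_{i,j}a_{ij}b_{ij}$. *)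

theory Defs
  imports "HOL-Analysis.Analysis"
begin

primrec Ck_on :: "nat \<Rightarrow> 'a::euclidean_space set \<Rightarrow> ('a \<Rightarrow> 'b::real_normed_vector) \<Rightarrow> bool" where
  "Ck_on 0 S f \<longleftrightarrow> continuous_on S f"
| "Ck_on (Suc k) S f \<longleftrightarrow> (\<forall>x\<in>S. f differentiable (at x)) \<and>
     (\<forall>v. Ck_on k S (\<lambda>x. frechet_derivative f (at x) v))"

(* Only meant for open sets S, because the derivatives are taken in the whole space. *)
definition smooth_on :: "'a::euclidean_space set \<Rightarrow> ('a \<Rightarrow> 'b::real_normed_vector) \<Rightarrow> bool" where
  "smooth_on S f \<longleftrightarrow> (\<forall>k. Ck_on k S f)"

definition test_function :: "('a::euclidean_space \<Rightarrow> 'b::real_normed_vector) \<Rightarrow> bool" where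
  "test_function \<phi> \<longleftrightarrow> smooth_on UNIV \<phi> \<and> compact (closure {x. \<phi> x \<noteq> 0})"

(* Square-integrable functions are functions, not classes: identification almost everywhere
   is made explicit wherever uniqueness is asserted. The norm on real^'n^'n is the Frobenius
   norm, and the inner product of two matrices is their Frobenius product A : B. *)
definition sq_integrable :: "'a measure \<Rightarrow> ('a \<Rightarrow> 'b::real_normed_vector) \<Rightarrow> bool" where
  "sq_integrable M u \<longleftrightarrow> u \<in> borel_measurable M \<and> integrable M (\<lambda>x. (norm (u x))\<^sup>2)"

text \<open>
  A kernel is a total function on the Euclidean space, but it is mathematically a function on
  the complement of the origin: its value at the origin is arbitrary and is never used, except
  on a null set of an integral.
\<close>

definition radial :: "(real^'n \<Rightarrow> real) \<Rightarrow> bool" where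
  "radial \<rho> \<longleftrightarrow> (\<forall>x y. x \<noteq> 0 \<longrightarrow> y \<noteq> 0 \<longrightarrow> norm x = norm y \<longrightarrow> \<rho> x = \<rho> y)"

(* For r > 0 and radial \<rho> the choice of the unit vector does not matter. *)
definition profile :: "(real^'n \<Rightarrow> real) \<Rightarrow> real \<Rightarrow> real" where
  "profile \<rho> r = \<rho> (r *\<^sub>R (SOME e. norm e = 1))"

definition f_kernel :: "(real^'n \<Rightarrow> real) \<Rightarrow> real \<Rightarrow> real" where
  "f_kernel \<rho> r = r powr (real CARD('n) - 2) * profile \<rho> r"

definition almost_decreasing_on :: "real set \<Rightarrow> (real \<Rightarrow> real) \<Rightarrow> bool" where
  "almost_decreasing_on S h \<longleftrightarrow> (\<exists>C>0. \<forall>a\<in>S. \<forall>b\<in>S. a \<le> b \<longrightarrow> h a \<ge> C * h b)"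

definition almost_increasing_on :: "real set \<Rightarrow> (real \<Rightarrow> real) \<Rightarrow> bool" where
  "almost_increasing_on S h \<longleftrightarrow> (\<exists>C>0. \<forall>a\<in>S. \<forall>b\<in>S. a \<le> b \<longrightarrow> h a \<le> C * h b)"

definition K0 :: "(real^'n \<Rightarrow> real) \<Rightarrow> real \<Rightarrow> bool" where
  "K0 \<rho> \<epsilon> \<longleftrightarrow>
     (\<forall>x. x \<noteq> 0 \<longrightarrow> \<rho> x \<ge> 0) \<and> radial \<rho> \<and>
     (\<forall>K. compact K \<longrightarrow> set_integrable lebesgue K \<rho>) \<and>
     integrable lebesgue (\<lambda>x. min 1 (1 / norm x) * \<rho> x) \<and>
     \<epsilon> > 0 \<and> (INF x\<in>cball 0 \<epsilon> - {0}. \<rho> x) > 0"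

definition K1 :: "(real^'n \<Rightarrow> real) \<Rightarrow> real \<Rightarrow> bool" where
  "K1 \<rho> \<epsilon> \<longleftrightarrow> (\<exists>\<nu>>0. antimono_on {0<..<\<epsilon>} (f_kernel \<rho>) \<and>
     antimono_on {0<..<\<epsilon>} (\<lambda>r. r powr \<nu> * f_kernel \<rho> r))"

definition K2 :: "(real^'n \<Rightarrow> real) \<Rightarrow> real \<Rightarrow> bool" where
  "K2 \<rho> \<epsilon> \<longleftrightarrow> smooth_on {0<..} (f_kernel \<rho>) \<and>
     (\<forall>k\<ge>1. \<exists>C>0. \<forall>r\<in>{0<..<\<epsilon>}.
        \<bar>(deriv ^^ k) (f_kernel \<rho>) r\<bar> \<le> C * r powr (- real k) * f_kernel \<rho> r)"

definition K3 :: "(real^'n \<Rightarrow> real) \<Rightarrow> real \<Rightarrow> bool" where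
  "K3 \<rho> \<epsilon> \<longleftrightarrow> (\<exists>s\<in>{0<..<1}. almost_decreasing_on {0<..<\<epsilon>}
     (\<lambda>r. r powr (real CARD('n) + s - 1) * profile \<rho> r))"

definition K4 :: "(real^'n \<Rightarrow> real) \<Rightarrow> real \<Rightarrow> bool" where
  "K4 \<rho> \<epsilon> \<longleftrightarrow> (\<exists>t\<in>{0<..<1}. almost_increasing_on {0<..<\<epsilon>}
     (\<lambda>r. r powr (real CARD('n) + t - 1) * profile \<rho> r))"

definition div_nl :: "(real^'n \<Rightarrow> real) \<Rightarrow> (real^'n \<Rightarrow> real^'n^'n) \<Rightarrow> real^'n \<Rightarrow> real^'n" where
  "div_nl \<rho> \<Phi> x = (\<integral>y. \<rho> (x - y) *\<^sub>R
     (((1 / norm (x - y)) *\<^sub>R (\<Phi> x - \<Phi> y)) *v ((1 / norm (x - y)) *\<^sub>R (x - y))) \<partial>lebesgue)"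

definition weak_D_nl ::
  "(real^'n \<Rightarrow> real) \<Rightarrow> (real^'n \<Rightarrow> real^'n) \<Rightarrow> (real^'n \<Rightarrow> real^'n^'n) \<Rightarrow> bool" where
  "weak_D_nl \<rho> u G \<longleftrightarrow> sq_integrable lebesgue G \<and>
     (\<forall>\<Phi>. test_function \<Phi> \<longrightarrow>
        (\<integral>x. G x \<bullet> \<Phi> x \<partial>lebesgue) = - (\<integral>x. u x \<bullet> div_nl \<rho> \<Phi> x \<partial>lebesgue))"

(* A representative of the weak nonlocal gradient, which is determined almost everywhere. *)
definition D_nl :: "(real^'n \<Rightarrow> real) \<Rightarrow> (real^'n \<Rightarrow> real^'n) \<Rightarrow> real^'n \<Rightarrow> real^'n^'n" where
  "D_nl \<rho> u = (SOME G. weak_D_nl \<rho> u G)"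

definition D_nl_sym :: "(real^'n \<Rightarrow> real) \<Rightarrow> (real^'n \<Rightarrow> real^'n) \<Rightarrow> real^'n \<Rightarrow> real^'n^'n" where
  "D_nl_sym \<rho> u x = (1/2) *\<^sub>R (D_nl \<rho> u x + transpose (D_nl \<rho> u x))"

definition H_nl :: "(real^'n \<Rightarrow> real) \<Rightarrow> (real^'n \<Rightarrow> real^'n) set" where
  "H_nl \<rho> = {u. sq_integrable lebesgue u \<and> (\<exists>G. weak_D_nl \<rho> u G)}"

definition H0_nl :: "(real^'n \<Rightarrow> real) \<Rightarrow> (real^'n) set \<Rightarrow> (real^'n \<Rightarrow> real^'n) set" where
  "H0_nl \<rho> \<Omega> = {u \<in> H_nl \<rho>. AE x in lebesgue. x \<notin> \<Omega> \<longrightarrow> u x = 0}"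

definition sym_mats :: "(real^'n^'n) set" where
  "sym_mats = {M. transpose M = M}"

text \<open>
  Linear symmetric positive definite maps from the space of symmetric matrices to itself. The
  values of the map outside this space are unconstrained and never used.
\<close>

definition elasticity_tensor :: "(real^'n^'n \<Rightarrow> real^'n^'n) \<Rightarrow> bool" where
  "elasticity_tensor C \<longleftrightarrow>
     C \<in> sym_mats \<rightarrow> sym_mats \<and>
     (\<forall>M\<in>sym_mats. \<forall>N\<in>sym_mats. C (M + N) = C M + C N) \<and>
     (\<forall>c. \<forall>M\<in>sym_mats. C (c *\<^sub>R M) = c *\<^sub>R C M) \<and>
     (\<forall>M\<in>sym_mats. \<forall>N\<in>sym_mats. C M \<bullet> N = M \<bullet> C N) \<and>
     (\<forall>M\<in>sym_mats. M \<noteq> 0 \<longrightarrow> C M \<bullet> M > 0)"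

definition weak_solution ::
  "(real^'n \<Rightarrow> real) \<Rightarrow> (real^'n^'n \<Rightarrow> real^'n^'n) \<Rightarrow> (real^'n) set \<Rightarrow> (real^'n \<Rightarrow> real^'n)
    \<Rightarrow> (real^'n \<Rightarrow> real^'n) \<Rightarrow> bool" where
  "weak_solution \<rho> C \<Omega> f v \<longleftrightarrow> v \<in> H0_nl \<rho> \<Omega> \<and>
     (\<forall>w\<in>H0_nl \<rho> \<Omega>.
        (\<integral>x. C (D_nl_sym \<rho> v x) \<bullet> D_nl_sym \<rho> w x \<partial>lebesgue) =
        (\<integral>x. f x \<bullet> w x \<partial>lebesgue_on \<Omega>))"

definition energy ::
  "(real^'n \<Rightarrow> real) \<Rightarrow> (real^'n^'n \<Rightarrow> real^'n^'n) \<Rightarrow> (real^'n) set \<Rightarrow> (real^'n \<Rightarrow> real^'n)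
    \<Rightarrow> (real^'n \<Rightarrow> real^'n) \<Rightarrow> real" where
  "energy \<rho> C \<Omega> f v =
     1/2 * (\<integral>x. C (D_nl_sym \<rho> v x) \<bullet> D_nl_sym \<rho> v x \<partial>lebesgue)
     - (\<integral>x. f x \<bullet> v x \<partial>lebesgue_on \<Omega>)"

end

(*
  By the Lax-Milgram argument (a minimising sequence of the energy and the parallelogram identity) it is
  enough that the energy form is coercive on H_0 and that weak nonlocal gradients are closed in L^2.

  Korn: the components of the nonlocal gradient commute and are antisymmetric, so the integral of
  Du : (Du)^T is the square norm of the trace of Du, and the norm of Du is at most sqrt 2 times that of its
  symmetric part.

  Poincare: write U for a mollification of u. The pairing of the nonlocal gradient of U with the classical
  gradient of U is, up to lower order terms, a positive form in the squared norms of U - U(. - z) with a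
  weight of size |z|^(-n-1-s), obtained by a radial integration by parts from the monotonicity of
  r^(n-2) rho(r). With U at scale d this bounds the change of u between the scales d and d/2 by d^(s/2),
  hence, after summing over dyadic scales, the error of mollification by the norms of u and Du. A sequence
  violating the Poincare inequality would therefore be compact, with a nonzero limit that has zero nonlocal
  gradient; but exponentials exp(h.x), h real, are eigenfunctions of the nonlocal gradient with nonzero
  eigenvalue, so such a limit is orthogonal to all of them and vanishes by Stone-Weierstrass.
*)
theory Submission
  imports Defs "HOL-Complex_Analysis.Great_Picard"
begin


section \<open>Square-integrable functions\<close>

text \<open>The pairing with the classical gradient is chosen because the integral of (U(x+z) -
  U(x)) (grad U(x) . z) is the radial derivative of half the squared norm of U(. + z) - U, so it can
  be integrated by parts in |z|; the norm of the nonlocal gradient itself is a double integral over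
  two shifts whose integrand has no sign. The price is a factor 1/d for the classical gradient at
  scale d, while mollification at scale d against the weight gains d^(1+s); what remains is d^s, and
  its root is summable over dyadic scales. (K3) yields the power s, and (K1) carries the lower bound
  from r^(n-2) rho(r) to its derivative. Real frequencies are admissible because function and kernel
  have compact support, and with t = z . h they make the component of the eigenvalue along h a
  weighted integral of t (exp t - 1), which is never negative; for imaginary frequencies positivity
  would need an argument of its own. All estimates are made for mollifications, whose nonlocal
  gradients are absolutely convergent integrals; shifted mollifiers as test functions identify them
  with the mollified weak gradient.\<close>

definition l2 :: "'a measure \<Rightarrow> ('a \<Rightarrow> 'b::euclidean_space) \<Rightarrow> real" where
  "l2 M u = sqrt (\<integral>x. (norm (u x))\<^sup>2 \<partial>M)"

lemma l2_nonneg [simp]: "0 \<le> l2 M u"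
  by (simp add: l2_def)

lemma l2_square: "(l2 M u)\<^sup>2 = (\<integral>x. (norm (u x))\<^sup>2 \<partial>M)"
  by (simp add: l2_def)

lemma sq_integrable_measurable [dest]: "sq_integrable M u \<Longrightarrow> u \<in> borel_measurable M"
  by (simp add: sq_integrable_def)

lemma sq_integrable_norm_mult:
  fixes f :: "'a \<Rightarrow> 'b::euclidean_space" and g :: "'a \<Rightarrow> 'c::euclidean_space"
  assumes "sq_integrable M f" "sq_integrable M g"
  shows "integrable M (\<lambda>x. norm (f x) * norm (g x))"
proof (rule Bochner_Integration.integrable_bound)
  show "integrable M (\<lambda>x. (norm (f x))\<^sup>2 + (norm (g x))\<^sup>2)"
    using assms by (auto simp: sq_integrable_def)
  show "AE x in M. norm (norm (f x) * norm (g x)) \<le> norm ((norm (f x))\<^sup>2 + (norm (g x))\<^sup>2)"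
  proof (rule AE_I2)
    fix x
    have "2 * norm (f x) * norm (g x) \<le> (norm (f x))\<^sup>2 + (norm (g x))\<^sup>2"
      by (rule sum_squares_bound)
    moreover have "0 \<le> norm (f x) * norm (g x)" by simp
    ultimately show "norm (norm (f x) * norm (g x)) \<le> norm ((norm (f x))\<^sup>2 + (norm (g x))\<^sup>2)"
      unfolding real_norm_def abs_mult abs_norm_cancel by linarith
  qed
qed (use assms in \<open>auto simp: sq_integrable_def\<close>)

lemma sq_integrable_inner:
  fixes f g :: "'a \<Rightarrow> 'b::euclidean_space"
  assumes "sq_integrable M f" "sq_integrable M g"
  shows "integrable M (\<lambda>x. f x \<bullet> g x)"
  by (rule Bochner_Integration.integrable_bound[OF sq_integrable_norm_mult[OF assms]])
    (use assms in \<open>auto simp: sq_integrable_def Cauchy_Schwarz_ineq2\<close>)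

lemma sq_integrable_add:
  fixes f g :: "'a \<Rightarrow> 'b::euclidean_space"
  assumes "sq_integrable M f" "sq_integrable M g"
  shows "sq_integrable M (\<lambda>x. f x + g x)"
proof -
  have "integrable M (\<lambda>x. f x \<bullet> f x + g x \<bullet> f x + (f x \<bullet> g x + g x \<bullet> g x))"
    by (intro Bochner_Integration.integrable_add sq_integrable_inner assms)
  then have "integrable M (\<lambda>x. (norm (f x + g x))\<^sup>2)"
    unfolding power2_norm_eq_inner inner_add_left inner_add_right .
  then show ?thesis
    using assms by (auto simp: sq_integrable_def)
qed

lemma sq_integrable_scaleR:
  fixes f :: "'a \<Rightarrow> 'b::euclidean_space"
  assumes "sq_integrable M f"
  shows "sq_integrable M (\<lambda>x. c *\<^sub>R f x)"
  using assms by (auto simp: sq_integrable_def power_mult_distrib)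

lemma sq_integrable_diff:
  fixes f g :: "'a \<Rightarrow> 'b::euclidean_space"
  assumes "sq_integrable M f" "sq_integrable M g"
  shows "sq_integrable M (\<lambda>x. f x - g x)"
  using sq_integrable_add[OF assms(1) sq_integrable_scaleR[OF assms(2), of "-1"]] by simp

lemma sq_integrable_zero [simp]: "sq_integrable M (\<lambda>x. 0 :: 'b::euclidean_space)"
  by (simp add: sq_integrable_def)

lemma sq_integrable_cong_AE:
  fixes f g :: "'a \<Rightarrow> 'b::euclidean_space"
  assumes "sq_integrable M f" "AE x in M. f x = g x" "g \<in> borel_measurable M"
  shows "sq_integrable M g"
proof -
  have "integrable M (\<lambda>x. (norm (g x))\<^sup>2) \<longleftrightarrow> integrable M (\<lambda>x. (norm (f x))\<^sup>2)"
    by (rule integrable_cong_AE) (use assms in \<open>auto simp: sq_integrable_def\<close>)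
  with assms show ?thesis by (simp add: sq_integrable_def)
qed

lemma l2_cong_AE:
  fixes f g :: "'a \<Rightarrow> 'b::euclidean_space"
  assumes "AE x in M. f x = g x" "f \<in> borel_measurable M" "g \<in> borel_measurable M"
  shows "l2 M f = l2 M g"
  unfolding l2_def by (rule arg_cong[of _ _ sqrt], rule integral_cong_AE) (use assms in auto)

lemma l2_norm_mult:
  fixes f :: "'a \<Rightarrow> 'b::euclidean_space" and g :: "'a \<Rightarrow> 'c::euclidean_space"
  assumes f: "sq_integrable M f" and g: "sq_integrable M g"
  shows "(\<integral>x. norm (f x) * norm (g x) \<partial>M) \<le> l2 M f * l2 M g"
proof -
  have [measurable]: "f \<in> borel_measurable M" "g \<in> borel_measurable M"
    using f g by auto
  have i: "integrable M (\<lambda>x. (norm (f x))\<^sup>2)" "integrable M (\<lambda>x. (norm (g x))\<^sup>2)"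
    using f g by (auto simp: sq_integrable_def)
  let ?I = "\<integral>x. norm (f x) * norm (g x) \<partial>M"
  have "(\<integral>\<^sup>+x. ennreal (norm (f x)) * ennreal (norm (g x)) \<partial>M)\<^sup>2
      \<le> (\<integral>\<^sup>+x. ennreal (norm (f x)) ^ 2 \<partial>M) * (\<integral>\<^sup>+x. ennreal (norm (g x)) ^ 2 \<partial>M)"
    by (rule Cauchy_Schwarz_nn_integral) auto
  also have "(\<integral>\<^sup>+x. ennreal (norm (f x)) * ennreal (norm (g x)) \<partial>M) = ennreal ?I"
    by (subst nn_integral_eq_integral[OF sq_integrable_norm_mult[OF f g], symmetric])
       (auto simp: ennreal_mult)
  also have "(\<integral>\<^sup>+x. ennreal (norm (f x)) ^ 2 \<partial>M) = ennreal ((l2 M f)\<^sup>2)"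
    unfolding l2_square by (subst nn_integral_eq_integral[OF i(1), symmetric]) (auto simp: ennreal_power)
  also have "(\<integral>\<^sup>+x. ennreal (norm (g x)) ^ 2 \<partial>M) = ennreal ((l2 M g)\<^sup>2)"
    unfolding l2_square by (subst nn_integral_eq_integral[OF i(2), symmetric]) (auto simp: ennreal_power)
  finally have "ennreal (?I\<^sup>2) \<le> ennreal ((l2 M f * l2 M g)\<^sup>2)"
    by (simp add: ennreal_power ennreal_mult[symmetric] power_mult_distrib)
  then have "?I\<^sup>2 \<le> (l2 M f * l2 M g)\<^sup>2"
    by (subst (asm) ennreal_le_iff) auto
  then show ?thesis
    by (rule power2_le_imp_le) simp
qed

lemma l2_inner:
  fixes f g :: "'a \<Rightarrow> 'b::euclidean_space"
  assumes f: "sq_integrable M f" and g: "sq_integrable M g"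
  shows "\<bar>\<integral>x. f x \<bullet> g x \<partial>M\<bar> \<le> l2 M f * l2 M g"
proof -
  have "\<bar>\<integral>x. f x \<bullet> g x \<partial>M\<bar> \<le> (\<integral>x. norm (f x \<bullet> g x) \<partial>M)"
    using integral_norm_bound[of M "\<lambda>x. f x \<bullet> g x"] by simp
  also have "\<dots> \<le> (\<integral>x. norm (f x) * norm (g x) \<partial>M)"
    by (rule integral_mono)
      (use sq_integrable_inner[OF f g] sq_integrable_norm_mult[OF f g] in \<open>auto simp: Cauchy_Schwarz_ineq2\<close>)
  also note l2_norm_mult[OF f g]
  finally show ?thesis .
qed

lemma l2_square_inner: "(l2 M f)\<^sup>2 = (\<integral>x. f x \<bullet> f x \<partial>M)"
  by (simp add: l2_square power2_norm_eq_inner)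

lemma l2_triangle:
  fixes f g :: "'a \<Rightarrow> 'b::euclidean_space"
  assumes f: "sq_integrable M f" and g: "sq_integrable M g"
  shows "l2 M (\<lambda>x. f x + g x) \<le> l2 M f + l2 M g"
proof (rule power2_le_imp_le)
  note [simp] = sq_integrable_inner[OF f f] sq_integrable_inner[OF f g] sq_integrable_inner[OF g g]
  have "(l2 M (\<lambda>x. f x + g x))\<^sup>2 = (\<integral>x. f x \<bullet> f x + 2 * (f x \<bullet> g x) + g x \<bullet> g x \<partial>M)"
    unfolding l2_square_inner
    by (rule Bochner_Integration.integral_cong) (auto simp: inner_add_left inner_add_right inner_commute)
  also have "\<dots> = (l2 M f)\<^sup>2 + 2 * (\<integral>x. f x \<bullet> g x \<partial>M) + (l2 M g)\<^sup>2"
    by (simp add: l2_square_inner)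
  also have "\<dots> \<le> (l2 M f + l2 M g)\<^sup>2"
    using l2_inner[OF f g] by (simp add: power2_sum)
  finally show "(l2 M (\<lambda>x. f x + g x))\<^sup>2 \<le> (l2 M f + l2 M g)\<^sup>2" .
qed simp

lemma l2_scaleR: "l2 M (\<lambda>x. c *\<^sub>R f x) = \<bar>c\<bar> * l2 M f"
  by (simp add: l2_def power_mult_distrib real_sqrt_mult)

lemma l2_minus_commute: "l2 M (\<lambda>x. f x - g x) = l2 M (\<lambda>x. g x - f x)"
  by (simp add: l2_def norm_minus_commute)

lemma l2_triangle_diff:
  fixes f g h :: "'a \<Rightarrow> 'b::euclidean_space"
  assumes "sq_integrable M f" "sq_integrable M g" "sq_integrable M h"
  shows "l2 M (\<lambda>x. f x - h x) \<le> l2 M (\<lambda>x. f x - g x) + l2 M (\<lambda>x. g x - h x)"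
  using l2_triangle[OF sq_integrable_diff[OF assms(1,2)] sq_integrable_diff[OF assms(2,3)]] by simp

lemma l2_le_add_diff:
  fixes f g :: "'a \<Rightarrow> 'b::euclidean_space"
  assumes "sq_integrable M f" "sq_integrable M g"
  shows "l2 M f \<le> l2 M g + l2 M (\<lambda>x. f x - g x)"
  using l2_triangle[OF assms(2) sq_integrable_diff[OF assms]] by simp

lemma l2_eq_0_AE:
  fixes f :: "'a \<Rightarrow> 'b::euclidean_space"
  assumes "sq_integrable M f" "l2 M f = 0"
  shows "AE x in M. f x = 0"
proof -
  have "(\<integral>x. (norm (f x))\<^sup>2 \<partial>M) = 0"
    using assms(2) l2_square[of M f] by simp
  then have "AE x in M. (norm (f x))\<^sup>2 = 0"
    by (subst (asm) integral_nonneg_eq_0_iff_AE) (use assms in \<open>auto simp: sq_integrable_def\<close>)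
  then show ?thesis by simp
qed

lemma nn_integral_l2:
  assumes "sq_integrable M f"
  shows "(\<integral>\<^sup>+x. ennreal ((norm (f x))\<^sup>2) \<partial>M) = ennreal ((l2 M f)\<^sup>2)"
  unfolding l2_square by (rule nn_integral_eq_integral) (use assms in \<open>auto simp: sq_integrable_def\<close>)

lemma l2_le_nn_integral:
  fixes f :: "'a \<Rightarrow> 'b::euclidean_space"
  assumes "f \<in> borel_measurable M" "0 \<le> c" "(\<integral>\<^sup>+x. ennreal ((norm (f x))\<^sup>2) \<partial>M) \<le> ennreal (c\<^sup>2)"
  shows "sq_integrable M f" "l2 M f \<le> c"
proof -
  show s: "sq_integrable M f"
    unfolding sq_integrable_def
    by (intro conjI integrableI_bounded) (use assms in \<open>auto intro: le_less_trans\<close>)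
  show "l2 M f \<le> c"
    using assms(2,3) unfolding nn_integral_l2[OF s] by (auto intro: power2_le_imp_le)
qed

lemma tendsto_l2_imp_tendsto_inner:
  fixes f g :: "nat \<Rightarrow> 'a \<Rightarrow> 'b::euclidean_space"
  assumes f: "\<And>n. sq_integrable M (f n)" "sq_integrable M F" "(\<lambda>n. l2 M (\<lambda>x. f n x - F x)) \<longlonglongrightarrow> 0"
    and g: "\<And>n. sq_integrable M (g n)" "sq_integrable M G" "(\<lambda>n. l2 M (\<lambda>x. g n x - G x)) \<longlonglongrightarrow> 0"
  shows "(\<lambda>n. \<integral>x. f n x \<bullet> g n x \<partial>M) \<longlonglongrightarrow> (\<integral>x. F x \<bullet> G x \<partial>M)"
proof (rule LIM_zero_cancel, rule Lim_null_comparison)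
  let ?a = "\<lambda>n. l2 M (\<lambda>x. f n x - F x)" and ?b = "\<lambda>n. l2 M (\<lambda>x. g n x - G x)"
  show "\<forall>\<^sub>F n in sequentially. norm ((\<integral>x. f n x \<bullet> g n x \<partial>M) - (\<integral>x. F x \<bullet> G x \<partial>M))
      \<le> ?a n * ?b n + ?a n * l2 M G + l2 M F * ?b n"
  proof (rule always_eventually, rule allI)
    fix n
    note d = sq_integrable_diff[OF f(1,2), of n] sq_integrable_diff[OF g(1,2), of n]
    have "(\<integral>x. f n x \<bullet> g n x \<partial>M) - (\<integral>x. F x \<bullet> G x \<partial>M) = (\<integral>x. f n x \<bullet> g n x - F x \<bullet> G x \<partial>M)"
      by (simp add: sq_integrable_inner f g)
    also have "\<dots> = (\<integral>x. (f n x - F x) \<bullet> (g n x - G x) + (f n x - F x) \<bullet> G x + F x \<bullet> (g n x - G x) \<partial>M)"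
      by (rule Bochner_Integration.integral_cong) (auto simp: algebra_simps)
    also have "\<dots> = (\<integral>x. (f n x - F x) \<bullet> (g n x - G x) \<partial>M) + (\<integral>x. (f n x - F x) \<bullet> G x \<partial>M)
        + (\<integral>x. F x \<bullet> (g n x - G x) \<partial>M)"
      by (simp add: sq_integrable_inner[OF d(1) d(2)] sq_integrable_inner[OF d(1) g(2)] sq_integrable_inner[OF f(2) d(2)])
    finally show "norm ((\<integral>x. f n x \<bullet> g n x \<partial>M) - (\<integral>x. F x \<bullet> G x \<partial>M)) \<le> ?a n * ?b n + ?a n * l2 M G + l2 M F * ?b n"
      using l2_inner[OF d] l2_inner[OF d(1) g(2)] l2_inner[OF f(2) d(2)] by simp
  qed
  show "(\<lambda>n. ?a n * ?b n + ?a n * l2 M G + l2 M F * ?b n) \<longlonglongrightarrow> 0"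
    using tendsto_add[OF tendsto_add[OF tendsto_mult[OF f(3) g(3)] tendsto_mult_right[OF f(3), of "l2 M G"]]
      tendsto_mult_left[OF g(3), of "l2 M F"]] by (simp add: mult.commute)
qed

text \<open>A subsequence whose consecutive differences have norm at most 4^-k converges almost
  everywhere; Fatou's lemma then transfers the Cauchy bound of the whole sequence to the pointwise
  limit.\<close>

theorem Riesz_Fischer:
  fixes u :: "nat \<Rightarrow> 'a \<Rightarrow> 'b::euclidean_space"
  assumes u: "\<And>n. sq_integrable M (u n)"
    and C: "\<And>e. 0 < e \<Longrightarrow> \<exists>N. \<forall>m\<ge>N. \<forall>n\<ge>N. l2 M (\<lambda>x. u m x - u n x) < e"
  obtains v where "sq_integrable M v" "(\<lambda>n. l2 M (\<lambda>x. u n x - v x)) \<longlonglongrightarrow> 0"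
proof -
  have "\<exists>r. \<forall>k. (\<forall>m\<ge>r k. \<forall>n\<ge>r k. l2 M (\<lambda>x. u m x - u n x) < (1/4)^k) \<and> r k < r (Suc k)"
  proof (rule dependent_nat_choice)
    show "\<exists>r. \<forall>m\<ge>r. \<forall>n\<ge>r. l2 M (\<lambda>x. u m x - u n x) < (1/4)^0"
      using C[of 1] by auto
    fix r k
    obtain N where "\<forall>m\<ge>N. \<forall>n\<ge>N. l2 M (\<lambda>x. u m x - u n x) < (1/4)^Suc k"
      using C[of "(1/4)^Suc k"] by auto
    then show "\<exists>r'. (\<forall>m\<ge>r'. \<forall>n\<ge>r'. l2 M (\<lambda>x. u m x - u n x) < (1/4)^Suc k) \<and> r < r'"
      by (intro exI[of _ "max N (Suc r)"]) auto
  qed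
  then obtain r where r: "\<And>k m n. m \<ge> r k \<Longrightarrow> n \<ge> r k \<Longrightarrow> l2 M (\<lambda>x. u m x - u n x) < (1/4)^k"
    and rS: "\<And>k. r k < r (Suc k)"
    by blast
  have sm: "strict_mono r" using rS by (simp add: strict_mono_Suc_iff)
  note [measurable] = sq_integrable_measurable[OF u]
  define d where "d = (\<lambda>k x. u (r (Suc k)) x - u (r k) x)"
  have d: "sq_integrable M (d k)" for k
    unfolding d_def by (intro sq_integrable_diff u)
  note [measurable] = sq_integrable_measurable[OF d]
  have dk: "(l2 M (d k))\<^sup>2 \<le> (1/16)^k" for k
  proof -
    have "l2 M (d k) \<le> (1/4)^k"
      unfolding d_def using r[of k "r (Suc k)" "r k"] rS[of k] by simp
    then have "(l2 M (d k))\<^sup>2 \<le> ((1/4)^k)\<^sup>2"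
      by (rule power_mono) simp
    also have "((1/4::real)^k)\<^sup>2 = ((1/4)\<^sup>2)^k"
      by (metis power_mult mult.commute)
    also have "((1/4::real)\<^sup>2)^k = (1/16)^k"
      by (simp add: power_divide)
    finally show ?thesis .
  qed
  \<comment> \<open>The squared norms of the differences are at most 16^-k, so the weight 4^k still
    leaves a convergent series. Its finiteness almost everywhere forces |d k x| <= 2^-k for large k,
    which makes the differences absolutely summable.\<close>
  have "(\<integral>\<^sup>+x. (\<Sum>k. ennreal (4^k * (norm (d k x))\<^sup>2)) \<partial>M) = (\<Sum>k. \<integral>\<^sup>+x. ennreal (4^k * (norm (d k x))\<^sup>2) \<partial>M)"
    by (rule nn_integral_suminf) auto
  also have "\<dots> = (\<Sum>k. ennreal (4^k * (l2 M (d k))\<^sup>2))"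
    by (intro suminf_cong) (simp add: ennreal_mult nn_integral_cmult nn_integral_l2[OF d])
  also have "\<dots> \<le> (\<Sum>k. ennreal ((1/4)^k))"
  proof (intro suminf_le ennreal_leI)
    fix k
    have "4^k * (l2 M (d k))\<^sup>2 \<le> 4^k * (1/16)^k"
      by (intro mult_left_mono dk) auto
    also have "4^k * (1/16::real)^k = (1/4)^k"
      by (simp add: power_mult_distrib[symmetric])
    finally show "4^k * (l2 M (d k))\<^sup>2 \<le> (1/4)^k" .
  qed auto
  also have "\<dots> < \<infinity>"
  proof -
    have "(\<lambda>k. (1/4)^k) sums (1 / (1 - 1/4::real))"
      by (rule geometric_sums) simp
    then have "(\<Sum>k. ennreal ((1/4)^k)) = ennreal (1 / (1 - 1/4))"
      by (intro suminf_ennreal_eq) auto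
    then show ?thesis by (simp only: ennreal_less_top infinity_ennreal_def)
  qed
  finally have "AE x in M. (\<Sum>k. ennreal (4^k * (norm (d k x))\<^sup>2)) \<noteq> \<infinity>"
    by (intro nn_integral_PInf_AE) auto
  then have conv: "AE x in M. convergent (\<lambda>k. u (r k) x)"
  proof (rule AE_mp, intro AE_I2 impI)
    fix x assume fin: "(\<Sum>k. ennreal (4^k * (norm (d k x))\<^sup>2)) \<noteq> \<infinity>"
    have f4: "(4::real)^k = (2^k)\<^sup>2" for k
      by (induction k) (auto simp: power2_eq_square)
    have "summable (\<lambda>k. 4^k * (norm (d k x))\<^sup>2)"
      using fin by (intro summable_suminf_not_top) auto
    then have "(\<lambda>k. 4^k * (norm (d k x))\<^sup>2) \<longlonglongrightarrow> 0"
      by (rule summable_LIMSEQ_zero)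
    then have "\<forall>\<^sub>F k in sequentially. 4^k * (norm (d k x))\<^sup>2 < 1"
      by (rule order_tendstoD) simp
    then have "\<forall>\<^sub>F k in sequentially. norm (norm (d k x)) \<le> (1/2)^k"
    proof eventually_elim
      case (elim k)
      have "(2^k * norm (d k x))\<^sup>2 < 1\<^sup>2"
        using elim unfolding f4 power_mult_distrib power_one .
      then have "2^k * norm (d k x) < 1"
        by (rule power_less_imp_less_base) simp
      then show ?case by (simp add: field_simps power_divide)
    qed
    then have "summable (\<lambda>k. norm (d k x))"
      by (rule summable_comparison_test_ev) (simp add: summable_geometric)
    then have "summable (\<lambda>k. d k x)"
      by (rule summable_norm_cancel)
    then have "convergent (\<lambda>n. \<Sum>k<n. d k x)"
      by (simp add: summable_iff_convergent)
    moreover have "(\<Sum>k<n. d k x) = u (r n) x - u (r 0) x" for n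
      unfolding d_def by (rule sum_lessThan_telescope)
    ultimately have "convergent (\<lambda>n. u (r n) x - u (r 0) x)" by simp
    then show "convergent (\<lambda>n. u (r n) x)"
      using convergent_add[OF _ convergent_const[of "u (r 0) x"]] by fastforce
  qed
  define v where "v = (\<lambda>x. lim (\<lambda>k. u (r k) x))"
  have [measurable]: "v \<in> borel_measurable M"
    unfolding v_def by measurable
  have lim: "AE x in M. (\<lambda>k. u (r k) x) \<longlonglongrightarrow> v x"
    using conv by eventually_elim (simp add: v_def convergent_LIMSEQ_iff)
  \<comment> \<open>Fatou is applied along the subsequence \<open>r\<close> with \<open>n\<close>
    fixed. Square integrability of the difference comes with the bound, and that of \<open>v\<close>
    follows by subtracting from some \<open>u N\<close>.\<close>
  have key: "sq_integrable M (\<lambda>x. u n x - v x) \<and> l2 M (\<lambda>x. u n x - v x) \<le> e"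
    if e: "0 < e" and N: "\<forall>m\<ge>N. \<forall>n\<ge>N. l2 M (\<lambda>x. u m x - u n x) < e" and n: "n \<ge> N" for n N e
  proof -
    have "(\<integral>\<^sup>+x. ennreal ((norm (u n x - v x))\<^sup>2) \<partial>M)
        = (\<integral>\<^sup>+x. liminf (\<lambda>k. ennreal ((norm (u n x - u (r k) x))\<^sup>2)) \<partial>M)"
    proof (rule nn_integral_cong_AE, use lim in eventually_elim)
      case (elim x)
      have "(\<lambda>k. ennreal ((norm (u n x - u (r k) x))\<^sup>2)) \<longlonglongrightarrow> ennreal ((norm (u n x - v x))\<^sup>2)"
        by (intro tendsto_intros elim)
      then show ?case
        using lim_imp_Liminf[OF sequentially_bot] by metis
    qed
    also have "\<dots> \<le> liminf (\<lambda>k. \<integral>\<^sup>+x. ennreal ((norm (u n x - u (r k) x))\<^sup>2) \<partial>M)"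
      by (rule nn_integral_liminf) auto
    also have "\<dots> \<le> limsup (\<lambda>k. \<integral>\<^sup>+x. ennreal ((norm (u n x - u (r k) x))\<^sup>2) \<partial>M)"
      by (rule Liminf_le_Limsup) simp
    also have "\<dots> \<le> ennreal (e\<^sup>2)"
    proof (rule Limsup_bounded)
      show "\<forall>\<^sub>F k in sequentially. (\<integral>\<^sup>+x. ennreal ((norm (u n x - u (r k) x))\<^sup>2) \<partial>M) \<le> ennreal (e\<^sup>2)"
        using eventually_ge_at_top[of N]
      proof eventually_elim
        case (elim k)
        have "r k \<ge> N" using elim seq_suble[OF sm, of k] by linarith
        then have "l2 M (\<lambda>x. u n x - u (r k) x) \<le> e" using N n by (auto intro: less_imp_le)
        then show ?case
          unfolding nn_integral_l2[OF sq_integrable_diff[OF u u]] by (intro ennreal_leI power_mono) auto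
      qed
    qed
    finally show ?thesis
      using l2_le_nn_integral[of "\<lambda>x. u n x - v x" M e] e by auto
  qed
  show thesis
  proof
    obtain N where N: "\<forall>m\<ge>N. \<forall>n\<ge>N. l2 M (\<lambda>x. u m x - u n x) < 1"
      using C[of 1] by auto
    have "sq_integrable M (\<lambda>x. u N x - (u N x - v x))"
      by (rule sq_integrable_diff[OF u]) (use key[OF _ N, of N] in simp)
    then show "sq_integrable M v" by simp
    show "(\<lambda>n. l2 M (\<lambda>x. u n x - v x)) \<longlonglongrightarrow> 0"
    proof (rule LIMSEQ_I)
      fix e :: real assume e: "0 < e"
      obtain N where N: "\<forall>m\<ge>N. \<forall>n\<ge>N. l2 M (\<lambda>x. u m x - u n x) < e/2"
        using C[of "e/2"] e by auto
      show "\<exists>N. \<forall>n\<ge>N. norm (l2 M (\<lambda>x. u n x - v x) - 0) < e"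
        using key[OF _ N] e by (intro exI[of _ N]) fastforce
    qed
  qed
qed

text \<open>Truncating \<open>u\<close> in space by a continuous cutoff and in size by projection
  onto a ball gives a bounded function of compact support near \<open>u\<close>. The continuous
  functions that converge to \<open>u\<close> almost everywhere, truncated in the same way, have a
  common bound and support, so dominated convergence turns pointwise into mean-square
  convergence.\<close>

lemma l2_dense_continuous:
  fixes u :: "'a::euclidean_space \<Rightarrow> 'b::euclidean_space"
  assumes u: "sq_integrable lborel u" and e: "0 < e"
  obtains h r where "continuous_on UNIV h" "\<And>x. r < norm x \<Longrightarrow> h x = 0" "sq_integrable lborel h"
    "l2 lborel (\<lambda>x. u x - h x) < e"
proof -
  note [measurable] = sq_integrable_measurable[OF u]
  have "u \<in> borel_measurable lebesgue" by (rule measurable_completion) simp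
  then have "u measurable_on UNIV"
    using lebesgue_measurable_imp_measurable_on[of u UNIV] by simp
  then obtain N g where N: "negligible N" and g: "\<And>n. continuous_on UNIV (g n)"
    and lim: "\<And>x. x \<notin> N \<Longrightarrow> (\<lambda>n. g n x) \<longlonglongrightarrow> u x"
    unfolding measurable_on_def by auto
  have AEN: "AE x in lborel. x \<notin> N"
    using N unfolding negligible_iff_null_sets by (auto dest!: AE_not_in simp: AE_completion_iff)
  \<comment> \<open>The nearest-point projection onto a ball is a continuous truncation of vectors:
    it fixes the ball pointwise and does not increase norms.\<close>
  define T where "T = (\<lambda>m::nat. closest_point (cball (0::'b) (real m)))"
  define c where "c = (\<lambda>(m::nat) (x::'a). max 0 (min 1 (real m + 1 - norm x)))"
  have Tc: "continuous_on UNIV (T m)" for m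
    unfolding T_def by (rule continuous_on_closest_point) auto
  have Tn: "norm (T m y) \<le> real m" for m y
    using closest_point_in_set[of "cball (0::'b) (real m)" y] by (auto simp: T_def)
  have Tid: "norm y \<le> real m \<Longrightarrow> T m y = y" for m y
    unfolding T_def by (rule closest_point_self) auto
  have Tle: "norm (T m y) \<le> norm y" for m y
    using closest_point_lipschitz[of "cball (0::'b) (real m)" y 0] closest_point_self[of 0 "cball (0::'b) (real m)"]
    by (auto simp: T_def)
  have c01: "0 \<le> c m x" "c m x \<le> 1" for m x by (auto simp: c_def)
  have cc: "continuous_on UNIV (c m)" for m
    unfolding c_def by (intro continuous_intros)
  have c0: "real m + 1 < norm x \<Longrightarrow> c m x = 0" for m x by (auto simp: c_def)
  have c1: "norm x \<le> real m \<Longrightarrow> c m x = 1" for m x by (auto simp: c_def)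
  note [measurable] = borel_measurable_continuous_onI[OF Tc] borel_measurable_continuous_onI[OF cc]
    borel_measurable_continuous_onI[OF g]
  define w where "w = (\<lambda>m x. c m x *\<^sub>R T m (u x))"
  have [measurable]: "w m \<in> borel_measurable borel" for m unfolding w_def by measurable
  have cT: "norm (c m x *\<^sub>R T m y) \<le> norm y" "norm (c m x *\<^sub>R T m y) \<le> real m" for m x y
    using mult_mono[OF c01(2)[of m x] Tle[of m y]] mult_mono[OF c01(2)[of m x] Tn[of m y]] c01[of m x] by auto
  have "(\<lambda>m. \<integral>x. (norm (u x - w m x))\<^sup>2 \<partial>lborel) \<longlonglongrightarrow> (\<integral>x. 0 \<partial>(lborel::'a measure))"
  proof (rule integral_dominated_convergence[where w="\<lambda>x. 4 * (norm (u x))\<^sup>2"])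
    show "integrable lborel (\<lambda>x. 4 * (norm (u x))\<^sup>2)" using u by (auto simp: sq_integrable_def)
    show "AE x in lborel. (\<lambda>m. (norm (u x - w m x))\<^sup>2) \<longlonglongrightarrow> 0"
    proof (rule AE_I2, rule tendsto_eventually)
      fix x
      obtain k :: nat where k: "norm (u x) \<le> real k" "norm x \<le> real k"
        using real_arch_simple[of "max (norm (u x)) (norm x)"] by auto
      show "\<forall>\<^sub>F m in sequentially. (norm (u x - w m x))\<^sup>2 = 0"
        using eventually_ge_at_top[of k] by eventually_elim (use k in \<open>simp add: w_def c1 Tid\<close>)
    qed
    show "AE x in lborel. norm ((norm (u x - w m x))\<^sup>2) \<le> 4 * (norm (u x))\<^sup>2" for m
    proof (rule AE_I2)
      fix x
      have "norm (u x - w m x) \<le> 2 * norm (u x)"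
        using norm_triangle_ineq4[of "u x" "w m x"] cT(1)[of m x "u x"] by (simp add: w_def)
      then have "(norm (u x - w m x))\<^sup>2 \<le> (2 * norm (u x))\<^sup>2" by (rule power_mono) simp
      then show "norm ((norm (u x - w m x))\<^sup>2) \<le> 4 * (norm (u x))\<^sup>2" by (simp add: power_mult_distrib)
    qed
  qed (measurable)
  then have "(\<lambda>m. l2 lborel (\<lambda>x. u x - w m x)) \<longlonglongrightarrow> sqrt 0"
    unfolding l2_def by (intro tendsto_real_sqrt) simp
  then have "\<forall>\<^sub>F m in sequentially. l2 lborel (\<lambda>x. u x - w m x) < e/2"
    using e by (intro order_tendstoD) auto
  then obtain m where m: "l2 lborel (\<lambda>x. u x - w m x) < e/2"
    by (auto simp: eventually_sequentially)
  define h where "h = (\<lambda>n x. c m x *\<^sub>R T m (g n x))"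
  have hc: "continuous_on UNIV (h n)" for n
    unfolding h_def by (intro continuous_on_scaleR cc continuous_on_compose2[OF Tc g]) auto
  have [measurable]: "h n \<in> borel_measurable borel" for n
    using hc by (rule borel_measurable_continuous_onI)
  have dom: "integrable lborel (\<lambda>x::'a. (2 * real m)\<^sup>2 * indicator (cball 0 (real m + 1)) x)"
    by (intro integrable_mult_right integrable_real_indicator) (use emeasure_bounded_finite[OF bounded_cball] in auto)
  have bnd: "(norm (a x - b x))\<^sup>2 \<le> (2 * real m)\<^sup>2 * indicator (cball 0 (real m + 1)) x"
    if "\<And>x. norm (a x) \<le> real m" "\<And>x. norm (b x) \<le> real m"
      "\<And>x. real m + 1 < norm x \<Longrightarrow> a x = 0 \<and> b x = 0" for a b :: "'a \<Rightarrow> 'b" and x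
  proof (cases "norm x \<le> real m + 1")
    case True
    have "norm (a x - b x) \<le> 2 * real m"
      using norm_triangle_ineq4[of "a x" "b x"] that(1)[of x] that(2)[of x] by simp
    then have "(norm (a x - b x))\<^sup>2 \<le> (2 * real m)\<^sup>2" by (rule power_mono) simp
    with True show ?thesis by simp
  qed (use that(3)[of x] in simp)
  have wB: "(norm (w m x))\<^sup>2 \<le> (2 * real m)\<^sup>2 * indicator (cball 0 (real m + 1)) x" for x
    using bnd[of "w m" "\<lambda>_. 0"] by (simp only: w_def c0 cT(2)) simp
  have hB: "(norm (h n x))\<^sup>2 \<le> (2 * real m)\<^sup>2 * indicator (cball 0 (real m + 1)) x" for n x
    using bnd[of "h n" "\<lambda>_. 0"] by (simp only: h_def c0 cT(2)) simp
  have wsq: "sq_integrable lborel (w m)"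
    unfolding sq_integrable_def
    by (intro conjI Bochner_Integration.integrable_bound[OF dom] AE_I2)
      (use wB in \<open>auto simp del: norm_scaleR\<close>)
  have hsq: "sq_integrable lborel (h n)" for n
    unfolding sq_integrable_def
    by (intro conjI Bochner_Integration.integrable_bound[OF dom] AE_I2)
      (use hB in \<open>auto simp del: norm_scaleR\<close>)
  have "(\<lambda>n. \<integral>x. (norm (w m x - h n x))\<^sup>2 \<partial>lborel) \<longlonglongrightarrow> (\<integral>x. 0 \<partial>(lborel::'a measure))"
  proof (rule integral_dominated_convergence[OF _ _ dom])
    show "AE x in lborel. (\<lambda>n. (norm (w m x - h n x))\<^sup>2) \<longlonglongrightarrow> 0"
      using AEN
    proof eventually_elim
      case (elim x)
      have "(\<lambda>n. T m (g n x)) \<longlonglongrightarrow> T m (u x)"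
        by (rule continuous_on_tendsto_compose[OF Tc lim[OF elim]]) auto
      then have "(\<lambda>n. (norm (w m x - h n x))\<^sup>2) \<longlonglongrightarrow> (norm (w m x - c m x *\<^sub>R T m (u x)))\<^sup>2"
        unfolding h_def by (intro tendsto_intros)
      then show ?case by (simp add: w_def)
    qed
    show "AE x in lborel. norm ((norm (w m x - h n x))\<^sup>2) \<le> (2 * real m)\<^sup>2 * indicator (cball 0 (real m + 1)) x" for n
    proof (rule AE_I2)
      fix x
      have "(norm (w m x - h n x))\<^sup>2 \<le> (2 * real m)\<^sup>2 * indicator (cball 0 (real m + 1)) x"
        by (rule bnd) (simp_all add: w_def h_def cT(2) c0 del: norm_scaleR)
      then show "norm ((norm (w m x - h n x))\<^sup>2) \<le> (2 * real m)\<^sup>2 * indicator (cball 0 (real m + 1)) x" by simp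
    qed
  qed (measurable)
  then have "(\<lambda>n. l2 lborel (\<lambda>x. w m x - h n x)) \<longlonglongrightarrow> sqrt 0"
    unfolding l2_def by (intro tendsto_real_sqrt) simp
  then have "\<forall>\<^sub>F n in sequentially. l2 lborel (\<lambda>x. w m x - h n x) < e/2"
    using e by (intro order_tendstoD) auto
  then obtain n where n: "l2 lborel (\<lambda>x. w m x - h n x) < e/2"
    by (auto simp: eventually_sequentially)
  show thesis
  proof
    show "continuous_on UNIV (h n)" by (rule hc)
    show "real m + 1 < norm x \<Longrightarrow> h n x = 0" for x by (simp add: h_def c0)
    show "sq_integrable lborel (h n)" by (rule hsq)
    show "l2 lborel (\<lambda>x. u x - h n x) < e"
      using l2_triangle_diff[OF u wsq hsq, of n] m n by simp
  qed
qed

text \<open>No integrability is required: a non-integrable function has integral 0 by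
  default.\<close>

lemma norm_integral_le_nn_integral:
  fixes f :: "'a \<Rightarrow> 'b::euclidean_space"
  shows "ennreal (norm (\<integral>x. f x \<partial>M)) \<le> (\<integral>\<^sup>+x. ennreal (norm (f x)) \<partial>M)"
  by (cases "integrable M f") (auto simp: integral_norm_bound_ennreal not_integrable_integral_eq)

text \<open>Schur's test: Cauchy--Schwarz with respect to the measures \<open>k x y dy\<close>.\<close>

lemma nn_integral_schur:
  fixes F :: "'a::euclidean_space \<Rightarrow> 'a \<Rightarrow> 'b::euclidean_space" and k v :: "'a \<Rightarrow> 'a \<Rightarrow> real"
  assumes [measurable]: "case_prod k \<in> borel_measurable (borel \<Otimes>\<^sub>M borel)" "case_prod v \<in> borel_measurable (borel \<Otimes>\<^sub>M borel)"
    and k: "\<And>x y. 0 \<le> k x y"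
    and v: "\<And>x y. 0 \<le> v x y"
    and F: "\<And>x y. norm (F x y) \<le> k x y * v x y"
    and A: "\<And>x. (\<integral>\<^sup>+y. ennreal (k x y) \<partial>lborel) \<le> ennreal A"
  shows "(\<integral>\<^sup>+x. ennreal ((norm (\<integral>y. F x y \<partial>lborel))\<^sup>2) \<partial>lborel)
    \<le> ennreal A * (\<integral>\<^sup>+x. \<integral>\<^sup>+y. ennreal (k x y * (v x y)\<^sup>2) \<partial>lborel \<partial>lborel)"
proof -
  have pt: "ennreal ((norm (\<integral>y. F x y \<partial>lborel))\<^sup>2) \<le> ennreal A * (\<integral>\<^sup>+y. ennreal (k x y * (v x y)\<^sup>2) \<partial>lborel)" for x
  proof -
    have "ennreal (norm (\<integral>y. F x y \<partial>lborel)) \<le> (\<integral>\<^sup>+y. ennreal (norm (F x y)) \<partial>lborel)"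
      by (rule norm_integral_le_nn_integral)
    also have "\<dots> \<le> (\<integral>\<^sup>+y. ennreal (sqrt (k x y)) * ennreal (sqrt (k x y) * v x y) \<partial>lborel)"
    proof (rule nn_integral_mono)
      fix y
      have "norm (F x y) \<le> sqrt (k x y) * (sqrt (k x y) * v x y)"
        using F[of x y] k[of x y] by (simp flip: mult.assoc)
      then show "ennreal (norm (F x y)) \<le> ennreal (sqrt (k x y)) * ennreal (sqrt (k x y) * v x y)"
        using k[of x y] by (subst ennreal_mult'[symmetric]) (auto intro: ennreal_leI)
    qed
    finally have "ennreal (norm (\<integral>y. F x y \<partial>lborel)) ^ 2
        \<le> (\<integral>\<^sup>+y. ennreal (sqrt (k x y)) * ennreal (sqrt (k x y) * v x y) \<partial>lborel)\<^sup>2"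
      by (rule power_mono) simp
    also have "\<dots> \<le> (\<integral>\<^sup>+y. ennreal (sqrt (k x y)) ^ 2 \<partial>lborel) * (\<integral>\<^sup>+y. ennreal (sqrt (k x y) * v x y) ^ 2 \<partial>lborel)"
      by (rule Cauchy_Schwarz_nn_integral) measurable
    also have "(\<integral>\<^sup>+y. ennreal (sqrt (k x y)) ^ 2 \<partial>lborel) = (\<integral>\<^sup>+y. ennreal (k x y) \<partial>lborel)"
      by (rule nn_integral_cong) (simp add: ennreal_power k)
    also have "(\<integral>\<^sup>+y. ennreal (sqrt (k x y) * v x y) ^ 2 \<partial>lborel) = (\<integral>\<^sup>+y. ennreal (k x y * (v x y)\<^sup>2) \<partial>lborel)"
      by (rule nn_integral_cong) (simp add: ennreal_power power_mult_distrib k v)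
    also have "(\<integral>\<^sup>+y. ennreal (k x y) \<partial>lborel) * (\<integral>\<^sup>+y. ennreal (k x y * (v x y)\<^sup>2) \<partial>lborel)
        \<le> ennreal A * (\<integral>\<^sup>+y. ennreal (k x y * (v x y)\<^sup>2) \<partial>lborel)"
      by (intro mult_right_mono A) simp
    finally show ?thesis by (simp add: ennreal_power)
  qed
  have "(\<integral>\<^sup>+x. ennreal ((norm (\<integral>y. F x y \<partial>lborel))\<^sup>2) \<partial>lborel)
      \<le> (\<integral>\<^sup>+x. ennreal A * (\<integral>\<^sup>+y. ennreal (k x y * (v x y)\<^sup>2) \<partial>lborel) \<partial>lborel)"
    by (rule nn_integral_mono) (rule pt)
  also have "\<dots> = ennreal A * (\<integral>\<^sup>+x. \<integral>\<^sup>+y. ennreal (k x y * (v x y)\<^sup>2) \<partial>lborel \<partial>lborel)"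
    by (rule nn_integral_cmult) measurable
  finally show ?thesis .
qed

section \<open>Changes of variables in Lebesgue measure\<close>

lemma integral_lborel_translate:
  fixes f :: "'a::euclidean_space \<Rightarrow> 'b::euclidean_space"
  assumes [measurable]: "f \<in> borel_measurable borel"
  shows "(\<integral>x. f (x + a) \<partial>lborel) = (\<integral>x. f x \<partial>lborel)"
proof -
  have "(\<integral>x. f x \<partial>lborel) = (\<integral>x. f x \<partial>distr lborel borel ((+) a))"
    by (simp add: lborel_distr_plus)
  also have "\<dots> = (\<integral>x. f (a + x) \<partial>lborel)" by (rule integral_distr) measurable
  finally show ?thesis by (simp add: add.commute)
qed

lemma nn_integral_lborel_translate:
  fixes f :: "'a::euclidean_space \<Rightarrow> ennreal"
  assumes [measurable]: "f \<in> borel_measurable borel"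
  shows "(\<integral>\<^sup>+x. f (x + a) \<partial>lborel) = (\<integral>\<^sup>+x. f x \<partial>lborel)"
proof -
  have "(\<integral>\<^sup>+x. f x \<partial>lborel) = (\<integral>\<^sup>+x. f x \<partial>distr lborel borel ((+) a))"
    by (simp add: lborel_distr_plus)
  also have "\<dots> = (\<integral>\<^sup>+x. f (a + x) \<partial>lborel)" by (rule nn_integral_distr) measurable
  finally show ?thesis by (simp add: add.commute)
qed

lemma integrable_lborel_translate:
  fixes f :: "'a::euclidean_space \<Rightarrow> 'b::euclidean_space"
  assumes "integrable lborel f"
  shows "integrable lborel (\<lambda>x. f (x + a))"
proof -
  have [measurable]: "f \<in> borel_measurable borel" using assms by (auto dest: borel_measurable_integrable)
  have "integrable (distr lborel borel ((+) a)) f" using assms by (simp add: lborel_distr_plus)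
  then show ?thesis by (subst (asm) integrable_distr_eq) (auto simp: add.commute)
qed

lemma lborel_distr_scaleR:
  assumes "c \<noteq> 0"
  shows "lborel = density (distr lborel borel (\<lambda>x::'a::euclidean_space. c *\<^sub>R x)) (\<lambda>_. \<bar>c\<bar>^DIM('a))"
  using lborel_affine[of c "0::'a"] assms by simp

lemma nn_integral_lborel_scaleR:
  fixes f :: "'a::euclidean_space \<Rightarrow> ennreal"
  assumes [measurable]: "f \<in> borel_measurable borel" and c: "c \<noteq> 0"
  shows "(\<integral>\<^sup>+x. f x \<partial>lborel) = ennreal (\<bar>c\<bar>^DIM('a)) * (\<integral>\<^sup>+x. f (c *\<^sub>R x) \<partial>lborel)"
  by (subst lborel_distr_scaleR[OF c]) (simp add: nn_integral_density nn_integral_distr nn_integral_cmult)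

lemma integral_lborel_scaleR:
  fixes f :: "'a::euclidean_space \<Rightarrow> 'b::euclidean_space"
  assumes [measurable]: "f \<in> borel_measurable borel" and c: "c \<noteq> 0"
  shows "(\<integral>x. f x \<partial>lborel) = (\<bar>c\<bar>^DIM('a)) *\<^sub>R (\<integral>x. f (c *\<^sub>R x) \<partial>lborel)"
  by (subst lborel_distr_scaleR[OF c]) (simp add: integral_density integral_distr)

lemma integrable_lborel_scaleR:
  fixes f :: "'a::euclidean_space \<Rightarrow> 'b::euclidean_space"
  assumes f: "integrable lborel f" and c: "c \<noteq> 0"
  shows "integrable lborel (\<lambda>x. f (c *\<^sub>R x))"
proof -
  have [measurable]: "f \<in> borel_measurable borel" using f by (auto dest: borel_measurable_integrable)
  have "integrable (density (distr lborel borel (\<lambda>x::'a. c *\<^sub>R x)) (\<lambda>_. \<bar>c\<bar>^DIM('a))) f"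
    using f lborel_distr_scaleR[OF c] by metis
  then have "integrable lborel (\<lambda>x. (\<bar>c\<bar>^DIM('a)) *\<^sub>R f (c *\<^sub>R x))"
    by (subst (asm) integrable_density) (auto simp: integrable_distr_eq)
  then have "integrable lborel (\<lambda>x. inverse (\<bar>c\<bar>^DIM('a)) *\<^sub>R (\<bar>c\<bar>^DIM('a)) *\<^sub>R f (c *\<^sub>R x))"
    by (rule integrable_scaleR_right)
  then show ?thesis using c by simp
qed

lemma integral_lborel_uminus:
  fixes f :: "'a::euclidean_space \<Rightarrow> 'b::euclidean_space"
  assumes "f \<in> borel_measurable borel"
  shows "(\<integral>x. f (- x) \<partial>lborel) = (\<integral>x. f x \<partial>lborel)"
  using integral_lborel_scaleR[OF assms, of "-1"] by simp

lemma integral_lborel_reflect: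
  fixes f :: "'a::euclidean_space \<Rightarrow> 'b::euclidean_space"
  assumes [measurable]: "f \<in> borel_measurable borel"
  shows "(\<integral>x. f (a - x) \<partial>lborel) = (\<integral>x. f x \<partial>lborel)"
  using integral_lborel_uminus[of "\<lambda>x. f (x + a)"] integral_lborel_translate[of f a] by simp

lemma nn_integral_lborel_reflect:
  fixes f :: "'a::euclidean_space \<Rightarrow> ennreal"
  assumes [measurable]: "f \<in> borel_measurable borel"
  shows "(\<integral>\<^sup>+x. f (a - x) \<partial>lborel) = (\<integral>\<^sup>+x. f x \<partial>lborel)"
  using nn_integral_lborel_scaleR[of "\<lambda>x. f (x + a)" "-1"] nn_integral_lborel_translate[of f a] by simp

lemma integrable_lborel_reflect:
  fixes f :: "'a::euclidean_space \<Rightarrow> 'b::euclidean_space"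
  assumes "integrable lborel f"
  shows "integrable lborel (\<lambda>x. f (a - x))"
  using integrable_lborel_scaleR[OF integrable_lborel_translate[OF assms, of a], of "-1"] by simp

lemma l2_translate:
  fixes f :: "'a::euclidean_space \<Rightarrow> 'b::euclidean_space"
  assumes "sq_integrable lborel f"
  shows "sq_integrable lborel (\<lambda>x. f (x + a))" "l2 lborel (\<lambda>x. f (x + a)) = l2 lborel f"
proof -
  have [measurable]: "f \<in> borel_measurable borel" using assms by (auto simp: sq_integrable_def)
  show "sq_integrable lborel (\<lambda>x. f (x + a))"
    using assms integrable_lborel_translate[of "\<lambda>x. (norm (f x))\<^sup>2" a] by (auto simp: sq_integrable_def)
  show "l2 lborel (\<lambda>x. f (x + a)) = l2 lborel f"
    unfolding l2_def using integral_lborel_translate[of "\<lambda>x. (norm (f x))\<^sup>2" a] by simp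
qed


section \<open>Smooth bump functions and mollification\<close>

text \<open>The powers of 1/t are included because they arise on differentiating exp (-1/t): the
  derivative of a member is a combination of later members of the family.\<close>

definition flat_exp :: "nat \<Rightarrow> real \<Rightarrow> real" where
  "flat_exp m t = (if t > 0 then inverse t ^ m * exp (- inverse t) else 0)"

lemma flat_exp_nonneg: "0 \<le> flat_exp m t"
  by (simp add: flat_exp_def)

lemma power_le_exp: "0 \<le> x \<Longrightarrow> x ^ k \<le> fact k * exp (x::real)"
proof -
  assume x: "0 \<le> x"
  have "(\<lambda>n. x ^ n /\<^sub>R fact n) sums exp x" by (rule exp_converges)
  then have "(\<Sum>n\<in>{k}. x ^ n /\<^sub>R fact n) \<le> exp x"
    using sum_le_suminf[of "\<lambda>n. x ^ n /\<^sub>R fact n" "{k}"] x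
    by (auto simp: sums_iff)
  then show ?thesis by (simp add: field_simps)
qed

text \<open>The term of order m + 2 in the series of exp (1/t) beats the power 1/t^m by a factor
  t^2. A quadratic bound is what makes the derivative at 0 vanish.\<close>

lemma flat_exp_le: "\<bar>flat_exp m t\<bar> \<le> fact (m + 2) * t\<^sup>2"
proof (cases "t > 0")
  case True
  have "inverse t ^ (m + 2) \<le> fact (m + 2) * exp (inverse t)"
    by (rule power_le_exp) (use True in simp)
  then have "inverse t ^ (m + 2) * exp (- inverse t) \<le> (fact (m + 2) * exp (inverse t)) * exp (- inverse t)"
    by (rule mult_right_mono) simp
  also have "\<dots> = fact (m + 2)"
    by (simp only: mult.assoc exp_minus_inverse mult_1_right)
  finally have "inverse t ^ (m + 2) * exp (- inverse t) \<le> fact (m + 2)" .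
  then have "t\<^sup>2 * (inverse t ^ (m + 2) * exp (- inverse t)) \<le> t\<^sup>2 * fact (m + 2)"
    by (rule mult_left_mono) simp
  also have "t\<^sup>2 * (inverse t ^ (m + 2) * exp (- inverse t)) = flat_exp m t"
    using True by (simp add: flat_exp_def power_add power2_eq_square field_simps)
  finally show ?thesis using flat_exp_nonneg[of m t] by (simp add: mult.commute)
qed (simp add: flat_exp_def)

lemma flat_exp_deriv:
  "(flat_exp m has_real_derivative (- real m * flat_exp (m + 1) t + flat_exp (m + 2) t)) (at t)"
proof -
  consider "t > 0" | "t < 0" | "t = 0" by linarith
  then show ?thesis
  proof cases
    case 1
    have i: "(inverse has_real_derivative - (inverse t * inverse t)) (at t)"
      using DERIV_inverse[of t] 1 by (simp add: power2_eq_square)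
    have "((\<lambda>t. inverse t ^ m * exp (- inverse t)) has_real_derivative
        (- real m * flat_exp (m + 1) t + flat_exp (m + 2) t)) (at t)"
      by (rule DERIV_cong[OF DERIV_mult[OF DERIV_power[OF i, of m] DERIV_fun_exp[OF DERIV_minus[OF i]]]])
        (use 1 in \<open>cases m; simp add: flat_exp_def algebra_simps\<close>)
    then show ?thesis
      by (rule has_field_derivative_transform_within_open[of _ _ _ "{0<..}"])
        (use 1 in \<open>auto simp: flat_exp_def\<close>)
  next
    case 2
    have "((\<lambda>t::real. 0) has_real_derivative (- real m * flat_exp (m + 1) t + flat_exp (m + 2) t)) (at t)"
      using 2 by (simp add: flat_exp_def)
    then show ?thesis
      by (rule has_field_derivative_transform_within_open[of _ _ _ "{..<0}"])
        (use 2 in \<open>auto simp: flat_exp_def\<close>)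
  next
    case 3
    have "(\<lambda>h. (flat_exp m (0 + h) - flat_exp m 0) / h) \<midarrow>0\<rightarrow> 0"
    proof (rule Lim_null_comparison)
      show "\<forall>\<^sub>F h in at 0. norm ((flat_exp m (0 + h) - flat_exp m 0) / h) \<le> fact (m + 2) * \<bar>h\<bar>"
      proof (rule always_eventually, rule allI)
        fix h :: real
        have "\<bar>flat_exp m h\<bar> \<le> (fact (m + 2) * \<bar>h\<bar>) * \<bar>h\<bar>"
          using flat_exp_le[of m h] by (simp add: power2_eq_square)
        then show "norm ((flat_exp m (0 + h) - flat_exp m 0) / h) \<le> fact (m + 2) * \<bar>h\<bar>"
          by (cases "h = 0") (auto simp: flat_exp_def[of m 0] abs_divide pos_divide_le_eq)
      qed
      show "(\<lambda>h::real. fact (m + 2) * \<bar>h\<bar>) \<midarrow>0\<rightarrow> 0" by (rule tendsto_eq_intros refl | simp)+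
    qed
    then show ?thesis using 3 by (simp add: DERIV_def flat_exp_def)
  qed
qed

lemma real_polynomial_function_derivative:
  assumes "real_polynomial_function p"
  shows "\<exists>p'. (\<forall>x. (p has_derivative p' x) (at x)) \<and> (\<forall>v. real_polynomial_function (\<lambda>x. p' x v))"
  using assms
proof induction
  case (linear f)
  then show ?case
    by (intro exI[of _ "\<lambda>x. f"]) (auto intro: bounded_linear_imp_has_derivative)
next
  case (const c)
  then show ?case by (intro exI[of _ "\<lambda>x v. 0"]) auto
next
  case (add f g)
  then obtain f' g' where fg: "\<And>x. (f has_derivative f' x) (at x)" "\<And>v. real_polynomial_function (\<lambda>x. f' x v)"
     "\<And>x. (g has_derivative g' x) (at x)" "\<And>v. real_polynomial_function (\<lambda>x. g' x v)"
    by blast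
  then show ?case
    by (intro exI[of _ "\<lambda>x v. f' x v + g' x v"]) (auto intro!: derivative_intros)
next
  case (mult f g)
  then obtain f' g' where fg: "\<And>x. (f has_derivative f' x) (at x)" "\<And>v. real_polynomial_function (\<lambda>x. f' x v)"
     "\<And>x. (g has_derivative g' x) (at x)" "\<And>v. real_polynomial_function (\<lambda>x. g' x v)"
    by blast
  then show ?case
    using mult.hyps
    by (intro exI[of _ "\<lambda>x v. f x * g' x v + f' x v * g x"])
      (auto intro!: has_derivative_mult real_polynomial_function.intros(3,4))
qed

text \<open>All derivatives of x \<mapsto> flat_exp 0 (q x) M belong to this class: for polynomial q
  the product and chain rules produce polynomial factors, higher m and sums, and nothing
  else.\<close>

inductive bump_family :: "('a::real_normed_vector \<Rightarrow> real) \<Rightarrow> 'b::real_normed_vector \<Rightarrow> ('a \<Rightarrow> 'b) \<Rightarrow> bool"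
  for q M where
  base: "real_polynomial_function p \<Longrightarrow> bump_family q M (\<lambda>x. (p x * flat_exp m (q x)) *\<^sub>R M)"
| add: "bump_family q M f \<Longrightarrow> bump_family q M g \<Longrightarrow> bump_family q M (\<lambda>x. f x + g x)"

lemma bump_family_derivative:
  assumes q: "real_polynomial_function q" and "bump_family q M f"
  shows "\<exists>f'. (\<forall>x. (f has_derivative f' x) (at x)) \<and> (\<forall>v. bump_family q M (\<lambda>x. f' x v))"
  using assms(2)
proof induction
  case (base p m)
  obtain p' where p': "\<And>x. (p has_derivative p' x) (at x)" "\<And>v. real_polynomial_function (\<lambda>x. p' x v)"
    using real_polynomial_function_derivative[OF base] by blast
  obtain q' where q': "\<And>x. (q has_derivative q' x) (at x)" "\<And>v. real_polynomial_function (\<lambda>x. q' x v)"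
    using real_polynomial_function_derivative[OF q] by blast
  define f' where "f' = (\<lambda>x v. (p' x v * flat_exp m (q x)) *\<^sub>R M
      + ((((- real m) * (p x * q' x v)) * flat_exp (m + 1) (q x)) *\<^sub>R M + ((p x * q' x v) * flat_exp (m + 2) (q x)) *\<^sub>R M))"
  have "((\<lambda>x. (p x * flat_exp m (q x)) *\<^sub>R M) has_derivative f' x) (at x)" for x
  proof -
    have d: "((\<lambda>x. flat_exp m (q x)) has_derivative (\<lambda>v. (- real m * flat_exp (m + 1) (q x) + flat_exp (m + 2) (q x)) * q' x v)) (at x)"
      using has_derivative_compose[OF q'(1)[of x] flat_exp_deriv[of m "q x", unfolded has_field_derivative_def]]
      by simp
    show ?thesis
      by (rule has_derivative_eq_rhs[OF has_derivative_scaleR_left[OF has_derivative_mult[OF p'(1) d]]])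
        (auto simp: f'_def algebra_simps)
  qed
  moreover have "bump_family q M (\<lambda>x. f' x v)" for v
    unfolding f'_def
    by (intro bump_family.intros real_polynomial_function.intros(2,4) p' q' base)
  ultimately show ?case by blast
next
  case (add f g)
  then obtain f' g' where "\<And>x. (f has_derivative f' x) (at x)" "\<And>v. bump_family q M (\<lambda>x. f' x v)"
     "\<And>x. (g has_derivative g' x) (at x)" "\<And>v. bump_family q M (\<lambda>x. g' x v)"
    by blast
  then show ?case
    by (intro exI[of _ "\<lambda>x v. f' x v + g' x v"]) (auto intro!: derivative_intros bump_family.add)
qed

text \<open>Induction over the order cannot be run for a single function; a class closed under
  directional derivatives is the strengthened induction hypothesis.\<close>

lemma Ck_on_if_closed_under_derivatives:
  assumes "\<And>f. F f \<Longrightarrow> \<exists>f'. (\<forall>x. (f has_derivative f' x) (at x)) \<and> (\<forall>v. F (\<lambda>x. f' x v))"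
    and "F f"
  shows "Ck_on k UNIV f"
  using assms(2)
proof (induction k arbitrary: f)
  case 0
  then show ?case
    using assms(1)[OF 0] has_derivative_continuous by (fastforce simp: continuous_on_eq_continuous_at)
next
  case (Suc k)
  obtain f' where f': "\<And>x. (f has_derivative f' x) (at x)" "\<And>v. F (\<lambda>x. f' x v)"
    using assms(1)[OF Suc.prems] by blast
  have "frechet_derivative f (at x) = f' x" for x
    by (rule frechet_derivative_at[OF f'(1), symmetric])
  then show ?case
    using f' Suc.IH by (auto simp: differentiable_def)
qed

lemma smooth_on_flat_exp_compose:
  fixes q :: "'a::euclidean_space \<Rightarrow> real" and M :: "'b::real_normed_vector"
  assumes "real_polynomial_function q"
  shows "smooth_on UNIV (\<lambda>x. (c * flat_exp 0 (q x)) *\<^sub>R M)"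
  unfolding smooth_on_def
  using Ck_on_if_closed_under_derivatives[of "bump_family q M"] bump_family_derivative[OF assms]
    bump_family.base[OF real_polynomial_function.intros(2), of q M c 0] by blast

lemma test_function_derivative:
  assumes "test_function \<phi>"
  shows "(\<phi> has_derivative frechet_derivative \<phi> (at x)) (at x)"
    and "test_function (\<lambda>x. frechet_derivative \<phi> (at x) v)"
proof -
  have C: "Ck_on k UNIV \<phi>" for k
    using assms by (simp add: test_function_def smooth_on_def)
  show d: "(\<phi> has_derivative frechet_derivative \<phi> (at x)) (at x)" for x
    using C[of "Suc 0"] by (auto simp: frechet_derivative_works)
  have "smooth_on UNIV (\<lambda>x. frechet_derivative \<phi> (at x) v)"
    unfolding smooth_on_def using C[of "Suc _"] by auto
  \<comment> \<open>Off the closed support the function vanishes on a neighbourhood, so its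
    derivative is 0 there; the support does not grow.\<close>
  moreover have "frechet_derivative \<phi> (at x) v = 0" if "x \<notin> closure {x. \<phi> x \<noteq> 0}" for x
  proof -
    have "((\<lambda>x. 0) has_derivative frechet_derivative \<phi> (at x)) (at x)"
      by (rule has_derivative_transform_within_open[OF d, of "- closure {x. \<phi> x \<noteq> 0}"])
        (use that closure_subset[of "{x. \<phi> x \<noteq> 0}"] in auto)
    from has_derivative_unique[OF this has_derivative_const] show ?thesis by simp
  qed
  then have "closure {x. frechet_derivative \<phi> (at x) v \<noteq> 0} \<subseteq> closure {x. \<phi> x \<noteq> 0}"
    by (intro closure_minimal) auto
  then have "compact (closure {x. frechet_derivative \<phi> (at x) v \<noteq> 0})"
    using assms unfolding test_function_def compact_eq_bounded_closed by (auto intro: bounded_subset)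
  ultimately show "test_function (\<lambda>x. frechet_derivative \<phi> (at x) v)"
    by (simp add: test_function_def)
qed

lemma test_function_continuous: "test_function \<phi> \<Longrightarrow> continuous_on UNIV \<phi>"
  unfolding test_function_def smooth_on_def using Ck_on.simps(1) by blast

lemma test_function_support:
  fixes \<phi> :: "'a::euclidean_space \<Rightarrow> 'b::real_normed_vector"
  assumes "test_function \<phi>"
  obtains R where "0 < R" "\<And>x. R < norm x \<Longrightarrow> \<phi> x = 0"
proof -
  have "bounded (closure {x. \<phi> x \<noteq> 0})"
    using assms compact_imp_bounded by (auto simp: test_function_def)
  then obtain R where R: "0 < R" "\<forall>x\<in>closure {x. \<phi> x \<noteq> 0}. norm x \<le> R"
    unfolding bounded_pos by blast
  have "\<phi> x = 0" if "R < norm x" for x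
    using R(2) that closure_subset[of "{x. \<phi> x \<noteq> 0}"] by (force simp: not_less[symmetric])
  with R(1) show thesis by (rule that)
qed

lemma test_function_bounded:
  fixes \<phi> :: "'a::euclidean_space \<Rightarrow> 'b::real_normed_vector"
  assumes "test_function \<phi>"
  obtains B where "0 < B" "\<And>x. norm (\<phi> x) \<le> B"
proof -
  obtain R where R: "0 < R" "\<And>x. R < norm x \<Longrightarrow> \<phi> x = 0" using test_function_support[OF assms] by blast
  have "compact (\<phi> ` cball 0 R)"
    by (intro compact_continuous_image continuous_on_subset[OF test_function_continuous[OF assms]]) auto
  then obtain B where B: "0 < B" "\<forall>y\<in>\<phi> ` cball 0 R. norm y \<le> B"
    using compact_imp_bounded bounded_pos by blast
  have "norm (\<phi> x) \<le> B" for x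
    using B R(2)[of x] by (cases "norm x \<le> R") auto
  with B(1) show thesis by (rule that)
qed

text \<open>Each partial derivative is again a test function and so bounded; summing over the basis
  bounds the operator norm of the derivative uniformly.\<close>

lemma test_function_Lipschitz:
  fixes \<phi> :: "'a::euclidean_space \<Rightarrow> 'b::real_normed_vector"
  assumes "test_function \<phi>"
  obtains L where "0 < L" "\<And>x y. norm (\<phi> x - \<phi> y) \<le> L * norm (x - y)"
proof -
  have "\<exists>B. \<forall>x. norm (frechet_derivative \<phi> (at x) v) \<le> B" for v
    using test_function_bounded[OF test_function_derivative(2)[OF assms, of v]] by metis
  then obtain B where B: "\<And>v x. norm (frechet_derivative \<phi> (at x) v) \<le> B v" by metis
  define L where "L = (\<Sum>b\<in>Basis. B b) + 1"
  have B0: "0 \<le> B v" for v using B[of undefined v] norm_ge_zero order_trans by blast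
  have "onorm (frechet_derivative \<phi> (at x)) \<le> L" for x
  proof (rule onorm_le)
    fix v :: 'a
    interpret bounded_linear "frechet_derivative \<phi> (at x)"
      using test_function_derivative(1)[OF assms] by (rule has_derivative_bounded_linear)
    have "norm (frechet_derivative \<phi> (at x) v) = norm (\<Sum>b\<in>Basis. (v \<bullet> b) *\<^sub>R frechet_derivative \<phi> (at x) b)"
      by (subst euclidean_representation[of v, symmetric]) (simp add: sum scale del: euclidean_representation)
    also have "\<dots> \<le> (\<Sum>b\<in>Basis. norm v * B b)"
      by (rule order_trans[OF norm_sum])
        (auto intro!: sum_mono mult_mono B simp: Basis_le_norm)
    also have "\<dots> \<le> L * norm v" by (simp add: L_def sum_distrib_left algebra_simps)
    finally show "norm (frechet_derivative \<phi> (at x) v) \<le> L * norm v" .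
  qed
  then have "norm (\<phi> x - \<phi> y) \<le> L * norm (x - y)" for x y
    by (intro differentiable_bound[of UNIV \<phi>]) (auto intro: test_function_derivative(1)[OF assms])
  moreover have "0 < L" unfolding L_def using sum_nonneg[of Basis B] B0 by (simp add: add_nonneg_pos)
  ultimately show thesis using that by blast
qed

definition gradient :: "('a::euclidean_space \<Rightarrow> real) \<Rightarrow> 'a \<Rightarrow> 'a" where
  "gradient \<phi> x = (\<Sum>b\<in>Basis. frechet_derivative \<phi> (at x) b *\<^sub>R b)"

lemma test_function_gradient:
  fixes \<phi> :: "'a::euclidean_space \<Rightarrow> real"
  assumes "test_function \<phi>"
  shows "(\<phi> has_derivative (\<lambda>h. gradient \<phi> x \<bullet> h)) (at x)"
proof -
  interpret bounded_linear "frechet_derivative \<phi> (at x)"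
    using test_function_derivative(1)[OF assms] by (rule has_derivative_bounded_linear)
  have "frechet_derivative \<phi> (at x) h = gradient \<phi> x \<bullet> h" for h
  proof -
    have "frechet_derivative \<phi> (at x) h = (\<Sum>b\<in>Basis. (h \<bullet> b) * frechet_derivative \<phi> (at x) b)"
      by (subst euclidean_representation[of h, symmetric]) (simp add: sum scale del: euclidean_representation)
    then show ?thesis by (simp add: gradient_def inner_sum_left inner_sum_right inner_commute mult.commute)
  qed
  then have "frechet_derivative \<phi> (at x) = (\<lambda>h. gradient \<phi> x \<bullet> h)" by blast
  then show ?thesis using test_function_derivative(1)[OF assms, of x] by simp
qed

lemma test_function_gradient_Lipschitz:
  fixes \<phi> :: "'a::euclidean_space \<Rightarrow> real"
  assumes "test_function \<phi>"
  obtains L where "0 < L" "\<And>x y. norm (gradient \<phi> x - gradient \<phi> y) \<le> L * norm (x - y)"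
proof -
  have "\<exists>L. \<forall>x y. norm (frechet_derivative \<phi> (at x) v - frechet_derivative \<phi> (at y) v) \<le> L * norm (x - y)" for v
    using test_function_Lipschitz[OF test_function_derivative(2)[OF assms, of v]] by metis
  then obtain L where L: "\<And>v x y. norm (frechet_derivative \<phi> (at x) v - frechet_derivative \<phi> (at y) v) \<le> L v * norm (x - y)"
    by metis
  have "norm (gradient \<phi> x - gradient \<phi> y) \<le> (1 + (\<Sum>b\<in>Basis. \<bar>L b\<bar>)) * norm (x - y)" for x y
  proof -
    have "norm (gradient \<phi> x - gradient \<phi> y) \<le> (\<Sum>b\<in>Basis. norm ((frechet_derivative \<phi> (at x) b - frechet_derivative \<phi> (at y) b) *\<^sub>R b))"
      unfolding gradient_def sum_subtractf[symmetric] scaleR_diff_left[symmetric] by (rule norm_sum)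
    also have "\<dots> \<le> (\<Sum>b\<in>Basis. \<bar>L b\<bar> * norm (x - y))"
    proof (rule sum_mono)
      fix b :: 'a assume "b \<in> Basis"
      then show "norm ((frechet_derivative \<phi> (at x) b - frechet_derivative \<phi> (at y) b) *\<^sub>R b) \<le> \<bar>L b\<bar> * norm (x - y)"
        using L[of x b y] mult_right_mono[OF abs_ge_self[of "L b"] norm_ge_zero[of "x - y"]] by simp
    qed
    finally show ?thesis by (simp add: sum_distrib_left algebra_simps add_increasing)
  qed
  moreover have "0 < 1 + (\<Sum>b\<in>Basis. \<bar>L b\<bar>)" by (simp add: add_pos_nonneg sum_nonneg)
  ultimately show thesis using that by blast
qed


lemma real_polynomial_function_inner_square:
  "real_polynomial_function (\<lambda>x::'a::euclidean_space. 1 - (c *\<^sub>R (x - a)) \<bullet> (c *\<^sub>R (x - a)))"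
proof -
  have p: "real_polynomial_function (\<lambda>x. x \<bullet> b)" for b :: 'a
    by (intro real_polynomial_function.intros(1) bounded_linear_inner_left)
  have "real_polynomial_function (\<lambda>x. 1 + (- (c * c)) * (\<Sum>b\<in>Basis. (x \<bullet> b + (- (a \<bullet> b))) * (x \<bullet> b + (- (a \<bullet> b)))))"
    by (intro real_polynomial_function.intros(2,3,4) real_polynomial_function_sum p finite_Basis)
  also have "(\<lambda>x. 1 + (- (c * c)) * (\<Sum>b\<in>Basis. (x \<bullet> b + (- (a \<bullet> b))) * (x \<bullet> b + (- (a \<bullet> b)))))
      = (\<lambda>x. 1 - (c *\<^sub>R (x - a)) \<bullet> (c *\<^sub>R (x - a)))"
  proof (rule ext)
    fix x
    have "(x - a) \<bullet> (x - a) = (\<Sum>b\<in>Basis. (x \<bullet> b + (- (a \<bullet> b))) * (x \<bullet> b + (- (a \<bullet> b))))"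
      by (subst euclidean_inner) (simp add: inner_diff_left)
    then show "1 + (- (c * c)) * (\<Sum>b\<in>Basis. (x \<bullet> b + (- (a \<bullet> b))) * (x \<bullet> b + (- (a \<bullet> b))))
      = 1 - (c *\<^sub>R (x - a)) \<bullet> (c *\<^sub>R (x - a))"
      by (simp only: inner_scaleR_left inner_scaleR_right) simp
  qed
  finally show ?thesis .
qed

section \<open>Normalised bumps, mollifiers and convolution\<close>

definition bump :: "'a::euclidean_space \<Rightarrow> real" where
  "bump x = flat_exp 0 (1 - x \<bullet> x) / (\<integral>y. flat_exp 0 (1 - y \<bullet> y) \<partial>(lborel :: 'a measure))"

definition mollifier :: "real \<Rightarrow> 'a::euclidean_space \<Rightarrow> real" where
  "mollifier d x = bump (x /\<^sub>R d) / d ^ DIM('a)"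

definition mollify :: "real \<Rightarrow> ('a::euclidean_space \<Rightarrow> 'b::euclidean_space) \<Rightarrow> 'a \<Rightarrow> 'b" where
  "mollify d u x = (\<integral>y. mollifier d (x - y) *\<^sub>R u y \<partial>lborel)"

lemma bounded_support_integrable:
  fixes h :: "'a::euclidean_space \<Rightarrow> 'b::euclidean_space"
  assumes [measurable]: "h \<in> borel_measurable borel" and B: "\<And>x. norm (h x) \<le> B" and R: "\<And>x. R < norm x \<Longrightarrow> h x = 0"
  shows "integrable lborel h" "sq_integrable lborel h"
proof -
  have B0: "0 \<le> B" using B[of 0] norm_ge_zero order_trans by blast
  have i: "integrable lborel (\<lambda>x::'a. c * indicator (cball 0 R) x)" for c :: real
    by (intro integrable_mult_right integrable_real_indicator)
      (use emeasure_bounded_finite[OF bounded_cball] in auto)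
  show "integrable lborel h"
    by (rule Bochner_Integration.integrable_bound[OF i[of B]])
      (use B R B0 in \<open>auto simp: indicator_def not_le\<close>)
  have "(norm (h x))\<^sup>2 \<le> B\<^sup>2 * indicator (cball 0 R) x" for x
    using power_mono[OF B[of x], of 2] R[of x] by (auto simp: indicator_def not_le)
  then have "integrable lborel (\<lambda>x. (norm (h x))\<^sup>2)"
    by (intro Bochner_Integration.integrable_bound[OF i[of "B\<^sup>2"]]) auto
  then show "sq_integrable lborel h" by (simp add: sq_integrable_def)
qed

lemma continuous_support_bounded:
  fixes h :: "'a::euclidean_space \<Rightarrow> 'b::euclidean_space"
  assumes c: "continuous_on UNIV h" and R: "\<And>x. R < norm x \<Longrightarrow> h x = 0"
  obtains B where "0 < B" "\<And>x. norm (h x) \<le> B"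
proof -
  have "compact (h ` cball 0 R)"
    by (intro compact_continuous_image continuous_on_subset[OF c]) auto
  then obtain B where B: "0 < B" "\<forall>y\<in>h ` cball 0 R. norm y \<le> B"
    using compact_imp_bounded bounded_pos by blast
  have "norm (h x) \<le> B" for x
    using B R[of x] by (cases "norm x \<le> R") auto
  with B(1) show thesis by (rule that)
qed

lemma continuous_support_integrable:
  fixes h :: "'a::euclidean_space \<Rightarrow> 'b::euclidean_space"
  assumes c: "continuous_on UNIV h" and R: "\<And>x. R < norm x \<Longrightarrow> h x = 0"
  shows "integrable lborel h" "sq_integrable lborel h"
proof -
  obtain B where "0 < B" "\<And>x. norm (h x) \<le> B" using continuous_support_bounded[OF assms] by blast
  then show "integrable lborel h" "sq_integrable lborel h"
    using bounded_support_integrable[OF borel_measurable_continuous_onI[OF c] _ R] by blast+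
qed

lemma continuous_on_flat_exp: "continuous_on S (flat_exp m)"
  by (intro continuous_at_imp_continuous_on ballI DERIV_isCont[OF flat_exp_deriv])

lemma bump_mass_pos: "0 < (\<integral>y. flat_exp 0 (1 - y \<bullet> y) \<partial>(lborel :: 'a::euclidean_space measure))"
proof -
  let ?f = "\<lambda>y::'a. flat_exp 0 (1 - y \<bullet> y)"
  have c: "continuous_on UNIV ?f"
    by (rule continuous_on_compose2[OF continuous_on_flat_exp[of UNIV]]) (auto intro!: continuous_intros)
  have supp: "?f y = 0" if "1 < norm y" for y
  proof -
    have "1 < y \<bullet> y" using that by (simp add: norm_eq_sqrt_inner)
    then show ?thesis by (simp add: flat_exp_def)
  qed
  have i: "integrable lborel ?f" by (rule continuous_support_integrable[OF c supp])
  \<comment> \<open>On the ball of radius 1/2 the argument 1 - |y|^2 is at least 1/2, whose inverse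
    is at most 2; hence the value exp (-2).\<close>
  have "exp (-2) * indicator (cball 0 (1/2)) y \<le> ?f y" for y
  proof (cases "y \<in> cball 0 (1/2)")
    case True
    then have "(norm y)\<^sup>2 \<le> (1/2)\<^sup>2" by (intro power_mono) auto
    then have "y \<bullet> y \<le> 1/4" by (simp only: power2_norm_eq_inner) (simp add: power2_eq_square)
    then have y: "1/2 \<le> 1 - y \<bullet> y" by linarith
    then have "inverse (1 - y \<bullet> y) \<le> inverse (1/2)" by (intro le_imp_inverse_le) auto
    then show ?thesis using y True by (simp add: flat_exp_def)
  qed (simp add: flat_exp_nonneg)
  then have "(\<integral>y. exp (-2) * indicator (cball (0::'a) (1/2)) y \<partial>lborel) \<le> (\<integral>y. ?f y \<partial>lborel)"
    by (intro integral_mono i integrable_mult_right integrable_real_indicator)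
      (use emeasure_bounded_finite[OF bounded_cball] in auto)
  moreover have "0 < exp (-2) * measure lborel (cball (0::'a) (1/2))"
    using content_cball_pos[of "1/2" "0::'a"] by simp
  moreover have "(\<integral>y. exp (-2) * indicator (cball (0::'a) (1/2)) y \<partial>lborel) = exp (-2) * measure lborel (cball (0::'a) (1/2))"
    by simp
  ultimately show ?thesis by linarith
qed

lemma bump_nonneg: "0 \<le> bump x"
  unfolding bump_def using bump_mass_pos flat_exp_nonneg by (intro divide_nonneg_pos)

lemma bump_support: "1 \<le> norm x \<Longrightarrow> bump x = 0"
proof -
  assume "1 \<le> norm x"
  then have "1 \<le> x \<bullet> x" by (simp add: norm_eq_sqrt_inner)
  then show ?thesis by (simp add: bump_def flat_exp_def)
qed

text \<open>Negative \<open>c\<close> is included so that the reflected and shifted mollifier y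
  \<mapsto> mollifier d (x - y) is covered. Times a constant vector or matrix \<open>M\<close>, it
  is the test function that extracts a mollification from a weak identity.\<close>

lemma test_function_bump_affine:
  fixes a :: "'a::euclidean_space"
  assumes "c \<noteq> 0"
  shows "test_function (\<lambda>x. (k * bump (c *\<^sub>R (x - a))) *\<^sub>R M)"
proof -
  have "smooth_on UNIV (\<lambda>x. ((k / (\<integral>y. flat_exp 0 (1 - y \<bullet> y) \<partial>(lborel :: 'a measure))) *
      flat_exp 0 (1 - (c *\<^sub>R (x - a)) \<bullet> (c *\<^sub>R (x - a)))) *\<^sub>R M)"
    by (intro smooth_on_flat_exp_compose real_polynomial_function_inner_square)
  moreover have "{x. (k * bump (c *\<^sub>R (x - a))) *\<^sub>R M \<noteq> 0} \<subseteq> cball a (1 / \<bar>c\<bar>)"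
  proof safe
    fix x assume "(k * bump (c *\<^sub>R (x - a))) *\<^sub>R M \<noteq> 0"
    then have "norm (c *\<^sub>R (x - a)) < 1" using bump_support[of "c *\<^sub>R (x - a)"] by force
    then have "\<bar>c\<bar> * norm (x - a) < 1" by simp
    then show "x \<in> cball a (1 / \<bar>c\<bar>)" using assms
      by (simp add: dist_norm norm_minus_commute field_simps)
  qed
  then have "compact (closure {x. (k * bump (c *\<^sub>R (x - a))) *\<^sub>R M \<noteq> 0})"
    using bounded_subset[OF bounded_cball] by (simp add: compact_closure)
  ultimately show ?thesis by (simp add: test_function_def bump_def)
qed

lemma test_function_mollifier_reflect:
  assumes "0 < d"
  shows "test_function (\<lambda>y. mollifier d (x - y) *\<^sub>R M)"
  using test_function_bump_affine[of "- inverse d" "1 / d ^ DIM('a)" x M] assms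
  by (simp add: mollifier_def scaleR_diff_right minus_diff_eq)

lemma test_function_mollifier:
  assumes "0 < d"
  shows "test_function (mollifier d :: 'a::euclidean_space \<Rightarrow> real)"
  using test_function_bump_affine[of "inverse d" "1 / d ^ DIM('a)" 0 "1::real"] assms
  by (simp add: mollifier_def[abs_def])

lemma test_function_bump: "test_function (bump :: 'a::euclidean_space \<Rightarrow> real)"
  using test_function_bump_affine[of 1 1 0 "1::real"] by simp

lemma continuous_on_bump: "continuous_on S bump"
  using test_function_continuous[OF test_function_bump] continuous_on_subset by blast

lemma continuous_on_mollifier: "0 < d \<Longrightarrow> continuous_on S (mollifier d)"
  using test_function_continuous[OF test_function_mollifier] continuous_on_subset by blast

lemma measurable_bump [measurable]: "bump \<in> borel_measurable borel"
  by (intro borel_measurable_continuous_onI continuous_on_bump)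

lemma measurable_mollifier [measurable]: "mollifier d \<in> borel_measurable borel"
  unfolding mollifier_def[abs_def] by measurable

lemma mollifier_nonneg: "0 < d \<Longrightarrow> 0 \<le> mollifier d x"
  by (simp add: mollifier_def bump_nonneg)

lemma mollifier_support: "0 < d \<Longrightarrow> d \<le> norm x \<Longrightarrow> mollifier d x = 0"
  by (simp add: mollifier_def bump_support divide_simps)

lemma mollifier_le:
  assumes "0 < d"
  shows "mollifier d (x::'a::euclidean_space) \<le> (1 / (\<integral>y. flat_exp 0 (1 - y \<bullet> y) \<partial>(lborel :: 'a measure))) / d ^ DIM('a)"
proof -
  have "flat_exp 0 t \<le> 1" for t by (simp add: flat_exp_def)
  then show ?thesis using assms bump_mass_pos[where 'a='a]
    by (simp add: mollifier_def bump_def divide_right_mono)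
qed

lemma mollifier_integral:
  assumes d: "0 < d"
  shows "integrable lborel (mollifier d :: 'a::euclidean_space \<Rightarrow> real)"
    "sq_integrable lborel (mollifier d :: 'a::euclidean_space \<Rightarrow> real)"
    "(\<integral>x. mollifier d (x::'a) \<partial>lborel) = 1"
    "(\<integral>\<^sup>+x. ennreal (mollifier d (x::'a)) \<partial>lborel) = 1"
proof -
  have "\<And>x::'a. d < norm x \<Longrightarrow> mollifier d x = 0" by (intro mollifier_support[OF d]) simp
  then show i: "integrable lborel (mollifier d :: 'a \<Rightarrow> real)" and "sq_integrable lborel (mollifier d :: 'a \<Rightarrow> real)"
    using continuous_support_integrable[OF continuous_on_mollifier[OF d], of d] by auto
  have "(\<integral>x. mollifier d (x::'a) \<partial>lborel) = d ^ DIM('a) * (\<integral>x. mollifier d (d *\<^sub>R x :: 'a) \<partial>lborel)"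
    using integral_lborel_scaleR[of "mollifier d :: 'a \<Rightarrow> real" d] d by simp
  also have "\<dots> = (\<integral>x. bump (x::'a) \<partial>lborel)"
    using d by (simp add: mollifier_def)
  also have "\<dots> = 1" using bump_mass_pos[where 'a='a] by (simp add: bump_def)
  finally show 1: "(\<integral>x. mollifier d (x::'a) \<partial>lborel) = 1" .
  show "(\<integral>\<^sup>+x. ennreal (mollifier d (x::'a)) \<partial>lborel) = 1"
    using nn_integral_eq_integral[OF i AE_I2[OF mollifier_nonneg[OF d]]] 1 by simp
qed

lemma integral_mollifier_scaleR:
  fixes v :: "'b::euclidean_space"
  assumes d: "0 < d"
  shows "(\<integral>x. mollifier d (x::'a::euclidean_space) *\<^sub>R v \<partial>lborel) = v"
    "integrable lborel (\<lambda>x::'a. mollifier d x *\<^sub>R v)"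
  using mollifier_integral(1,3)[OF d, where 'a='a]
  by (simp_all only: integral_scaleR_left integrable_scaleR_left scaleR_one)

lemma gradient_mollifier:
  assumes d: "0 < d"
  shows "gradient (mollifier d) (x::'a::euclidean_space) = (1 / d ^ Suc (DIM('a))) *\<^sub>R gradient bump (x /\<^sub>R d)"
proof -
  have "(mollifier d has_derivative (\<lambda>h. ((1 / d ^ Suc (DIM('a))) *\<^sub>R gradient bump (x /\<^sub>R d)) \<bullet> h)) (at x)"
  proof -
    have 1: "((\<lambda>x. bump (x /\<^sub>R d)) has_derivative (\<lambda>h. gradient bump (x /\<^sub>R d) \<bullet> (h /\<^sub>R d))) (at x)"
      by (rule has_derivative_compose[OF has_derivative_scaleR_right[OF has_derivative_ident] test_function_gradient[OF test_function_bump]])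
    have 2: "((\<lambda>x. (1 / d ^ DIM('a)) * bump (x /\<^sub>R d)) has_derivative
        (\<lambda>h. (1 / d ^ DIM('a)) * (gradient bump (x /\<^sub>R d) \<bullet> (h /\<^sub>R d)))) (at x)"
      by (rule has_derivative_mult_right[OF 1])
    have 3: "(1 / d ^ DIM('a)) * (gradient bump (x /\<^sub>R d) \<bullet> (h /\<^sub>R d)) =
        ((1 / d ^ Suc (DIM('a))) *\<^sub>R gradient bump (x /\<^sub>R d)) \<bullet> h" for h
      unfolding inner_scaleR_left inner_scaleR_right power_Suc inverse_eq_divide by simp
    show ?thesis using 2 unfolding 3 by (simp add: mollifier_def[abs_def])
  qed
  note e = has_derivative_unique[OF this test_function_gradient[OF test_function_mollifier[OF d], of x]]
  have "((1 / d ^ Suc (DIM('a))) *\<^sub>R gradient bump (x /\<^sub>R d)) \<bullet> h = gradient (mollifier d) x \<bullet> h" for h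
    using fun_cong[OF e, of h] .
  then show ?thesis by (rule euclidean_eqI[OF sym]) 
qed

lemma continuous_on_gradient:
  assumes "test_function \<phi>"
  shows "continuous_on S (gradient \<phi>)"
proof -
  obtain L where L: "0 < L" "\<And>x y. norm (gradient \<phi> x - gradient \<phi> y) \<le> L * norm (x - y)"
    using test_function_gradient_Lipschitz[OF assms] by blast
  have "L-lipschitz_on UNIV (gradient \<phi>)"
    by (rule lipschitz_onI) (use L in \<open>auto simp: dist_norm\<close>)
  then show ?thesis using lipschitz_on_continuous_on continuous_on_subset by blast
qed

lemma gradient_support:
  assumes \<phi>: "test_function \<phi>" and R: "\<And>x. R \<le> norm x \<Longrightarrow> \<phi> x = 0" and x: "R < norm x"
  shows "gradient \<phi> x = 0"
proof -
  have "((\<lambda>x. 0::real) has_derivative (\<lambda>h. gradient \<phi> x \<bullet> h)) (at x)"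
    by (rule has_derivative_transform_within_open[OF test_function_gradient[OF \<phi>], of "- cball 0 R"])
      (use R x in auto)
  note e = has_derivative_unique[OF this has_derivative_const]
  have "gradient \<phi> x \<bullet> gradient \<phi> x = 0" using fun_cong[OF e, of "gradient \<phi> x"] .
  then show ?thesis by simp
qed

lemma measurable_gradient_mollifier: "0 < d \<Longrightarrow> gradient (mollifier d) \<in> borel_measurable borel"
  by (intro borel_measurable_continuous_onI continuous_on_gradient test_function_mollifier)

text \<open>Scaling gives d^n from the measure and d^(-n-1) from the derivative. The resulting 1/d
  is the price of a classical derivative at scale d.\<close>

lemma nn_integral_gradient_mollifier:
  assumes d: "0 < d"
  shows "(\<integral>\<^sup>+x. ennreal (norm (gradient (mollifier d) (x::'a::euclidean_space))) \<partial>lborel)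
    = ennreal ((\<integral>x. norm (gradient bump (x::'a)) \<partial>lborel) / d)"
proof -
  have [measurable]: "gradient (bump :: 'a \<Rightarrow> real) \<in> borel_measurable borel"
    by (intro borel_measurable_continuous_onI continuous_on_gradient test_function_bump)
  have s: "\<And>x. 1 < norm x \<Longrightarrow> gradient bump x = 0"
    by (rule gradient_support[OF test_function_bump bump_support])
  have i: "integrable lborel (gradient (bump :: 'a \<Rightarrow> real))"
    by (rule continuous_support_integrable[OF continuous_on_gradient[OF test_function_bump] s])
  have "(\<integral>\<^sup>+x. ennreal (norm (gradient (mollifier d) (x::'a))) \<partial>lborel)
      = ennreal (d ^ DIM('a)) * (\<integral>\<^sup>+x. ennreal (norm (gradient (mollifier d) (d *\<^sub>R x :: 'a))) \<partial>lborel)"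
    using measurable_gradient_mollifier[OF d, where 'a='a]
    by (subst nn_integral_lborel_scaleR[of _ d]) (use d in auto)
  also have "(\<integral>\<^sup>+x. ennreal (norm (gradient (mollifier d) (d *\<^sub>R x :: 'a))) \<partial>lborel)
     = (\<integral>\<^sup>+x. ennreal (1 / d ^ Suc (DIM('a))) * ennreal (norm (gradient bump (x :: 'a))) \<partial>lborel)"
    by (rule nn_integral_cong) (use d in \<open>simp add: gradient_mollifier ennreal_mult[symmetric]\<close>)
  also have "\<dots> = ennreal (1 / d ^ Suc (DIM('a))) * ennreal (\<integral>x. norm (gradient bump (x::'a)) \<partial>lborel)"
    by (subst nn_integral_cmult) (auto simp: nn_integral_eq_integral[OF integrable_norm[OF i]])
  also have "ennreal (d ^ DIM('a)) * \<dots> = ennreal ((\<integral>x. norm (gradient bump (x::'a)) \<partial>lborel) / d)"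
    using d by (simp add: ennreal_mult[symmetric])
  finally show ?thesis .
qed

text \<open>Schur's test with the kernel k (x - y), followed by Fubini. The integrand
  \<open>F\<close> is only dominated by a convolution, which covers scalar kernels acting on vectors
  as well as vector kernels acting on scalars.\<close>

lemma Young_l2:
  fixes F :: "'a::euclidean_space \<Rightarrow> 'a \<Rightarrow> 'b::euclidean_space" and k :: "'a \<Rightarrow> real" and u :: "'a \<Rightarrow> 'c::euclidean_space"
  assumes [measurable]: "k \<in> borel_measurable borel" and k: "\<And>x. 0 \<le> k x"
    and u: "sq_integrable lborel u"
    and F: "\<And>x y. norm (F x y) \<le> k (x - y) * norm (u y)"
    and A: "(\<integral>\<^sup>+x. ennreal (k x) \<partial>lborel) \<le> ennreal A" "0 \<le> A"
    and m: "(\<lambda>x. \<integral>y. F x y \<partial>lborel) \<in> borel_measurable borel"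
  shows "sq_integrable lborel (\<lambda>x. \<integral>y. F x y \<partial>lborel)" "l2 lborel (\<lambda>x. \<integral>y. F x y \<partial>lborel) \<le> A * l2 lborel u"
proof -
  have [measurable]: "u \<in> borel_measurable borel" using u by auto
  have s: "(\<integral>\<^sup>+x. ennreal ((norm (\<integral>y. F x y \<partial>lborel))\<^sup>2) \<partial>lborel)
      \<le> ennreal A * (\<integral>\<^sup>+x. \<integral>\<^sup>+y. ennreal (k (x - y) * (norm (u y))\<^sup>2) \<partial>lborel \<partial>lborel)"
  proof (rule nn_integral_schur)
    show "(\<integral>\<^sup>+y. ennreal (k (x - y)) \<partial>lborel) \<le> ennreal A" for x
      using nn_integral_lborel_reflect[of "\<lambda>y. ennreal (k y)" x] A by simp
  qed (use k F in auto)
  have "(\<integral>\<^sup>+x. \<integral>\<^sup>+y. ennreal (k (x - y) * (norm (u y))\<^sup>2) \<partial>lborel \<partial>lborel)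
      = (\<integral>\<^sup>+y. \<integral>\<^sup>+x. ennreal (k (x - y) * (norm (u y))\<^sup>2) \<partial>lborel \<partial>lborel)"
    by (rule lborel_pair.Fubini') measurable
  also have "\<dots> = (\<integral>\<^sup>+y. (\<integral>\<^sup>+x. ennreal (k x) \<partial>lborel) * ennreal ((norm (u y))\<^sup>2) \<partial>lborel)"
  proof (rule nn_integral_cong)
    fix y
    have "(\<integral>\<^sup>+x. ennreal (k (x - y) * (norm (u y))\<^sup>2) \<partial>lborel) = (\<integral>\<^sup>+x. ennreal (k (x - y)) * ennreal ((norm (u y))\<^sup>2) \<partial>lborel)"
      by (simp add: ennreal_mult k)
    also have "\<dots> = (\<integral>\<^sup>+x. ennreal (k (x - y)) \<partial>lborel) * ennreal ((norm (u y))\<^sup>2)"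
      by (rule nn_integral_multc) measurable
    also have "(\<integral>\<^sup>+x. ennreal (k (x - y)) \<partial>lborel) = (\<integral>\<^sup>+x. ennreal (k x) \<partial>lborel)"
      using nn_integral_lborel_translate[of "\<lambda>x. ennreal (k x)" "- y"] by simp
    finally show "(\<integral>\<^sup>+x. ennreal (k (x - y) * (norm (u y))\<^sup>2) \<partial>lborel)
        = (\<integral>\<^sup>+x. ennreal (k x) \<partial>lborel) * ennreal ((norm (u y))\<^sup>2)" .
  qed
  also have "\<dots> \<le> (\<integral>\<^sup>+y. ennreal A * ennreal ((norm (u y))\<^sup>2) \<partial>lborel)"
    by (intro nn_integral_mono mult_right_mono A) simp
  also have "\<dots> = ennreal A * ennreal ((l2 lborel u)\<^sup>2)"
    by (subst nn_integral_cmult) (auto simp: nn_integral_l2[OF u])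
  finally have e: "(\<integral>\<^sup>+x. \<integral>\<^sup>+y. ennreal (k (x - y) * (norm (u y))\<^sup>2) \<partial>lborel \<partial>lborel)
      \<le> ennreal A * ennreal ((l2 lborel u)\<^sup>2)" .
  have "ennreal A * (ennreal A * ennreal ((l2 lborel u)\<^sup>2)) = ennreal ((A * l2 lborel u)\<^sup>2)"
    using A(2) by (simp add: ennreal_mult[symmetric] power2_eq_square ac_simps)
  with order_trans[OF s mult_left_mono[OF e]]
  have b: "(\<integral>\<^sup>+x. ennreal ((norm (\<integral>y. F x y \<partial>lborel))\<^sup>2) \<partial>lborel) \<le> ennreal ((A * l2 lborel u)\<^sup>2)"
    by simp
  show "sq_integrable lborel (\<lambda>x. \<integral>y. F x y \<partial>lborel)" "l2 lborel (\<lambda>x. \<integral>y. F x y \<partial>lborel) \<le> A * l2 lborel u"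
    using l2_le_nn_integral[OF _ _ b] m A(2) by auto
qed

lemma mollify_integrable:
  fixes u :: "'a::euclidean_space \<Rightarrow> 'b::euclidean_space"
  assumes d: "0 < d" and u: "sq_integrable lborel u"
  shows "integrable lborel (\<lambda>y. mollifier d (x - y) *\<^sub>R u y)"
proof -
  have [measurable]: "u \<in> borel_measurable borel" using u by auto
  have "sq_integrable lborel (\<lambda>y. mollifier d (x - y))"
    using test_function_mollifier_reflect[OF d, of x "1::real"] test_function_support[of "\<lambda>y. mollifier d (x - y)"]
      continuous_support_integrable(2)[OF test_function_continuous] by (metis (no_types, lifting) real_scaleR_def mult.right_neutral ext)
  from sq_integrable_norm_mult[OF this u]
  have "integrable lborel (\<lambda>y. norm (mollifier d (x - y) *\<^sub>R u y))" by simp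
  then show ?thesis by (rule integrable_norm_cancel) measurable
qed

lemma mollify_alt:
  fixes u :: "'a::euclidean_space \<Rightarrow> 'b::euclidean_space"
  assumes [measurable]: "u \<in> borel_measurable borel"
  shows "mollify d u x = (\<integral>y. mollifier d y *\<^sub>R u (x - y) \<partial>lborel)"
  unfolding mollify_def using integral_lborel_reflect[of "\<lambda>y. mollifier d (x - y) *\<^sub>R u y" x] by simp

lemma mollify_integrable_alt:
  fixes u :: "'a::euclidean_space \<Rightarrow> 'b::euclidean_space"
  assumes d: "0 < d" and u: "sq_integrable lborel u"
  shows "integrable lborel (\<lambda>y. mollifier d y *\<^sub>R u (x - y))"
  using integrable_lborel_reflect[OF mollify_integrable[OF assms, of x], of x] by simp

lemma measurable_mollify [measurable]:
  fixes u :: "'a::euclidean_space \<Rightarrow> 'b::euclidean_space"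
  assumes [measurable]: "u \<in> borel_measurable borel"
  shows "mollify d u \<in> borel_measurable borel"
  unfolding mollify_def[abs_def] by measurable

lemma mollify_l2:
  fixes u :: "'a::euclidean_space \<Rightarrow> 'b::euclidean_space"
  assumes d: "0 < d" and u: "sq_integrable lborel u"
  shows "sq_integrable lborel (mollify d u)" "l2 lborel (mollify d u) \<le> l2 lborel u"
proof -
  have [measurable]: "u \<in> borel_measurable borel" using u by auto
  note y = Young_l2[of "mollifier d" u "\<lambda>x y. mollifier d (x - y) *\<^sub>R u y" 1]
  show "sq_integrable lborel (mollify d u)" "l2 lborel (mollify d u) \<le> l2 lborel u"
    using y u mollifier_integral(4)[OF d, where 'a='a] mollifier_nonneg[OF d]
    by (auto simp: mollify_def[abs_def])
qed

lemma mollify_diff: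
  fixes u v :: "'a::euclidean_space \<Rightarrow> 'b::euclidean_space"
  assumes d: "0 < d" and u: "sq_integrable lborel u" and v: "sq_integrable lborel v"
  shows "mollify d (\<lambda>x. u x - v x) x = mollify d u x - mollify d v x"
  unfolding mollify_def scaleR_diff_right
  by (rule Bochner_Integration.integral_diff) (intro mollify_integrable assms)+

lemma mollify_support:
  fixes u :: "'a::euclidean_space \<Rightarrow> 'b::euclidean_space"
  assumes d: "0 < d" and R: "\<And>x. R < norm x \<Longrightarrow> u x = 0" and x: "R + d < norm x"
  shows "mollify d u x = 0"
proof -
  have "mollifier d (x - y) *\<^sub>R u y = 0" for y
    using mollifier_support[OF d, of "x - y"] R[of y] norm_triangle_sub[of x y] x
    by (cases "norm y \<le> R") auto
  then show ?thesis unfolding mollify_def by (simp del: scaleR_eq_0_iff)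
qed

text \<open>Lets two scales be compared through the function mollified at both.\<close>

lemma mollify_commute:
  fixes u :: "'a::euclidean_space \<Rightarrow> 'b::euclidean_space"
  assumes d: "0 < d" and e: "0 < e" and u: "sq_integrable lborel u"
  shows "mollify d (mollify e u) x = mollify e (mollify d u) x"
proof -
  have [measurable]: "u \<in> borel_measurable borel" using u by auto
  \<comment> \<open>Absolute convergence of the double integral is the same iterated mollification
    applied to the norm of \<open>u\<close>.\<close>
  define nu where "nu = (\<lambda>x. norm (u x))"
  have [measurable]: "nu \<in> borel_measurable borel" unfolding nu_def by measurable
  have nu: "sq_integrable lborel nu" using u by (auto simp: nu_def sq_integrable_def)
  let ?f = "\<lambda>y z. mollifier d y *\<^sub>R mollifier e z *\<^sub>R u (x - y - z)"
  have i: "integrable (lborel \<Otimes>\<^sub>M lborel) (case_prod ?f)"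
  proof (rule lborel_pair.Fubini_integrable)
    show "(\<lambda>(y, z). ?f y z) \<in> borel_measurable (lborel \<Otimes>\<^sub>M lborel)" by measurable
    have "(\<integral>z. norm (case (y, z) of (y, z) \<Rightarrow> ?f y z) \<partial>lborel) = mollifier d y * mollify e nu (x - y)" for y
      by (simp add: mollify_alt[of "\<lambda>x. norm (u x)"] nu_def abs_mult mult.assoc mollifier_nonneg d e)
    then show "integrable lborel (\<lambda>y. \<integral>z. norm (case (y, z) of (y, z) \<Rightarrow> ?f y z) \<partial>lborel)"
      using mollify_integrable_alt[OF d mollify_l2(1)[OF e nu], of x] by simp
    have "integrable lborel (\<lambda>z. mollifier d y *\<^sub>R mollifier e z *\<^sub>R u (x - y - z))" for y
      by (intro integrable_scaleR_right mollify_integrable_alt[OF e u])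
    then show "AE y in lborel. integrable lborel (\<lambda>z. case (y, z) of (y, z) \<Rightarrow> ?f y z)"
      by (intro AE_I2) simp
  qed
  have "mollify d (mollify e u) x = (\<integral>y. (\<integral>z. ?f y z \<partial>lborel) \<partial>lborel)"
    by (simp add: mollify_alt[of "mollify e u"] mollify_alt[of u] del: scaleR_scaleR)
  also have "\<dots> = (\<integral>z. (\<integral>y. ?f y z \<partial>lborel) \<partial>lborel)"
    by (rule lborel_pair.Fubini_integral[OF i, symmetric])
  also have "\<dots> = (\<integral>z. mollifier e z *\<^sub>R (\<integral>y. mollifier d y *\<^sub>R u (x - z - y) \<partial>lborel) \<partial>lborel)"
  proof -
    have "?f y z = mollifier e z *\<^sub>R mollifier d y *\<^sub>R u (x - z - y)" for y z
      by (simp add: algebra_simps)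
    then show ?thesis by (simp only: integral_scaleR_right)
  qed
  also have "\<dots> = mollify e (mollify d u) x"
    by (simp add: mollify_alt[of "mollify d u"] mollify_alt[of u])
  finally show ?thesis .
qed

text \<open>Mollification does not increase the norm, so it suffices to treat a continuous
  \<open>h\<close> of compact support close to \<open>u\<close>; for it the convergence is uniform,
  with supports in a fixed ball.\<close>

lemma mollify_tendsto:
  fixes u :: "'a::euclidean_space \<Rightarrow> 'b::euclidean_space"
  assumes u: "sq_integrable lborel u" and e: "0 < e"
  obtains d0 where "0 < d0" "\<And>d. 0 < d \<Longrightarrow> d < d0 \<Longrightarrow> l2 lborel (\<lambda>x. mollify d u x - u x) < e"
proof -
  have e3: "0 < e/3" using e by simp
  obtain h r where h: "continuous_on UNIV h" and hr: "\<And>x. r < norm x \<Longrightarrow> h x = 0" and hs: "sq_integrable lborel h"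
    and uh: "l2 lborel (\<lambda>x. u x - h x) < e/3"
    using l2_dense_continuous[OF u e3] by blast
  have [measurable]: "h \<in> borel_measurable borel" using h by (rule borel_measurable_continuous_onI)
  let ?V = "measure lborel (cball (0::'a) (r + 1))"
  \<comment> \<open>A uniform error t on the ball costs t times the root of its volume. The summand
    1 keeps the denominator positive and the product strictly below e/3.\<close>
  define t where "t = e / 3 / (sqrt ?V + 1)"
  have t: "0 < t" using e unfolding t_def by (intro divide_pos_pos) (auto intro: add_nonneg_pos)
  have V: "t * sqrt ?V < e/3"
  proof -
    have "0 < sqrt ?V + 1" by (intro add_nonneg_pos) auto
    then have "sqrt ?V + 1 \<noteq> 0" by simp
    then have "t * (sqrt ?V + 1) = e/3" using t_def nonzero_eq_divide_eq by metis
    then show ?thesis using t by (simp add: distrib_left)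
  qed
  have "uniformly_continuous_on (cball 0 (r + 2)) h"
    by (intro compact_uniformly_continuous continuous_on_subset[OF h]) auto
  then obtain d1 where d1: "0 < d1" "\<And>x y. x \<in> cball 0 (r+2) \<Longrightarrow> y \<in> cball 0 (r+2) \<Longrightarrow> dist y x < d1 \<Longrightarrow> dist (h y) (h x) < t"
    unfolding uniformly_continuous_on_def using t by metis
  show thesis
  proof
    show "0 < min 1 d1" using d1 by simp
    fix d :: real assume d: "0 < d" "d < min 1 d1"
    have pt: "norm (mollify d h x - h x) \<le> t * indicator (cball 0 (r+1)) x" for x
    proof (cases "norm x \<le> r + 1")
      case False
      then show ?thesis using mollify_support[where u=h and R=r and x=x, OF d(1) hr] hr[of x] d by auto
    next
      case True
      have "mollify d h x - h x = (\<integral>y. mollifier d y *\<^sub>R h (x - y) \<partial>lborel) - (\<integral>y. mollifier d (y::'a) *\<^sub>R h x \<partial>lborel)"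
        by (simp add: mollify_alt integral_mollifier_scaleR[OF d(1)])
      also have "\<dots> = (\<integral>y. mollifier d y *\<^sub>R (h (x - y) - h x) \<partial>lborel)"
        unfolding scaleR_diff_right
        by (rule Bochner_Integration.integral_diff[symmetric])
          (rule mollify_integrable_alt[OF d(1) hs] integral_mollifier_scaleR(2)[OF d(1)])+
      finally have "norm (mollify d h x - h x) \<le> (\<integral>y. norm (mollifier d y *\<^sub>R (h (x - y) - h x)) \<partial>lborel)"
        by (simp only: integral_norm_bound)
      also have "\<dots> \<le> (\<integral>y. mollifier d (y::'a) * t \<partial>lborel)"
      proof (rule integral_mono')
        show "integrable lborel (\<lambda>y::'a. mollifier d y * t)" using mollifier_integral(1)[OF d(1), where 'a='a] by simp
        fix y :: 'a
        show "norm (mollifier d y *\<^sub>R (h (x - y) - h x)) \<le> mollifier d y * t"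
        proof (cases "norm y < d")
          case True
          have "norm (x - y) \<le> r + 2" using \<open>norm x \<le> r+1\<close> norm_triangle_ineq4[of x y] True d by simp
          then have "norm (h (x - y) - h x) \<le> t"
            using d1(2)[of x "x - y"] \<open>norm (x - y) \<le> r + 2\<close> \<open>norm x \<le> r+1\<close> True d by (simp add: dist_norm norm_minus_commute[of y x])
          then show ?thesis using mollifier_nonneg[OF d(1), of y] by (simp add: mult_left_mono)
        qed (use mollifier_support[OF d(1), of y] in simp)
        show "0 \<le> mollifier d y * t" using mollifier_nonneg[OF d(1), of y] t by simp
      qed
      also have "\<dots> = t" using mollifier_integral(3)[OF d(1), where 'a='a] by simp
      finally show ?thesis using True by simp
    qed
    have ms: "sq_integrable lborel (mollify d h)" by (rule mollify_l2(1)[OF d(1) hs])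
    have "l2 lborel (\<lambda>x. mollify d h x - h x) \<le> t * sqrt ?V"
    proof (rule l2_le_nn_integral(2))
      have "(\<integral>\<^sup>+x. ennreal ((norm (mollify d h x - h x))\<^sup>2) \<partial>lborel) \<le> (\<integral>\<^sup>+x. ennreal (t\<^sup>2) * indicator (cball (0::'a) (r+1)) x \<partial>lborel)"
      proof (rule nn_integral_mono)
        fix x
        have "(norm (mollify d h x - h x))\<^sup>2 \<le> (t * indicator (cball 0 (r+1)) x)\<^sup>2"
          by (rule power_mono[OF pt]) simp
        then show "ennreal ((norm (mollify d h x - h x))\<^sup>2) \<le> ennreal (t\<^sup>2) * indicator (cball 0 (r+1)) x"
          by (auto simp: indicator_def intro: ennreal_leI)
      qed
      also have "\<dots> = ennreal (t\<^sup>2) * emeasure lborel (cball (0::'a) (r+1))"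
        by (simp add: nn_integral_cmult_indicator)
      also have "emeasure lborel (cball (0::'a) (r+1)) = ennreal ?V"
        using emeasure_bounded_finite[OF bounded_cball[of "0::'a" "r+1"]] by (intro emeasure_eq_ennreal_measure) auto
      also have "ennreal (t\<^sup>2) * ennreal ?V = ennreal ((t * sqrt ?V)\<^sup>2)"
        by (simp add: ennreal_mult[symmetric] power_mult_distrib)
      finally show "(\<integral>\<^sup>+x. ennreal ((norm (mollify d h x - h x))\<^sup>2) \<partial>lborel) \<le> ennreal ((t * sqrt ?V)\<^sup>2)" .
    qed (use t in auto)
    moreover have "l2 lborel (\<lambda>x. mollify d u x - mollify d h x) \<le> l2 lborel (\<lambda>x. u x - h x)"
      using mollify_l2(2)[OF d(1) sq_integrable_diff[OF u hs]]
      unfolding ext[of "mollify d (\<lambda>x. u x - h x)", OF mollify_diff[OF d(1) u hs]] .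
    moreover have "l2 lborel (\<lambda>x. mollify d u x - u x) \<le> l2 lborel (\<lambda>x. mollify d u x - mollify d h x)
        + l2 lborel (\<lambda>x. mollify d h x - u x)"
      by (rule l2_triangle_diff) (use u ms mollify_l2[OF d(1) u] in auto)
    moreover have "l2 lborel (\<lambda>x. mollify d h x - u x) \<le> l2 lborel (\<lambda>x. mollify d h x - h x) + l2 lborel (\<lambda>x. h x - u x)"
      by (rule l2_triangle_diff) (use u ms hs in auto)
    ultimately show "l2 lborel (\<lambda>x. mollify d u x - u x) < e"
      using uh V l2_minus_commute[of lborel u h] by linarith
  qed
qed

text \<open>The mollifier is a probability density, so the square of the averaged difference is at
  most the average of the squares (\<open>nn_integral_schur\<close> with constant 1). This turns
  control of translations into control of the mollification error.\<close>

lemma mollify_diff_nn_integral: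
  fixes u :: "'a::euclidean_space \<Rightarrow> 'b::euclidean_space"
  assumes d: "0 < d" and u: "sq_integrable lborel u"
  shows "(\<integral>\<^sup>+x. ennreal ((norm (u x - mollify d u x))\<^sup>2) \<partial>lborel)
    \<le> (\<integral>\<^sup>+z. ennreal (mollifier d z) * (\<integral>\<^sup>+x. ennreal ((norm (u x - u (x - z)))\<^sup>2) \<partial>lborel) \<partial>lborel)"
proof -
  have [measurable]: "u \<in> borel_measurable borel" using u by auto
  have eq: "u x - mollify d u x = (\<integral>z. mollifier d z *\<^sub>R (u x - u (x - z)) \<partial>lborel)" for x
  proof -
    have "u x - mollify d u x = (\<integral>y. mollifier d (y::'a) *\<^sub>R u x \<partial>lborel) - (\<integral>y. mollifier d y *\<^sub>R u (x - y) \<partial>lborel)"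
      by (simp add: mollify_alt integral_mollifier_scaleR[OF d])
    also have "\<dots> = (\<integral>y. mollifier d y *\<^sub>R (u x - u (x - y)) \<partial>lborel)"
      unfolding scaleR_diff_right
      by (rule Bochner_Integration.integral_diff[symmetric])
        (rule mollify_integrable_alt[OF d u] integral_mollifier_scaleR(2)[OF d])+
    finally show ?thesis .
  qed
  have "(\<integral>\<^sup>+x. ennreal ((norm (\<integral>z. mollifier d z *\<^sub>R (u x - u (x - z)) \<partial>lborel))\<^sup>2) \<partial>lborel)
      \<le> ennreal 1 * (\<integral>\<^sup>+x. \<integral>\<^sup>+z. ennreal (mollifier d z * (norm (u x - u (x - z)))\<^sup>2) \<partial>lborel \<partial>lborel)"
    by (rule nn_integral_schur) (auto simp: mollifier_nonneg d mollifier_integral(4))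
  also have "\<dots> = (\<integral>\<^sup>+z. \<integral>\<^sup>+x. ennreal (mollifier d z * (norm (u x - u (x - z)))\<^sup>2) \<partial>lborel \<partial>lborel)"
    by (subst lborel_pair.Fubini') auto
  also have "\<dots> = (\<integral>\<^sup>+z. ennreal (mollifier d z) * (\<integral>\<^sup>+x. ennreal ((norm (u x - u (x - z)))\<^sup>2) \<partial>lborel) \<partial>lborel)"
    by (rule nn_integral_cong, subst nn_integral_cmult[symmetric])
      (auto simp: ennreal_mult mollifier_nonneg d)
  finally show ?thesis by (simp add: eq)
qed

section \<open>The classical gradient of a mollification\<close>

definition mollify_gradient :: "real \<Rightarrow> ('a::euclidean_space \<Rightarrow> real) \<Rightarrow> 'a \<Rightarrow> 'a" where
  "mollify_gradient d u x = (\<integral>y. u y *\<^sub>R gradient (mollifier d) (x - y) \<partial>lborel)"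

lemma gradient_mollifier_bounded:
  assumes "0 < d"
  obtains B where "0 < B" "\<And>x. norm (gradient (mollifier d) (x::'a::euclidean_space)) \<le> B"
proof -
  have "\<And>x::'a. d < norm x \<Longrightarrow> gradient (mollifier d) x = 0"
    by (rule gradient_support[OF test_function_mollifier[OF assms] mollifier_support[OF assms]])
  then show thesis
    using continuous_support_bounded[OF continuous_on_gradient[OF test_function_mollifier[OF assms]]] that by blast
qed

lemma mollify_gradient_integrable:
  fixes u :: "'a::euclidean_space \<Rightarrow> real"
  assumes d: "0 < d" and u: "integrable lborel u"
  shows "integrable lborel (\<lambda>y. u y *\<^sub>R gradient (mollifier d) (x - y))"
proof -
  have [measurable]: "u \<in> borel_measurable borel" "gradient (mollifier d :: 'a \<Rightarrow> real) \<in> borel_measurable borel"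
    using u measurable_gradient_mollifier[OF d] by (auto dest: borel_measurable_integrable)
  obtain B where B: "0 < B" "\<And>x. norm (gradient (mollifier d) (x::'a)) \<le> B"
    using gradient_mollifier_bounded[OF d] by blast
  show ?thesis
  proof (rule Bochner_Integration.integrable_bound[OF integrable_mult_right[OF u, of B]])
    show "AE y in lborel. norm (u y *\<^sub>R gradient (mollifier d) (x - y)) \<le> norm (B * u y)"
      using mult_left_mono[OF B(2) abs_ge_zero] B(1) by (intro AE_I2) (simp add: abs_mult mult.commute)
  qed measurable
qed

lemma gradient_quadratic_bound:
  fixes \<phi> :: "'a::euclidean_space \<Rightarrow> real"
  assumes \<phi>: "test_function \<phi>" and L: "\<And>x y. norm (gradient \<phi> x - gradient \<phi> y) \<le> L * norm (x - y)"
  shows "\<bar>\<phi> (a + h) - \<phi> a - gradient \<phi> a \<bullet> h\<bar> \<le> L * (norm h)\<^sup>2"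
proof -
  have "((\<lambda>t. \<phi> (a + t *\<^sub>R h)) has_real_derivative gradient \<phi> (a + t *\<^sub>R h) \<bullet> h) (at t)" for t
    unfolding has_field_derivative_def
    by (rule has_derivative_eq_rhs[OF has_derivative_compose[OF _ test_function_gradient[OF \<phi>]]])
      (auto intro!: derivative_eq_intros)
  from MVT2[of 0 1, OF _ this] obtain t where t: "0 < t" "t < 1"
    "\<phi> (a + h) - \<phi> a = gradient \<phi> (a + t *\<^sub>R h) \<bullet> h" by auto
  have L0: "0 \<le> L"
  proof -
    obtain b :: 'a where "b \<in> Basis" using nonempty_Basis by blast
    then have "norm (gradient \<phi> b - gradient \<phi> 0) \<le> L" using L[of b 0] by simp
    then show ?thesis using norm_ge_zero order_trans by blast
  qed
  have "\<bar>\<phi> (a + h) - \<phi> a - gradient \<phi> a \<bullet> h\<bar> = \<bar>(gradient \<phi> (a + t *\<^sub>R h) - gradient \<phi> a) \<bullet> h\<bar>"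
    by (simp add: t(3) inner_diff_left)
  also have "\<dots> \<le> norm (gradient \<phi> (a + t *\<^sub>R h) - gradient \<phi> a) * norm h"
    by (rule Cauchy_Schwarz_ineq2)
  also have "\<dots> \<le> (L * norm (t *\<^sub>R h)) * norm h"
    by (rule mult_right_mono) (use L[of "a + t *\<^sub>R h" a] in auto)
  also have "\<dots> = t * (L * (norm h)\<^sup>2)" using t by (simp add: power2_eq_square)
  also have "\<dots> \<le> 1 * (L * (norm h)\<^sup>2)" using t L0 by (intro mult_right_mono) auto
  finally show ?thesis by simp
qed

text \<open>The second-order remainder of the mollifier is uniform in its base point, so multiplying
  by the integrable \<open>u\<close> and integrating leaves an error of order |y - x|^2.\<close>

lemma mollify_has_derivative:
  fixes u :: "'a::euclidean_space \<Rightarrow> real"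
  assumes d: "0 < d" and u: "integrable lborel u" and us: "sq_integrable lborel u"
  shows "(mollify d u has_derivative (\<lambda>h. mollify_gradient d u x \<bullet> h)) (at x)"
proof -
  have tf: "test_function (mollifier d :: 'a \<Rightarrow> real)" by (rule test_function_mollifier[OF d])
  obtain L where L: "0 < L" "\<And>x y. norm (gradient (mollifier d) (x::'a) - gradient (mollifier d) y) \<le> L * norm (x - y)"
    using test_function_gradient_Lipschitz[OF tf] by blast
  have "norm ((mollify d u y - mollify d u x) - mollify_gradient d u x \<bullet> (y - x)) / norm (y - x)
      \<le> L * (\<integral>z. norm (u z) \<partial>lborel) * norm (y - x)" if "y \<noteq> x" for y
  proof -
    note i = mollify_integrable[OF d us] mollify_gradient_integrable[OF d u]
    have eq: "(mollify d u y - mollify d u x) - mollify_gradient d u x \<bullet> (y - x)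
      = (\<integral>z. mollifier d (y - z) *\<^sub>R u z - mollifier d (x - z) *\<^sub>R u z - (u z *\<^sub>R gradient (mollifier d) (x - z)) \<bullet> (y - x) \<partial>lborel)"
    proof -
      have 1: "(\<integral>z. u z *\<^sub>R gradient (mollifier d) (x - z) \<partial>lborel) \<bullet> (y - x)
          = (\<integral>z. (u z *\<^sub>R gradient (mollifier d) (x - z)) \<bullet> (y - x) \<partial>lborel)"
        by (rule integral_inner_left[symmetric]) (rule i)
      have 2: "integrable lborel (\<lambda>z. (u z *\<^sub>R gradient (mollifier d) (x - z)) \<bullet> (y - x))"
        by (rule integrable_inner_left) (rule i)
      show ?thesis unfolding mollify_def mollify_gradient_def 1
        using i(1) by (simp only: 2 Bochner_Integration.integral_diff Bochner_Integration.integrable_diff)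
    qed
    have "norm ((mollify d u y - mollify d u x) - mollify_gradient d u x \<bullet> (y - x)) \<le> (\<integral>z. norm (mollifier d (y - z) *\<^sub>R u z - mollifier d (x - z) *\<^sub>R u z - (u z *\<^sub>R gradient (mollifier d) (x - z)) \<bullet> (y - x)) \<partial>lborel)"
      unfolding eq by (rule integral_norm_bound)
    also have "\<dots> \<le> (\<integral>z. (L * (norm (y - x))\<^sup>2) * norm (u z) \<partial>lborel)"
    proof (rule integral_mono')
      show "integrable lborel (\<lambda>z. (L * (norm (y - x))\<^sup>2) * norm (u z))" using u by simp
      fix z
      have "mollifier d (y - z) *\<^sub>R u z - mollifier d (x - z) *\<^sub>R u z - (u z *\<^sub>R gradient (mollifier d) (x - z)) \<bullet> (y - x)
        = (mollifier d ((x - z) + (y - x)) - mollifier d (x - z) - gradient (mollifier d) (x - z) \<bullet> (y - x)) * u z"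
        by (simp add: algebra_simps)
      then show "norm (mollifier d (y - z) *\<^sub>R u z - mollifier d (x - z) *\<^sub>R u z - (u z *\<^sub>R gradient (mollifier d) (x - z)) \<bullet> (y - x))
          \<le> (L * (norm (y - x))\<^sup>2) * norm (u z)"
        using gradient_quadratic_bound[OF tf L(2), of "x - z" "y - x"] by (simp add: abs_mult mult_right_mono)
      show "0 \<le> (L * (norm (y - x))\<^sup>2) * norm (u z)" using L by simp
    qed
    finally show ?thesis using that by (simp add: divide_le_eq power2_eq_square ac_simps)
  qed
  then show ?thesis
    by (intro has_derivativeI_sandwich[of 1 _ _ _ _ "\<lambda>y. L * (\<integral>z. norm (u z) \<partial>lborel) * norm (y - x)"])
      (auto intro!: bounded_linear_inner_right tendsto_eq_intros)
qed

lemma mollify_gradient_continuous: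
  fixes u :: "'a::euclidean_space \<Rightarrow> real"
  assumes d: "0 < d" and u: "integrable lborel u"
  shows "continuous_on S (mollify_gradient d u)"
proof -
  have tf: "test_function (mollifier d :: 'a \<Rightarrow> real)" by (rule test_function_mollifier[OF d])
  obtain L where L: "0 < L" "\<And>x y. norm (gradient (mollifier d) (x::'a) - gradient (mollifier d) y) \<le> L * norm (x - y)"
    using test_function_gradient_Lipschitz[OF tf] by blast
  have "(L * (\<integral>z. norm (u z) \<partial>lborel))-lipschitz_on UNIV (mollify_gradient d u)"
  proof (rule lipschitz_onI)
    show "0 \<le> L * (\<integral>z. norm (u z) \<partial>lborel)" using L by simp
    fix x y
    have eq: "mollify_gradient d u x - mollify_gradient d u y
        = (\<integral>z. u z *\<^sub>R gradient (mollifier d) (x - z) - u z *\<^sub>R gradient (mollifier d) (y - z) \<partial>lborel)"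
      unfolding mollify_gradient_def
      by (rule Bochner_Integration.integral_diff[symmetric]) (intro mollify_gradient_integrable d u)+
    have "norm (mollify_gradient d u x - mollify_gradient d u y) \<le> (\<integral>z. norm (u z *\<^sub>R gradient (mollifier d) (x - z) - u z *\<^sub>R gradient (mollifier d) (y - z)) \<partial>lborel)"
      unfolding eq by (rule integral_norm_bound)
    also have "\<dots> \<le> (\<integral>z. (L * norm (x - y)) * norm (u z) \<partial>lborel)"
    proof (rule integral_mono')
      show "integrable lborel (\<lambda>z. (L * norm (x - y)) * norm (u z))" using u by simp
      fix z
      show "norm (u z *\<^sub>R gradient (mollifier d) (x - z) - u z *\<^sub>R gradient (mollifier d) (y - z))
          \<le> (L * norm (x - y)) * norm (u z)"
        using mult_right_mono[OF L(2)[of "x - z" "y - z"], of "norm (u z)"]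
        by (simp add: scaleR_diff_right[symmetric] mult.commute)
      show "0 \<le> (L * norm (x - y)) * norm (u z)" using L by simp
    qed
    finally show "dist (mollify_gradient d u x) (mollify_gradient d u y) \<le> L * (\<integral>z. norm (u z) \<partial>lborel) * dist x y"
      by (simp add: dist_norm ac_simps)
  qed
  then show ?thesis using lipschitz_on_continuous_on continuous_on_subset by blast
qed

lemma mollify_gradient_l2:
  fixes u :: "'a::euclidean_space \<Rightarrow> real"
  assumes d: "0 < d" and u: "integrable lborel u" and us: "sq_integrable lborel u"
  shows "sq_integrable lborel (mollify_gradient d u)"
    "l2 lborel (mollify_gradient d u) \<le> (\<integral>x. norm (gradient bump (x::'a)) \<partial>lborel) / d * l2 lborel u"
proof -
  have [measurable]: "u \<in> borel_measurable borel" "gradient (mollifier d :: 'a \<Rightarrow> real) \<in> borel_measurable borel"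
    using us measurable_gradient_mollifier[OF d] by auto
  note y = Young_l2[of "\<lambda>x. norm (gradient (mollifier d) (x::'a))" u "\<lambda>(x::'a) y. u y *\<^sub>R gradient (mollifier d) (x - y)"
      "(\<integral>x. norm (gradient bump (x::'a)) \<partial>lborel) / d"]
  show "sq_integrable lborel (mollify_gradient d u)"
    "l2 lborel (mollify_gradient d u) \<le> (\<integral>x. norm (gradient bump (x::'a)) \<partial>lborel) / d * l2 lborel u"
    using y us nn_integral_gradient_mollifier[OF d, where 'a='a] d
    by (auto simp: mollify_gradient_def[abs_def])
qed

lemma mollify_gradient_support:
  fixes u :: "'a::euclidean_space \<Rightarrow> real"
  assumes d: "0 < d" and R: "\<And>x. R < norm x \<Longrightarrow> u x = 0" and x: "R + d < norm x"
  shows "mollify_gradient d u x = 0"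
proof -
  have "u y *\<^sub>R gradient (mollifier d) (x - y) = 0" for y
    using gradient_support[OF test_function_mollifier[OF d] mollifier_support[OF d], where x="x - y"]
      R[of y] norm_triangle_sub[of x y] x
    by (cases "norm y \<le> R") auto
  then show ?thesis unfolding mollify_gradient_def by (simp del: scaleR_eq_0_iff)
qed


section \<open>The nonlocal gradient of smooth functions\<close>

text \<open>The gradient is an argument rather than a derivative taken by choice, so that
  \<open>mollify_gradient\<close> can be put in its place.\<close>

definition C1_support :: "real \<Rightarrow> ('a::euclidean_space \<Rightarrow> real) \<Rightarrow> ('a \<Rightarrow> 'a) \<Rightarrow> bool" where
  "C1_support r U G \<longleftrightarrow> (\<forall>x. (U has_derivative (\<lambda>h. G x \<bullet> h)) (at x)) \<and> continuous_on UNIV G \<and>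
     (\<forall>x. r < norm x \<longrightarrow> U x = 0 \<and> G x = 0)"

lemma C1_support_mollify:
  fixes u :: "'a::euclidean_space \<Rightarrow> real"
  assumes "0 < d" "integrable lborel u" "sq_integrable lborel u" "\<And>x. r < norm x \<Longrightarrow> u x = 0"
  shows "C1_support (r + d) (mollify d u) (mollify_gradient d u)"
  unfolding C1_support_def
  using mollify_has_derivative[OF assms(1,2,3)] mollify_gradient_continuous[OF assms(1,2)]
    mollify_support[where u=u and R=r and d=d] mollify_gradient_support[where u=u and R=r and d=d] assms(1,4)
  by blast

lemma C1_supportD:
  fixes U :: "'a::euclidean_space \<Rightarrow> real"
  assumes "C1_support r U G"
  shows "\<And>x. (U has_derivative (\<lambda>h. G x \<bullet> h)) (at x)" "continuous_on UNIV G" "continuous_on UNIV U"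
    "\<And>x. r < norm x \<Longrightarrow> U x = 0" "\<And>x. r < norm x \<Longrightarrow> G x = 0"
    "U \<in> borel_measurable borel" "G \<in> borel_measurable borel"
    "integrable lborel U" "integrable lborel G" "sq_integrable lborel U" "sq_integrable lborel G"
proof -
  show d: "(U has_derivative (\<lambda>h. G x \<bullet> h)) (at x)" for x using assms by (simp add: C1_support_def)
  show G: "continuous_on UNIV G" using assms by (simp add: C1_support_def)
  show s: "\<And>x. r < norm x \<Longrightarrow> U x = 0" "\<And>x. r < norm x \<Longrightarrow> G x = 0"
    using assms by (auto simp: C1_support_def)
  show U: "continuous_on UNIV U"
    using has_derivative_continuous[OF d] by (simp add: continuous_on_eq_continuous_at)
  show "U \<in> borel_measurable borel" "G \<in> borel_measurable borel"
    using U G by (auto intro: borel_measurable_continuous_onI)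
  show "integrable lborel U" "integrable lborel G" "sq_integrable lborel U" "sq_integrable lborel G"
    using continuous_support_integrable[OF U s(1)] continuous_support_integrable[OF G s(2)] by auto
qed

lemma C1_support_Lipschitz:
  fixes U :: "'a::euclidean_space \<Rightarrow> real"
  assumes "C1_support r U G"
  shows "\<exists>L>0. (\<forall>x. norm (G x) \<le> L) \<and> (\<forall>x y. \<bar>U x - U y\<bar> \<le> L * norm (x - y))"
proof -
  note D = C1_supportD[OF assms]
  obtain L where L: "0 < L" "\<And>x. norm (G x) \<le> L" using continuous_support_bounded[OF D(2,5)] by blast
  have "onorm (\<lambda>h. G x \<bullet> h) \<le> L" for x
  proof (rule onorm_le)
    fix h
    show "norm (G x \<bullet> h) \<le> L * norm h"
      using Cauchy_Schwarz_ineq2[of "G x" h] mult_right_mono[OF L(2)[of x] norm_ge_zero[of h]] by simp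
  qed
  then have "norm (U x - U y) \<le> L * norm (x - y)" for x y
    by (intro differentiable_bound[of UNIV U]) (auto intro: D(1))
  with L show ?thesis by auto
qed

lemma integrable_pair_mult:
  fixes f :: "'a::euclidean_space \<Rightarrow> real" and g :: "'b::euclidean_space \<Rightarrow> real"
  assumes f: "integrable lborel f" and g: "integrable lborel g"
  shows "integrable (lborel \<Otimes>\<^sub>M lborel) (\<lambda>(x, y). f x * g y)"
proof (rule lborel_pair.Fubini_integrable)
  have [measurable]: "f \<in> borel_measurable borel" "g \<in> borel_measurable borel"
    using f g by (auto dest: borel_measurable_integrable)
  show "(\<lambda>(x, y). f x * g y) \<in> borel_measurable (lborel \<Otimes>\<^sub>M lborel)" by measurable
  show "integrable lborel (\<lambda>x. \<integral>y. norm (case (x, y) of (x, y) \<Rightarrow> f x * g y) \<partial>lborel)"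
    using f by (simp add: abs_mult)
  show "AE x in lborel. integrable lborel (\<lambda>y. case (x, y) of (x, y) \<Rightarrow> f x * g y)"
    using g by simp
qed

lemma integrable_pair_bound:
  fixes F :: "'a::euclidean_space \<Rightarrow> 'b::euclidean_space \<Rightarrow> real"
  assumes "integrable lborel f" "integrable lborel g"
    and "case_prod F \<in> borel_measurable (borel \<Otimes>\<^sub>M borel)"
    and "\<And>x y. \<bar>F x y\<bar> \<le> f x * g y"
  shows "integrable (lborel \<Otimes>\<^sub>M lborel) (case_prod F)"
proof (rule Bochner_Integration.integrable_bound[OF integrable_pair_mult[OF assms(1,2)]])
  show "case_prod F \<in> borel_measurable (lborel \<Otimes>\<^sub>M lborel)" using assms(3) by simp
  show "AE z in lborel \<Otimes>\<^sub>M lborel. norm (case z of (x, y) \<Rightarrow> F x y) \<le> norm (case z of (x, y) \<Rightarrow> f x * g y)"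
    using assms(4) by (intro AE_I2) (auto intro: order_trans[OF _ abs_ge_self])
qed

lemma integrable_indicator_cball: "integrable lborel (\<lambda>x::'a::euclidean_space. c * indicator (cball 0 R) x :: real)"
  by (intro integrable_mult_right integrable_real_indicator)
    (use emeasure_bounded_finite[OF bounded_cball[of "0::'a" R]] in auto)

text \<open>
  The kernel is \<open>\<kappa> z = \<bar>z\<bar>\<^sup>2 k z\<close> with \<open>k z = f \<bar>z\<bar> / \<bar>z\<bar> ^ n\<close>, so that \<open>f r = r powr (n - 2) * \<kappa>\<close>.
  Only the behaviour of \<open>f\<close> on \<open>(0, e]\<close> matters for the singularity.
\<close>

locale nonlocal_kernel =
  fixes f f' :: "real \<Rightarrow> real" and e c s C R :: real and dummy :: "'a::euclidean_space itself"
  assumes f_meas [measurable]: "f \<in> borel_measurable borel" and f'_meas [measurable]: "f' \<in> borel_measurable borel"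
    and f_nonneg: "0 < r \<Longrightarrow> 0 \<le> f r"
    and f_support: "R < r \<Longrightarrow> f r = 0"
    and kappa_integrable: "integrable lborel (\<lambda>z::'a. f (norm z) / norm z ^ DIM('a) * (norm z)\<^sup>2)"
    and f_deriv: "0 < r \<Longrightarrow> (f has_real_derivative f' r) (at r)"
    and f'_cont: "0 < r \<Longrightarrow> isCont f' r"
    and e_pos: "0 < e" and c_pos: "0 < c" and s_pos: "0 < s" and R_pos: "0 < R"
    and f_lower: "0 < r \<Longrightarrow> r \<le> e \<Longrightarrow> c \<le> r * f r"
    and f'_lower: "0 < r \<Longrightarrow> r \<le> e \<Longrightarrow> c * r powr (- 1 - s) \<le> - (r * f' r)"
    and f'_upper: "0 < r \<Longrightarrow> r \<le> e \<Longrightarrow> - (r * f' r) \<le> C * f r"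
begin

definition k :: "'a \<Rightarrow> real" where
  "k z = (if z = 0 then 0 else f (norm z) / norm z ^ DIM('a))"

definition kappa :: "'a \<Rightarrow> real" where
  "kappa z = k z * (norm z)\<^sup>2"

text \<open>The nonlocal gradient of a scalar function after the substitution y = x - z. Both
  factors 1/|z| of the original integrand are absorbed into \<open>k\<close>, since
  \<open>kappa\<close>, which is \<open>k\<close> times |z|^2, is the given kernel away from the
  origin.\<close>

definition nlgrad :: "('a \<Rightarrow> real) \<Rightarrow> 'a \<Rightarrow> 'a" where
  "nlgrad U x = (\<integral>z. ((U x - U (x - z)) * k z) *\<^sub>R z \<partial>lborel)"

lemma k_meas [measurable]: "k \<in> borel_measurable borel"
  unfolding k_def[abs_def] by measurable

lemma kappa_meas [measurable]: "kappa \<in> borel_measurable borel"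
  unfolding kappa_def[abs_def] by measurable

lemma k_nonneg: "0 \<le> k z"
  using f_nonneg[of "norm z"] by (simp add: k_def)

lemma kappa_nonneg: "0 \<le> kappa z"
  by (simp add: kappa_def k_nonneg)

lemma k_minus: "k (- z) = k z"
  by (simp add: k_def)

lemma k_support: "R < norm z \<Longrightarrow> k z = 0"
  by (simp add: k_def f_support)

lemma integrable_kappa: "integrable lborel kappa"
proof -
  have "kappa = (\<lambda>z::'a. f (norm z) / norm z ^ DIM('a) * (norm z)\<^sup>2)"
    by (auto simp: kappa_def k_def)
  then show ?thesis using kappa_integrable by simp
qed

lemma nlgrad_integrable:
  assumes [measurable]: "U \<in> borel_measurable borel" and L: "\<And>x y. \<bar>U x - U y\<bar> \<le> L * norm (x - y)"
  shows "norm (((U x - U (x - z)) * k z) *\<^sub>R z) \<le> L * kappa z"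
    "integrable lborel (\<lambda>z. ((U x - U (x - z)) * k z) *\<^sub>R z)"
proof -
  show b: "norm (((U x - U (x - z)) * k z) *\<^sub>R z) \<le> L * kappa z" for z
  proof -
    have "\<bar>U x - U (x - z)\<bar> * (k z * norm z) \<le> (L * norm z) * (k z * norm z)"
      by (rule mult_right_mono) (use L[of x "x - z"] k_nonneg in auto)
    then show ?thesis by (simp add: abs_mult k_nonneg kappa_def power2_eq_square ac_simps)
  qed
  show "integrable lborel (\<lambda>z. ((U x - U (x - z)) * k z) *\<^sub>R z)"
  proof (rule Bochner_Integration.integrable_bound[OF integrable_mult_right[OF integrable_kappa, of L]])
    show "AE z in lborel. norm (((U x - U (x - z)) * k z) *\<^sub>R z) \<le> norm (L * kappa z)"
      unfolding real_norm_def[of "L * _"] by (intro AE_I2 order_trans[OF b abs_ge_self])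
  qed measurable
qed

lemma nlgrad_meas [measurable]:
  assumes [measurable]: "U \<in> borel_measurable borel"
  shows "nlgrad U \<in> borel_measurable borel"
  unfolding nlgrad_def[abs_def] by measurable

lemma nlgrad_bounded:
  assumes [measurable]: "U \<in> borel_measurable borel" and L: "\<And>x y. \<bar>U x - U y\<bar> \<le> L * norm (x - y)"
  shows "norm (nlgrad U x) \<le> L * (\<integral>z. kappa z \<partial>lborel)"
proof -
  have "norm (nlgrad U x) \<le> (\<integral>z. norm (((U x - U (x - z)) * k z) *\<^sub>R z) \<partial>lborel)"
    unfolding nlgrad_def by (rule integral_norm_bound)
  also have "\<dots> \<le> (\<integral>z. L * kappa z \<partial>lborel)"
    by (rule integral_mono)
      (use integrable_norm[OF nlgrad_integrable(2)[OF assms]] nlgrad_integrable(1)[OF assms] integrable_kappa in auto)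
  finally show ?thesis by simp
qed

lemma nlgrad_support:
  assumes "\<And>x. r < norm x \<Longrightarrow> U x = 0" and "r + R < norm x"
  shows "nlgrad U x = 0"
proof -
  have "((U x - U (x - z)) * k z) *\<^sub>R z = 0" for z
  proof (cases "norm z \<le> R")
    case True
    have "r < norm x" using assms(2) R_pos by simp
    moreover have "r < norm (x - z)" using assms(2) True norm_triangle_ineq2[of x z] by simp
    ultimately show ?thesis using assms(1) by simp
  qed (simp add: k_support)
  then show ?thesis unfolding nlgrad_def by (simp del: scaleR_eq_0_iff)
qed

section \<open>Radial integration by parts\<close>

text \<open>
  \<open>E U z\<close> measures the translate of \<open>U\<close> by \<open>z\<close> and \<open>H U (gradient U)\<close> is its radial derivative, so that
  \<open>E U z\<close> is the integral of \<open>H U (gradient U) (t z) / t\<close> over \<open>t\<close> in \<open>[0, 1]\<close>. Integration by parts in the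
  radial variable turns the weight \<open>q\<close>, the part of \<open>k\<close> above the level \<open>f e\<close>, into the weight \<open>w\<close>,
  which is positive because \<open>f\<close> decreases on \<open>(0, e]\<close>.
\<close>

definition H :: "('a \<Rightarrow> real) \<Rightarrow> ('a \<Rightarrow> 'a) \<Rightarrow> 'a \<Rightarrow> real" where
  "H U G z = (\<integral>x. (U (x + z) - U x) * (G x \<bullet> z) \<partial>lborel)"

definition E :: "('a \<Rightarrow> real) \<Rightarrow> 'a \<Rightarrow> real" where
  "E U z = (\<integral>x. (U x - U (x - z))\<^sup>2 \<partial>lborel) / 2"

definition w :: "'a \<Rightarrow> real" where
  "w z = (if z \<noteq> 0 \<and> norm z \<le> e then - (norm z * f' (norm z)) / norm z ^ DIM('a) else 0)"

definition q :: "'a \<Rightarrow> real" where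
  "q z = (if z \<noteq> 0 \<and> norm z \<le> e then (f (norm z) - f e) / norm z ^ DIM('a) else 0)"

lemma w_meas [measurable]: "w \<in> borel_measurable borel"
  unfolding w_def[abs_def] by measurable

lemma q_meas [measurable]: "q \<in> borel_measurable borel"
  unfolding q_def[abs_def] by measurable

lemma w_nonneg: "0 \<le> w z"
proof (cases "z \<noteq> 0 \<and> norm z \<le> e")
  case True
  then have "0 \<le> c * norm z powr (- 1 - s)" using c_pos by simp
  also have "\<dots> \<le> - (norm z * f' (norm z))" using True f'_lower[of "norm z"] by simp
  finally have "0 \<le> - (norm z * f' (norm z)) / norm z ^ DIM('a)" by (rule divide_nonneg_nonneg) simp
  also have "\<dots> = w z" using True by (simp add: w_def)
  finally show ?thesis .
qed (auto simp: w_def)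

text \<open>The upper bound on the derivative of \<open>f\<close> enters here: as
  \<open>E U z\<close> is of order |z|^2, it makes the weighted energy finite.\<close>

lemma w_le: "w z * (norm z)\<^sup>2 \<le> \<bar>C\<bar> * kappa z"
proof (cases "z \<noteq> 0 \<and> norm z \<le> e")
  case True
  have "- (norm z * f' (norm z)) \<le> C * f (norm z)" using True f'_upper[of "norm z"] by simp
  also have "\<dots> \<le> \<bar>C\<bar> * f (norm z)" using True f_nonneg[of "norm z"] by (intro mult_right_mono) auto
  finally have "- (norm z * f' (norm z)) / norm z ^ DIM('a) * (norm z)\<^sup>2 \<le> (\<bar>C\<bar> * f (norm z)) / norm z ^ DIM('a) * (norm z)\<^sup>2"
    by (intro mult_right_mono divide_right_mono) auto
  then show ?thesis using True by (simp add: w_def kappa_def k_def)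
next
  case False
  then show ?thesis using kappa_nonneg by (auto simp: w_def)
qed

lemma f_antimono: "0 < a \<Longrightarrow> a \<le> b \<Longrightarrow> b \<le> e \<Longrightarrow> f b \<le> f a"
proof -
  assume ab: "0 < a" "a \<le> b" "b \<le> e"
  have "f' x \<le> 0" if "0 < x" "x \<le> e" for x
  proof -
    have "0 \<le> c * x powr (- 1 - s)" using c_pos by simp
    also have "\<dots> \<le> - (x * f' x)" using f'_lower that by simp
    finally show ?thesis using that by (simp add: mult_le_0_iff)
  qed
  then show ?thesis using ab
    by (intro DERIV_nonpos_imp_nonincreasing[of a b f]) (auto intro!: exI[of _ "f' _"] f_deriv)
qed

lemma q_bounds: "0 \<le> q z" "q z \<le> k z"
proof -
  show "0 \<le> q z" using f_antimono[of "norm z" e] by (simp add: q_def)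
  show "q z \<le> k z"
    using f_nonneg[of e] f_nonneg[of "norm z"] e_pos by (auto simp: q_def k_def divide_right_mono)
qed

lemma H_meas [measurable]:
  assumes [measurable]: "U \<in> borel_measurable borel" "G \<in> borel_measurable borel"
  shows "H U G \<in> borel_measurable borel"
proof -
  have "(\<lambda>(z, x). (U (x + z) - U x) * (G x \<bullet> z)) \<in> borel_measurable (borel \<Otimes>\<^sub>M lborel)"
    by measurable
  then show ?thesis unfolding H_def[abs_def] by (rule lborel.borel_measurable_lebesgue_integral)
qed

context
  fixes U :: "'a \<Rightarrow> real" and G :: "'a \<Rightarrow> 'a" and r :: real
  assumes C1: "C1_support r U G"
begin

private lemma UG_meas: "U \<in> borel_measurable borel" "G \<in> borel_measurable borel"
  using C1_supportD[OF C1] by auto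

text \<open>The shift \<open>z\<close> and the direction \<open>y\<close> are kept apart because the
  bound is applied to the shift t z in the direction z as well as to equal ones. Together they
  supply the |z|^2 that makes \<open>k\<close> integrable.\<close>

lemma H_bound_aux:
  assumes L: "\<And>x y. \<bar>U x - U y\<bar> \<le> L * norm (x - y)" 
  shows "\<bar>(U (x + z) - U x) * (G x \<bullet> y)\<bar> \<le> L * norm z * norm y * norm (G x)"
    "integrable lborel (\<lambda>x. (U (x + z) - U x) * (G x \<bullet> y))"
    "\<bar>\<integral>x. (U (x + z) - U x) * (G x \<bullet> y) \<partial>lborel\<bar> \<le> L * norm z * norm y * (\<integral>x. norm (G x) \<partial>lborel)"
proof -
  note [measurable] = UG_meas
  show b: "\<bar>(U (x + z) - U x) * (G x \<bullet> y)\<bar> \<le> L * norm z * norm y * norm (G x)" for x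
  proof -
    have Lz: "\<bar>U (x + z) - U x\<bar> \<le> L * norm z" using L[of "x+z" x] by simp
    then have "0 \<le> L * norm z" by linarith
    then have "\<bar>U (x + z) - U x\<bar> * \<bar>G x \<bullet> y\<bar> \<le> (L * norm z) * (norm (G x) * norm y)"
      by (intro mult_mono Lz Cauchy_Schwarz_ineq2) auto
    then show ?thesis by (simp add: abs_mult ac_simps)
  qed
  have i: "integrable lborel (\<lambda>x. L * norm z * norm y * norm (G x))"
    using C1_supportD(9)[OF C1] by simp
  show i': "integrable lborel (\<lambda>x. (U (x + z) - U x) * (G x \<bullet> y))"
  proof (rule Bochner_Integration.integrable_bound[OF i])
    show "AE x in lborel. norm ((U (x + z) - U x) * (G x \<bullet> y)) \<le> norm (L * norm z * norm y * norm (G x))"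
      unfolding real_norm_def by (intro AE_I2 order_trans[OF b abs_ge_self])
  qed measurable
  have "\<bar>\<integral>x. (U (x + z) - U x) * (G x \<bullet> y) \<partial>lborel\<bar> \<le> (\<integral>x. \<bar>(U (x + z) - U x) * (G x \<bullet> y)\<bar> \<partial>lborel)"
    by (rule integral_abs_bound)
  also have "\<dots> \<le> (\<integral>x. L * norm z * norm y * norm (G x) \<partial>lborel)"
    by (rule integral_mono) (use i i' b in auto)
  finally show "\<bar>\<integral>x. (U (x + z) - U x) * (G x \<bullet> y) \<partial>lborel\<bar> \<le> L * norm z * norm y * (\<integral>x. norm (G x) \<partial>lborel)"
    by simp
qed

lemma integrable_H_k: "integrable lborel (\<lambda>z. k z * \<bar>H U G z\<bar>)"
proof -
  note [measurable] = UG_meas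
  obtain L where L: "0 < L" "\<And>x y. \<bar>U x - U y\<bar> \<le> L * norm (x - y)"
    using C1_support_Lipschitz[OF C1] by blast
  let ?I = "\<integral>x. norm (G x) \<partial>lborel"
  show ?thesis
  proof (rule Bochner_Integration.integrable_bound[OF integrable_mult_right[OF integrable_kappa, of "L * ?I"]])
    show "AE z in lborel. norm (k z * \<bar>H U G z\<bar>) \<le> norm (L * ?I * kappa z)"
    proof (rule AE_I2)
      fix z
      have "k z * \<bar>H U G z\<bar> \<le> k z * (L * norm z * norm z * ?I)"
        unfolding H_def by (intro mult_left_mono H_bound_aux(3) L k_nonneg)
      then have "norm (k z * \<bar>H U G z\<bar>) \<le> L * ?I * kappa z"
        by (simp add: abs_mult k_nonneg kappa_def power2_eq_square ac_simps)
      then show "norm (k z * \<bar>H U G z\<bar>) \<le> norm (L * ?I * kappa z)" by simp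
    qed
  qed measurable
qed

text \<open>Fubini, then z is replaced by -z, which turns the backward differences of the nonlocal
  gradient into the forward differences of \<open>H\<close>; \<open>k\<close> is even.\<close>

lemma nlgrad_gradient_pairing:
  "(\<integral>x. nlgrad U x \<bullet> G x \<partial>lborel) = (\<integral>z. k z * H U G z \<partial>lborel)"
proof -
  note [measurable] = UG_meas
  obtain L where L: "0 < L" "\<And>x y. \<bar>U x - U y\<bar> \<le> L * norm (x - y)"
    using C1_support_Lipschitz[OF C1] by blast
  note D = C1_supportD[OF C1]
  let ?F = "\<lambda>x z. (((U x - U (x - z)) * k z) *\<^sub>R z) \<bullet> G x"
  have i: "integrable (lborel \<Otimes>\<^sub>M lborel) (case_prod ?F)"
  proof (rule integrable_pair_bound)
    show "integrable lborel (\<lambda>x. norm (G x))" using D by simp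
    show "integrable lborel (\<lambda>z. L * kappa z)" using integrable_kappa by simp
    show "(\<lambda>(x, z). ?F x z) \<in> borel_measurable (borel \<Otimes>\<^sub>M borel)" by measurable
    fix x z
    have "\<bar>?F x z\<bar> \<le> norm (((U x - U (x - z)) * k z) *\<^sub>R z) * norm (G x)"
      by (rule Cauchy_Schwarz_ineq2)
    also have "\<dots> \<le> (L * kappa z) * norm (G x)"
      by (intro mult_right_mono nlgrad_integrable(1) L) auto
    finally show "\<bar>?F x z\<bar> \<le> norm (G x) * (L * kappa z)" by (simp only: mult.commute)
  qed
  have "(\<integral>x. nlgrad U x \<bullet> G x \<partial>lborel) = (\<integral>x. (\<integral>z. ?F x z \<partial>lborel) \<partial>lborel)"
    unfolding nlgrad_def
    by (intro Bochner_Integration.integral_cong refl integral_inner_left[symmetric]) 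
      (use nlgrad_integrable(2)[of U L] L in auto)
  also have "\<dots> = (\<integral>z. (\<integral>x. ?F x z \<partial>lborel) \<partial>lborel)"
    by (rule lborel_pair.Fubini_integral[OF i, symmetric])
  also have "\<dots> = (\<integral>z. k (- z) * H U G (- z) \<partial>lborel)"
  proof (rule Bochner_Integration.integral_cong[OF refl])
    fix z
    have "(\<integral>x. ?F x z \<partial>lborel) = (\<integral>x. k z * ((U (x + - z) - U x) * (G x \<bullet> - z)) \<partial>lborel)"
      by (intro Bochner_Integration.integral_cong refl) (simp add: inner_commute algebra_simps)
    also have "\<dots> = k (- z) * H U G (- z)" by (simp only: integral_mult_right_zero H_def k_minus)
    finally show "(\<integral>x. ?F x z \<partial>lborel) = k (- z) * H U G (- z)" .
  qed
  also have "\<dots> = (\<integral>z. k z * H U G z \<partial>lborel)"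
    by (rule integral_lborel_uminus) measurable
  finally show ?thesis .
qed

text \<open>For fixed x the fundamental theorem is applied to t \<mapsto> (U x - U (x - t z))^2 / 2,
  and translation by t z then moves the gradient to x. Taking the direction z instead of t z avoids
  a division by t at t = 0.\<close>

lemma E_eq:
  "E U z = (\<integral>t. indicator {0..1} t * (\<integral>x. (U (x + t *\<^sub>R z) - U x) * (G x \<bullet> z) \<partial>lborel) \<partial>lborel)"
proof -
  note [measurable] = UG_meas
  obtain L where L: "0 < L" "\<And>x. norm (G x) \<le> L" "\<And>x y. \<bar>U x - U y\<bar> \<le> L * norm (x - y)"
    using C1_support_Lipschitz[OF C1] by blast
  note D = C1_supportD[OF C1]
  let ?F = "\<lambda>x t. ((U x - U (x - t *\<^sub>R z)) * (G (x - t *\<^sub>R z) \<bullet> z)) * indicator {0..1} t"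
  have ftc: "(\<integral>t. ?F x t \<partial>lborel) = (U x - U (x - z))\<^sup>2 / 2" for x
  proof -
    have "(\<integral>t. ?F x t \<partial>lborel) = (U x - U (x - 1 *\<^sub>R z))\<^sup>2 / 2 - (U x - U (x - 0 *\<^sub>R z))\<^sup>2 / 2"
    proof (rule integral_FTC_Icc_real)
      fix t :: real
      have "((\<lambda>t. U (x - t *\<^sub>R z)) has_derivative (\<lambda>h. G (x - t *\<^sub>R z) \<bullet> (- (h *\<^sub>R z)))) (at t)"
        by (rule has_derivative_compose[OF _ D(1)]) (auto intro!: derivative_eq_intros)
      then have d: "((\<lambda>t. U (x - t *\<^sub>R z)) has_real_derivative - (G (x - t *\<^sub>R z) \<bullet> z)) (at t)"
        unfolding has_field_derivative_def by (rule has_derivative_eq_rhs) (auto simp: mult.commute)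
      show "((\<lambda>t. (U x - U (x - t *\<^sub>R z))\<^sup>2 / 2) has_real_derivative (U x - U (x - t *\<^sub>R z)) * (G (x - t *\<^sub>R z) \<bullet> z)) (at t)"
        using DERIV_cdivide[OF DERIV_power[OF DERIV_diff[OF DERIV_const d], of "U x" 2], of 2] by (simp add: mult.commute)
      have "continuous_on UNIV (\<lambda>t::real. (U x - U (x - t *\<^sub>R z)) * (G (x - t *\<^sub>R z) \<bullet> z))"
        by (intro continuous_intros continuous_on_compose2[OF D(3)] continuous_on_compose2[OF D(2)]) auto
      then show "isCont (\<lambda>t. (U x - U (x - t *\<^sub>R z)) * (G (x - t *\<^sub>R z) \<bullet> z)) t"
        by (simp add: continuous_on_eq_continuous_at)
    qed simp
    then show ?thesis by simp
  qed
  have i: "integrable (lborel \<Otimes>\<^sub>M lborel) (case_prod ?F)"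
  proof (rule integrable_pair_bound)
    show "integrable lborel (\<lambda>x::'a. (L * norm z * (L * norm z)) * indicator (cball 0 (r + norm z)) x)"
      by (rule integrable_indicator_cball)
    show "integrable lborel (\<lambda>t::real. indicator {0..1} t :: real)" by simp
    show "(\<lambda>(x, t). ?F x t) \<in> borel_measurable (borel \<Otimes>\<^sub>M borel)" by measurable
    fix x :: 'a and t :: real
    show "\<bar>?F x t\<bar> \<le> (L * norm z * (L * norm z)) * indicator (cball 0 (r + norm z)) x * indicator {0..1} t"
    proof (cases "t \<in> {0..1} \<and> norm x \<le> r + norm z")
      case True
      have tz: "norm (t *\<^sub>R z) \<le> norm z" using True by (simp add: mult_left_le_one_le)
      have "\<bar>U x - U (x - t *\<^sub>R z)\<bar> \<le> L * norm z"
        using order_trans[OF L(3)[of x "x - t *\<^sub>R z"]] mult_left_mono[OF tz, of L] L(1) by simp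
      moreover have "\<bar>G (x - t *\<^sub>R z) \<bullet> z\<bar> \<le> L * norm z"
        using Cauchy_Schwarz_ineq2[of "G (x - t *\<^sub>R z)" z] mult_right_mono[OF L(2)[of "x - t *\<^sub>R z"] norm_ge_zero[of z]] by simp
      ultimately have "\<bar>U x - U (x - t *\<^sub>R z)\<bar> * \<bar>G (x - t *\<^sub>R z) \<bullet> z\<bar> \<le> L * norm z * (L * norm z)"
        using L(1) by (intro mult_mono) auto
      then show ?thesis using True by (simp add: abs_mult)
    next
      case False
      show ?thesis
      proof (cases "t \<in> {0..1}")
        case t: True
        have tz: "norm (t *\<^sub>R z) \<le> norm z" using t by (simp add: mult_left_le_one_le)
        have xr: "r + norm z < norm x" using False t by auto
        then have "r < norm x" using norm_ge_zero[of z] by linarith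
        moreover have "r < norm (x - t *\<^sub>R z)" using xr tz norm_triangle_ineq2[of x "t *\<^sub>R z"] by linarith
        ultimately show ?thesis using D(4) by simp
      qed simp
    qed
  qed
  have "E U z = (\<integral>x. (\<integral>t. ?F x t \<partial>lborel) \<partial>lborel)" unfolding ftc E_def by simp
  also have "\<dots> = (\<integral>t. (\<integral>x. ?F x t \<partial>lborel) \<partial>lborel)"
    by (rule lborel_pair.Fubini_integral[OF i, symmetric])
  also have "\<dots> = (\<integral>t. indicator {0..1} t * (\<integral>x. (U (x + t *\<^sub>R z) - U x) * (G x \<bullet> z) \<partial>lborel) \<partial>lborel)"
  proof (rule Bochner_Integration.integral_cong[OF refl])
    fix t
    have "(\<integral>x. (U x - U (x - t *\<^sub>R z)) * (G (x - t *\<^sub>R z) \<bullet> z) \<partial>lborel) = (\<integral>x. (U (x + t *\<^sub>R z) - U x) * (G x \<bullet> z) \<partial>lborel)"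
      using integral_lborel_translate[of "\<lambda>x. (U x - U (x - t *\<^sub>R z)) * (G (x - t *\<^sub>R z) \<bullet> z)" "t *\<^sub>R z"] by simp
    then show "(\<integral>x. ?F x t \<partial>lborel) = indicator {0..1} t * (\<integral>x. (U (x + t *\<^sub>R z) - U x) * (G x \<bullet> z) \<partial>lborel)"
      by (simp add: mult.commute)
  qed
  finally show ?thesis .
qed

text \<open>Up to the factor \<open>\<bar>y\<bar> ^ n\<close>, the integrand is the \<open>t\<close>-derivative of \<open>f (\<bar>y\<bar> / t)\<close>.\<close>

lemma q_eq:
  "has_bochner_integral lborel (\<lambda>t. indicator {0..1} t * (inverse t ^ Suc (DIM('a)) * w (y /\<^sub>R t))) (q y)"
proof (cases "y \<noteq> 0 \<and> norm y \<le> e")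
  case True
  let ?r = "norm y" and ?n = "DIM('a)"
  have r: "0 < ?r" "?r \<le> e" using True by auto
  \<comment> \<open>For t < |y|/e the point y/t lies outside the ball of radius e and
    \<open>w\<close> vanishes, so the integral starts at |y|/e; that endpoint contributes the
    subtracted level f e.\<close>
  have "has_bochner_integral lborel (\<lambda>t. (- (?r / t\<^sup>2) * f' (?r / t) / ?r ^ ?n) * indicator {?r / e..1} t)
      (f (?r / 1) / ?r ^ ?n - f (?r / (?r / e)) / ?r ^ ?n)"
  proof (rule has_bochner_integral_FTC_Icc_real)
    show "?r / e \<le> 1" using r e_pos by simp
    fix t assume t: "?r / e \<le> t" "t \<le> 1"
    have t0: "0 < t" using t(1) r e_pos by (meson divide_pos_pos less_le_trans)
    have g: "((\<lambda>t. ?r / t) has_real_derivative - (?r / t\<^sup>2)) (at t)"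
      using t0 by (auto intro!: derivative_eq_intros simp: power2_eq_square)
    have "((\<lambda>t. f (?r / t)) has_real_derivative f' (?r / t) * - (?r / t\<^sup>2)) (at t)"
      by (rule DERIV_chain2[OF f_deriv g]) (use r t0 in simp)
    then show "((\<lambda>t. f (?r / t) / ?r ^ ?n) has_real_derivative - (?r / t\<^sup>2) * f' (?r / t) / ?r ^ ?n) (at t)"
      using DERIV_cdivide[of "\<lambda>t. f (?r / t)" "f' (?r / t) * - (?r / t\<^sup>2)" t UNIV "?r ^ ?n"] by (simp add: mult.commute)
    have "isCont (\<lambda>t. ?r / t) t" using t0 by (intro continuous_intros) simp
    moreover have "isCont f' (?r / t)" using r t0 by (intro f'_cont) simp
    ultimately have "isCont (\<lambda>t. f' (?r / t)) t" by (rule isCont_o2)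
    then show "isCont (\<lambda>t. - (?r / t\<^sup>2) * f' (?r / t) / ?r ^ ?n) t"
      using t0 r by (intro continuous_intros) auto
  qed
  moreover have "f (?r / 1) / ?r ^ ?n - f (?r / (?r / e)) / ?r ^ ?n = q y"
    using True e_pos by (simp add: q_def diff_divide_distrib)
  moreover have "(- (?r / t\<^sup>2) * f' (?r / t) / ?r ^ ?n) * indicator {?r / e..1} t
      = indicator {0..1} t * (inverse t ^ Suc ?n * w (y /\<^sub>R t))" for t
  proof (cases "0 < t \<and> t \<le> 1")
    case t: True
    have nz: "norm (y /\<^sub>R t) = ?r / t" using t by (simp add: divide_inverse mult.commute)
    have le: "?r / t \<le> e \<longleftrightarrow> ?r / e \<le> t" using t e_pos by (simp add: field_simps)
    show ?thesis
    proof (cases "?r / e \<le> t")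
      case te: True
      have "w (y /\<^sub>R t) = - (?r / t * f' (?r / t)) / (?r / t) ^ ?n"
        unfolding w_def nz using le te t True by simp
      then have "inverse t ^ Suc ?n * w (y /\<^sub>R t) = - (?r / t\<^sup>2) * f' (?r / t) / ?r ^ ?n"
        using t r by (simp add: power_divide field_simps power2_eq_square)
      then show ?thesis using t te by simp
    next
      case te: False
      then have "w (y /\<^sub>R t) = 0" unfolding w_def nz using le by simp
      then show ?thesis using te by simp
    qed
  next
    case False
    have "0 < ?r / e" using r e_pos by simp
    then show ?thesis using False by (cases "t = 0") (auto simp: indicator_def)
  qed
  ultimately show ?thesis by simp
next
  case False
  have z: "indicator {0..1} t * (inverse t ^ Suc (DIM('a)) * w (y /\<^sub>R t)) = 0" for t
  proof (cases "0 < t \<and> t \<le> 1 \<and> y \<noteq> 0")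
    case True
    have "norm y \<le> norm y / t" using True by (simp add: le_divide_eq mult_left_le)
    then have "e < norm y / t" using False True by linarith
    also have "norm y / t = norm (y /\<^sub>R t)" using True by (simp add: divide_inverse mult.commute)
    finally have "e < norm (y /\<^sub>R t)" .
    then show ?thesis by (simp add: w_def)
  qed (auto simp: w_def indicator_def)
  have "q y = 0" using False by (auto simp: q_def)
  then show ?thesis unfolding z by (simp only: has_bochner_integral_zero)
qed

text \<open>After \<open>E_eq\<close> and Fubini, the substitution y = t z gives the Jacobian t^-n
  and one more factor 1/t, since the direction z becomes y/t. The remaining integral of
  \<open>w\<close> over t is exactly \<open>q\<close>.\<close>

lemma w_energy: "(\<integral>z. w z * E U z \<partial>lborel) = (\<integral>y. q y * H U G y \<partial>lborel)" "integrable lborel (\<lambda>z. w z * E U z)"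
proof -
  note [measurable] = UG_meas
  obtain L where L: "0 < L" "\<And>x y. \<bar>U x - U y\<bar> \<le> L * norm (x - y)"
    using C1_support_Lipschitz[OF C1] by blast
  note D = C1_supportD[OF C1]
  let ?I = "\<integral>x. norm (G x) \<partial>lborel"
  let ?h = "\<lambda>t z. \<integral>x. (U (x + t *\<^sub>R z) - U x) * (G x \<bullet> z) \<partial>lborel"
  let ?F = "\<lambda>z t. w z * (indicator {0..1} t * ?h t z)"
  have i1: "integrable (lborel \<Otimes>\<^sub>M lborel) (case_prod ?F)"
  proof (rule integrable_pair_bound)
    show "integrable lborel (\<lambda>z. \<bar>C\<bar> * L * ?I * kappa z)" using integrable_kappa by simp
    show "integrable lborel (\<lambda>t::real. indicator {0..1} t :: real)" by simp
    show "(\<lambda>(z, t). ?F z t) \<in> borel_measurable (borel \<Otimes>\<^sub>M borel)" by measurable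
    fix z :: 'a and t :: real
    show "\<bar>?F z t\<bar> \<le> \<bar>C\<bar> * L * ?I * kappa z * indicator {0..1} t"
    proof (cases "t \<in> {0..1}")
      case True
      have tz: "norm (t *\<^sub>R z) \<le> norm z" using True by (simp add: mult_left_le_one_le)
      have "\<bar>?h t z\<bar> \<le> L * norm (t *\<^sub>R z) * norm z * ?I" by (rule H_bound_aux(3)[OF L(2)])
      also have "\<dots> \<le> L * norm z * norm z * ?I"
        using tz L(1) by (intro mult_right_mono mult_left_mono) auto
      finally have "w z * \<bar>?h t z\<bar> \<le> w z * (L * norm z * norm z * ?I)" by (intro mult_left_mono w_nonneg)
      also have "\<dots> = (w z * (norm z)\<^sup>2) * (L * ?I)" by (simp add: power2_eq_square)
      also have "\<dots> \<le> (\<bar>C\<bar> * kappa z) * (L * ?I)" using L(1) by (intro mult_right_mono w_le) auto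
      finally show ?thesis using True by (simp add: abs_mult w_nonneg ac_simps)
    qed simp
  qed
  let ?K = "\<lambda>y t. H U G y * (indicator {0..1} t * (inverse t ^ Suc (DIM('a)) * w (y /\<^sub>R t)))"
  \<comment> \<open>The integral of the absolute values over t is |H U G y| q y by
    \<open>q_eq\<close>, and q is at most k, so \<open>integrable_H_k\<close> dominates it.\<close>
  have i2: "integrable (lborel \<Otimes>\<^sub>M lborel) (case_prod ?K)"
  proof (rule lborel_pair.Fubini_integrable)
    show "(\<lambda>(y, t). ?K y t) \<in> borel_measurable (lborel \<Otimes>\<^sub>M lborel)" by measurable
    have "(\<integral>t. norm (case (y, t) of (y, t) \<Rightarrow> ?K y t) \<partial>lborel) = \<bar>H U G y\<bar> * q y" for y
    proof -
      have "(\<integral>t. norm (case (y, t) of (y, t) \<Rightarrow> ?K y t) \<partial>lborel)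
        = (\<integral>t. \<bar>H U G y\<bar> * (indicator {0..1} t * (inverse t ^ Suc (DIM('a)) * w (y /\<^sub>R t))) \<partial>lborel)"
        by (intro Bochner_Integration.integral_cong refl) (auto simp: abs_mult w_nonneg indicator_def)
      then show ?thesis by (simp only: integral_mult_right_zero has_bochner_integral_integral_eq[OF q_eq])
    qed
    moreover have "integrable lborel (\<lambda>y. \<bar>H U G y\<bar> * q y)"
    proof (rule Bochner_Integration.integrable_bound[OF integrable_H_k])
      show "AE y in lborel. norm (\<bar>H U G y\<bar> * q y) \<le> norm (k y * \<bar>H U G y\<bar>)"
        using q_bounds by (intro AE_I2) (simp add: abs_mult k_nonneg mult.commute mult_right_mono)
    qed measurable
    ultimately show "integrable lborel (\<lambda>y. \<integral>t. norm (case (y, t) of (y, t) \<Rightarrow> ?K y t) \<partial>lborel)"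
      by (simp only:)
    show "AE y in lborel. integrable lborel (\<lambda>t. case (y, t) of (y, t) \<Rightarrow> ?K y t)"
      unfolding case_prod_conv
      by (intro AE_I2 integrable_mult_right integrable.intros[OF q_eq])
  qed
  have E: "(\<lambda>z. w z * E U z) = (\<lambda>z. \<integral>t. ?F z t \<partial>lborel)"
    by (simp add: E_eq)
  show "integrable lborel (\<lambda>z. w z * E U z)"
    unfolding E by (rule lborel_pair.integrable_fst[OF i1])
  have "(\<integral>z. w z * E U z \<partial>lborel) = (\<integral>t. (\<integral>z. ?F z t \<partial>lborel) \<partial>lborel)"
    unfolding E by (rule lborel_pair.Fubini_integral[OF i1, symmetric])
  also have "\<dots> = (\<integral>t. (\<integral>y. ?K y t \<partial>lborel) \<partial>lborel)"
  proof (rule integral_cong_AE)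
    show "AE t in lborel. (\<integral>z. ?F z t \<partial>lborel) = (\<integral>y. ?K y t \<partial>lborel)"
    proof (rule AE_mp[OF AE_lborel_singleton[of 0]], rule AE_I2, rule impI)
      fix t :: real assume t: "t \<noteq> 0"
      show "(\<integral>z. ?F z t \<partial>lborel) = (\<integral>y. ?K y t \<partial>lborel)"
      proof (cases "t \<in> {0..1}")
        case True
        then have t0: "0 < t" using t by auto
        have h: "?h t (y /\<^sub>R t) = H U G y / t" for y
        proof -
          have "?h t (y /\<^sub>R t) = (\<integral>x. (U (x + y) - U x) * (G x \<bullet> y) / t \<partial>lborel)"
            by (intro Bochner_Integration.integral_cong refl) (use t in \<open>simp add: divide_inverse\<close>)
          then show ?thesis by (simp only: integral_divide_zero H_def)
        qed
        have "(\<integral>z. ?F z t \<partial>lborel) = \<bar>inverse t\<bar> ^ DIM('a) *\<^sub>R (\<integral>z. ?F (inverse t *\<^sub>R z) t \<partial>lborel)"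
          by (rule integral_lborel_scaleR) (use t in \<open>auto\<close>)
        also have "\<dots> = (\<integral>y. inverse t ^ DIM('a) * ?F (y /\<^sub>R t) t \<partial>lborel)" using t0 by simp
        also have "\<dots> = (\<integral>y. ?K y t \<partial>lborel)"
          unfolding h by (intro Bochner_Integration.integral_cong refl) (use t0 in \<open>simp add: divide_inverse\<close>)
        finally show ?thesis .
      qed simp
    qed
  qed measurable
  also have "\<dots> = (\<integral>y. (\<integral>t. ?K y t \<partial>lborel) \<partial>lborel)"
    by (rule lborel_pair.Fubini_integral[OF i2])
  also have "\<dots> = (\<integral>y. H U G y * q y \<partial>lborel)"
    by (simp only: integral_mult_right_zero has_bochner_integral_integral_eq[OF q_eq])
  finally show "(\<integral>z. w z * E U z \<partial>lborel) = (\<integral>y. q y * H U G y \<partial>lborel)" by (simp only: mult.commute)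
qed

text \<open>Only one power of |y| is gained, but mean-square norms take the place of a Lipschitz
  constant. The bound serves the part of the kernel with a finite first moment.\<close>

lemma H_le: "\<bar>H U G y\<bar> \<le> norm y * (2 * l2 lborel U * l2 lborel G)"
proof -
  note [measurable] = UG_meas
  note D = C1_supportD[OF C1]
  have t: "sq_integrable lborel (\<lambda>x. U (x + y))" "l2 lborel (\<lambda>x. U (x + y)) = l2 lborel U"
    using l2_translate[OF D(10), of y] by auto
  note d = sq_integrable_diff[OF t(1) D(10)]
  have "\<bar>H U G y\<bar> \<le> (\<integral>x. \<bar>(U (x + y) - U x) * (G x \<bullet> y)\<bar> \<partial>lborel)"
    unfolding H_def by (rule integral_abs_bound)
  also have "\<dots> \<le> (\<integral>x. norm y * (norm (U (x + y) - U x) * norm (G x)) \<partial>lborel)"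
  proof (rule integral_mono')
    show "integrable lborel (\<lambda>x. norm y * (norm (U (x + y) - U x) * norm (G x)))"
      by (intro integrable_mult_right sq_integrable_norm_mult d D)
    fix x
    show "\<bar>(U (x + y) - U x) * (G x \<bullet> y)\<bar> \<le> norm y * (norm (U (x + y) - U x) * norm (G x))"
      using mult_left_mono[OF Cauchy_Schwarz_ineq2[of "G x" y] abs_ge_zero[of "U (x + y) - U x"]]
      by (simp add: abs_mult ac_simps)
  qed simp
  also have "\<dots> = norm y * (\<integral>x. norm (U (x + y) - U x) * norm (G x) \<partial>lborel)" by simp
  also have "\<dots> \<le> norm y * (l2 lborel (\<lambda>x. U (x + y) - U x) * l2 lborel G)"
    by (intro mult_left_mono l2_norm_mult d D) simp
  also have "\<dots> \<le> norm y * ((l2 lborel U + l2 lborel U) * l2 lborel G)"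
    using l2_triangle_diff[OF t(1) sq_integrable_zero D(10)] t(2) l2_minus_commute[of lborel "\<lambda>_. 0" U]
    by (intro mult_left_mono mult_right_mono) auto
  finally show ?thesis by (simp add: ac_simps)
qed

end

text \<open>Bounds the contribution of the lower-order part k - q of the kernel; the 2 comes from
  \<open>H_le\<close>.\<close>

definition M where "M = 2 * (\<integral>y. (k y - q y) * norm y \<partial>lborel)"

text \<open>Inside the ball of radius e the difference is f e / |y|^n, and \<open>f_lower\<close>
  trades the missing power of |y| for \<open>kappa\<close>; outside it |y| is at most |y|^2 /
  e.\<close>

lemma integrable_k_minus_q: "integrable lborel (\<lambda>y. (k y - q y) * norm y)"
proof -
  let ?B = "f e / c + 1 / e"
  have fe: "0 \<le> f e" using f_nonneg e_pos by simp
  show ?thesis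
  proof (rule Bochner_Integration.integrable_bound[OF integrable_mult_right[OF integrable_kappa, of ?B]])
    show "AE y in lborel. norm ((k y - q y) * norm y) \<le> norm (?B * kappa y)"
    proof (rule AE_I2)
      fix y
      have B: "0 \<le> f e / c" "0 \<le> 1 / e" "0 \<le> ?B" using fe c_pos e_pos by auto
      have "(k y - q y) * norm y \<le> ?B * kappa y"
      proof (cases "y = 0")
        case True then show ?thesis by (simp add: kappa_def)
      next
        case y: False
        show ?thesis
        proof (cases "norm y \<le> e")
          case True
          have "c \<le> norm y * f (norm y)" using f_lower[of "norm y"] y True by simp
          then have "f e / c * c \<le> f e / c * (norm y * f (norm y))" by (rule mult_left_mono) (rule B)
          then have "f e \<le> f e / c * (norm y * f (norm y))" using c_pos by simp
          then have "f e / norm y ^ DIM('a) * norm y \<le> f e / c * (norm y * f (norm y)) / norm y ^ DIM('a) * norm y"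
            by (intro mult_right_mono divide_right_mono) auto
          also have "\<dots> = f e / c * kappa y" using y by (simp add: kappa_def k_def power2_eq_square)
          finally have "(k y - q y) * norm y \<le> f e / c * kappa y"
            using y True by (simp add: k_def q_def diff_divide_distrib)
          also have "\<dots> \<le> ?B * kappa y" using B by (intro mult_right_mono kappa_nonneg) auto
          finally show ?thesis .
        next
          case False
          then have "norm y * e \<le> norm y * norm y" by (intro mult_left_mono) auto
          then have "norm y \<le> 1 / e * (norm y)\<^sup>2" using e_pos by (simp add: power2_eq_square le_divide_eq)
          then have "k y * norm y \<le> k y * (1 / e * (norm y)\<^sup>2)" by (intro mult_left_mono k_nonneg)
          then have "(k y - q y) * norm y \<le> 1 / e * kappa y" using False by (simp add: q_def kappa_def)
          also have "\<dots> \<le> ?B * kappa y" using fe c_pos e_pos by (intro mult_right_mono kappa_nonneg) auto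
          finally show ?thesis .
        qed
      qed
      moreover have "0 \<le> (k y - q y) * norm y" using q_bounds[of y] by simp
      ultimately show "norm ((k y - q y) * norm y) \<le> norm (?B * kappa y)" by simp
    qed
  qed measurable
qed

lemma M_nonneg: "0 \<le> M"
  unfolding M_def using q_bounds by (intro mult_nonneg_nonneg integral_nonneg) auto

text \<open>Write q = k - (k - q) in \<open>w_energy\<close>: the part with \<open>k\<close> is the
  pairing of the nonlocal with the classical gradient, and the rest is bounded through the first
  moment \<open>M\<close>.\<close>

lemma energy_le:
  assumes C1: "C1_support r U G"
  shows "(\<integral>z. w z * E U z \<partial>lborel) \<le> (l2 lborel (nlgrad U) + M * l2 lborel U) * l2 lborel G"
proof -
  note D = C1_supportD[OF C1]
  have [measurable]: "U \<in> borel_measurable borel" "G \<in> borel_measurable borel" using D by auto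
  obtain L where L: "0 < L" "\<And>x y. \<bar>U x - U y\<bar> \<le> L * norm (x - y)"
    using C1_support_Lipschitz[OF C1] by blast
  have ns: "sq_integrable lborel (nlgrad U)"
    by (rule bounded_support_integrable(2)[OF _ nlgrad_bounded[OF _ L(2)] nlgrad_support[OF D(4)]]) auto
  let ?H = "H U G"
  have ik: "integrable lborel (\<lambda>y. k y * ?H y)"
    by (rule Bochner_Integration.integrable_bound[OF integrable_H_k[OF C1]]) (auto simp: abs_mult)
  have iq: "integrable lborel (\<lambda>y. q y * ?H y)"
  proof (rule Bochner_Integration.integrable_bound[OF integrable_H_k[OF C1]])
    show "AE y in lborel. norm (q y * ?H y) \<le> norm (k y * \<bar>?H y\<bar>)"
      using q_bounds by (intro AE_I2) (simp add: abs_mult k_nonneg mult_right_mono)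
  qed measurable
  have "(\<integral>z. w z * E U z \<partial>lborel) = (\<integral>y. k y * ?H y - (k y - q y) * ?H y \<partial>lborel)"
    unfolding w_energy(1)[OF C1] by (simp add: algebra_simps)
  also have "\<dots> = (\<integral>x. nlgrad U x \<bullet> G x \<partial>lborel) - (\<integral>y. (k y - q y) * ?H y \<partial>lborel)"
    unfolding nlgrad_gradient_pairing[OF C1] left_diff_distrib
    using ik iq by simp
  also have "\<dots> \<le> l2 lborel (nlgrad U) * l2 lborel G + M * l2 lborel U * l2 lborel G"
  proof -
    have "\<bar>\<integral>y. (k y - q y) * ?H y \<partial>lborel\<bar> \<le> (\<integral>y. \<bar>(k y - q y) * ?H y\<bar> \<partial>lborel)" by (rule integral_abs_bound)
    also have "\<dots> \<le> (\<integral>y. ((k y - q y) * norm y) * (2 * l2 lborel U * l2 lborel G) \<partial>lborel)"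
    proof (rule integral_mono')
      show "integrable lborel (\<lambda>y. ((k y - q y) * norm y) * (2 * l2 lborel U * l2 lborel G))"
        by (rule integrable_mult_left[OF integrable_k_minus_q])
      fix y
      show "\<bar>(k y - q y) * ?H y\<bar> \<le> ((k y - q y) * norm y) * (2 * l2 lborel U * l2 lborel G)"
        using mult_left_mono[OF H_le[OF C1, of y], of "k y - q y"] q_bounds[of y] by (simp add: abs_mult ac_simps)
      show "0 \<le> ((k y - q y) * norm y) * (2 * l2 lborel U * l2 lborel G)"
        using q_bounds[of y] by simp
    qed
    also have "\<dots> = M * l2 lborel U * l2 lborel G" by (simp add: M_def)
    finally show ?thesis using l2_inner[OF ns D(11)] by linarith
  qed
  finally show ?thesis by (simp add: distrib_right)
qed

end


text \<open>Cauchy-Schwarz against the indicator of the ball.\<close>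

lemma sq_integrable_support:
  fixes u :: "'a::euclidean_space \<Rightarrow> 'b::euclidean_space"
  assumes u: "sq_integrable lborel u" and r: "\<And>x. r < norm x \<Longrightarrow> u x = 0"
  shows "integrable lborel u" "(\<integral>x. norm (u x) \<partial>lborel) \<le> sqrt (measure lborel (cball (0::'a) r)) * l2 lborel u"
proof -
  let ?i = "\<lambda>x::'a. indicator (cball 0 r) x :: real"
  have [measurable]: "u \<in> borel_measurable borel" using u by auto
  have i: "sq_integrable lborel ?i"
    using bounded_support_integrable(2)[of ?i 1 r] by (auto simp: indicator_def)
  have eq: "norm (?i x) * norm (u x) = norm (u x)" for x
    using r[of x] by (auto simp: indicator_def not_le)
  show "integrable lborel u"
    using sq_integrable_norm_mult[OF i u] unfolding eq by (rule integrable_norm_cancel) measurable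
  have "l2 lborel ?i = sqrt (measure lborel (cball (0::'a) r))"
  proof -
    have "(norm (?i x))\<^sup>2 = ?i x" for x by (auto simp: indicator_def)
    then show ?thesis by (simp add: l2_def)
  qed
  with l2_norm_mult[OF i u] show "(\<integral>x. norm (u x) \<partial>lborel) \<le> sqrt (measure lborel (cball (0::'a) r)) * l2 lborel u"
    unfolding eq by simp
qed

section \<open>The rate of approximation by mollification\<close>

context nonlocal_kernel
begin

lemma E_nonneg: "0 \<le> E U z"
  by (simp add: E_def)

text \<open>The product of the 2 that undoes the 1/2 in \<open>E\<close>, the bound of the bump
  function, and the 1/c from \<open>f'_lower\<close>.\<close>

definition B0 :: real where
  "B0 = 2 * (1 / (\<integral>y. flat_exp 0 (1 - y \<bullet> y) \<partial>(lborel :: 'a measure))) / c"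

lemma B0_nonneg: "0 \<le> B0"
  using bump_mass_pos[where 'a='a] c_pos by (simp add: B0_def)

text \<open>On the support of the mollifier |z| < d <= e, so the weight is at least c d^(-n-1-s),
  while the mollifier is at most a constant times d^-n. The origin is excluded because
  \<open>w\<close> is 0 there.\<close>

lemma mollifier_le_w:
  assumes "0 < d" "d \<le> e" "z \<noteq> 0"
  shows "mollifier d z * 2 \<le> B0 * d powr (1 + s) * w z"
proof (cases "norm z < d")
  case True
  let ?I = "\<integral>y. flat_exp 0 (1 - y \<bullet> y) \<partial>(lborel :: 'a measure)" and ?n = "DIM('a)"
  have I: "0 < ?I" by (rule bump_mass_pos)
  have z: "0 < norm z" "norm z \<le> e" using assms True by auto
  have "c * d powr (- 1 - s) \<le> c * norm z powr (- 1 - s)"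
    using z True s_pos c_pos by (intro mult_left_mono powr_mono2') auto
  also have "\<dots> \<le> - (norm z * f' (norm z))" by (rule f'_lower[OF z])
  finally have "c * d powr (- 1 - s) \<le> - (norm z * f' (norm z))" .
  then have "c * d powr (- 1 - s) / d ^ ?n \<le> - (norm z * f' (norm z)) / norm z ^ ?n"
  proof (intro frac_le power_mono)
    have "0 \<le> c * d powr (- 1 - s)" using c_pos by simp
    also note \<open>c * d powr (- 1 - s) \<le> - (norm z * f' (norm z))\<close>
    finally show "0 \<le> - (norm z * f' (norm z))" .
  qed (use z True in auto)
  also have "\<dots> = w z" using z by (simp add: w_def)
  finally have w: "c * d powr (- 1 - s) / d ^ ?n \<le> w z" .
  have "mollifier d z * 2 \<le> (1 / ?I) / d ^ ?n * 2"
    using mollifier_le[OF assms(1), of z] by simp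
  also have "\<dots> = B0 * (d powr (1 + s) * d powr (- 1 - s)) * c / d ^ ?n"
    using c_pos assms(1) by (simp add: B0_def powr_add[symmetric])
  also have "\<dots> = B0 * d powr (1 + s) * (c * d powr (- 1 - s) / d ^ ?n)" by simp
  also have "\<dots> \<le> B0 * d powr (1 + s) * w z"
    using w B0_nonneg by (intro mult_left_mono) auto
  finally show ?thesis .
next
  case False
  then have "mollifier d z = 0" by (intro mollifier_support assms) simp
  then show ?thesis using B0_nonneg w_nonneg by simp
qed

text \<open>The inner integral in \<open>mollify_diff_nn_integral\<close> is 2 E U z, and the
  mollifier in front of it is dominated by the weight.\<close>

lemma mollify_diff_energy:
  assumes C1: "C1_support r U G" and d: "0 < d" "d \<le> e"
  shows "(l2 lborel (\<lambda>x. U x - mollify d U x))\<^sup>2 \<le> B0 * d powr (1 + s) * (\<integral>z. w z * E U z \<partial>lborel)"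
proof -
  note D = C1_supportD[OF C1]
  have [measurable]: "U \<in> borel_measurable borel" by (rule D(6))
  let ?B = "B0 * d powr (1 + s)"
  have B: "0 \<le> ?B" using B0_nonneg by simp
  have inn: "(\<integral>\<^sup>+x. ennreal ((norm (U x - U (x - z)))\<^sup>2) \<partial>lborel) = ennreal (2 * E U z)" for z
  proof -
    have "sq_integrable lborel (\<lambda>x. U x - U (x - z))"
      using sq_integrable_diff[OF D(10) l2_translate(1)[OF D(10), of "- z"]] by simp
    from nn_integral_l2[OF this] show ?thesis by (simp add: l2_square E_def)
  qed
  have sd: "sq_integrable lborel (\<lambda>x. U x - mollify d U x)"
    by (intro sq_integrable_diff D mollify_l2(1) d)
  have "ennreal ((l2 lborel (\<lambda>x. U x - mollify d U x))\<^sup>2) = (\<integral>\<^sup>+x. ennreal ((norm (U x - mollify d U x))\<^sup>2) \<partial>lborel)"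
    by (rule nn_integral_l2[OF sd, symmetric])
  also have "\<dots> \<le> (\<integral>\<^sup>+z. ennreal (mollifier d z) * (\<integral>\<^sup>+x. ennreal ((norm (U x - U (x - z)))\<^sup>2) \<partial>lborel) \<partial>lborel)"
    by (rule mollify_diff_nn_integral[OF d(1) D(10)])
  also have "\<dots> \<le> (\<integral>\<^sup>+z. ennreal (?B * (w z * E U z)) \<partial>lborel)"
  proof (rule nn_integral_mono)
    fix z
    have "mollifier d z * (2 * E U z) \<le> ?B * (w z * E U z)"
    \<comment> \<open>At the origin the weight gives no bound, but there \<open>E\<close>
      vanishes.\<close>
    proof (cases "z = 0")
      case True
      then show ?thesis by (simp add: E_def)
    next
      case False
      have "(mollifier d z * 2) * E U z \<le> (?B * w z) * E U z"
        by (intro mult_right_mono mollifier_le_w d False E_nonneg)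
      then show ?thesis by (simp add: mult.assoc)
    qed
    then show "ennreal (mollifier d z) * (\<integral>\<^sup>+x. ennreal ((norm (U x - U (x - z)))\<^sup>2) \<partial>lborel) \<le> ennreal (?B * (w z * E U z))"
      unfolding inn using d E_nonneg[of U z] mollifier_nonneg[OF d(1), of z]
      by (simp add: ennreal_mult[symmetric] ennreal_leI)
  qed
  also have "\<dots> = ennreal (\<integral>z. ?B * (w z * E U z) \<partial>lborel)"
    by (intro nn_integral_eq_integral integrable_mult_right w_energy(2)[OF C1] AE_I2)
      (use B w_nonneg E_nonneg in auto)
  also have "(\<integral>z. ?B * (w z * E U z) \<partial>lborel) = ?B * (\<integral>z. w z * E U z \<partial>lborel)" by simp
  finally have "ennreal ((l2 lborel (\<lambda>x. U x - mollify d U x))\<^sup>2) \<le> ennreal (?B * (\<integral>z. w z * E U z \<partial>lborel))" .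
  moreover have "0 \<le> ?B * (\<integral>z. w z * E U z \<partial>lborel)"
    by (rule mult_nonneg_nonneg[OF B])
      (use w_nonneg E_nonneg in \<open>intro Bochner_Integration.integral_nonneg; simp\<close>)
  ultimately show ?thesis by (simp add: ennreal_le_iff)
qed

text \<open>Expresses that \<open>g\<close> is the weak nonlocal gradient of \<open>u\<close> in the
  form used by the estimates: at every scale, the mollified \<open>g\<close> is the pointwise
  nonlocal gradient of the mollified \<open>u\<close>.\<close>

definition grad_pair :: "real \<Rightarrow> ('a \<Rightarrow> real) \<Rightarrow> ('a \<Rightarrow> 'a) \<Rightarrow> bool" where
  "grad_pair r u g \<longleftrightarrow> sq_integrable lborel u \<and> sq_integrable lborel g \<and> (\<forall>x. r < norm x \<longrightarrow> u x = 0) \<and>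
     (\<forall>d>0. \<forall>x. mollify d g x = nlgrad (mollify d u) x)"

text \<open>\<open>B0\<close> comes from the mollification error, 1 + M from the two terms of
  \<open>energy_le\<close>, and the mass of the gradient of the bump from the classical
  gradient.\<close>

definition B1 :: real where
  "B1 = B0 * (1 + M) * (\<integral>x. norm (gradient bump (x::'a)) \<partial>lborel)"

lemma B1_nonneg: "0 \<le> B1"
  unfolding B1_def using B0_nonneg M_nonneg by simp

lemma grad_pairD:
  assumes "grad_pair r u g"
  shows "sq_integrable lborel u" "sq_integrable lborel g" "\<And>x. r < norm x \<Longrightarrow> u x = 0" "integrable lborel u"
    "\<And>d. 0 < d \<Longrightarrow> mollify d g = nlgrad (mollify d u)"
    "\<And>d. 0 < d \<Longrightarrow> C1_support (r + d) (mollify d u) (mollify_gradient d u)"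
proof -
  show u: "sq_integrable lborel u" "sq_integrable lborel g" "\<And>x. r < norm x \<Longrightarrow> u x = 0"
    "\<And>d. 0 < d \<Longrightarrow> mollify d g = nlgrad (mollify d u)"
    using assms by (auto simp: grad_pair_def)
  show i: "integrable lborel u" by (rule sq_integrable_support[OF u(1,3)])
  show "\<And>d. 0 < d \<Longrightarrow> C1_support (r + d) (mollify d u) (mollify_gradient d u)"
    by (rule C1_support_mollify[OF _ i u(1,3)])
qed

text \<open>The classical gradient at scale d costs 1/d, whereas mollifying at scale h gains
  h^(1+s). For comparable scales the quotient is of order d^s.\<close>

lemma mollify_mollify_diff:
  assumes p: "grad_pair r u g" and d: "0 < d" and h: "0 < h" "h \<le> e"
  shows "(l2 lborel (\<lambda>x. mollify d u x - mollify h (mollify d u) x))\<^sup>2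
    \<le> B1 * (h powr (1 + s) / d) * (l2 lborel g + l2 lborel u)\<^sup>2"
proof -
  note P = grad_pairD[OF p]
  let ?N = "l2 lborel g + l2 lborel u" and ?I = "\<integral>x. norm (gradient bump (x::'a)) \<partial>lborel"
  have N: "l2 lborel u \<le> ?N" "l2 lborel g \<le> ?N" "0 \<le> ?N" by auto
  have I: "0 \<le> ?I" by simp
  have 1: "l2 lborel (nlgrad (mollify d u)) \<le> l2 lborel g"
    using mollify_l2(2)[OF d P(2)] P(5)[OF d] by simp
  have 2: "M * l2 lborel (mollify d u) \<le> M * l2 lborel u"
    by (intro mult_left_mono mollify_l2(2) d P M_nonneg)
  have "M * l2 lborel u \<le> M * ?N" by (intro mult_left_mono N M_nonneg)
  with 1 2 have 3: "l2 lborel (nlgrad (mollify d u)) + M * l2 lborel (mollify d u) \<le> (1 + M) * ?N"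
    using l2_nonneg[of lborel u] unfolding distrib_right mult_1_left by linarith
  have 4: "l2 lborel (mollify_gradient d u) \<le> ?I / d * ?N"
    by (rule order_trans[OF mollify_gradient_l2(2)[OF d P(4,1)]]) (use I d N in \<open>intro mult_left_mono; simp\<close>)
  have "(\<integral>z. w z * E (mollify d u) z \<partial>lborel)
      \<le> (l2 lborel (nlgrad (mollify d u)) + M * l2 lborel (mollify d u)) * l2 lborel (mollify_gradient d u)"
    by (rule energy_le[OF P(6)[OF d]])
  also have "\<dots> \<le> ((1 + M) * ?N) * (?I / d * ?N)"
    by (rule mult_mono[OF 3 4]) (use M_nonneg N in auto)
  finally have E: "(\<integral>z. w z * E (mollify d u) z \<partial>lborel) \<le> ((1 + M) * ?N) * (?I / d * ?N)" .
  have "(l2 lborel (\<lambda>x. mollify d u x - mollify h (mollify d u) x))\<^sup>2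
      \<le> B0 * h powr (1 + s) * (\<integral>z. w z * E (mollify d u) z \<partial>lborel)"
    by (rule mollify_diff_energy[OF P(6)[OF d] h])
  also have "\<dots> \<le> B0 * h powr (1 + s) * (((1 + M) * ?N) * (?I / d * ?N))"
    by (rule mult_left_mono[OF E]) (use B0_nonneg in auto)
  also have "\<dots> = B1 * (h powr (1 + s) / d) * ?N\<^sup>2"
    by (simp add: B1_def power2_eq_square)
  finally show ?thesis .
qed

text \<open>Both functions are compared with the one mollified at d and at d/2:
  \<open>mollify (d/2) u\<close> is mollified once more at d, and \<open>mollify d u\<close> once
  more at d/2. The results agree since mollifications commute.\<close>

lemma mollify_half_diff:
  assumes p: "grad_pair r u g" and d: "0 < d" "d \<le> e"
  shows "l2 lborel (\<lambda>x. mollify (d/2) u x - mollify d u x) \<le> (2 * sqrt (2 * B1)) * d powr (s/2) * (l2 lborel g + l2 lborel u)"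
proof -
  note P = grad_pairD[OF p]
  let ?N = "l2 lborel g + l2 lborel u"
  \<comment> \<open>The two comparisons produce d^(1+s) / (d/2) and (d/2)^(1+s) / d; the common
    bound 2 d^s covers both.\<close>
  let ?X = "sqrt (2 * B1) * d powr (s/2) * ?N"
  have d2: "0 < d/2" "d/2 \<le> e" using d by auto
  have X: "?X\<^sup>2 = B1 * (2 * d powr s) * ?N\<^sup>2"
    using B1_nonneg d by (simp add: power_mult_distrib power2_eq_square[of "d powr _"] powr_add[symmetric])
  have X0: "0 \<le> ?X" using B1_nonneg by (intro mult_nonneg_nonneg add_nonneg_nonneg) auto
  have a: "d powr (1 + s) / (d/2) = 2 * d powr s"
    using d by (simp add: powr_add)
  have b: "(d/2) powr (1 + s) / d \<le> 2 * d powr s"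
  proof -
    have "(d/2) powr (1 + s) \<le> d powr (1 + s)" using d s_pos by (intro powr_mono2) auto
    then have "(d/2) powr (1 + s) / d \<le> d powr (1 + s) / d" using d by (intro divide_right_mono) auto
    also have "\<dots> = d powr s" using d by (simp add: powr_add)
    finally show ?thesis using powr_ge_zero[of d s] by linarith
  qed
  have 1: "l2 lborel (\<lambda>x. mollify (d/2) u x - mollify d (mollify (d/2) u) x) \<le> ?X"
    by (rule power2_le_imp_le[OF _ X0]) (use mollify_mollify_diff[OF p d2(1) d] X in \<open>simp only: a\<close>)
  have "B1 * ((d/2) powr (1 + s) / d) * ?N\<^sup>2 \<le> B1 * (2 * d powr s) * ?N\<^sup>2"
    by (intro mult_right_mono mult_left_mono b B1_nonneg) auto
  then have 2: "l2 lborel (\<lambda>x. mollify d u x - mollify (d/2) (mollify d u) x) \<le> ?X"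
    using X0 unfolding X[symmetric] by (intro power2_le_imp_le[OF order_trans[OF mollify_mollify_diff[OF p d(1) d2]]])
  have eq: "mollify (d/2) (mollify d u) = mollify d (mollify (d/2) u)"
    by (rule ext) (rule mollify_commute[OF d2(1) d(1) P(1)])
  note m = mollify_l2(1)[OF d2(1) P(1)] mollify_l2(1)[OF d(1) P(1)] mollify_l2(1)[OF d(1) mollify_l2(1)[OF d2(1) P(1)]]
  have "l2 lborel (\<lambda>x. mollify (d/2) u x - mollify d u x) \<le> l2 lborel (\<lambda>x. mollify (d/2) u x - mollify d (mollify (d/2) u) x)
      + l2 lborel (\<lambda>x. mollify d (mollify (d/2) u) x - mollify d u x)"
    by (rule l2_triangle_diff[OF m(1,3,2)])
  then show ?thesis
    using 1 2 unfolding eq l2_minus_commute[of lborel "mollify d u"] by linarith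
qed

text \<open>The denominator sums the geometric series with ratio 2^(-s/2), by which d^(s/2) shrinks
  when the scale is halved.\<close>

definition B2 :: real where
  "B2 = 2 * sqrt (2 * B1) / (1 - 2 powr (- s/2))"

lemma ratio: "0 < 2 powr (- s/2)" "2 powr (- s/2) < 1"
  using s_pos powr_less_mono[of "- s/2" 0 2] by auto

lemma B2_nonneg: "0 \<le> B2"
  using ratio B1_nonneg by (simp add: B2_def)

text \<open>Telescoping over the scales \<open>d / 2 ^ j\<close>.\<close>

lemma mollify_approx:
  assumes p: "grad_pair r u g" and d: "0 < d" "d \<le> e"
  shows "l2 lborel (\<lambda>x. u x - mollify d u x) \<le> B2 * d powr (s/2) * (l2 lborel g + l2 lborel u)"
proof -
  note P = grad_pairD[OF p]
  let ?N = "l2 lborel g + l2 lborel u" and ?q = "2 powr (- s/2) :: real"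
  let ?K = "2 * sqrt (2 * B1) * d powr (s/2) * ?N"
  have K0: "0 \<le> ?K" using B1_nonneg by (intro mult_nonneg_nonneg add_nonneg_nonneg) auto
  have dj: "0 < d / 2^j" "d / 2^j \<le> e" for j :: nat
  proof -
    show "0 < d / 2^j" using d by simp
    have "d / 2^j \<le> d / 1" using d by (intro divide_left_mono) auto
    then show "d / 2^j \<le> e" using d by simp
  qed
  have qi: "?q = inverse (2 powr (s/2))" using powr_minus[of 2 "s/2"] by simp
  have pw: "(d / 2^j) powr (s/2) = d powr (s/2) * ?q ^ j" for j :: nat
  proof (induction j)
    case (Suc j)
    have "(d / 2 ^ Suc j) powr (s/2) = ((d / 2^j) / 2) powr (s/2)" by (simp add: mult.commute)
    also have "\<dots> = (d / 2^j) powr (s/2) / 2 powr (s/2)" by (rule powr_divide)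
    also have "\<dots> = (d powr (s/2) * ?q ^ j) * inverse (2 powr (s/2))"
      by (simp only: Suc divide_inverse[of _ "2 powr (s/2)"])
    also have "\<dots> = d powr (s/2) * ?q ^ Suc j" by (simp only: qi[symmetric] power_Suc ac_simps)
    finally show ?case .
  qed simp
  have tele: "l2 lborel (\<lambda>x. mollify (d / 2^J) u x - mollify d u x) \<le> ?K * (\<Sum>j<J. ?q ^ j)" for J :: nat
  proof (induction J)
    case 0
    show ?case by (simp add: l2_def)
  next
    case (Suc J)
    have h: "l2 lborel (\<lambda>x. mollify (d / 2 ^ Suc J) u x - mollify (d / 2^J) u x) \<le> ?K * ?q ^ J"
      using mollify_half_diff[OF p dj, of J] by (simp add: pw ac_simps)
    have "l2 lborel (\<lambda>x. mollify (d / 2 ^ Suc J) u x - mollify d u x)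
        \<le> l2 lborel (\<lambda>x. mollify (d / 2 ^ Suc J) u x - mollify (d / 2^J) u x)
        + l2 lborel (\<lambda>x. mollify (d / 2^J) u x - mollify d u x)"
      by (rule l2_triangle_diff) (intro mollify_l2(1) dj d P)+
    then show ?case using h Suc by (simp add: distrib_left)
  qed
  have geo: "(\<Sum>j<J. ?q ^ j) \<le> 1 / (1 - ?q)" for J :: nat
    using ratio s_pos by (simp add: sum_gp_strict divide_right_mono)
  show ?thesis
  proof (rule field_le_epsilon)
    fix ep :: real assume ep: "0 < ep"
    obtain d0 where d0: "0 < d0" "\<And>d. 0 < d \<Longrightarrow> d < d0 \<Longrightarrow> l2 lborel (\<lambda>x. mollify d u x - u x) < ep"
      using mollify_tendsto[OF P(1) ep] by blast
    \<comment> \<open>Telescoping reaches only finitely many scales; convergence of the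
      mollifications bridges the rest with an error below \<open>ep\<close>.\<close>
    obtain J :: nat where J: "d / d0 < 2^J" using real_arch_pow[of 2 "d / d0"] by auto
    then have "d / 2^J < d0" using d0(1) by (simp add: field_simps)
    then have A: "l2 lborel (\<lambda>x. mollify (d / 2^J) u x - u x) < ep" using d0(2) dj by blast
    have "l2 lborel (\<lambda>x. u x - mollify d u x) \<le> l2 lborel (\<lambda>x. u x - mollify (d / 2^J) u x)
        + l2 lborel (\<lambda>x. mollify (d / 2^J) u x - mollify d u x)"
      by (rule l2_triangle_diff) (intro mollify_l2(1) dj d P)+
    also have "\<dots> \<le> ep + ?K * (\<Sum>j<J. ?q ^ j)"
      using A tele[of J] unfolding l2_minus_commute[of lborel u] by simp
    also have "\<dots> \<le> ep + ?K * (1 / (1 - ?q))"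
      by (intro add_left_mono mult_left_mono geo K0)
    finally show "l2 lborel (\<lambda>x. u x - mollify d u x) \<le> B2 * d powr (s/2) * ?N + ep"
      by (simp add: B2_def ac_simps)
  qed
qed

section \<open>Real exponentials as eigenfunctions\<close>

definition P :: "'a \<Rightarrow> real" where
  "P h = (\<integral>z. k z * (z \<bullet> h) * (exp (z \<bullet> h) - 1) \<partial>lborel)"

text \<open>The sign of t (exp t - 1) is what makes \<open>P\<close> positive; the last bound shows
  that this product is of second order in t, so that \<open>kappa\<close> makes the integral
  converge.\<close>

lemma mult_exp_minus_1: "0 \<le> t * (exp t - 1 :: real)" "t * (exp t - 1) = 0 \<longleftrightarrow> t = 0" "\<bar>exp t - 1\<bar> \<le> \<bar>t\<bar> * exp \<bar>t\<bar>"
proof -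
  show "0 \<le> t * (exp t - 1)" by (cases "0 \<le> t") (auto simp: zero_le_mult_iff)
  show "t * (exp t - 1) = 0 \<longleftrightarrow> t = 0" by auto
  have 1: "exp a - 1 \<le> a * exp a" for a :: real
  proof -
    have "(1 - a) * exp a \<le> exp (- a) * exp a"
      by (rule mult_right_mono) (use exp_ge_add_one_self[of "- a"] in auto)
    then show ?thesis by (simp add: exp_minus algebra_simps)
  qed
  show "\<bar>exp t - 1\<bar> \<le> \<bar>t\<bar> * exp \<bar>t\<bar>"
  proof (cases "0 \<le> t")
    case False
    have "1 - exp t \<le> \<bar>t\<bar>" using exp_ge_add_one_self[of t] False by linarith
    also have "\<dots> \<le> \<bar>t\<bar> * exp \<bar>t\<bar>" using mult_left_mono[of 1 "exp \<bar>t\<bar>" "\<bar>t\<bar>"] by simp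
    finally show ?thesis using False by simp
  qed (use 1[of t] in simp)
qed

lemma P_integrable: "integrable lborel (\<lambda>z. k z * (z \<bullet> h) * (exp (z \<bullet> h) - 1))"
proof (rule Bochner_Integration.integrable_bound[OF integrable_mult_right[OF integrable_kappa, of "(norm h)\<^sup>2 * exp (R * norm h)"]])
  show "AE z in lborel. norm (k z * (z \<bullet> h) * (exp (z \<bullet> h) - 1)) \<le> norm ((norm h)\<^sup>2 * exp (R * norm h) * kappa z)"
  proof (rule AE_I2)
    fix z
    show "norm (k z * (z \<bullet> h) * (exp (z \<bullet> h) - 1)) \<le> norm ((norm h)\<^sup>2 * exp (R * norm h) * kappa z)"
    proof (cases "norm z \<le> R")
      case True
      have zh: "\<bar>z \<bullet> h\<bar> \<le> norm z * norm h" by (rule Cauchy_Schwarz_ineq2)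
      also have "\<dots> \<le> R * norm h" using True by (intro mult_right_mono) auto
      finally have e: "exp \<bar>z \<bullet> h\<bar> \<le> exp (R * norm h)" by simp
      have "\<bar>exp (z \<bullet> h) - 1\<bar> \<le> \<bar>z \<bullet> h\<bar> * exp \<bar>z \<bullet> h\<bar>" by (rule mult_exp_minus_1)
      also have "\<dots> \<le> (norm z * norm h) * exp (R * norm h)" by (intro mult_mono zh e) auto
      finally have "\<bar>z \<bullet> h\<bar> * \<bar>exp (z \<bullet> h) - 1\<bar> \<le> (norm z * norm h) * ((norm z * norm h) * exp (R * norm h))"
        by (intro mult_mono zh) auto
      then have "k z * (\<bar>z \<bullet> h\<bar> * \<bar>exp (z \<bullet> h) - 1\<bar>) \<le> k z * ((norm z * norm h) * ((norm z * norm h) * exp (R * norm h)))"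
        by (intro mult_left_mono k_nonneg)
      then show ?thesis by (simp add: abs_mult k_nonneg kappa_nonneg kappa_def power2_eq_square ac_simps)
    qed (simp add: k_support kappa_def)
  qed
qed measurable

text \<open>The integrand is nonnegative, so a vanishing integral would make it vanish almost
  everywhere, yet it is positive on a ball.\<close>

lemma P_pos:
  assumes "h \<noteq> 0"
  shows "0 < P h"
proof -
  have nn: "0 \<le> k z * (z \<bullet> h) * (exp (z \<bullet> h) - 1)" for z
    using mult_nonneg_nonneg[OF k_nonneg mult_exp_minus_1(1)] by (simp add: mult.assoc)
  then have P0: "0 \<le> P h" unfolding P_def by (intro Bochner_Integration.integral_nonneg) auto
  have "P h \<noteq> 0"
  proof
    assume "P h = 0"
    then have "AE z in lborel. k z * (z \<bullet> h) * (exp (z \<bullet> h) - 1) = 0"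
      unfolding P_def using nn by (subst (asm) integral_nonneg_eq_0_iff_AE[OF P_integrable]) auto
    then obtain N where N: "{z \<in> space lborel. \<not> k z * (z \<bullet> h) * (exp (z \<bullet> h) - 1) = 0} \<subseteq> N"
        "emeasure lborel N = 0" "N \<in> sets lborel"
      by (rule AE_E)
    \<comment> \<open>The ball of radius e/2 about the point at distance e/2 in the direction of h
      lies in the half-space z \<bullet> h > 0 and in the ball of radius e, where \<open>k\<close>
      is positive off the origin.\<close>
    define a where "a = (e / (2 * norm h)) *\<^sub>R h"
    have na: "norm a = e/2" using assms e_pos by (simp add: a_def)
    have "ball a (e/2) \<subseteq> N"
    proof
      fix z assume z: "z \<in> ball a (e/2)"
      have "norm (z - a) < e/2" using z by (simp add: dist_norm norm_minus_commute)
      then have zn: "norm z < e" using norm_triangle_ineq2[of z a] na by simp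
      have "z \<bullet> h = a \<bullet> h + (z - a) \<bullet> h" by (simp add: inner_diff_left)
      moreover have "a \<bullet> h = e/2 * norm h"
        using assms by (simp add: a_def power2_norm_eq_inner[symmetric] power2_eq_square)
      moreover have "\<bar>(z - a) \<bullet> h\<bar> \<le> norm (z - a) * norm h" by (rule Cauchy_Schwarz_ineq2)
      moreover have "norm (z - a) * norm h < e/2 * norm h" using \<open>norm (z - a) < e/2\<close> assms by simp
      ultimately have zh: "0 < z \<bullet> h" by linarith
      then have z0: "0 < norm z" by auto
      have "0 < norm z * f (norm z)" using f_lower[of "norm z"] z0 zn c_pos by simp
      then have "0 < k z" using z0 by (simp add: k_def zero_less_mult_iff)
      then have "k z * (z \<bullet> h) * (exp (z \<bullet> h) - 1) \<noteq> 0" using zh by simp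
      then show "z \<in> N" using N(1) by auto
    qed
    then have "emeasure lborel (ball a (e/2)) \<le> 0" using emeasure_mono[of _ N lborel] N by metis
    then have "measure lborel (ball a (e/2)) = 0" by (simp add: measure_def)
    then show False using content_ball_pos[of "e/2" a] e_pos by simp
  qed
  with P0 show ?thesis by simp
qed

text \<open>
  The exponential \<open>exp (x \<bullet> h)\<close> is an eigenfunction of the nonlocal gradient. As \<open>h\<close> is real, the eigenvalue
  \<open>P h\<close> is positive, so a function with vanishing nonlocal gradient is orthogonal to all exponentials.
\<close>

lemma nlgrad_exp_pairing:
  assumes C1: "C1_support r U G"
  shows "(\<integral>x. (nlgrad U x \<bullet> h) * exp (x \<bullet> h) \<partial>lborel) = - (P h * (\<integral>x. U x * exp (x \<bullet> h) \<partial>lborel))"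
proof -
  note D = C1_supportD[OF C1]
  have [measurable]: "U \<in> borel_measurable borel" by (rule D(6))
  obtain L where L: "0 < L" "\<And>x y. \<bar>U x - U y\<bar> \<le> L * norm (x - y)"
    using C1_support_Lipschitz[OF C1] by blast
  let ?F = "\<lambda>x z. ((U x - U (x - z)) * k z) * (z \<bullet> h) * exp (x \<bullet> h)"
  let ?b = "norm h * exp ((r + R) * norm h)"
  let ?U = "\<integral>x. U x * exp (x \<bullet> h) \<partial>lborel"
  have i: "integrable (lborel \<Otimes>\<^sub>M lborel) (case_prod ?F)"
  proof (rule integrable_pair_bound)
    show "integrable lborel (\<lambda>x::'a. ?b * indicator (cball 0 (r + R)) x)" by (rule integrable_indicator_cball)
    show "integrable lborel (\<lambda>z. L * kappa z)" using integrable_kappa by simp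
    show "(\<lambda>(x, z). ?F x z) \<in> borel_measurable (borel \<Otimes>\<^sub>M borel)" by measurable
    fix x z
    show "\<bar>?F x z\<bar> \<le> ?b * indicator (cball 0 (r + R)) x * (L * kappa z)"
    proof (cases "norm z \<le> R \<and> norm x \<le> r + R")
      case True
      have "\<bar>(U x - U (x - z)) * k z\<bar> * \<bar>z \<bullet> h\<bar> \<le> \<bar>(U x - U (x - z)) * k z\<bar> * (norm z * norm h)"
        by (intro mult_left_mono Cauchy_Schwarz_ineq2) simp
      also have "\<dots> = norm (((U x - U (x - z)) * k z) *\<^sub>R z) * norm h" by simp
      also have "\<dots> \<le> L * kappa z * norm h" by (intro mult_right_mono nlgrad_integrable(1) L) auto
      finally have 1: "\<bar>(U x - U (x - z)) * k z\<bar> * \<bar>z \<bullet> h\<bar> \<le> L * kappa z * norm h" .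
      have "x \<bullet> h \<le> norm x * norm h" by (rule norm_cauchy_schwarz)
      also have "\<dots> \<le> (r + R) * norm h" using True by (intro mult_right_mono) auto
      finally have 2: "exp (x \<bullet> h) \<le> exp ((r + R) * norm h)" by simp
      have "\<bar>(U x - U (x - z)) * k z\<bar> * \<bar>z \<bullet> h\<bar> * exp (x \<bullet> h) \<le> L * kappa z * norm h * exp ((r + R) * norm h)"
        by (rule mult_mono[OF 1 2]) (use L kappa_nonneg in auto)
      then show ?thesis using True by (simp add: abs_mult ac_simps)
    next
      case False
      have "?F x z = 0"
      proof (cases "norm z \<le> R")
        case z: True
        then have "r + R < norm x" using False by simp
        moreover from this have "r < norm (x - z)" using z norm_triangle_ineq2[of x z] by simp
        moreover have "r < norm x" using calculation(1) R_pos by simp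
        ultimately show ?thesis using D(4) by simp
      qed (simp add: k_support)
      then show ?thesis using L(1) kappa_nonneg[of z] by (simp only:) (simp add: zero_le_mult_iff)
    qed
  qed
  have iU: "integrable lborel (\<lambda>x. U x * exp (x \<bullet> h))"
    by (rule continuous_support_integrable(1)[of _ r]) (use D(4) in \<open>auto intro!: continuous_intros D(3)\<close>)
  \<comment> \<open>Translating \<open>U\<close> by z multiplies its integral against the
    exponential by exp (z \<bullet> h): the eigenfunction property, moved onto
    \<open>U\<close>.\<close>
  have sh: "(\<integral>x. U (x - z) * exp (x \<bullet> h) \<partial>lborel) = exp (z \<bullet> h) * ?U"
      "integrable lborel (\<lambda>x. U (x - z) * exp (x \<bullet> h))" for z
  proof -
    have eq: "U (x - z) * exp (x \<bullet> h) = exp (z \<bullet> h) * (U (x + - z) * exp ((x + - z) \<bullet> h))" for x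
      by (simp add: exp_add[symmetric] inner_diff_left)
    show "(\<integral>x. U (x - z) * exp (x \<bullet> h) \<partial>lborel) = exp (z \<bullet> h) * ?U"
      unfolding eq integral_mult_right_zero
      by (subst integral_lborel_translate[of "\<lambda>x. U x * exp (x \<bullet> h)" "- z"]) auto
    show "integrable lborel (\<lambda>x. U (x - z) * exp (x \<bullet> h))"
      unfolding eq by (intro integrable_mult_right integrable_lborel_translate[OF iU])
  qed
  have "(\<integral>x. (nlgrad U x \<bullet> h) * exp (x \<bullet> h) \<partial>lborel) = (\<integral>x. (\<integral>z. ?F x z \<partial>lborel) \<partial>lborel)"
  proof (rule Bochner_Integration.integral_cong[OF refl])
    fix x
    have "nlgrad U x \<bullet> h = (\<integral>z. (((U x - U (x - z)) * k z) *\<^sub>R z) \<bullet> h \<partial>lborel)"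
      unfolding nlgrad_def by (rule integral_inner_left[symmetric]) (use nlgrad_integrable(2)[of U L] L in auto)
    then show "(nlgrad U x \<bullet> h) * exp (x \<bullet> h) = (\<integral>z. ?F x z \<partial>lborel)"
      by (simp only: inner_scaleR_left integral_mult_left_zero)
  qed
  also have "\<dots> = (\<integral>z. (\<integral>x. ?F x z \<partial>lborel) \<partial>lborel)"
    by (rule lborel_pair.Fubini_integral[OF i, symmetric])
  also have "\<dots> = (\<integral>z. - ?U * (k z * (z \<bullet> h) * (exp (z \<bullet> h) - 1)) \<partial>lborel)"
  proof (rule Bochner_Integration.integral_cong[OF refl])
    fix z
    have "(\<integral>x. ?F x z \<partial>lborel) = (\<integral>x. (k z * (z \<bullet> h)) * (U x * exp (x \<bullet> h) - U (x - z) * exp (x \<bullet> h)) \<partial>lborel)"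
      by (intro Bochner_Integration.integral_cong refl) (simp add: algebra_simps)
    also have "\<dots> = (k z * (z \<bullet> h)) * (?U - exp (z \<bullet> h) * ?U)"
      using iU sh by (simp only: integral_mult_right_zero Bochner_Integration.integral_diff)
    also have "\<dots> = - ?U * (k z * (z \<bullet> h) * (exp (z \<bullet> h) - 1))" by (simp add: algebra_simps)
    finally show "(\<integral>x. ?F x z \<partial>lborel) = - ?U * (k z * (z \<bullet> h) * (exp (z \<bullet> h) - 1))" .
  qed
  also have "\<dots> = - ?U * P h" by (simp only: integral_mult_right_zero P_def)
  finally show ?thesis by (simp add: mult.commute)
qed

text \<open>The nonlocal gradient of the mollification vanishes outside the ball of radius r + d +
  R, so the exponential may be cut off there; it then becomes square integrable and Cauchy-Schwarz
  applies to the pairing.\<close>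

lemma exp_transform_bound:
  assumes p: "grad_pair r u g" and d: "0 < d"
  shows "\<bar>\<integral>x. mollify d u x * exp (x \<bullet> h) \<partial>lborel\<bar> * P h
    \<le> l2 lborel g * l2 lborel (\<lambda>x. (indicator (cball 0 (r + d + R)) x * exp (x \<bullet> h)) *\<^sub>R h)"
proof -
  note Q = grad_pairD[OF p]
  note C1 = Q(6)[OF d]
  let ?U = "mollify d u" and ?v = "\<lambda>x. (indicator (cball 0 (r + d + R)) x * exp (x \<bullet> h)) *\<^sub>R h"
  have P0: "0 \<le> P h" using P_pos[of h] by (cases "h = 0") (auto simp: P_def)
  have "norm (?v x) \<le> exp ((r + d + R) * norm h) * norm h" for x
  proof (cases "norm x \<le> r + d + R")
    case True
    have "x \<bullet> h \<le> norm x * norm h" by (rule norm_cauchy_schwarz)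
    also have "\<dots> \<le> (r + d + R) * norm h" using True by (intro mult_right_mono) auto
    finally show ?thesis using True by (simp add: mult_right_mono)
  qed simp
  moreover have [measurable]: "cball (0::'a) (r + d + R) \<in> sets borel" by (rule borel_closed) simp
  ultimately have sv: "sq_integrable lborel ?v"
    by (intro bounded_support_integrable(2)[of ?v _ "r + d + R"]) auto
  have sm: "sq_integrable lborel (mollify d g)" by (rule mollify_l2(1)[OF d Q(2)])
  have "(\<integral>x. (nlgrad ?U x \<bullet> h) * exp (x \<bullet> h) \<partial>lborel) = (\<integral>x. mollify d g x \<bullet> ?v x \<partial>lborel)"
  proof (rule Bochner_Integration.integral_cong[OF refl])
    fix x
    have "nlgrad ?U x = 0" if "r + d + R < norm x"
      by (rule nlgrad_support[OF C1_supportD(4)[OF C1] that])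
    then show "(nlgrad ?U x \<bullet> h) * exp (x \<bullet> h) = mollify d g x \<bullet> ?v x"
      by (auto simp: Q(5)[OF d] indicator_def not_le)
  qed
  then have "\<bar>P h * (\<integral>x. ?U x * exp (x \<bullet> h) \<partial>lborel)\<bar> \<le> l2 lborel (mollify d g) * l2 lborel ?v"
    using l2_inner[OF sm sv] nlgrad_exp_pairing[OF C1, of h] by simp
  also have "\<dots> \<le> l2 lborel g * l2 lborel ?v" by (intro mult_right_mono mollify_l2(2) d Q) simp
  finally show ?thesis using P0 by (simp add: abs_mult mult.commute)
qed

section \<open>Symmetry in the components of the nonlocal gradient\<close>

text \<open>
  Both sides are double integrals over kernels in \<open>z\<close> and \<open>w\<close>, exchanged by the substitution
  \<open>(z, w) \<mapsto> (- w, - z)\<close>, which preserves the correlation \<open>\<Gamma>\<close>.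
\<close>

lemma nlgrad_components_commute:
  assumes U: "C1_support r U G" and V: "C1_support r' V G'"
  shows "(\<integral>x. (nlgrad U x \<bullet> a) * (nlgrad V x \<bullet> b) \<partial>lborel) = (\<integral>x. (nlgrad U x \<bullet> b) * (nlgrad V x \<bullet> a) \<partial>lborel)"
proof -
  note D = C1_supportD[OF U] and D' = C1_supportD[OF V]
  have [measurable]: "U \<in> borel_measurable borel" "V \<in> borel_measurable borel" by (rule D(6), rule D'(6))
  obtain L where L: "0 < L" "\<And>x y. \<bar>U x - U y\<bar> \<le> L * norm (x - y)"
    using C1_support_Lipschitz[OF U] by blast
  obtain L' where L': "0 < L'" "\<And>x y. \<bar>V x - V y\<bar> \<le> L' * norm (x - y)"
    using C1_support_Lipschitz[OF V] by blast
  define \<Gamma> where "\<Gamma> = (\<lambda>z w. \<integral>x. (U x - U (x - z)) * (V x - V (x - w)) \<partial>lborel)"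
  have [measurable]: "(\<lambda>p. \<Gamma> (fst p) (snd p)) \<in> borel_measurable (borel \<Otimes>\<^sub>M borel)"
    unfolding \<Gamma>_def by measurable
  have meas: "(\<lambda>p. k (fst p) * k (snd p) * (fst p \<bullet> a) * (snd p \<bullet> b) * \<Gamma> (fst p) (snd p)) \<in> borel_measurable borel"
    unfolding borel_prod[symmetric] by measurable
  have main: "(\<integral>x. (nlgrad U x \<bullet> a) * (nlgrad V x \<bullet> b) \<partial>lborel)
     = (\<integral>p. k (fst p) * k (snd p) * (fst p \<bullet> a) * (snd p \<bullet> b) * \<Gamma> (fst p) (snd p) \<partial>lborel)" for a b
  proof -
    let ?F = "\<lambda>x z. ((U x - U (x - z)) * k z) * (z \<bullet> a)" and ?F' = "\<lambda>x w. ((V x - V (x - w)) * k w) * (w \<bullet> b)"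
    have inU: "nlgrad U x \<bullet> a = (\<integral>z. ?F x z \<partial>lborel)" "integrable lborel (\<lambda>z. ?F x z)"
      and inV: "nlgrad V x \<bullet> b = (\<integral>z. ?F' x z \<partial>lborel)" "integrable lborel (\<lambda>z. ?F' x z)" for x
    proof -
      have 1: "integrable lborel (\<lambda>z. ((U x - U (x - z)) * k z) *\<^sub>R z)" by (rule nlgrad_integrable(2)[OF _ L(2)]) simp
      have 2: "integrable lborel (\<lambda>z. ((V x - V (x - z)) * k z) *\<^sub>R z)" by (rule nlgrad_integrable(2)[OF _ L'(2)]) simp
      show "nlgrad U x \<bullet> a = (\<integral>z. ?F x z \<partial>lborel)" "integrable lborel (\<lambda>z. ?F x z)"
        using integral_inner_left[OF 1, of a] integrable_inner_left[OF 1, of a] by (simp_all add: nlgrad_def)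
      show "nlgrad V x \<bullet> b = (\<integral>z. ?F' x z \<partial>lborel)" "integrable lborel (\<lambda>z. ?F' x z)"
        using integral_inner_left[OF 2, of b] integrable_inner_left[OF 2, of b] by (simp_all add: nlgrad_def)
    qed
    have bF: "\<bar>?F x z\<bar> \<le> L * kappa z * norm a" "\<bar>?F' x z\<bar> \<le> L' * kappa z * norm b" for x z
    proof -
      have "\<bar>(((U x - U (x - z)) * k z) *\<^sub>R z) \<bullet> a\<bar> \<le> norm (((U x - U (x - z)) * k z) *\<^sub>R z) * norm a"
        by (rule Cauchy_Schwarz_ineq2)
      also have "\<dots> \<le> L * kappa z * norm a" by (intro mult_right_mono nlgrad_integrable(1) L) auto
      finally show "\<bar>?F x z\<bar> \<le> L * kappa z * norm a" by simp
      have "\<bar>(((V x - V (x - z)) * k z) *\<^sub>R z) \<bullet> b\<bar> \<le> norm (((V x - V (x - z)) * k z) *\<^sub>R z) * norm b"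
        by (rule Cauchy_Schwarz_ineq2)
      also have "\<dots> \<le> L' * kappa z * norm b" by (intro mult_right_mono nlgrad_integrable(1) L') auto
      finally show "\<bar>?F' x z\<bar> \<le> L' * kappa z * norm b" by simp
    qed
    let ?H = "\<lambda>x p. ?F x (fst p) * ?F' x (snd p)"
    have i: "integrable (lborel \<Otimes>\<^sub>M lborel) (case_prod ?H)"
    proof (rule integrable_pair_bound)
      show "integrable lborel (\<lambda>x::'a. 1 * indicator (cball 0 (r + R)) x :: real)" by (rule integrable_indicator_cball)
      show "integrable lborel (\<lambda>p. (L * kappa (fst p) * norm a) * (L' * kappa (snd p) * norm b))"
      proof -
        have "integrable lborel (\<lambda>z. L * kappa z * norm a)" "integrable lborel (\<lambda>z. L' * kappa z * norm b)"
          using integrable_kappa by simp_all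
        from integrable_pair_mult[OF this] show ?thesis by (simp only: lborel_prod case_prod_unfold)
      qed
      show "(\<lambda>(x, p). ?H x p) \<in> borel_measurable (borel \<Otimes>\<^sub>M borel)"
        unfolding borel_prod[symmetric] by measurable
      fix x :: 'a and p :: "'a \<times> 'a"
      show "\<bar>?H x p\<bar> \<le> 1 * indicator (cball 0 (r + R)) x * ((L * kappa (fst p) * norm a) * (L' * kappa (snd p) * norm b))"
      proof (cases "norm x \<le> r + R")
        case True
        have "\<bar>?F x (fst p)\<bar> * \<bar>?F' x (snd p)\<bar> \<le> (L * kappa (fst p) * norm a) * (L' * kappa (snd p) * norm b)"
          using L(1) kappa_nonneg by (intro mult_mono bF) auto
        then show ?thesis using True by (simp add: abs_mult[of "?F x (fst p)"])
      next
        case False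
        have "?F x (fst p) = 0"
        proof (cases "norm (fst p) \<le> R")
          case z: True
          have "r < norm x" using False R_pos by simp
          moreover have "r < norm (x - fst p)" using z False norm_triangle_ineq2[of x "fst p"] by simp
          ultimately show ?thesis using D(4) by simp
        qed (simp add: k_support)
        then show ?thesis using False by (simp only: mult_zero_left) simp
      qed
    qed
    have "(\<integral>x. (nlgrad U x \<bullet> a) * (nlgrad V x \<bullet> b) \<partial>lborel) = (\<integral>x. (\<integral>p. ?H x p \<partial>lborel) \<partial>lborel)"
    proof (rule Bochner_Integration.integral_cong[OF refl])
      fix x
      have ip: "integrable (lborel \<Otimes>\<^sub>M lborel) (\<lambda>(z, w). ?F x z * ?F' x w)"
        by (rule integrable_pair_mult[OF inU(2) inV(2)])
      have "(nlgrad U x \<bullet> a) * (nlgrad V x \<bullet> b) = (\<integral>z. (\<integral>w. ?F x z * ?F' x w \<partial>lborel) \<partial>lborel)"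
        unfolding inU(1) inV(1) by (simp only: integral_mult_right_zero integral_mult_left_zero)
      also have "\<dots> = (\<integral>p. (case p of (z, y) \<Rightarrow> ?F x z * ?F' x y) \<partial>(lborel \<Otimes>\<^sub>M lborel))"
        using lborel_pair.integral_fst[OF ip] by simp
      also have "\<dots> = (\<integral>p. ?H x p \<partial>lborel)" by (simp add: lborel_prod case_prod_beta)
      finally show "(nlgrad U x \<bullet> a) * (nlgrad V x \<bullet> b) = (\<integral>p. ?H x p \<partial>lborel)" .
    qed
    also have "\<dots> = (\<integral>p. (\<integral>x. ?H x p \<partial>lborel) \<partial>lborel)"
      by (rule lborel_pair.Fubini_integral[OF i, symmetric])
    also have "\<dots> = (\<integral>p. k (fst p) * k (snd p) * (fst p \<bullet> a) * (snd p \<bullet> b) * \<Gamma> (fst p) (snd p) \<partial>lborel)"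
    proof (rule Bochner_Integration.integral_cong[OF refl])
      fix p :: "'a \<times> 'a"
      have "?H x p = (k (fst p) * k (snd p) * (fst p \<bullet> a) * (snd p \<bullet> b)) * ((U x - U (x - fst p)) * (V x - V (x - snd p)))" for x
        by (simp only: ac_simps)
      then show "(\<integral>x. ?H x p \<partial>lborel) = k (fst p) * k (snd p) * (fst p \<bullet> a) * (snd p \<bullet> b) * \<Gamma> (fst p) (snd p)"
        unfolding \<Gamma>_def by (simp only: integral_mult_right_zero)
    qed
    finally show ?thesis .
  qed
  have sym: "\<Gamma> (- w) (- z) = \<Gamma> z w" for z w
  proof -
    note tU = l2_translate(1)[OF D(10)] and tV = l2_translate(1)[OF D'(10)]
    have pr: "integrable lborel (\<lambda>x. U (x + y) * V (x + y'))" for y y'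
      using sq_integrable_inner[OF tU[of y] tV[of y']] by simp
    have sh: "(\<integral>x. U (x + y) * V (x + y') \<partial>lborel) = (\<integral>x. U x * V (x + (y' - y)) \<partial>lborel)" for y y'
    proof -
      have "(\<lambda>x. U x * V (x + (y' - y))) \<in> borel_measurable borel" by measurable
      from integral_lborel_translate[OF this, of y] show ?thesis by (simp add: algebra_simps)
    qed
    \<comment> \<open>Translation invariance reduces the four products to the cross-correlation of
      \<open>U\<close> and \<open>V\<close> at 0, -w, z and z - w. Replacing (z, w) by (-w, -z)
      exchanges the second and third and fixes the others.\<close>
    have ex: "\<Gamma> z w = (\<integral>x. U x * V x \<partial>lborel) - (\<integral>x. U x * V (x + - w) \<partial>lborel) - (\<integral>x. U x * V (x + z) \<partial>lborel)
        + (\<integral>x. U x * V (x + (z - w)) \<partial>lborel)" for z w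
    proof -
      have "\<Gamma> z w = (\<integral>x. U (x + 0) * V (x + 0) - U (x + 0) * V (x + - w) - U (x + - z) * V (x + 0) + U (x + - z) * V (x + - w) \<partial>lborel)"
        unfolding \<Gamma>_def by (simp add: algebra_simps)
      also have "\<dots> = (\<integral>x. U (x + 0) * V (x + 0) \<partial>lborel) - (\<integral>x. U (x + 0) * V (x + - w) \<partial>lborel)
          - (\<integral>x. U (x + - z) * V (x + 0) \<partial>lborel) + (\<integral>x. U (x + - z) * V (x + - w) \<partial>lborel)"
        by (simp only: pr Bochner_Integration.integral_diff Bochner_Integration.integral_add
            Bochner_Integration.integrable_diff)
      also have "\<dots> = (\<integral>x. U x * V x \<partial>lborel) - (\<integral>x. U x * V (x + - w) \<partial>lborel) - (\<integral>x. U x * V (x + z) \<partial>lborel)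
        + (\<integral>x. U x * V (x + (z - w)) \<partial>lborel)"
        unfolding sh by simp
      finally show ?thesis .
    qed
    show ?thesis unfolding ex by (simp add: algebra_simps)
  qed
  \<comment> \<open>The map is the reflection of the product space composed with the exchange of its
    factors, and both preserve Lebesgue measure.\<close>
  have inv: "(\<integral>p. F (- snd p, - fst p) \<partial>lborel) = (\<integral>p. F p \<partial>lborel)"
    if [measurable]: "F \<in> borel_measurable borel" for F :: "'a \<times> 'a \<Rightarrow> real"
  proof -
    have m: "(\<lambda>(z, w). F (w, z)) \<in> borel_measurable borel" unfolding borel_prod[symmetric] using that
      by (simp add: borel_prod[symmetric])
    have "(\<integral>p. F (- snd p, - fst p) \<partial>lborel) = (\<integral>p. (case - p of (z, y) \<Rightarrow> F (y, z)) \<partial>lborel)"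
      by (simp add: case_prod_beta)
    also have "\<dots> = (\<integral>p. (case p of (z, y) \<Rightarrow> F (y, z)) \<partial>lborel)" by (rule integral_lborel_uminus[OF m])
    also have "\<dots> = (\<integral>p. F p \<partial>lborel)"
      using lborel_pair.integral_product_swap[of F] that by (simp add: lborel_prod)
    finally show ?thesis .
  qed
  have "(\<integral>x. (nlgrad U x \<bullet> a) * (nlgrad V x \<bullet> b) \<partial>lborel)
     = (\<integral>p. k (fst p) * k (snd p) * (fst p \<bullet> a) * (snd p \<bullet> b) * \<Gamma> (fst p) (snd p) \<partial>lborel)" by (rule main)
  also have "\<dots> = (\<integral>p. k (- snd p) * k (- fst p) * (- snd p \<bullet> a) * (- fst p \<bullet> b) * \<Gamma> (- snd p) (- fst p) \<partial>lborel)"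
    using inv[OF meas] by simp
  also have "\<dots> = (\<integral>p. k (fst p) * k (snd p) * (fst p \<bullet> b) * (snd p \<bullet> a) * \<Gamma> (fst p) (snd p) \<partial>lborel)"
    unfolding sym k_minus by (intro Bochner_Integration.integral_cong refl) simp
  also have "\<dots> = (\<integral>x. (nlgrad U x \<bullet> b) * (nlgrad V x \<bullet> a) \<partial>lborel)" by (rule main[symmetric])
  finally show ?thesis .
qed

end


section \<open>The Poincare inequality\<close>

text \<open>An algebra, since exponents add under multiplication; h = 0 supplies the
  constants.\<close>

inductive exp_sum :: "('a::euclidean_space \<Rightarrow> real) \<Rightarrow> bool" where
  base: "exp_sum (\<lambda>x. c * exp (x \<bullet> h))"
| add: "exp_sum f \<Longrightarrow> exp_sum g \<Longrightarrow> exp_sum (\<lambda>x. f x + g x)"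

lemma exp_sum_continuous: "exp_sum f \<Longrightarrow> continuous_on S f"
  by (induction rule: exp_sum.induct) (intro continuous_intros; assumption)+

lemma exp_sum_mult:
  assumes "exp_sum f" "exp_sum g"
  shows "exp_sum (\<lambda>x. f x * g x)"
  using assms(1)
proof induction
  case (base c h)
  from assms(2) show ?case
  proof induction
    case (base c' h')
    have "(\<lambda>x. c * exp (x \<bullet> h) * (c' * exp (x \<bullet> h'))) = (\<lambda>x. (c * c') * exp (x \<bullet> (h + h')))"
      by (simp add: inner_add_right exp_add ac_simps)
    then show ?case by (simp only: exp_sum.base)
  next
    case (add f g)
    then show ?case by (simp only: distrib_left exp_sum.add)
  qed
next
  case (add f g)
  then show ?case by (simp only: distrib_right exp_sum.add)
qed

lemma exp_sum_dense:
  fixes g :: "'a::euclidean_space \<Rightarrow> real"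
  assumes "compact S" "continuous_on S g" "0 < e"
  obtains f where "exp_sum f" "\<And>x. x \<in> S \<Longrightarrow> \<bar>g x - f x\<bar> < e"
proof -
  have "\<exists>f. exp_sum f \<and> (\<forall>x\<in>S. \<bar>g x - f x\<bar> < e)"
  proof (rule Stone_Weierstrass_HOL[where P=exp_sum])
    show "exp_sum (\<lambda>x. c)" for c using exp_sum.base[of c 0] by simp
    show "x \<in> S \<and> y \<in> S \<and> x \<noteq> y \<Longrightarrow> \<exists>f. exp_sum f \<and> f x \<noteq> f y" for x y :: 'a
    proof -
      assume "x \<in> S \<and> y \<in> S \<and> x \<noteq> y"
      \<comment> \<open>The frequency x - y separates x from y because the two exponents differ by
        |x - y|^2.\<close>
      then have "x \<bullet> (x - y) \<noteq> y \<bullet> (x - y)"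
        using inner_eq_zero_iff[of "x - y"] unfolding inner_diff_left[of x y] by auto
      then show ?thesis
        by (intro exI[of _ "\<lambda>z. 1 * exp (z \<bullet> (x - y))"]) (use exp_sum.base[of 1 "x - y"] in auto)
    qed
  qed (use assms in \<open>auto intro: exp_sum_continuous exp_sum_mult exp_sum.add\<close>)
  with that show thesis by blast
qed

text \<open>A function orthogonal to all exponentials is orthogonal to the algebra they span, which
  is uniformly dense on the ball, and hence to itself. Continuity is asked on the closed ball only,
  since the function may jump to 0 across its boundary.\<close>

lemma exp_transform_injective:
  fixes G :: "'a::euclidean_space \<Rightarrow> real"
  assumes c: "continuous_on (cball 0 r) G" and m [measurable]: "G \<in> borel_measurable borel"
    and s: "\<And>x. r < norm x \<Longrightarrow> G x = 0"
    and z: "\<And>h. h \<noteq> 0 \<Longrightarrow> (\<integral>x. G x * exp (x \<bullet> h) \<partial>lborel) = 0"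
  shows "(\<integral>x. (G x)\<^sup>2 \<partial>lborel) = 0"
proof -
  have "compact (G ` cball 0 r)" by (intro compact_continuous_image c) simp
  then obtain B where B: "0 < B" "\<forall>y\<in>G ` cball 0 r. norm y \<le> B"
    using compact_imp_bounded bounded_pos by blast
  have B': "norm (G x) \<le> B" for x
    using B s[of x] by (cases "norm x \<le> r") auto
  have iG: "integrable lborel G" by (rule bounded_support_integrable(1)[OF m B' s])
  have prod: "integrable lborel (\<lambda>x. G x * f x)" if "continuous_on UNIV f" for f :: "'a \<Rightarrow> real"
  proof -
    have [measurable]: "f \<in> borel_measurable borel" by (rule borel_measurable_continuous_onI[OF that])
    have "compact (f ` cball 0 r)" by (intro compact_continuous_image continuous_on_subset[OF that]) auto
    then obtain B2 where B2: "0 < B2" "\<forall>y\<in>f ` cball 0 r. norm y \<le> B2"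
      using compact_imp_bounded bounded_pos by blast
    have "norm (G x * f x) \<le> B * B2" for x
      using B2 s[of x] B'[of x] B(1) by (cases "norm x \<le> r") (auto simp: abs_mult intro!: mult_mono)
    then show ?thesis by (rule bounded_support_integrable(1)[of _ _ r, rotated]) (use s in auto)
  qed
  \<comment> \<open>The hypothesis excludes the frequency 0, where \<open>P\<close> vanishes, but
    the algebra contains the constants; dominated convergence along frequencies tending to 0
    recovers this case.\<close>
  have z0: "(\<integral>x. G x \<partial>lborel) = 0"
  proof -
    obtain b :: 'a where b: "b \<in> Basis" using nonempty_Basis by blast
    let ?h = "\<lambda>n. inverse (real (Suc n)) *\<^sub>R b"
    have "(\<lambda>n. \<integral>x. G x * exp (x \<bullet> ?h n) \<partial>lborel) \<longlonglongrightarrow> (\<integral>x. G x * exp (x \<bullet> (0 *\<^sub>R b)) \<partial>lborel)"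
    proof (rule integral_dominated_convergence[where w="\<lambda>x. exp r * norm (G x)"])
      show "integrable lborel (\<lambda>x. exp r * norm (G x))" using iG by simp
      show "AE x in lborel. (\<lambda>n. G x * exp (x \<bullet> ?h n)) \<longlonglongrightarrow> G x * exp (x \<bullet> (0 *\<^sub>R b))"
        by (intro AE_I2 tendsto_intros LIMSEQ_inverse_real_of_nat)
      show "AE x in lborel. norm (G x * exp (x \<bullet> ?h n)) \<le> exp r * norm (G x)" for n
      proof (rule AE_I2)
        fix x
        show "norm (G x * exp (x \<bullet> ?h n)) \<le> exp r * norm (G x)"
        proof (cases "norm x \<le> r")
          case True
          have "x \<bullet> ?h n \<le> norm x * norm (?h n)" by (rule norm_cauchy_schwarz)
          also have "\<dots> \<le> norm x * 1" using b by (intro mult_left_mono) (auto simp: inverse_le_1_iff)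
          finally have "exp (x \<bullet> ?h n) \<le> exp r" using True by simp
          then have "\<bar>G x\<bar> * exp (x \<bullet> ?h n) \<le> \<bar>G x\<bar> * exp r" by (rule mult_left_mono) simp
          then show ?thesis by (simp add: abs_mult mult.commute)
        qed (simp add: s)
      qed
    qed measurable
    moreover have "(\<integral>x. G x * exp (x \<bullet> ?h n) \<partial>lborel) = 0" for n
      using b by (intro z) auto
    ultimately show ?thesis by (simp add: LIMSEQ_const_iff)
  qed
  have zs: "(\<integral>x. G x * f x \<partial>lborel) = 0" if "exp_sum f" for f
    using that
  proof induction
    case (base c h)
    have "(\<integral>x. G x * (c * exp (x \<bullet> h)) \<partial>lborel) = c * (\<integral>x. G x * exp (x \<bullet> h) \<partial>lborel)"
      by (subst integral_mult_right_zero[symmetric]) (simp add: ac_simps)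
    then show ?case using z[of h] z0 by (cases "h = 0") auto
  next
    case (add f g)
    have "(\<integral>x. G x * (f x + g x) \<partial>lborel) = (\<integral>x. G x * f x \<partial>lborel) + (\<integral>x. G x * g x \<partial>lborel)"
      unfolding distrib_left
      by (intro Bochner_Integration.integral_add prod exp_sum_continuous add)
    then show ?case using add by simp
  qed
  have G2: "integrable lborel (\<lambda>x. G x * G x)"
    using sq_integrable_inner[OF bounded_support_integrable(2)[OF m B' s] bounded_support_integrable(2)[OF m B' s]] by simp
  have "(\<integral>x. (G x)\<^sup>2 \<partial>lborel) \<le> 0"
  proof (rule field_le_epsilon)
    fix e :: real assume e: "0 < e"
    let ?I = "\<integral>x. norm (G x) \<partial>lborel"
    have I: "0 \<le> ?I" by simp
    obtain f where f: "exp_sum f" "\<And>x. x \<in> cball 0 r \<Longrightarrow> \<bar>G x - f x\<bar> < e / (?I + 1)"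
      using exp_sum_dense[of "cball 0 r" G "e / (?I + 1)"] c e I by (auto simp: add_nonneg_pos)
    have if': "integrable lborel (\<lambda>x. G x * f x)" by (intro prod exp_sum_continuous f)
    have "(\<integral>x. (G x)\<^sup>2 \<partial>lborel) = (\<integral>x. G x * G x \<partial>lborel) - (\<integral>x. G x * f x \<partial>lborel)"
      using zs[OF f(1)] by (simp add: power2_eq_square)
    also have "\<dots> = (\<integral>x. G x * (G x - f x) \<partial>lborel)"
      unfolding right_diff_distrib by (rule Bochner_Integration.integral_diff[OF G2 if', symmetric])
    also have "\<dots> \<le> (\<integral>x. norm (G x) * (e / (?I + 1)) \<partial>lborel)"
    proof (rule integral_mono)
      show "integrable lborel (\<lambda>x. G x * (G x - f x))"
        unfolding right_diff_distrib by (intro Bochner_Integration.integrable_diff G2 if')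
      show "integrable lborel (\<lambda>x. norm (G x) * (e / (?I + 1)))" using iG by simp
      fix x
      show "G x * (G x - f x) \<le> norm (G x) * (e / (?I + 1))"
      proof (cases "norm x \<le> r")
        case True
        have "G x * (G x - f x) \<le> \<bar>G x\<bar> * \<bar>G x - f x\<bar>" by (metis abs_ge_self abs_mult)
        also have "\<dots> \<le> \<bar>G x\<bar> * (e / (?I + 1))" using f(2)[of x] True by (intro mult_left_mono) auto
        finally show ?thesis by simp
      qed (simp add: s)
    qed
    also have "\<dots> = ?I * (e / (?I + 1))" by (rule integral_mult_left_zero)
    also have "\<dots> \<le> e"
    proof -
      have "?I * e \<le> (?I + 1) * e" using e by (intro mult_right_mono) auto
      moreover have p: "0 < ?I + 1" using I by linarith
      ultimately have "?I * e / (?I + 1) \<le> e" by (simp only: pos_divide_le_eq[OF p] mult.commute)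
      then show ?thesis by simp
    qed
    finally show "(\<integral>x. (G x)\<^sup>2 \<partial>lborel) \<le> 0 + e" by simp
  qed
  moreover have "0 \<le> (\<integral>x. (G x)\<^sup>2 \<partial>lborel)" by simp
  ultimately show ?thesis by simp
qed

lemma l2_le_sup:
  fixes h :: "'a::euclidean_space \<Rightarrow> real"
  assumes [measurable]: "h \<in> borel_measurable borel" and B: "\<And>x. \<bar>h x\<bar> \<le> B" "0 \<le> B" and s: "\<And>x. r < norm x \<Longrightarrow> h x = 0"
  shows "l2 lborel h \<le> B * sqrt (measure lborel (cball (0::'a) r))"
proof (rule l2_le_nn_integral(2))
  let ?V = "measure lborel (cball (0::'a) r)"
  have "(\<integral>\<^sup>+x. ennreal ((norm (h x))\<^sup>2) \<partial>lborel) \<le> (\<integral>\<^sup>+x. ennreal (B\<^sup>2) * indicator (cball (0::'a) r) x \<partial>lborel)"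
  proof (rule nn_integral_mono)
    fix x
    have "(norm (h x))\<^sup>2 \<le> B\<^sup>2" using power_mono[OF B(1)[of x], of 2] by simp
    then show "ennreal ((norm (h x))\<^sup>2) \<le> ennreal (B\<^sup>2) * indicator (cball 0 r) x"
      using s[of x] by (auto simp: indicator_def not_le intro!: ennreal_leI)
  qed
  also have "\<dots> = ennreal (B\<^sup>2) * emeasure lborel (cball (0::'a) r)"
    by (simp add: nn_integral_cmult_indicator)
  also have "emeasure lborel (cball (0::'a) r) = ennreal ?V"
    using emeasure_bounded_finite[OF bounded_cball[of "0::'a" r]] by (intro emeasure_eq_ennreal_measure) auto
  also have "ennreal (B\<^sup>2) * ennreal ?V = ennreal ((B * sqrt ?V)\<^sup>2)"
    by (simp add: ennreal_mult[symmetric] power_mult_distrib)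
  finally show "(\<integral>\<^sup>+x. ennreal ((norm (h x))\<^sup>2) \<partial>lborel) \<le> ennreal ((B * sqrt ?V)\<^sup>2)" .
qed (use B in auto)

text \<open>At a fixed scale and for a fixed support, the mollifications are bounded and
  equicontinuous in terms of the mean-square norm alone, as Arzela-Ascoli requires. The support
  enters through the bound of the integral of |u| by the root of the volume.\<close>

lemma mollify_bounds:
  assumes d: "0 < d"
  shows "\<exists>K>0. (\<forall>u x. sq_integrable lborel u \<longrightarrow> (\<forall>x. r < norm x \<longrightarrow> u x = 0) \<longrightarrow>
      \<bar>mollify d u (x::'a::euclidean_space)\<bar> \<le> K * l2 lborel u) \<and>
    (\<forall>u x y. sq_integrable lborel u \<longrightarrow> (\<forall>x. r < norm x \<longrightarrow> u x = 0) \<longrightarrow>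
      \<bar>mollify d u (x::'a) - mollify d u y\<bar> \<le> K * l2 lborel u * norm (x - y))"
proof -
  have tf: "test_function (mollifier d :: 'a \<Rightarrow> real)" by (rule test_function_mollifier[OF d])
  obtain L where L: "0 < L" "\<And>x y. norm (mollifier d (x::'a) - mollifier d y) \<le> L * norm (x - y)"
    using test_function_Lipschitz[OF tf] by blast
  obtain B where B: "0 < B" "\<And>x. norm (mollifier d (x::'a)) \<le> B"
    using test_function_bounded[OF tf] by blast
  let ?V = "sqrt (measure lborel (cball (0::'a) r))"
  let ?K = "(B + L) * ?V + 1"
  have V: "0 \<le> ?V" by simp
  have K: "B * ?V \<le> ?K" "L * ?V \<le> ?K" "0 < ?K"
    using B(1) L(1) V mult_nonneg_nonneg[of B ?V] mult_nonneg_nonneg[of L ?V] by (simp_all add: distrib_right add_nonneg_pos)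
  have 1: "\<bar>mollify d u x\<bar> \<le> ?K * l2 lborel u"
    if u: "sq_integrable lborel u" and s: "\<And>x. r < norm x \<Longrightarrow> u x = 0" for u and x :: 'a
  proof -
    note i = sq_integrable_support[OF u s]
    have "\<bar>mollify d u x\<bar> \<le> (\<integral>y. norm (mollifier d (x - y) *\<^sub>R u y) \<partial>lborel)"
      unfolding mollify_def using integral_norm_bound[of lborel "\<lambda>y. mollifier d (x - y) *\<^sub>R u y"] by simp
    also have "\<dots> \<le> (\<integral>y. B * norm (u y) \<partial>lborel)"
      by (rule integral_mono')
        (use i(1) B in \<open>auto intro!: mult_right_mono simp: abs_mult\<close>)
    also have "\<dots> = B * (\<integral>y. norm (u y) \<partial>lborel)" by simp
    also have "\<dots> \<le> B * (?V * l2 lborel u)" using i(2) B by (intro mult_left_mono) auto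
    also have "\<dots> = (B * ?V) * l2 lborel u" by simp
    also have "\<dots> \<le> ?K * l2 lborel u" by (rule mult_right_mono[OF K(1)]) simp
    finally show ?thesis .
  qed
  have 2: "\<bar>mollify d u x - mollify d u y\<bar> \<le> ?K * l2 lborel u * norm (x - y)"
    if u: "sq_integrable lborel u" and s: "\<And>x. r < norm x \<Longrightarrow> u x = 0" for u and x y :: 'a
  proof -
    note i = sq_integrable_support[OF u s]
    have "mollify d u x - mollify d u y = (\<integral>z. mollifier d (x - z) *\<^sub>R u z - mollifier d (y - z) *\<^sub>R u z \<partial>lborel)"
      unfolding mollify_def by (rule Bochner_Integration.integral_diff[symmetric]) (rule mollify_integrable[OF d u])+
    then have "\<bar>mollify d u x - mollify d u y\<bar> \<le> (\<integral>z. norm (mollifier d (x - z) *\<^sub>R u z - mollifier d (y - z) *\<^sub>R u z) \<partial>lborel)"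
      by (simp only: integral_norm_bound[of lborel "\<lambda>z. mollifier d (x - z) *\<^sub>R u z - mollifier d (y - z) *\<^sub>R u z", unfolded real_norm_def[of "integral\<^sup>L _ _"]])
    also have "\<dots> \<le> (\<integral>z. L * norm (x - y) * norm (u z) \<partial>lborel)"
    proof (rule integral_mono')
      show "integrable lborel (\<lambda>z. L * norm (x - y) * norm (u z))" using i(1) by simp
      fix z
      show "norm (mollifier d (x - z) *\<^sub>R u z - mollifier d (y - z) *\<^sub>R u z) \<le> L * norm (x - y) * norm (u z)"
        using mult_right_mono[OF L(2)[of "x - z" "y - z"], of "norm (u z)"]
        by (simp add: left_diff_distrib[symmetric] abs_mult)
      show "0 \<le> L * norm (x - y) * norm (u z)" using L by simp
    qed
    also have "\<dots> = L * norm (x - y) * (\<integral>y. norm (u y) \<partial>lborel)" by simp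
    also have "\<dots> \<le> L * norm (x - y) * (?V * l2 lborel u)" using i(2) L by (intro mult_left_mono) auto
    also have "\<dots> = (L * ?V) * (l2 lborel u * norm (x - y))" by simp
    also have "\<dots> \<le> ?K * (l2 lborel u * norm (x - y))" by (rule mult_right_mono[OF K(2)]) simp
    finally show ?thesis by (simp add: mult.assoc)
  qed
  show ?thesis by (rule exI[of _ ?K], intro conjI allI impI K(3) 1 2) simp_all
qed

context nonlocal_kernel
begin

text \<open>
  By compactness: a counterexample sequence, mollified at one fixed small scale, has a uniform limit by
  Arzela-Ascoli, which is orthogonal to all exponentials and hence zero; this contradicts \<open>mollify_approx\<close>.
\<close>

theorem Poincare:
  obtains K where "0 < K" "\<And>u g. grad_pair r u g \<Longrightarrow> l2 lborel u \<le> K * l2 lborel g"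
proof (rule ccontr)
  assume "\<not> thesis"
  with that have neg: "\<exists>u g. grad_pair r u g \<and> K * l2 lborel g < l2 lborel u" if "0 < K" for K
    using \<open>0 < K\<close> not_le by metis
  have "\<forall>n. \<exists>u g. grad_pair r u g \<and> real (Suc n) * l2 lborel g < l2 lborel u"
    using neg[of "real (Suc _)"] by simp
  then obtain u g where pr: "\<And>n. grad_pair r (u n) (g n)" and ug: "\<And>n. real (Suc n) * l2 lborel (g n) < l2 lborel (u n)"
    by metis
  define a where "a = (\<lambda>n. l2 lborel (u n))"
  have a: "0 < a n" for n using order_le_less_trans[OF _ ug[of n], of 0] by (simp add: a_def)
  have ga: "l2 lborel (g n) \<le> a n / real (Suc n)" for n
    using ug[of n] by (simp add: a_def field_simps)
  \<comment> \<open>Chosen so that B2 d^(s/2) <= 1/4. As the gradient norm is at most the norm of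
    \<open>u n\<close>, the error of mollification is then at most half of the latter. The summand 1
    guards against B2 = 0.\<close>
  define d where "d = min e ((1 / (4 * (B2 + 1))) powr (2/s))"
  have d: "0 < d" "d \<le> e" "B2 * d powr (s/2) \<le> 1/4"
  proof -
    show d0: "0 < d" using e_pos B2_nonneg by (simp add: d_def)
    show "d \<le> e" by (simp add: d_def)
    have "d powr (s/2) \<le> ((1 / (4 * (B2 + 1))) powr (2/s)) powr (s/2)"
      using d0 s_pos by (intro powr_mono2) (auto simp: d_def)
    also have "\<dots> = 1 / (4 * (B2 + 1))" using s_pos B2_nonneg by (simp add: powr_powr)
    finally have "B2 * d powr (s/2) \<le> B2 * (1 / (4 * (B2 + 1)))" by (rule mult_left_mono[OF _ B2_nonneg])
    also have "\<dots> \<le> 1/4" using B2_nonneg by (simp add: divide_le_eq)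
    finally show "B2 * d powr (s/2) \<le> 1/4" .
  qed
  note Q = grad_pairD[OF pr]
  obtain K where K: "0 < K"
    "\<And>u x. sq_integrable lborel u \<Longrightarrow> (\<And>x. r < norm x \<Longrightarrow> u x = 0) \<Longrightarrow> \<bar>mollify d u (x::'a)\<bar> \<le> K * l2 lborel u"
    "\<And>u x y. sq_integrable lborel u \<Longrightarrow> (\<And>x. r < norm x \<Longrightarrow> u x = 0) \<Longrightarrow> \<bar>mollify d u (x::'a) - mollify d u y\<bar> \<le> K * l2 lborel u * norm (x - y)"
  proof -
    obtain K where K: "0 < K"
      "\<forall>u x. sq_integrable lborel u \<longrightarrow> (\<forall>x. r < norm x \<longrightarrow> u x = 0) \<longrightarrow> \<bar>mollify d u (x::'a)\<bar> \<le> K * l2 lborel u"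
      "\<forall>u x y. sq_integrable lborel u \<longrightarrow> (\<forall>x. r < norm x \<longrightarrow> u x = 0) \<longrightarrow> \<bar>mollify d u (x::'a) - mollify d u y\<bar> \<le> K * l2 lborel u * norm (x - y)"
      using mollify_bounds[OF d(1), of r] by blast
    show thesis by (rule that[OF K(1)]) (use K(2,3) in blast)+
  qed
  \<comment> \<open>The mollified sequence is divided by the norm of \<open>u n\<close>: it keeps
    norm at least 1/2, while its nonlocal gradient has norm at most 1/(n+1).\<close>
  define W where "W = (\<lambda>n x. mollify d (u n) x / a n)"
  have W1: "\<bar>W n x\<bar> \<le> K" for n x
    using K(2)[OF Q(1,3), of n x] a[of n] by (simp add: W_def a_def divide_le_eq)
  have W2: "\<bar>W n x - W n y\<bar> \<le> K * norm (x - y)" for n x y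
    using K(3)[OF Q(1,3), of n x y] a[of n]
    by (simp add: W_def a_def diff_divide_distrib[symmetric] divide_le_eq ac_simps)
  have W3: "W n x = 0" if "r + d < norm x" for n x
    using mollify_support[where u="u n" and R=r and x=x, OF d(1) Q(3) that] by (simp add: W_def)
  have [measurable]: "W n \<in> borel_measurable borel" for n
    using Q(1)[of n] unfolding W_def by (intro borel_measurable_divide measurable_mollify) auto
  have Wl: "1/2 \<le> l2 lborel (W n)" for n
  proof -
    have g1: "l2 lborel (g n) \<le> a n"
      using order_trans[OF ga[of n]] a[of n] by (simp add: divide_le_eq)
    have m: "sq_integrable lborel (mollify d (u n))" by (rule mollify_l2(1)[OF d(1) Q(1)])
    have "a n \<le> l2 lborel (mollify d (u n)) + l2 lborel (\<lambda>x. u n x - mollify d (u n) x)"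
      unfolding a_def by (rule l2_le_add_diff[OF Q(1) m])
    also have "l2 lborel (\<lambda>x. u n x - mollify d (u n) x) \<le> B2 * d powr (s/2) * (l2 lborel (g n) + l2 lborel (u n))"
      by (rule mollify_approx[OF pr d(1,2)])
    also have "\<dots> \<le> 1/4 * (a n + a n)"
      using g1 d(3) B2_nonneg by (intro mult_mono) (auto simp: a_def)
    finally have "a n / 2 \<le> l2 lborel (mollify d (u n))" by simp
    moreover have "l2 lborel (W n) = l2 lborel (mollify d (u n)) / a n"
      using l2_scaleR[of lborel "inverse (a n)" "mollify d (u n)"] a[of n]
      by (simp add: W_def divide_inverse mult.commute)
    ultimately show ?thesis using a[of n] by (simp add: le_divide_eq)
  qed
  let ?S = "cball (0::'a) (r + d)"
  obtain G k where G: "continuous_on ?S G" and k: "strict_mono (k :: nat \<Rightarrow> nat)"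
    and conv: "\<And>e. 0 < e \<Longrightarrow> \<exists>N. \<forall>n x. n \<ge> N \<and> x \<in> ?S \<longrightarrow> norm (W (k n) x - G x) < e"
  proof (rule Arzela_Ascoli[of ?S W K])
    show "compact ?S" by simp
    show "norm (W n x) \<le> K" for n x using W1 by simp
    show "\<exists>d. 0 < d \<and> (\<forall>n y. y \<in> ?S \<and> norm (x - y) < d \<longrightarrow> norm (W n x - W n y) < e)" if "0 < e" for x e
    proof (intro exI[of _ "e / K"] conjI allI impI)
      show "0 < e / K" using that K(1) by simp
      fix n y assume "y \<in> ?S \<and> norm (x - y) < e / K"
      then have "K * norm (x - y) < e" using K(1) by (simp add: less_divide_eq mult.commute)
      then show "norm (W n x - W n y) < e" using W2[of n x y] by simp
    qed
  qed blast
  \<comment> \<open>Arzela-Ascoli yields the limit on the ball only; outside it every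
    \<open>W n\<close> vanishes, so extension by 0 keeps the convergence uniform on the whole
    space.\<close>
  define F where "F = (\<lambda>x. indicator ?S x * G x)"
  have Fm [measurable]: "F \<in> borel_measurable borel"
    using borel_measurable_continuous_on_indicator[OF _ G] by (simp add: F_def)
  have Fs: "F x = 0" if "r + d < norm x" for x using that by (simp add: F_def)
  have Fc: "continuous_on ?S F"
    by (rule continuous_on_eq[OF G]) (simp add: F_def)
  have conv': "\<exists>N. \<forall>n\<ge>N. \<forall>x. \<bar>W (k n) x - F x\<bar> \<le> t" if t: "0 < t" for t
  proof -
    obtain N where N: "\<forall>n x. n \<ge> N \<and> x \<in> ?S \<longrightarrow> norm (W (k n) x - G x) < t" using conv[OF t] by blast
    have "\<bar>W (k n) x - F x\<bar> \<le> t" if "n \<ge> N" for n x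
    proof (cases "x \<in> ?S")
      case True
      then show ?thesis using N that by (auto simp: F_def intro: less_imp_le)
    next
      case False
      then show ?thesis using W3[of x] t by (simp add: F_def)
    qed
    then show ?thesis by blast
  qed
  have Fb: "\<bar>F x\<bar> \<le> K + 1" for x
    using conv'[of 1] W1[of _ x] by (metis abs_minus_commute abs_triangle_ineq2 add.commute diff_le_eq le_refl order_trans zero_less_one add_mono)
  have Fz: "(\<integral>x. F x * exp (x \<bullet> h) \<partial>lborel) = 0" if h: "h \<noteq> 0" for h
  proof -
    let ?c = "l2 lborel (\<lambda>x. (indicator (cball 0 (r + d + R)) x * exp (x \<bullet> h)) *\<^sub>R h)"
    let ?X = "\<integral>x. indicator ?S x * exp (x \<bullet> h) \<partial>lborel"
    define I where "I = (\<lambda>n. \<integral>x. W n x * exp (x \<bullet> h) \<partial>lborel)"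
    have eb: "exp (x \<bullet> h) \<le> exp ((r + d) * norm h)" if "norm x \<le> r + d" for x
    proof -
      have "x \<bullet> h \<le> norm x * norm h" by (rule norm_cauchy_schwarz)
      also have "\<dots> \<le> (r + d) * norm h" using that by (intro mult_right_mono) auto
      finally show ?thesis by simp
    qed
    have bi: "integrable lborel (\<lambda>x. H x * exp (x \<bullet> h))"
      if [measurable]: "H \<in> borel_measurable borel" and "\<And>x. \<bar>H x\<bar> \<le> B" "\<And>x. r + d < norm x \<Longrightarrow> H x = 0" for H B
    proof (rule bounded_support_integrable(1)[of _ "B * exp ((r + d) * norm h)" "r + d"])
      have B: "0 \<le> B" using that(2)[of 0] by linarith
      show "norm (H x * exp (x \<bullet> h)) \<le> B * exp ((r + d) * norm h)" for x
      proof (cases "norm x \<le> r + d")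
        case True
        then show ?thesis using mult_mono[OF that(2)[of x] eb[OF True] B] by (simp add: abs_mult)
      qed (use that(3)[of x] B in simp)
    qed (use that in auto)
    have iX: "integrable lborel (\<lambda>x. indicator ?S x * exp (x \<bullet> h))"
      by (rule bi[of "indicator ?S" 1], rule borel_measurable_indicator, simp) (simp_all add: indicator_def)
    \<comment> \<open>The exponential transform is controlled by the gradient norm divided by P h >
      0, and relative to \<open>a n\<close> the gradient norm is at most 1/(n+1).\<close>
    have IP: "\<bar>I n\<bar> \<le> ?c / P h * inverse (real (Suc n))" for n
    proof -
      have "I n = (\<integral>x. mollify d (u n) x * exp (x \<bullet> h) / a n \<partial>lborel)"
        unfolding I_def W_def by (intro Bochner_Integration.integral_cong refl) simp
      then have "I n * a n = (\<integral>x. mollify d (u n) x * exp (x \<bullet> h) \<partial>lborel)"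
        using a[of n] by (simp only: integral_divide_zero) simp
      then have "\<bar>I n * a n\<bar> * P h \<le> l2 lborel (g n) * ?c"
        using exp_transform_bound[OF pr d(1), of n h] by simp
      also have "\<dots> \<le> a n / real (Suc n) * ?c" by (intro mult_right_mono ga) simp
      finally have "a n * (\<bar>I n\<bar> * P h) \<le> a n * (?c * inverse (real (Suc n)))"
        using a[of n] by (simp add: abs_mult ac_simps divide_inverse)
      then have "\<bar>I n\<bar> * P h \<le> ?c * inverse (real (Suc n))"
        using a[of n] by simp
      then show ?thesis using P_pos[OF h] by (simp add: le_divide_eq ac_simps)
    qed
    have "I \<longlonglongrightarrow> 0"
    proof (rule Lim_null_comparison)
      show "\<forall>\<^sub>F n in sequentially. norm (I n) \<le> ?c / P h * inverse (real (Suc n))"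
        using IP by (intro always_eventually allI) simp
      show "(\<lambda>n. ?c / P h * inverse (real (Suc n))) \<longlonglongrightarrow> 0"
        by (rule tendsto_mult_right_zero[OF LIMSEQ_inverse_real_of_nat])
    qed
    then have I0: "(\<lambda>n. I (k n)) \<longlonglongrightarrow> 0"
      using LIMSEQ_subseq_LIMSEQ[OF _ k] by (auto simp: o_def)
    have "(\<lambda>n. I (k n)) \<longlonglongrightarrow> (\<integral>x. F x * exp (x \<bullet> h) \<partial>lborel)"
    proof (rule LIMSEQ_I)
      fix t :: real assume t: "0 < t"
      have X: "0 \<le> ?X" by simp
      obtain N where N: "\<forall>n\<ge>N. \<forall>x. \<bar>W (k n) x - F x\<bar> \<le> t / (?X + 1)"
        using conv'[of "t / (?X + 1)"] t X by (auto simp: add_nonneg_pos)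
      have "norm (I (k n) - (\<integral>x. F x * exp (x \<bullet> h) \<partial>lborel)) < t" if n: "n \<ge> N" for n
      proof -
        have iW: "integrable lborel (\<lambda>x. W (k n) x * exp (x \<bullet> h))" by (rule bi[OF _ W1 W3]) auto
        have iF: "integrable lborel (\<lambda>x. F x * exp (x \<bullet> h))" by (rule bi[OF Fm Fb Fs])
        have "I (k n) - (\<integral>x. F x * exp (x \<bullet> h) \<partial>lborel) = (\<integral>x. W (k n) x * exp (x \<bullet> h) - F x * exp (x \<bullet> h) \<partial>lborel)"
          unfolding I_def by (rule Bochner_Integration.integral_diff[OF iW iF, symmetric])
        then have "\<bar>I (k n) - (\<integral>x. F x * exp (x \<bullet> h) \<partial>lborel)\<bar> \<le> (\<integral>x. \<bar>W (k n) x * exp (x \<bullet> h) - F x * exp (x \<bullet> h)\<bar> \<partial>lborel)"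
          by (simp only: integral_abs_bound)
        also have "\<dots> \<le> (\<integral>x. t / (?X + 1) * (indicator ?S x * exp (x \<bullet> h)) \<partial>lborel)"
        proof (rule integral_mono')
          show "integrable lborel (\<lambda>x. t / (?X + 1) * (indicator ?S x * exp (x \<bullet> h)))"
            by (intro integrable_mult_right iX)
          fix x
          show "\<bar>W (k n) x * exp (x \<bullet> h) - F x * exp (x \<bullet> h)\<bar> \<le> t / (?X + 1) * (indicator ?S x * exp (x \<bullet> h))"
          proof (cases "norm x \<le> r + d")
            case True
            have "\<bar>W (k n) x - F x\<bar> * exp (x \<bullet> h) \<le> t / (?X + 1) * exp (x \<bullet> h)"
              using N n by (intro mult_right_mono) auto
            then show ?thesis using True by (simp add: left_diff_distrib[symmetric] abs_mult)
          qed (use W3[of x] Fs[of x] in simp)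
          show "0 \<le> t / (?X + 1) * (indicator ?S x * exp (x \<bullet> h))" using t X by simp
        qed
        also have "\<dots> = t / (?X + 1) * ?X" by (rule integral_mult_right_zero)
        also have "\<dots> < t"
        proof -
          have "t * ?X < t * (?X + 1)" using t by simp
          moreover have p: "0 < ?X + 1" using X by linarith
          ultimately have "t * ?X / (?X + 1) < t" by (simp only: pos_divide_less_eq[OF p])
          then show ?thesis by simp
        qed
        finally show ?thesis by simp
      qed
      then show "\<exists>N. \<forall>n\<ge>N. norm (I (k n) - (\<integral>x. F x * exp (x \<bullet> h) \<partial>lborel)) < t" by blast
    qed
    from LIMSEQ_unique[OF this I0] show ?thesis .
  qed
  have "(\<integral>x. (F x)\<^sup>2 \<partial>lborel) = 0"
    by (rule exp_transform_injective[OF Fc Fm Fs Fz])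
  then have F0: "l2 lborel F = 0" by (simp add: l2_def)
  have Fsq: "sq_integrable lborel F"
    by (rule bounded_support_integrable(2)[OF Fm _ Fs]) (use Fb in auto)
  let ?V = "sqrt (measure lborel ?S)"
  have V: "0 \<le> ?V" by simp
  \<comment> \<open>This uniform error on the ball has norm at most 1/4; as the limit has norm 0,
    the lower bound 1/2 for \<open>W\<close> is contradicted.\<close>
  obtain N where N: "\<forall>n\<ge>N. \<forall>x. \<bar>W (k n) x - F x\<bar> \<le> 1/4 / (?V + 1)"
    using conv'[of "1/4 / (?V + 1)"] V by (auto simp: add_nonneg_pos)
  have "l2 lborel (\<lambda>x. W (k N) x - F x) \<le> 1/4 / (?V + 1) * ?V"
    by (rule l2_le_sup) (use N W3 Fs V in auto)
  also have "\<dots> \<le> 1/4"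
  proof -
    have "1/4 * ?V \<le> 1/4 * (?V + 1)" by simp
    moreover have p: "0 < ?V + 1" using V by linarith
    ultimately have "1/4 * ?V / (?V + 1) \<le> 1/4" by (simp only: pos_divide_le_eq[OF p])
    then show ?thesis by simp
  qed
  finally have "l2 lborel (\<lambda>x. W (k N) x - F x) \<le> 1/4" .
  moreover have "sq_integrable lborel (W (k N))"
    by (rule bounded_support_integrable(2)[OF _ _ W3]) (use W1 in auto)
  ultimately have "l2 lborel (W (k N)) \<le> 1/4"
    using l2_le_add_diff[OF _ Fsq, of "W (k N)"] F0 by simp
  with Wl[of "k N"] show False by simp
qed

section \<open>Passage from mollifications to the limit\<close>

lemma mollify_tendsto_sequentially:
  fixes u :: "'b::euclidean_space \<Rightarrow> 'c::euclidean_space"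
  assumes u: "sq_integrable lborel u"
  shows "(\<lambda>n. l2 lborel (\<lambda>x. mollify (inverse (real (Suc n))) u x - u x)) \<longlonglongrightarrow> 0"
proof (rule LIMSEQ_I)
  fix t :: real assume t: "0 < t"
  obtain d0 where d0: "0 < d0" "\<And>d. 0 < d \<Longrightarrow> d < d0 \<Longrightarrow> l2 lborel (\<lambda>x. mollify d u x - u x) < t"
    using mollify_tendsto[OF u t] by blast
  obtain N where N: "inverse (real (Suc N)) < d0" using reals_Archimedean[OF d0(1)] by blast
  have "inverse (real (Suc n)) < d0" if "n \<ge> N" for n
    using that by (intro le_less_trans[OF _ N] le_imp_inverse_le) auto
  then show "\<exists>N. \<forall>n\<ge>N. norm (l2 lborel (\<lambda>x. mollify (inverse (real (Suc n))) u x - u x) - 0) < t"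
    using d0(2) by (intro exI[of _ N]) auto
qed

lemma sq_integrable_inner_const:
  fixes F :: "'b \<Rightarrow> 'c::euclidean_space"
  assumes "sq_integrable M' F"
  shows "sq_integrable M' (\<lambda>x. F x \<bullet> a)" "l2 M' (\<lambda>x. F x \<bullet> a) \<le> norm a * l2 M' F"
proof -
  have [measurable]: "F \<in> borel_measurable M'" using assms by auto
  have i: "integrable M' (\<lambda>x. (norm a)\<^sup>2 * (norm (F x))\<^sup>2)"
    using assms by (auto simp: sq_integrable_def)
  have b: "(norm (F x \<bullet> a))\<^sup>2 \<le> (norm a)\<^sup>2 * (norm (F x))\<^sup>2" for x
    using power_mono[OF Cauchy_Schwarz_ineq2[of "F x" a] abs_ge_zero, of 2]
    by (simp add: power_mult_distrib mult.commute)
  have j: "integrable M' (\<lambda>x. (norm (F x \<bullet> a))\<^sup>2)"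
    by (rule Bochner_Integration.integrable_bound[OF i]) (use b in auto)
  then show "sq_integrable M' (\<lambda>x. F x \<bullet> a)" by (simp add: sq_integrable_def)
  have "(l2 M' (\<lambda>x. F x \<bullet> a))\<^sup>2 \<le> (\<integral>x. (norm a)\<^sup>2 * (norm (F x))\<^sup>2 \<partial>M')"
    unfolding l2_square by (rule integral_mono[OF j i b])
  also have "\<dots> = (norm a * l2 M' F)\<^sup>2" by (simp add: power_mult_distrib l2_square)
  finally show "l2 M' (\<lambda>x. F x \<bullet> a) \<le> norm a * l2 M' F" by (rule power2_le_imp_le) simp
qed

text \<open>The identity for mollified gradients passes to the limit in mean square. The two
  functions may be different components of one vector field, which is the case needed for Korn's
  inequality.\<close>

lemma grad_pair_components_commute:
  assumes u: "grad_pair r u g" and v: "grad_pair r' v h"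
  shows "(\<integral>x. (g x \<bullet> a) * (h x \<bullet> b) \<partial>lborel) = (\<integral>x. (g x \<bullet> b) * (h x \<bullet> a) \<partial>lborel)"
proof -
  note Q = grad_pairD[OF u] and Q' = grad_pairD[OF v]
  let ?d = "\<lambda>n. inverse (real (Suc n))"
  have l: "(\<lambda>n. \<integral>x. (mollify (?d n) g x \<bullet> a) * (mollify (?d n) h x \<bullet> b) \<partial>lborel) \<longlonglongrightarrow> (\<integral>x. (g x \<bullet> a) * (h x \<bullet> b) \<partial>lborel)" for a b
  proof -
    have t: "(\<lambda>n. l2 lborel (\<lambda>x. mollify (?d n) w x \<bullet> c - w x \<bullet> c)) \<longlonglongrightarrow> 0"
      if w: "sq_integrable lborel w" for w :: "'a \<Rightarrow> 'a" and c
    proof (rule Lim_null_comparison[OF always_eventually])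
      show "\<forall>n. norm (l2 lborel (\<lambda>x. mollify (?d n) w x \<bullet> c - w x \<bullet> c)) \<le> norm c * l2 lborel (\<lambda>x. mollify (?d n) w x - w x)"
      proof
        fix n
        have "sq_integrable lborel (\<lambda>x. mollify (?d n) w x - w x)"
          by (intro sq_integrable_diff mollify_l2(1) w) simp
        from sq_integrable_inner_const(2)[OF this, of c]
        show "norm (l2 lborel (\<lambda>x. mollify (?d n) w x \<bullet> c - w x \<bullet> c)) \<le> norm c * l2 lborel (\<lambda>x. mollify (?d n) w x - w x)"
          by (simp add: inner_diff_left)
      qed
      show "(\<lambda>n. norm c * l2 lborel (\<lambda>x. mollify (?d n) w x - w x)) \<longlonglongrightarrow> 0"
        by (rule tendsto_mult_right_zero[OF mollify_tendsto_sequentially[OF w]])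
    qed
    have "(\<lambda>n. \<integral>x. (mollify (?d n) g x \<bullet> a) \<bullet> (mollify (?d n) h x \<bullet> b) \<partial>lborel) \<longlonglongrightarrow> (\<integral>x. (g x \<bullet> a) \<bullet> (h x \<bullet> b) \<partial>lborel)"
      by (rule tendsto_l2_imp_tendsto_inner)
        (intro sq_integrable_inner_const(1) mollify_l2(1) t Q(2) Q'(2); simp)+
    then show ?thesis by simp
  qed
  have "(\<integral>x. (mollify (?d n) g x \<bullet> a) * (mollify (?d n) h x \<bullet> b) \<partial>lborel)
      = (\<integral>x. (mollify (?d n) g x \<bullet> b) * (mollify (?d n) h x \<bullet> a) \<partial>lborel)" for n
    using nlgrad_components_commute[OF Q(6)[of "?d n"] Q'(6)[of "?d n"]] Q(5)[of "?d n"] Q'(5)[of "?d n"] by simp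
  with l[of a b] have "(\<lambda>n. \<integral>x. (mollify (?d n) g x \<bullet> b) * (mollify (?d n) h x \<bullet> a) \<partial>lborel) \<longlonglongrightarrow> (\<integral>x. (g x \<bullet> a) * (h x \<bullet> b) \<partial>lborel)"
    by simp
  from LIMSEQ_unique[OF this l] show ?thesis .
qed

end


section \<open>The weak nonlocal gradient\<close>

text \<open>Membership in the spaces is stated for Lebesgue measurable functions, whereas Fubini and
  convolutions are applied to Borel functions. A Lebesgue measurable function is an almost
  everywhere limit of continuous ones, so it has a Borel representative.\<close>

lemma borel_representative:
  fixes u :: "'a::euclidean_space \<Rightarrow> 'b::euclidean_space"
  assumes "u \<in> borel_measurable lebesgue"
  obtains v where "v \<in> borel_measurable borel" "AE x in lebesgue. u x = v x"
proof -
  have "u measurable_on UNIV"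
    using lebesgue_measurable_imp_measurable_on[of u UNIV] assms by simp
  then obtain N g where N: "negligible N" and g: "\<And>n. continuous_on UNIV (g n)"
    and lim: "\<And>x. x \<notin> N \<Longrightarrow> (\<lambda>n. g n x) \<longlonglongrightarrow> u x"
    unfolding measurable_on_def by auto
  have [measurable]: "g n \<in> borel_measurable borel" for n by (rule borel_measurable_continuous_onI[OF g])
  have m: "(\<lambda>x. lim (\<lambda>n. g n x)) \<in> borel_measurable borel" by measurable
  have "AE x in lebesgue. x \<notin> N"
    using N unfolding negligible_iff_null_sets by (auto dest!: AE_not_in)
  then have "AE x in lebesgue. u x = lim (\<lambda>n. g n x)"
    by eventually_elim (simp add: limI[OF lim])
  with m show thesis by (rule that)
qed

lemma sq_integrable_lebesgue_iff:
  fixes v :: "'a::euclidean_space \<Rightarrow> 'b::euclidean_space"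
  assumes [measurable]: "v \<in> borel_measurable borel"
  shows "sq_integrable lebesgue v \<longleftrightarrow> sq_integrable lborel v" "l2 lebesgue v = l2 lborel v"
proof -
  have "integrable lebesgue (\<lambda>x. (norm (v x))\<^sup>2) \<longleftrightarrow> integrable lborel (\<lambda>x. (norm (v x))\<^sup>2)"
    by (rule integrable_completion) simp
  moreover have "v \<in> borel_measurable lebesgue" by (rule measurable_completion) simp
  ultimately show "sq_integrable lebesgue v \<longleftrightarrow> sq_integrable lborel v"
    by (simp add: sq_integrable_def)
  have "(\<integral>x. (norm (v x))\<^sup>2 \<partial>lebesgue) = (\<integral>x. (norm (v x))\<^sup>2 \<partial>lborel)"
    by (rule integral_completion) simp
  then show "l2 lebesgue v = l2 lborel v" by (simp add: l2_def)
qed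

lemma sq_integrable_borel_representative:
  fixes u v :: "'a::euclidean_space \<Rightarrow> 'b::euclidean_space"
  assumes u: "sq_integrable lebesgue u" and uv: "AE x in lebesgue. u x = v x" and v: "v \<in> borel_measurable borel"
  shows "sq_integrable lborel v" "l2 lborel v = l2 lebesgue u"
proof -
  have vm: "v \<in> borel_measurable lebesgue" by (rule measurable_completion) (simp add: v)
  have "sq_integrable lebesgue v" by (rule sq_integrable_cong_AE[OF u uv vm])
  then show "sq_integrable lborel v" using sq_integrable_lebesgue_iff(1)[OF v] by blast
  show "l2 lborel v = l2 lebesgue u"
    using l2_cong_AE[OF uv sq_integrable_measurable[OF u] vm] sq_integrable_lebesgue_iff(2)[OF v] by metis
qed

lemma integral_lebesgue_inner_cong:
  fixes u v g h :: "'a::euclidean_space \<Rightarrow> 'b::euclidean_space"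
  assumes uv: "AE x in lebesgue. u x = v x" and u: "u \<in> borel_measurable lebesgue"
    and gh: "AE x in lebesgue. g x = h x" and g: "g \<in> borel_measurable lebesgue"
    and [measurable]: "v \<in> borel_measurable borel" "h \<in> borel_measurable borel"
  shows "(\<integral>x. u x \<bullet> g x \<partial>lebesgue) = (\<integral>x. v x \<bullet> h x \<partial>lborel)"
proof -
  have [measurable]: "v \<in> borel_measurable lebesgue" "h \<in> borel_measurable lebesgue"
    by (rule measurable_completion, simp)+
  have "(\<integral>x. u x \<bullet> g x \<partial>lebesgue) = (\<integral>x. v x \<bullet> h x \<partial>lebesgue)"
    using uv gh u g by (intro integral_cong_AE) auto
  also have "\<dots> = (\<integral>x. v x \<bullet> h x \<partial>lborel)" by (rule integral_completion) simp
  finally show ?thesis .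
qed

text \<open>Shifted mollifiers times basis vectors as test functions show that every mollification
  of \<open>u\<close> vanishes, and mollifications converge to \<open>u\<close>.\<close>

lemma AE_zero_if_orthogonal_to_test_functions:
  fixes u :: "'a::euclidean_space \<Rightarrow> 'b::euclidean_space"
  assumes u: "sq_integrable lebesgue u"
    and z: "\<And>\<phi>. test_function \<phi> \<Longrightarrow> (\<integral>x. u x \<bullet> \<phi> x \<partial>lebesgue) = 0"
  shows "AE x in lebesgue. u x = 0"
proof -
  have um: "u \<in> borel_measurable lebesgue" using u by auto
  obtain v where v [measurable]: "v \<in> borel_measurable borel" and uv: "AE x in lebesgue. u x = v x"
    using borel_representative[OF um] by blast
  have vs: "sq_integrable lborel v" by (rule sq_integrable_borel_representative(1)[OF u uv v])
  have m0: "mollify d v x = 0" if d: "0 < d" for d x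
  proof (rule euclidean_eqI)
    fix b :: 'b
    let ?\<phi> = "\<lambda>y. mollifier d (x - y) *\<^sub>R b"
    have "(\<integral>y. u y \<bullet> ?\<phi> y \<partial>lebesgue) = (\<integral>y. v y \<bullet> ?\<phi> y \<partial>lborel)"
      by (intro integral_lebesgue_inner_cong uv um measurable_completion AE_I2) simp_all
    also have "\<dots> = (\<integral>y. (mollifier d (x - y) *\<^sub>R v y) \<bullet> b \<partial>lborel)" by simp
    also have "\<dots> = mollify d v x \<bullet> b"
      unfolding mollify_def by (rule integral_inner_left) (rule mollify_integrable[OF d vs])
    finally show "mollify d v x \<bullet> b = 0 \<bullet> b"
      using z[OF test_function_mollifier_reflect[OF d, of x b]] by simp
  qed
  have "l2 lborel v \<le> 0"
  proof (rule field_le_epsilon)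
    fix t :: real assume "0 < t"
    then obtain d0 where d0: "0 < d0" "\<And>d. 0 < d \<Longrightarrow> d < d0 \<Longrightarrow> l2 lborel (\<lambda>x. mollify d v x - v x) < t"
      using mollify_tendsto[OF vs] by blast
    have "l2 lborel (\<lambda>x. - v x) < t" using d0(2)[of "d0/2"] d0(1) by (simp add: m0)
    then show "l2 lborel v \<le> 0 + t" by (simp add: l2_def)
  qed
  then have "l2 lborel v = 0" using l2_nonneg[of lborel v] by linarith
  from l2_eq_0_AE[OF vs this] have "AE x in lebesgue. v x = 0" by (simp add: AE_completion_iff AE_completion)
  with uv show ?thesis by eventually_elim simp
qed

text \<open>Makes the arbitrary choice in \<open>D_nl\<close> agree almost everywhere with any weak
  gradient at hand.\<close>

lemma weak_D_nl_unique:
  assumes G: "weak_D_nl \<rho> u G" and G': "weak_D_nl \<rho> u G'"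
  shows "AE x in lebesgue. G x = G' x"
proof -
  have s: "sq_integrable lebesgue G" "sq_integrable lebesgue G'" using G G' by (auto simp: weak_D_nl_def)
  have "AE x in lebesgue. G x - G' x = 0"
  proof (rule AE_zero_if_orthogonal_to_test_functions)
    show "sq_integrable lebesgue (\<lambda>x. G x - G' x)" by (rule sq_integrable_diff[OF s])
    fix \<phi> :: "real^'a \<Rightarrow> real^'a^'a" assume t: "test_function \<phi>"
    obtain B where "0 < B" "\<And>x. norm (\<phi> x) \<le> B" by (rule test_function_bounded[OF t]) blast
    moreover obtain R where "0 < R" "\<And>x. R < norm x \<Longrightarrow> \<phi> x = 0" using test_function_support[OF t] by blast
    ultimately have "sq_integrable lborel \<phi>"
      using continuous_support_integrable(2)[OF test_function_continuous[OF t]] by blast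
    then have p: "sq_integrable lebesgue \<phi>"
      using sq_integrable_lebesgue_iff(1)[of \<phi>] by auto
    show "(\<integral>x. (G x - G' x) \<bullet> \<phi> x \<partial>lebesgue) = 0"
      using G G' t unfolding inner_diff_left
      by (simp add: sq_integrable_inner[OF s(1) p] sq_integrable_inner[OF s(2) p] weak_D_nl_def)
  qed
  then show ?thesis by eventually_elim simp
qed

text \<open>The kernel is tied to \<open>kappa\<close> off the origin only; at the origin its value
  is arbitrary, and there the integrand of \<open>div_nl\<close> vanishes.\<close>

locale vector_kernel = nonlocal_kernel f f' e c s C R "TYPE(real^'n)"
  for f f' :: "real \<Rightarrow> real" and e c s C R :: real +
  fixes \<rho> :: "real^'n \<Rightarrow> real"
  assumes rho_eq: "z \<noteq> 0 \<Longrightarrow> \<rho> z = kappa z"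
begin

lemma matrix_vector_bound:
  obtains K where "0 < K" "\<And>(A::real^'n^'n) x. norm (A *v x) \<le> K * norm A * norm x"
proof -
  have "bilinear (\<lambda>(A::real^'n^'n) x. A *v x)"
    unfolding bilinear_def by (auto intro!: linearI simp: algebra_simps scaleR_matrix_vector_assoc[symmetric]
      matrix_vector_mult_add_rdistrib vector_scaleR_matrix_ac)
  then show thesis using bilinear_bounded_pos that by blast
qed

lemma borel_measurable_matrix_vector_mult:
  fixes A :: "'b \<Rightarrow> real^'n^'n" and v :: "'b \<Rightarrow> real^'n"
  assumes "A \<in> borel_measurable N" "v \<in> borel_measurable N"
  shows "(\<lambda>y. A y *v v y) \<in> borel_measurable N"
proof -
  have c: "continuous_on UNIV (\<lambda>p::(real^'n^'n) \<times> (real^'n). fst p *v snd p)"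
    unfolding matrix_vector_mult_def by (intro continuous_intros)
  show ?thesis
    using borel_measurable_continuous_on[OF c, of "\<lambda>y. (A y, v y)" N] assms by simp
qed

lemma div_nl_integrand:
  fixes \<Phi> :: "real^'n \<Rightarrow> real^'n^'n"
  shows "\<rho> (x - y) *\<^sub>R (((1 / norm (x - y)) *\<^sub>R (\<Phi> x - \<Phi> y)) *v ((1 / norm (x - y)) *\<^sub>R (x - y)))
    = k (x - y) *\<^sub>R ((\<Phi> x - \<Phi> y) *v (x - y))"
proof (cases "x = y")
  case False
  then have n: "norm (x - y) \<noteq> 0" by simp
  have "\<rho> (x - y) *\<^sub>R (((1 / norm (x - y)) *\<^sub>R (\<Phi> x - \<Phi> y)) *v ((1 / norm (x - y)) *\<^sub>R (x - y)))
      = (\<rho> (x - y) * (1 / norm (x - y)) * (1 / norm (x - y))) *\<^sub>R ((\<Phi> x - \<Phi> y) *v (x - y))"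
    by (simp add: scaleR_matrix_vector_assoc[symmetric] matrix_vector_mult_scaleR)
  also have "\<rho> (x - y) * (1 / norm (x - y)) * (1 / norm (x - y)) = k (x - y)"
    using False n by (simp add: rho_eq kappa_def power2_eq_square)
  finally show ?thesis .
qed simp

lemma div_nl_eq:
  fixes \<Phi> :: "real^'n \<Rightarrow> real^'n^'n"
  assumes [measurable]: "\<Phi> \<in> borel_measurable borel"
  shows "div_nl \<rho> \<Phi> x = (\<integral>z. k z *\<^sub>R ((\<Phi> x - \<Phi> (x - z)) *v z) \<partial>lborel)"
proof -
  note mv = borel_measurable_matrix_vector_mult
  have m: "(\<lambda>y. k y *\<^sub>R ((\<Phi> x - \<Phi> (x - y)) *v y)) \<in> borel_measurable borel"
    by (intro borel_measurable_scaleR k_meas mv) measurable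
  have m': "(\<lambda>y. k (x - y) *\<^sub>R ((\<Phi> x - \<Phi> y) *v (x - y))) \<in> borel_measurable lborel"
  proof -
    have "(\<lambda>y. (\<Phi> x - \<Phi> y) *v (x - y)) \<in> borel_measurable borel"
      by (rule mv) measurable
    then have "(\<lambda>y. k (x - y) *\<^sub>R ((\<Phi> x - \<Phi> y) *v (x - y))) \<in> borel_measurable borel"
      by (rule borel_measurable_scaleR[rotated]) measurable
    then show ?thesis by simp
  qed
  have "div_nl \<rho> \<Phi> x = (\<integral>y. k (x - y) *\<^sub>R ((\<Phi> x - \<Phi> y) *v (x - y)) \<partial>lborel)"
    unfolding div_nl_def div_nl_integrand by (rule integral_completion[OF m'])
  also have "\<dots> = (\<integral>z. k z *\<^sub>R ((\<Phi> x - \<Phi> (x - z)) *v z) \<partial>lborel)"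
    using integral_lborel_reflect[OF m, of x] by simp
  finally show ?thesis .
qed

text \<open>The Lipschitz bound of the test function makes the divergence bounded, and the bounded
  range of the kernel gives it compact support. Being square integrable, it pairs linearly and
  continuously with \<open>u\<close>.\<close>

lemma sq_integrable_div_nl:
  fixes \<Phi> :: "real^'n \<Rightarrow> real^'n^'n"
  assumes t: "test_function \<Phi>"
  shows "sq_integrable lebesgue (div_nl \<rho> \<Phi>)"
proof -
  have [measurable]: "\<Phi> \<in> borel_measurable borel"
    by (rule borel_measurable_continuous_onI[OF test_function_continuous[OF t]])
  obtain K where K: "0 < K" "\<And>(A::real^'n^'n) x. norm (A *v x) \<le> K * norm A * norm x"
    using matrix_vector_bound by blast
  obtain L where L: "0 < L" "\<And>x y. norm (\<Phi> x - \<Phi> y) \<le> L * norm (x - y)"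
    using test_function_Lipschitz[OF t] by blast
  obtain r where r: "0 < r" "\<And>x. r < norm x \<Longrightarrow> \<Phi> x = 0"
    using test_function_support[OF t] by blast
  let ?F = "\<lambda>x z. k z *\<^sub>R ((\<Phi> x - \<Phi> (x - z)) *v z)"
  have mv: "(\<lambda>p. (\<Phi> (fst p) - \<Phi> (fst p - snd p)) *v snd p) \<in> borel_measurable (borel \<Otimes>\<^sub>M borel)"
    by (rule borel_measurable_matrix_vector_mult) measurable
  have "(\<lambda>p. ?F (fst p) (snd p)) \<in> borel_measurable (borel \<Otimes>\<^sub>M borel)"
    by (intro borel_measurable_scaleR mv) measurable
  then have "(\<lambda>(x, z). ?F x z) \<in> borel_measurable (borel \<Otimes>\<^sub>M lborel)" by (simp add: case_prod_unfold)
  then have m: "(\<lambda>x. \<integral>z. ?F x z \<partial>lborel) \<in> borel_measurable borel"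
    by (rule lborel.borel_measurable_lebesgue_integral)
  have eq: "div_nl \<rho> \<Phi> = (\<lambda>x. \<integral>z. ?F x z \<partial>lborel)" by (rule ext) (rule div_nl_eq, simp)
  have b: "norm (?F x z) \<le> K * L * kappa z" for x z
  proof -
    have "norm ((\<Phi> x - \<Phi> (x - z)) *v z) \<le> K * norm (\<Phi> x - \<Phi> (x - z)) * norm z" by (rule K)
    also have "\<dots> \<le> K * (L * norm z) * norm z"
      using L(2)[of x "x - z"] K(1) by (intro mult_right_mono mult_left_mono) auto
    finally have "k z * norm ((\<Phi> x - \<Phi> (x - z)) *v z) \<le> k z * (K * (L * norm z) * norm z)"
      by (intro mult_left_mono k_nonneg)
    then show ?thesis by (simp add: k_nonneg kappa_def power2_eq_square ac_simps)
  qed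
  have B: "norm (div_nl \<rho> \<Phi> x) \<le> K * L * (\<integral>z. kappa z \<partial>lborel)" for x
  proof -
    have "norm (div_nl \<rho> \<Phi> x) \<le> (\<integral>z. norm (?F x z) \<partial>lborel)" unfolding eq by (rule integral_norm_bound)
    also have "\<dots> \<le> (\<integral>z. K * L * kappa z \<partial>lborel)"
      by (rule integral_mono') (use integrable_kappa b K L kappa_nonneg in auto)
    finally show ?thesis by simp
  qed
  have S: "div_nl \<rho> \<Phi> x = 0" if "r + R < norm x" for x
  proof -
    have "?F x z = 0" for z
    proof (cases "norm z \<le> R")
      case True
      have "r < norm x" using that R_pos by simp
      moreover have "r < norm (x - z)" using that True norm_triangle_ineq2[of x z] by simp
      ultimately show ?thesis using r(2) by simp
    qed (simp add: k_support)
    then show ?thesis unfolding eq by (simp del: scaleR_eq_0_iff)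
  qed
  have m2: "div_nl \<rho> \<Phi> \<in> borel_measurable borel" unfolding eq by (rule m)
  have "sq_integrable lborel (div_nl \<rho> \<Phi>)" by (rule bounded_support_integrable(2)[OF m2 B S])
  then show ?thesis using sq_integrable_lebesgue_iff(1)[OF m2] by simp
qed

lemma sq_integrable_test_function:
  fixes \<Phi> :: "real^'n \<Rightarrow> real^'n^'n"
  assumes t: "test_function \<Phi>"
  shows "sq_integrable lebesgue \<Phi>"
proof -
  obtain r where r: "0 < r" "\<And>x. r < norm x \<Longrightarrow> \<Phi> x = 0"
    using test_function_support[OF t] by blast
  have "sq_integrable lborel \<Phi>"
    by (rule continuous_support_integrable(2)[OF test_function_continuous[OF t] r(2)])
  then show ?thesis
    using sq_integrable_lebesgue_iff(1)[OF borel_measurable_continuous_onI[OF test_function_continuous[OF t]]] by simp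
qed

lemma weak_D_nl_linear:
  assumes u: "sq_integrable lebesgue u" "weak_D_nl \<rho> u G" and v: "sq_integrable lebesgue v" "weak_D_nl \<rho> v G'"
  shows "weak_D_nl \<rho> (\<lambda>x. u x + a *\<^sub>R v x) (\<lambda>x. G x + a *\<^sub>R G' x)"
  unfolding weak_D_nl_def
proof (intro conjI allI impI)
  have GH: "sq_integrable lebesgue G" "sq_integrable lebesgue G'" using u v by (auto simp: weak_D_nl_def)
  show "sq_integrable lebesgue (\<lambda>x. G x + a *\<^sub>R G' x)"
    by (intro sq_integrable_add sq_integrable_scaleR GH)
  fix \<Phi> :: "real^'n \<Rightarrow> real^'n^'n" assume t: "test_function \<Phi>"
  note p = sq_integrable_test_function[OF t] and q = sq_integrable_div_nl[OF t]
  show "(\<integral>x. (G x + a *\<^sub>R G' x) \<bullet> \<Phi> x \<partial>lebesgue) = - (\<integral>x. (u x + a *\<^sub>R v x) \<bullet> div_nl \<rho> \<Phi> x \<partial>lebesgue)"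
    using u(2) v(2) t unfolding inner_add_left inner_scaleR_left
    by (simp add: sq_integrable_inner[OF GH(1) p] sq_integrable_inner[OF GH(2) p]
        sq_integrable_inner[OF u(1) q] sq_integrable_inner[OF v(1) q] weak_D_nl_def)
qed

text \<open>For a fixed test function both sides of the weak identity are continuous in mean
  square.\<close>

lemma weak_D_nl_closed:
  assumes u: "\<And>n. sq_integrable lebesgue (u n)" "\<And>n. weak_D_nl \<rho> (u n) (G n)"
    and v: "sq_integrable lebesgue v" "(\<lambda>n. l2 lebesgue (\<lambda>x. u n x - v x)) \<longlonglongrightarrow> 0"
    and G': "sq_integrable lebesgue G'" "(\<lambda>n. l2 lebesgue (\<lambda>x. G n x - G' x)) \<longlonglongrightarrow> 0"
  shows "weak_D_nl \<rho> v G'"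
  unfolding weak_D_nl_def
proof (intro conjI allI impI G'(1))
  fix \<Phi> :: "real^'n \<Rightarrow> real^'n^'n" assume t: "test_function \<Phi>"
  note p = sq_integrable_test_function[OF t] and q = sq_integrable_div_nl[OF t]
  have G: "sq_integrable lebesgue (G n)" for n using u(2)[of n] by (simp add: weak_D_nl_def)
  have z: "(\<lambda>n. l2 lebesgue (\<lambda>x. F x - F x)) \<longlonglongrightarrow> 0" for F :: "real^'n \<Rightarrow> 'z::euclidean_space"
    by (simp add: l2_def)
  have 1: "(\<lambda>n. \<integral>x. G n x \<bullet> \<Phi> x \<partial>lebesgue) \<longlonglongrightarrow> (\<integral>x. G' x \<bullet> \<Phi> x \<partial>lebesgue)"
    by (rule tendsto_l2_imp_tendsto_inner[OF G G' p p z])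
  have 2: "(\<lambda>n. - (\<integral>x. u n x \<bullet> div_nl \<rho> \<Phi> x \<partial>lebesgue)) \<longlonglongrightarrow> - (\<integral>x. v x \<bullet> div_nl \<rho> \<Phi> x \<partial>lebesgue)"
    by (rule tendsto_minus[OF tendsto_l2_imp_tendsto_inner[OF u(1) v q q z]])
  have "(\<integral>x. G n x \<bullet> \<Phi> x \<partial>lebesgue) = - (\<integral>x. u n x \<bullet> div_nl \<rho> \<Phi> x \<partial>lebesgue)" for n
    using u(2)[of n] t by (simp add: weak_D_nl_def)
  with 1 2 show "(\<integral>x. G' x \<bullet> \<Phi> x \<partial>lebesgue) = - (\<integral>x. v x \<bullet> div_nl \<rho> \<Phi> x \<partial>lebesgue)"
    by (metis (no_types, lifting) LIMSEQ_unique ext)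
qed

text \<open>Fubini moves the difference from the mollification to the mollifier, and replacing z by
  -z turns it into the nonlocal gradient of the reflected mollifier. The sign is the antisymmetry of
  the nonlocal gradient.\<close>

lemma nlgrad_mollify_adjoint:
  fixes u :: "real^'n \<Rightarrow> real"
  assumes d: "0 < d" and us: "sq_integrable lborel u" and r: "\<And>x. r < norm x \<Longrightarrow> u x = 0"
  shows "nlgrad (mollify d u) x \<bullet> a = - (\<integral>y. u y * (nlgrad (\<lambda>y. mollifier d (x - y)) y \<bullet> a) \<partial>lborel)"
proof -
  let ?m = "mollifier d :: real^'n \<Rightarrow> real"
  have u: "integrable lborel u" by (rule sq_integrable_support(1)[OF us r])
  have [measurable]: "u \<in> borel_measurable borel" using us by auto
  obtain L where L: "0 < L" "\<And>x y. norm (?m x - ?m y) \<le> L * norm (x - y)"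
    using test_function_Lipschitz[OF test_function_mollifier[OF d]] by blast
  let ?F = "\<lambda>y z. (((?m (x - y) - ?m (x - y - z)) * u y) * k z) * (z \<bullet> a)"
  have i: "integrable (lborel \<Otimes>\<^sub>M lborel) (case_prod ?F)"
  proof (rule integrable_pair_bound)
    show "integrable lborel (\<lambda>y. L * norm a * \<bar>u y\<bar>)" using u by simp
    show "integrable lborel kappa" by (rule integrable_kappa)
    show "(\<lambda>(y, z). ?F y z) \<in> borel_measurable (borel \<Otimes>\<^sub>M borel)" by measurable
    fix y z
    have "\<bar>?m (x - y) - ?m (x - y - z)\<bar> * \<bar>z \<bullet> a\<bar> \<le> (L * norm z) * (norm z * norm a)"
      using L(2)[of "x - y" "x - y - z"] L(1) Cauchy_Schwarz_ineq2[of z a] by (intro mult_mono) auto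
    then have "(\<bar>?m (x - y) - ?m (x - y - z)\<bar> * \<bar>z \<bullet> a\<bar>) * (\<bar>u y\<bar> * k z) \<le> ((L * norm z) * (norm z * norm a)) * (\<bar>u y\<bar> * k z)"
      using k_nonneg by (intro mult_right_mono) auto
    then show "\<bar>?F y z\<bar> \<le> L * norm a * \<bar>u y\<bar> * kappa z"
      by (simp add: abs_mult k_nonneg kappa_def power2_eq_square ac_simps)
  qed
  obtain L' where UL: "\<And>x y. \<bar>mollify d u x - mollify d u y\<bar> \<le> L' * norm (x - y)"
    using C1_support_Lipschitz[OF C1_support_mollify[OF d u us r]] by blast
  have "nlgrad (mollify d u) x \<bullet> a = (\<integral>z. (((mollify d u x - mollify d u (x - z)) * k z) *\<^sub>R z) \<bullet> a \<partial>lborel)"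
    unfolding nlgrad_def by (rule integral_inner_left[symmetric]) (use nlgrad_integrable(2)[OF _ UL] in auto)
  also have "\<dots> = (\<integral>z. (\<integral>y. ?F y z \<partial>lborel) \<partial>lborel)"
  proof (rule Bochner_Integration.integral_cong[OF refl])
    fix z
    have "mollify d u x - mollify d u (x - z) = (\<integral>y. ?m (x - y) *\<^sub>R u y - ?m (x - z - y) *\<^sub>R u y \<partial>lborel)"
      unfolding mollify_def by (rule Bochner_Integration.integral_diff[symmetric]) (rule mollify_integrable[OF d us])+
    also have "\<dots> = (\<integral>y. (?m (x - y) - ?m (x - y - z)) * u y \<partial>lborel)"
      by (intro Bochner_Integration.integral_cong refl) (simp add: algebra_simps)
    finally show "(((mollify d u x - mollify d u (x - z)) * k z) *\<^sub>R z) \<bullet> a = (\<integral>y. ?F y z \<partial>lborel)"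
      by (simp only: inner_scaleR_left integral_mult_left_zero)
  qed
  also have "\<dots> = (\<integral>y. (\<integral>z. ?F y z \<partial>lborel) \<partial>lborel)"
    by (rule lborel_pair.Fubini_integral[OF i])
  also have "\<dots> = (\<integral>y. - (u y * (nlgrad (\<lambda>y. ?m (x - y)) y \<bullet> a)) \<partial>lborel)"
  proof (rule Bochner_Integration.integral_cong[OF refl])
    fix y
    have 1: "nlgrad (\<lambda>y. ?m (x - y)) y \<bullet> a = (\<integral>z. (((?m (x - y) - ?m (x - (y - z))) * k z) *\<^sub>R z) \<bullet> a \<partial>lborel)"
      unfolding nlgrad_def
    proof (rule integral_inner_left[symmetric], rule nlgrad_integrable(2))
      show "\<bar>?m (x - y) - ?m (x - y')\<bar> \<le> L * norm (y - y')" for y y'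
        using L(2)[of "x - y" "x - y'"] by (simp add: norm_minus_commute)
    qed simp
    have 2: "(\<integral>z. (((?m (x - y) - ?m (x - (y - z))) * k z) *\<^sub>R z) \<bullet> a \<partial>lborel)
        = (\<integral>z. (((?m (x - y) - ?m (x - (y - - z))) * k (- z)) *\<^sub>R (- z)) \<bullet> a \<partial>lborel)"
      by (rule integral_lborel_uminus[symmetric]) measurable
    have "u y * (nlgrad (\<lambda>y. ?m (x - y)) y \<bullet> a) = (\<integral>z. u y * ((((?m (x - y) - ?m (x - (y - - z))) * k (- z)) *\<^sub>R (- z)) \<bullet> a) \<partial>lborel)"
      unfolding 1 2 by (rule integral_mult_right_zero[symmetric])
    also have "\<dots> = (\<integral>z. - ?F y z \<partial>lborel)"
      by (intro Bochner_Integration.integral_cong refl) (simp add: k_minus diff_diff_eq ac_simps)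
    finally show "(\<integral>z. ?F y z \<partial>lborel) = - (u y * (nlgrad (\<lambda>y. ?m (x - y)) y \<bullet> a))" by simp
  qed
  finally show ?thesis by simp
qed

text \<open>Row i of the weak gradient is the nonlocal gradient of component i. Testing with the
  shifted mollifier times the matrix unit at (i, j) isolates entry j of that row, mollified at
  x.\<close>

lemma grad_pair_component:
  fixes u :: "real^'n \<Rightarrow> real^'n"
  assumes u: "sq_integrable lebesgue u" and G: "weak_D_nl \<rho> u G" and r: "AE x in lebesgue. r < norm x \<longrightarrow> u x = 0"
  shows "\<exists>v G'. v \<in> borel_measurable borel \<and> G' \<in> borel_measurable borel \<and>
    (AE x in lebesgue. u x = v x) \<and> (AE x in lebesgue. G x = G' x) \<and>
    (\<forall>i. grad_pair r (\<lambda>x. v x $ i) (\<lambda>x. G' x $ i))"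
proof -
  have um: "u \<in> borel_measurable lebesgue" by (rule sq_integrable_measurable[OF u])
  have Gs: "sq_integrable lebesgue G" using G by (simp add: weak_D_nl_def)
  then have Gm: "G \<in> borel_measurable lebesgue" by (rule sq_integrable_measurable)
  obtain v0 where v0 [measurable]: "v0 \<in> borel_measurable borel" "AE x in lebesgue. u x = v0 x"
    by (rule borel_representative[OF um])
  \<comment> \<open>The support is known almost everywhere only, while \<open>grad_pair\<close> asks
    for it at every point; the cutoff changes \<open>v0\<close> on a null set.\<close>
  define v where "v = (\<lambda>x. indicator (cball 0 r) x *\<^sub>R v0 x)"
  have v [measurable]: "v \<in> borel_measurable borel" unfolding v_def
    by (intro borel_measurable_scaleR borel_measurable_indicator v0) simp
  have uv: "AE x in lebesgue. u x = v x"
    using v0(2) r by eventually_elim (auto simp: v_def indicator_def)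
  obtain G' where G' [measurable]: "G' \<in> borel_measurable borel" and GH: "AE x in lebesgue. G x = G' x"
    by (rule borel_representative[OF Gm])
  have vs: "sq_integrable lborel v" by (rule sq_integrable_borel_representative(1)[OF u uv v])
  have Hs: "sq_integrable lborel G'" by (rule sq_integrable_borel_representative(1)[OF Gs GH G'])
  have "grad_pair r (\<lambda>x. v x $ i) (\<lambda>x. G' x $ i)" for i
    unfolding grad_pair_def
  proof (intro conjI allI impI)
    have vi: "(\<lambda>x. v x $ i) = (\<lambda>x. v x \<bullet> axis i 1)" by (simp add: inner_axis)
    show vis: "sq_integrable lborel (\<lambda>x. v x $ i)"
      unfolding vi by (rule sq_integrable_inner_const(1)[OF vs])
    have [measurable]: "(\<lambda>x. G' x $ i) \<in> borel_measurable borel"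
      by (rule borel_measurable_continuous_on[OF _ G']) (intro continuous_intros)
    have Hle: "(norm (G' x $ i))\<^sup>2 \<le> (norm (G' x))\<^sup>2" for x
      by (intro power_mono Finite_Cartesian_Product.norm_nth_le) simp
    have "integrable lborel (\<lambda>x. (norm (G' x $ i))\<^sup>2)"
      by (rule Bochner_Integration.integrable_bound[of _ "\<lambda>x. (norm (G' x))\<^sup>2"])
        (use Hs Hle in \<open>auto simp: sq_integrable_def\<close>)
    then show His: "sq_integrable lborel (\<lambda>x. G' x $ i)" by (simp add: sq_integrable_def)
    show vsup: "v x $ i = 0" if "r < norm x" for x using that by (simp add: v_def)
    fix d :: real and x :: "real^'n" assume d: "0 < d"
    let ?m = "\<lambda>y. mollifier d (x - y)"
    have tm: "test_function ?m"
      using test_function_mollifier_reflect[OF d, of x "1::real"] by simp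
    have mm [measurable]: "?m \<in> borel_measurable borel" by measurable
    obtain L where L: "0 < L" "\<And>x y. norm (?m x - ?m y) \<le> L * norm (x - y)"
      using test_function_Lipschitz[OF tm] by blast
    have "mollify d (\<lambda>x. G' x $ i) x $ j = nlgrad (mollify d (\<lambda>x. v x $ i)) x $ j" for j
    proof -
      let ?E = "axis i (axis j 1) :: real^'n^'n"
      let ?\<Phi> = "\<lambda>y. ?m y *\<^sub>R ?E"
      have t: "test_function ?\<Phi>" by (rule test_function_mollifier_reflect[OF d])
      have \<Phi>m: "?\<Phi> \<in> borel_measurable borel" by measurable
      have Ev: "?E *v z = (z $ j) *\<^sub>R axis i 1" for z
        by (simp add: vec_eq_iff matrix_vector_mult_def axis_def if_distrib[of "\<lambda>a. a $ _"] if_distrib[of "\<lambda>a. a * _"] cong: if_cong)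
      have div: "div_nl \<rho> ?\<Phi> y = (nlgrad ?m y $ j) *\<^sub>R axis i 1" for y
      proof -
        have "div_nl \<rho> ?\<Phi> y = (\<integral>z. k z *\<^sub>R ((?\<Phi> y - ?\<Phi> (y - z)) *v z) \<partial>lborel)" by (rule div_nl_eq[OF \<Phi>m])
        also have "\<dots> = (\<integral>z. ((((?m y - ?m (y - z)) * k z) *\<^sub>R z) \<bullet> axis j 1) *\<^sub>R axis i 1 \<partial>lborel)"
          by (intro Bochner_Integration.integral_cong refl)
            (simp add: scaleR_diff_left[symmetric] scaleR_matrix_vector_assoc[symmetric] Ev inner_axis ac_simps)
        also have "\<dots> = (\<integral>z. (((?m y - ?m (y - z)) * k z) *\<^sub>R z) \<bullet> axis j 1 \<partial>lborel) *\<^sub>R axis i 1"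
          by (intro integral_scaleR_left integrable_inner_left nlgrad_integrable(2)[OF mm]) (use L in auto)
        also have "(\<integral>z. (((?m y - ?m (y - z)) * k z) *\<^sub>R z) \<bullet> axis j 1 \<partial>lborel) = nlgrad ?m y \<bullet> axis j 1"
          unfolding nlgrad_def by (intro integral_inner_left nlgrad_integrable(2)[OF mm]) (use L in auto)
        finally show ?thesis by (simp add: inner_axis)
      qed
      have nm: "(\<lambda>y. (nlgrad ?m y $ j) *\<^sub>R axis i 1 :: real^'n) \<in> borel_measurable borel"
      proof -
        have "(\<lambda>y. (nlgrad ?m y \<bullet> axis j 1) *\<^sub>R axis i 1 :: real^'n) \<in> borel_measurable borel"
          using nlgrad_meas[OF mm] by measurable
        then show ?thesis by (simp add: inner_axis)
      qed
      have "(\<integral>y. G y \<bullet> ?\<Phi> y \<partial>lebesgue) = (\<integral>y. G' y \<bullet> ?\<Phi> y \<partial>lborel)"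
        by (rule integral_lebesgue_inner_cong[OF GH Gm _ _ G' \<Phi>m]) (use measurable_completion[of ?\<Phi> lborel borel] \<Phi>m in auto)
      also have "\<dots> = (\<integral>y. (?m y *\<^sub>R (G' y $ i)) \<bullet> axis j 1 \<partial>lborel)"
        by (intro Bochner_Integration.integral_cong refl) (simp add: inner_axis)
      also have "\<dots> = mollify d (\<lambda>x. G' x $ i) x \<bullet> axis j 1"
        unfolding mollify_def by (rule integral_inner_left) (rule mollify_integrable[OF d His])
      finally have 1: "(\<integral>y. G y \<bullet> ?\<Phi> y \<partial>lebesgue) = mollify d (\<lambda>x. G' x $ i) x $ j" by (simp add: inner_axis)
      have "(\<integral>y. u y \<bullet> div_nl \<rho> ?\<Phi> y \<partial>lebesgue) = (\<integral>y. v y \<bullet> ((nlgrad ?m y $ j) *\<^sub>R axis i 1) \<partial>lborel)"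
        unfolding div
        by (rule integral_lebesgue_inner_cong[OF uv um _ _ v nm])
          (use measurable_completion[of _ lborel borel] nm in auto)
      also have "\<dots> = (\<integral>y. v y $ i * (nlgrad ?m y \<bullet> axis j 1) \<partial>lborel)"
        by (intro Bochner_Integration.integral_cong refl) (simp add: inner_axis)
      also have "\<dots> = - (nlgrad (mollify d (\<lambda>x. v x $ i)) x \<bullet> axis j 1)"
        using nlgrad_mollify_adjoint[OF d vis vsup, where x=x and a="axis j 1"] by simp
      finally have 2: "(\<integral>y. u y \<bullet> div_nl \<rho> ?\<Phi> y \<partial>lebesgue) = - (nlgrad (mollify d (\<lambda>x. v x $ i)) x \<bullet> axis j 1)" .
      have "(\<integral>y. G y \<bullet> ?\<Phi> y \<partial>lebesgue) = - (\<integral>y. u y \<bullet> div_nl \<rho> ?\<Phi> y \<partial>lebesgue)"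
        using G t unfolding weak_D_nl_def by blast
      then show ?thesis unfolding 1 2 by (simp add: inner_axis)
    qed
    then show "mollify d (\<lambda>x. G' x $ i) x = nlgrad (mollify d (\<lambda>x. v x $ i)) x" by (simp add: vec_eq_iff)
  qed
  then have "\<forall>i. grad_pair r (\<lambda>x. v x $ i) (\<lambda>x. G' x $ i)" by blast
  with v G' uv GH show ?thesis by (intro exI[of _ v] exI[of _ G'] conjI)
qed

end


section \<open>Korn's inequality and coercivity\<close>

definition sym_part :: "real^'n^'n \<Rightarrow> real^'n^'n" where
  "sym_part M = (1/2) *\<^sub>R (M + transpose M)"

lemma D_nl_sym_eq: "D_nl_sym \<rho> u = (\<lambda>x. sym_part (D_nl \<rho> u x))"
  by (simp add: fun_eq_iff D_nl_sym_def sym_part_def)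

lemma linear_sym_part: "linear sym_part"
  by (rule linearI) (simp_all add: sym_part_def vec_eq_iff transpose_def algebra_simps)

lemma sym_part_sym: "sym_part M \<in> sym_mats"
  by (simp add: sym_part_def sym_mats_def vec_eq_iff transpose_def)

lemma sym_part_eq: "M \<in> sym_mats \<Longrightarrow> sym_part M = M"
  by (simp add: sym_part_def sym_mats_def)

lemma inner_matrix: "(A::real^'n^'m) \<bullet> B = (\<Sum>i\<in>UNIV. \<Sum>j\<in>UNIV. A $ i $ j * B $ i $ j)"
  by (simp add: inner_vec_def)

lemma inner_transpose: "transpose A \<bullet> transpose B = (A::real^'n^'n) \<bullet> B"
  unfolding inner_matrix by (simp add: transpose_def) (rule sum.swap)

text \<open>Reduces Korn's inequality to the sign of the integral of A : transpose A.\<close>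

lemma norm_sym_part_square:
  "(norm (sym_part A))\<^sup>2 = 1/2 * (norm A)\<^sup>2 + 1/2 * (A \<bullet> transpose (A::real^'n^'n))"
proof -
  have "(norm (sym_part A))\<^sup>2 = 1/4 * (A \<bullet> A + transpose A \<bullet> transpose A + 2 * (A \<bullet> transpose A))"
    unfolding power2_norm_eq_inner sym_part_def
    by (simp add: inner_add_left inner_add_right inner_commute)
  then show ?thesis by (simp add: inner_transpose power2_norm_eq_inner)
qed

lemma norm_sym_part_le: "norm (sym_part A) \<le> norm (A::real^'n^'n)"
proof (rule power2_le_imp_le)
  have "norm (transpose A) = norm A"
    by (simp add: norm_eq_sqrt_inner inner_transpose)
  then have "A \<bullet> transpose A \<le> (norm A)\<^sup>2"
    using norm_cauchy_schwarz[of A "transpose A"] by (simp add: power2_eq_square)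
  then show "(norm (sym_part A))\<^sup>2 \<le> (norm A)\<^sup>2" unfolding norm_sym_part_square by simp
qed simp

lemma linear_borel_measurable:
  fixes T :: "'b::euclidean_space \<Rightarrow> 'c::euclidean_space"
  assumes "linear T" "u \<in> borel_measurable M"
  shows "(\<lambda>x. T (u x)) \<in> borel_measurable M"
proof -
  have "continuous_on UNIV T" using assms(1) by (simp add: linear_continuous_on linear_conv_bounded_linear)
  then show ?thesis using assms(2) by (rule borel_measurable_continuous_on)
qed

lemma sq_integrable_linear:
  fixes T :: "'b::euclidean_space \<Rightarrow> 'c::euclidean_space"
  assumes T: "linear T" and K: "\<And>x. norm (T x) \<le> K * norm x" "0 \<le> K" and u: "sq_integrable M u"
  shows "sq_integrable M (\<lambda>x. T (u x))" "l2 M (\<lambda>x. T (u x)) \<le> K * l2 M u"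
proof -
  have m: "(\<lambda>x. T (u x)) \<in> borel_measurable M" by (rule linear_borel_measurable[OF T]) (use u in auto)
  have i: "integrable M (\<lambda>x. K\<^sup>2 * (norm (u x))\<^sup>2)" using u by (auto simp: sq_integrable_def)
  have b: "(norm (T (u x)))\<^sup>2 \<le> K\<^sup>2 * (norm (u x))\<^sup>2" for x
    using power_mono[OF K(1)[of "u x"], of 2] by (simp add: power_mult_distrib)
  have j: "integrable M (\<lambda>x. (norm (T (u x)))\<^sup>2)"
    by (rule Bochner_Integration.integrable_bound[OF i]) (use b m in auto)
  then show "sq_integrable M (\<lambda>x. T (u x))" using m by (simp add: sq_integrable_def)
  have "(l2 M (\<lambda>x. T (u x)))\<^sup>2 \<le> (\<integral>x. K\<^sup>2 * (norm (u x))\<^sup>2 \<partial>M)"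
    unfolding l2_square by (rule integral_mono[OF j i b])
  also have "\<dots> = (K * l2 M u)\<^sup>2" by (simp add: power_mult_distrib l2_square)
  finally show "l2 M (\<lambda>x. T (u x)) \<le> K * l2 M u" by (rule power2_le_imp_le) (use K in simp)
qed

lemma l2_square_components:
  fixes u :: "'a \<Rightarrow> 'b::euclidean_space ^ 'n"
  assumes "\<And>i. sq_integrable M (\<lambda>x. u x $ i)"
  shows "(l2 M u)\<^sup>2 = (\<Sum>i\<in>UNIV. (l2 M (\<lambda>x. u x $ i))\<^sup>2)"
proof -
  have "(norm (u x))\<^sup>2 = (\<Sum>i\<in>UNIV. (norm (u x $ i))\<^sup>2)" for x
    by (simp add: power2_norm_eq_inner inner_vec_def)
  then show ?thesis unfolding l2_square
    using assms by (simp add: Bochner_Integration.integral_sum sq_integrable_def)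
qed

context vector_kernel
begin

text \<open>
  Korn's inequality holds because \<open>G : transpose G\<close> integrates to the square norm of the trace of \<open>G\<close>, by
  \<open>grad_pair_components_commute\<close>.
\<close>

lemma weak_D_nl_coercive:
  obtains K where "0 < K"
    "\<And>u G. sq_integrable lebesgue u \<Longrightarrow> weak_D_nl \<rho> u G \<Longrightarrow> AE x in lebesgue. r < norm x \<longrightarrow> u x = 0 \<Longrightarrow>
      l2 lebesgue u \<le> K * l2 lebesgue (\<lambda>x. sym_part (G x)) \<and> l2 lebesgue G \<le> K * l2 lebesgue (\<lambda>x. sym_part (G x))"
proof -
  obtain K where K: "0 < K" "\<And>u g. grad_pair r u g \<Longrightarrow> l2 lborel u \<le> K * l2 lborel g"
    using Poincare[of r] by blast
  \<comment> \<open>One constant for both estimates: Korn gives 2 for the gradient, and Poincare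
    multiplies it by K for the function.\<close>
  have main: "l2 lebesgue u \<le> (2 * K + 2) * l2 lebesgue (\<lambda>x. sym_part (G x)) \<and>
      l2 lebesgue G \<le> (2 * K + 2) * l2 lebesgue (\<lambda>x. sym_part (G x))"
    if u: "sq_integrable lebesgue u" and G: "weak_D_nl \<rho> u G" and r: "AE x in lebesgue. r < norm x \<longrightarrow> u x = 0" for u G
  proof -
    obtain v G' where rep: "v \<in> borel_measurable borel \<and> G' \<in> borel_measurable borel \<and>
      (AE x in lebesgue. u x = v x) \<and> (AE x in lebesgue. G x = G' x) \<and>
      (\<forall>i. grad_pair r (\<lambda>x. v x $ i) (\<lambda>x. G' x $ i))"
      using grad_pair_component[OF u G r] by (elim exE)
    note v = conjunct1[OF rep] and G' = conjunct1[OF conjunct2[OF rep]]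
      and uv = conjunct1[OF conjunct2[OF conjunct2[OF rep]]]
      and GG = conjunct1[OF conjunct2[OF conjunct2[OF conjunct2[OF rep]]]]
      and gp = spec[OF conjunct2[OF conjunct2[OF conjunct2[OF conjunct2[OF rep]]]]]
    have Gs: "sq_integrable lebesgue G" using G by (simp add: weak_D_nl_def)
    note us = sq_integrable_borel_representative[OF u uv v] and Gs' = sq_integrable_borel_representative[OF Gs GG G']
    have gi: "sq_integrable lborel (\<lambda>x. G' x $ i)" and vi: "sq_integrable lborel (\<lambda>x. v x $ i)" for i
      using gp[of i] by (simp_all add: grad_pair_def)
    have Sm: "(\<lambda>x. sym_part (G' x)) \<in> borel_measurable borel"
      by (rule linear_borel_measurable[OF linear_sym_part G'])
    have Ss: "sq_integrable lebesgue (\<lambda>x. sym_part (G x))"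
      by (rule sq_integrable_linear(1)[OF linear_sym_part _ _ Gs, of 1]) (use norm_sym_part_le in auto)
    have SS: "AE x in lebesgue. sym_part (G x) = sym_part (G' x)" using GG by eventually_elim simp
    note Sl = sq_integrable_borel_representative(2)[OF Ss SS Sm] and Ssq = sq_integrable_borel_representative(1)[OF Ss SS Sm]
    have "(l2 lborel v)\<^sup>2 \<le> K\<^sup>2 * (l2 lborel G')\<^sup>2"
    proof -
      have "(l2 lborel v)\<^sup>2 = (\<Sum>i\<in>UNIV. (l2 lborel (\<lambda>x. v x $ i))\<^sup>2)" by (rule l2_square_components[OF vi])
      also have "\<dots> \<le> (\<Sum>i\<in>UNIV. (K * l2 lborel (\<lambda>x. G' x $ i))\<^sup>2)"
        by (intro sum_mono power_mono K(2) gp) simp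
      also have "\<dots> = K\<^sup>2 * (l2 lborel G')\<^sup>2"
        by (simp add: power_mult_distrib sum_distrib_left l2_square_components[OF gi])
      finally show ?thesis .
    qed
    then have "(l2 lborel v)\<^sup>2 \<le> (K * l2 lborel G')\<^sup>2" by (simp add: power_mult_distrib)
    then have 1: "l2 lborel v \<le> K * l2 lborel G'"
      by (rule power2_le_imp_le) (use K(1) in simp)
    have ent: "sq_integrable lborel (\<lambda>x. G' x $ i $ j)" for i j
      using sq_integrable_inner_const(1)[OF gi[of i], of "axis j 1"] by (simp add: inner_axis)
    have pr: "integrable lborel (\<lambda>x. G' x $ i $ j * G' x $ k $ l)" for i j k l
      using sq_integrable_inner[OF ent[of i j] ent[of k l]] by simp
    have "(\<integral>x. G' x \<bullet> transpose (G' x) \<partial>lborel) = (\<Sum>i\<in>UNIV. \<Sum>j\<in>UNIV. \<integral>x. G' x $ i $ j * G' x $ j $ i \<partial>lborel)"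
      by (simp add: inner_matrix transpose_def pr)
    also have "\<dots> = (\<Sum>i\<in>UNIV. \<Sum>j\<in>UNIV. \<integral>x. G' x $ i $ i * G' x $ j $ j \<partial>lborel)"
    proof (intro sum.cong refl)
      \<comment> \<open>The directions j and i are exchanged between rows i and j, which leaves
        diagonal entries only.\<close>
      fix i j
      show "(\<integral>x. G' x $ i $ j * G' x $ j $ i \<partial>lborel) = (\<integral>x. G' x $ i $ i * G' x $ j $ j \<partial>lborel)"
        using grad_pair_components_commute[OF gp[of i] gp[of j], of "axis j 1" "axis i 1"] by (simp add: inner_axis)
    qed
    also have "\<dots> = (\<integral>x. (\<Sum>i\<in>UNIV. G' x $ i $ i)\<^sup>2 \<partial>lborel)"
      by (simp add: power2_eq_square sum_product pr)
    also have "\<dots> \<ge> 0" by simp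
    finally have tr: "0 \<le> (\<integral>x. G' x \<bullet> transpose (G' x) \<partial>lborel)" .
    have "integrable lborel (\<lambda>x. G' x \<bullet> transpose (G' x))"
      by (simp add: inner_matrix transpose_def pr)
    moreover have "integrable lborel (\<lambda>x. (norm (G' x))\<^sup>2)" using Gs'(1) by (simp add: sq_integrable_def)
    ultimately have "(l2 lborel (\<lambda>x. sym_part (G' x)))\<^sup>2 = 1/2 * (l2 lborel G')\<^sup>2 + 1/2 * (\<integral>x. G' x \<bullet> transpose (G' x) \<partial>lborel)"
      unfolding l2_square norm_sym_part_square by simp
    \<comment> \<open>The identity gives the factor 2 between the squares; the larger 4 spares a
      root in the constant.\<close>
    with tr have "(l2 lborel G')\<^sup>2 \<le> (2 * l2 lborel (\<lambda>x. sym_part (G' x)))\<^sup>2"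
      using zero_le_power2[of "l2 lborel (\<lambda>x. sym_part (G' x))"] by (simp add: power_mult_distrib)
    then have 2: "l2 lborel G' \<le> 2 * l2 lborel (\<lambda>x. sym_part (G' x))" by (rule power2_le_imp_le) simp
    have "K * l2 lborel G' \<le> K * (2 * l2 lborel (\<lambda>x. sym_part (G' x)))" using 2 K(1) by simp
    moreover have "0 \<le> K * l2 lborel (\<lambda>x. sym_part (G' x))" using K(1) by simp
    ultimately have "l2 lborel v \<le> (2 * K + 2) * l2 lborel (\<lambda>x. sym_part (G' x)) \<and>
        l2 lborel G' \<le> (2 * K + 2) * l2 lborel (\<lambda>x. sym_part (G' x))"
      using 1 2 l2_nonneg[of lborel "\<lambda>x. sym_part (G' x)"] unfolding distrib_right by linarith
    then show ?thesis by (simp only: us(2) Gs'(2) Sl)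
  qed
  show thesis by (rule that[of "2 * K + 2"]) (use K(1) main in auto)
qed

end

section \<open>Minimisation of a quadratic functional\<close>

lemma quadratic_nonneg_imp:
  fixes a b c :: real
  assumes "\<And>t. 0 \<le> a + 2 * t * b + t\<^sup>2 * c" "0 \<le> c"
  shows "b\<^sup>2 \<le> a * c"
proof (cases "c = 0")
  case True
  have "b = 0"
  proof (rule ccontr)
    assume b: "b \<noteq> 0"
    \<comment> \<open>With c = 0 the polynomial is affine in t, and this t gives it the value
      -1.\<close>
    have "0 \<le> a + 2 * (- (a + 1) / (2 * b)) * b" using assms(1)[of "- (a + 1) / (2 * b)"] True by simp
    also have "\<dots> = - 1" using b by (simp add: field_simps)
    finally show False by simp
  qed
  with True show ?thesis by simp
next
  case False
  then have c: "0 < c" using assms(2) by simp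
  have "0 \<le> (a + 2 * (- b / c) * b + (- b / c)\<^sup>2 * c) * c" using assms(1)[of "- b / c"] c by (intro mult_nonneg_nonneg) auto
  also have "\<dots> = a * c - b\<^sup>2" using c by (simp add: field_simps power2_eq_square)
  finally show ?thesis by simp
qed

text \<open>The form is assumed semidefinite, since functions equal almost everywhere are not
  identified, and convergence is measured by \<open>B\<close> itself. Differences are written as u +
  (-1) v so that one linearity axiom serves all combinations.\<close>

locale complete_form =
  fixes V :: "('x \<Rightarrow> 'y::real_vector) set" and B :: "('x \<Rightarrow> 'y) \<Rightarrow> ('x \<Rightarrow> 'y) \<Rightarrow> real" and L :: "('x \<Rightarrow> 'y) \<Rightarrow> real" and K :: real
  assumes V_zero: "(\<lambda>x. 0) \<in> V"
    and V_linear: "u \<in> V \<Longrightarrow> v \<in> V \<Longrightarrow> (\<lambda>x. u x + a *\<^sub>R v x) \<in> V"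
    and B_sym: "u \<in> V \<Longrightarrow> v \<in> V \<Longrightarrow> B u v = B v u"
    and B_linear: "u \<in> V \<Longrightarrow> v \<in> V \<Longrightarrow> w \<in> V \<Longrightarrow> B (\<lambda>x. u x + a *\<^sub>R v x) w = B u w + a * B v w"
    and B_nonneg: "u \<in> V \<Longrightarrow> 0 \<le> B u u"
    and L_linear: "u \<in> V \<Longrightarrow> v \<in> V \<Longrightarrow> L (\<lambda>x. u x + a *\<^sub>R v x) = L u + a * L v"
    and L_bounded: "u \<in> V \<Longrightarrow> \<bar>L u\<bar> \<le> K * sqrt (B u u)"
    and complete: "(\<And>n. U n \<in> V) \<Longrightarrow>
      (\<And>e. 0 < e \<Longrightarrow> \<exists>N. \<forall>m\<ge>N. \<forall>n\<ge>N. B (\<lambda>x. U m x + (-1) *\<^sub>R U n x) (\<lambda>x. U m x + (-1) *\<^sub>R U n x) < e) \<Longrightarrow>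
      \<exists>v\<in>V. (\<lambda>n. B (\<lambda>x. U n x + (-1) *\<^sub>R v x) (\<lambda>x. U n x + (-1) *\<^sub>R v x)) \<longlonglongrightarrow> 0"
begin

definition J :: "('x \<Rightarrow> 'y) \<Rightarrow> real" where "J u = 1/2 * B u u - L u"

lemma B_add_square:
  assumes "u \<in> V" "v \<in> V"
  shows "B (\<lambda>x. u x + a *\<^sub>R v x) (\<lambda>x. u x + a *\<^sub>R v x) = B u u + 2 * a * B u v + a\<^sup>2 * B v v"
proof -
  note w = V_linear[OF assms, of a]
  have "B (\<lambda>x. u x + a *\<^sub>R v x) (\<lambda>x. u x + a *\<^sub>R v x) = B u (\<lambda>x. u x + a *\<^sub>R v x) + a * B v (\<lambda>x. u x + a *\<^sub>R v x)"
    by (rule B_linear[OF assms w])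
  also have "B u (\<lambda>x. u x + a *\<^sub>R v x) = B u u + a * B v u"
    using B_sym[OF assms(1) w] B_linear[OF assms assms(1)] by simp
  also have "B v (\<lambda>x. u x + a *\<^sub>R v x) = B u v + a * B v v"
    using B_sym[OF assms(2) w] B_linear[OF assms assms(2)] by simp
  finally show ?thesis using B_sym[OF assms] by (simp add: algebra_simps power2_eq_square)
qed

lemma J_add: "u \<in> V \<Longrightarrow> v \<in> V \<Longrightarrow> J (\<lambda>x. u x + a *\<^sub>R v x) = J u + a * (B u v - L v) + a\<^sup>2 / 2 * B v v"
  by (simp add: J_def B_add_square L_linear algebra_simps)

lemma B_Cauchy_Schwarz: "u \<in> V \<Longrightarrow> v \<in> V \<Longrightarrow> \<bar>B u v\<bar> \<le> sqrt (B u u) * sqrt (B v v)"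
proof -
  assume uv: "u \<in> V" "v \<in> V"
  have "(B u v)\<^sup>2 \<le> B u u * B v v"
  proof (rule quadratic_nonneg_imp)
    show "0 \<le> B u u + 2 * t * B u v + t\<^sup>2 * B v v" for t
      using B_nonneg[OF V_linear[OF uv, of t]] B_add_square[OF uv, of t] by simp
  qed (rule B_nonneg[OF uv(2)])
  then have "sqrt ((B u v)\<^sup>2) \<le> sqrt (B u u * B v v)" by (rule real_sqrt_le_mono)
  then show ?thesis by (simp add: real_sqrt_mult)
qed

theorem solution_exists: "\<exists>v\<in>V. \<forall>w\<in>V. B v w = L w"
proof -
  \<comment> \<open>Young's inequality: half of B u u absorbs the linear term, up to K^2 /
    2.\<close>
  have low: "- (K\<^sup>2 / 2) \<le> J u" if "u \<in> V" for u
  proof -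
    have "L u \<le> K * sqrt (B u u)" using L_bounded[OF that] by simp
    also have "\<dots> \<le> K\<^sup>2 / 2 + B u u / 2"
      using sum_squares_bound[of K "sqrt (B u u)"] B_nonneg[OF that] by simp
    finally show ?thesis by (simp add: J_def)
  qed
  define I where "I = Inf (J ` V)"
  have ne: "J ` V \<noteq> {}" using V_zero by blast
  have bdd: "bdd_below (J ` V)" using low by (intro bdd_belowI[of _ "- (K\<^sup>2 / 2)"]) auto
  have I: "I \<le> J u" if "u \<in> V" for u unfolding I_def using bdd that by (intro cInf_lower) auto
  have "\<exists>u\<in>V. J u < I + inverse (real (Suc n))" for n
    using cInf_lessD[OF ne, of "I + inverse (real (Suc n))"] by (auto simp: I_def)
  then obtain U where UV: "\<And>n. U n \<in> V" and UJ: "\<And>n. J (U n) < I + inverse (real (Suc n))" by metis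
  \<comment> \<open>With \<open>?D\<close> the difference of \<open>U m\<close> and
    \<open>U n\<close>, both their midpoint and \<open>U n\<close> lie on the line through
    \<open>U m\<close> in the direction \<open>?D\<close>. Eliminating the linear term from the two
    expansions of \<open>J\<close> leaves B ?D ?D / 8 <= (J (U m) + J (U n)) / 2 - I, and both
    energies are close to \<open>I\<close>.\<close>
  have par: "B (\<lambda>x. U m x + (-1) *\<^sub>R U n x) (\<lambda>x. U m x + (-1) *\<^sub>R U n x) \<le> 4 * (inverse (real (Suc m)) + inverse (real (Suc n)))" for m n
  proof -
    let ?D = "\<lambda>x. U m x + (-1) *\<^sub>R U n x"
    have D: "?D \<in> V" by (rule V_linear[OF UV UV])
    have "I \<le> J (\<lambda>x. U m x + (-1/2) *\<^sub>R ?D x)" by (rule I[OF V_linear[OF UV D]])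
    also have "\<dots> = J (U m) - 1/2 * (B (U m) ?D - L ?D) + 1/8 * B ?D ?D"
      by (subst J_add[OF UV D]) (simp add: power2_eq_square)
    finally have 1: "I \<le> J (U m) - 1/2 * (B (U m) ?D - L ?D) + 1/8 * B ?D ?D" .
    have "J (\<lambda>x. U m x + (-1) *\<^sub>R ?D x) = J (U m) - (B (U m) ?D - L ?D) + 1/2 * B ?D ?D"
      by (subst J_add[OF UV D]) simp
    moreover have "(\<lambda>x. U m x + (-1) *\<^sub>R ?D x) = U n" by (simp add: fun_eq_iff)
    ultimately have 2: "J (U n) = J (U m) - (B (U m) ?D - L ?D) + 1/2 * B ?D ?D" by simp
    have "b \<le> 4 * (i + j)" if "I \<le> a - 1/2 * p + 1/8 * b" "a < I + i" "a' < I + j" "a' = a - p + 1/2 * b"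
      for a a' b p i j :: real using that by argo
    from this[OF 1 UJ UJ 2] show ?thesis .
  qed
  have inv: "\<exists>N. \<forall>n\<ge>N. inverse (real (Suc n)) < e" if "0 < e" for e :: real
    using LIMSEQ_inverse_real_of_nat that by (auto dest!: order_tendstoD(2)[of _ 0] simp: eventually_sequentially)
  have "\<exists>N. \<forall>m\<ge>N. \<forall>n\<ge>N. B (\<lambda>x. U m x + (-1) *\<^sub>R U n x) (\<lambda>x. U m x + (-1) *\<^sub>R U n x) < e" if e: "0 < e" for e
  proof -
    obtain N where N: "\<forall>n\<ge>N. inverse (real (Suc n)) < e / 8" using inv[of "e/8"] e by auto
    have half: "i < e / 8 \<Longrightarrow> j < e / 8 \<Longrightarrow> 4 * (i + j) < e" for i j :: real using e by argo
    have "B (\<lambda>x. U m x + (-1) *\<^sub>R U n x) (\<lambda>x. U m x + (-1) *\<^sub>R U n x) < e" if "m \<ge> N" "n \<ge> N" for m n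
    proof (rule le_less_trans[OF par])
      show "4 * (inverse (real (Suc m)) + inverse (real (Suc n))) < e"
        using that N half by blast
    qed
    then show ?thesis by blast
  qed
  from complete[OF UV this] obtain v where v: "v \<in> V"
    and vl: "(\<lambda>n. B (\<lambda>x. U n x + (-1) *\<^sub>R v x) (\<lambda>x. U n x + (-1) *\<^sub>R v x)) \<longlonglongrightarrow> 0"
    by blast
  have "B v w = L w" if w: "w \<in> V" for w
  proof -
    have BU: "(\<lambda>n. B (U n) w) \<longlonglongrightarrow> B v w"
    proof (rule LIM_zero_cancel, rule Lim_null_comparison)
      let ?D = "\<lambda>n x. U n x + (-1) *\<^sub>R v x"
      show "\<forall>\<^sub>F n in sequentially. norm (B (U n) w - B v w) \<le> sqrt (B (?D n) (?D n)) * sqrt (B w w)"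
      proof (intro always_eventually allI)
        fix n
        have "B (?D n) w = B (U n) w - B v w" using B_linear[OF UV v w, of n "-1"] by simp
        then show "norm (B (U n) w - B v w) \<le> sqrt (B (?D n) (?D n)) * sqrt (B w w)"
          using B_Cauchy_Schwarz[OF V_linear[OF UV v, of n "-1"] w] by simp
      qed
      show "(\<lambda>n. sqrt (B (?D n) (?D n)) * sqrt (B w w)) \<longlonglongrightarrow> 0"
        by (rule tendsto_mult_left_zero) (use tendsto_real_sqrt[OF vl] in simp)
    qed
    \<comment> \<open>\<open>U n\<close> is minimal up to 1/(n+1), so its variation along t w is at
      least -1/(n+1). In the limit this is a nonnegative quadratic polynomial in t without constant
      term, whose linear coefficient must vanish.\<close>
    have nn: "0 \<le> 0 + 2 * t * (B v w - L w) + t\<^sup>2 * B w w" for t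
    proof -
      have "(\<lambda>n. inverse (real (Suc n)) + (t * (B (U n) w - L w) + t\<^sup>2 / 2 * B w w))
          \<longlonglongrightarrow> 0 + (t * (B v w - L w) + t\<^sup>2 / 2 * B w w)"
        by (intro tendsto_intros LIMSEQ_inverse_real_of_nat BU)
      moreover have "0 \<le> inverse (real (Suc n)) + (t * (B (U n) w - L w) + t\<^sup>2 / 2 * B w w)" for n
        using I[OF V_linear[OF UV w, of n t]] UJ[of n] J_add[OF UV w, of n t] by linarith
      ultimately have "0 \<le> 0 + (t * (B v w - L w) + t\<^sup>2 / 2 * B w w)"
        by (intro LIMSEQ_le_const) auto
      then show ?thesis by simp
    qed
    have "(B v w - L w)\<^sup>2 \<le> 0 * B w w" by (rule quadratic_nonneg_imp[OF nn B_nonneg[OF w]])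
    then show ?thesis by simp
  qed
  with v show ?thesis by blast
qed

end


section \<open>The elasticity form\<close>

text \<open>\<open>C\<close> is meaningful on symmetric matrices only; composed with
  \<open>sym_part\<close> it becomes a linear, hence continuous map on all matrices. The lower bound
  is the minimum of the quadratic form on the compact set of symmetric matrices of norm 1, extended
  by homogeneity.\<close>

lemma elasticity_tensor_bounds:
  fixes C :: "real^'n^'n \<Rightarrow> real^'n^'n"
  assumes C: "elasticity_tensor C"
  shows "linear (\<lambda>M. C (sym_part M))"
    and "\<exists>b>0. \<forall>M\<in>sym_mats. norm (C M) \<le> b * norm M"
    and "\<exists>a>0. \<forall>M\<in>sym_mats. a * (norm M)\<^sup>2 \<le> C M \<bullet> M"
proof -
  let ?T = "\<lambda>M. C (sym_part M)"
  have add: "C (M + N) = C M + C N" if "M \<in> sym_mats" "N \<in> sym_mats" for M N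
    using C that unfolding elasticity_tensor_def by blast
  have scale: "C (r *\<^sub>R M) = r *\<^sub>R C M" if "M \<in> sym_mats" for r M
    using C that unfolding elasticity_tensor_def by blast
  have pos: "0 < C M \<bullet> M" if "M \<in> sym_mats" "M \<noteq> 0" for M
    using C that unfolding elasticity_tensor_def by blast
  show lin: "linear ?T"
    by (rule linearI) (simp_all add: linear_add[OF linear_sym_part] linear_scale[OF linear_sym_part] add scale sym_part_sym)
  then have bl: "bounded_linear ?T" by (simp add: linear_conv_bounded_linear)
  then obtain b where b: "0 < b" "\<And>M. norm (?T M) \<le> norm M * b"
    using bounded_linear.pos_bounded by blast
  have "norm (C M) \<le> b * norm M" if "M \<in> sym_mats" for M
    using b(2)[of M] sym_part_eq[OF that] by (simp add: mult.commute)
  with b(1) show "\<exists>b>0. \<forall>M\<in>sym_mats. norm (C M) \<le> b * norm M" by blast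
  let ?S = "{M::real^'n^'n. sym_part M = M} \<inter> sphere 0 1"
  have "closed {M::real^'n^'n. sym_part M = M}"
    using linear_sym_part by (intro closed_Collect_eq continuous_on_id linear_continuous_on) (simp_all add: linear_conv_bounded_linear)
  then have cS: "compact ?S" by (rule closed_Int_compact) simp
  have symS: "sym_part M = M \<Longrightarrow> M \<in> sym_mats" for M :: "real^'n^'n" using sym_part_sym[of M] by simp
  show "\<exists>a>0. \<forall>M\<in>sym_mats. a * (norm M)\<^sup>2 \<le> C M \<bullet> M"
  proof (cases "?S = {}")
    \<comment> \<open>In this case the only symmetric matrix is 0 and any constant works; it is
      separated because a minimum needs a nonempty set.\<close>
    case True
    have "M = 0" if "M \<in> sym_mats" for M :: "real^'n^'n"
    proof (rule ccontr)
      assume "M \<noteq> 0"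
      then have "(1 / norm M) *\<^sub>R M \<in> ?S"
        using sym_part_eq[OF that] by (simp add: linear_scale[OF linear_sym_part])
      with True show False by blast
    qed
    moreover have "(0::real^'n^'n) \<in> sym_mats" by (simp add: sym_mats_def transpose_def vec_eq_iff)
    ultimately have "1 * (norm M)\<^sup>2 \<le> C M \<bullet> M" if "M \<in> sym_mats" for M
      using that scale[of 0 0] by force
    then show ?thesis using zero_less_one by blast
  next
    case False
    have "continuous_on ?S (\<lambda>M. ?T M \<bullet> M)"
      by (intro continuous_intros linear_continuous_on bl)
    then obtain N where N: "N \<in> ?S" "\<forall>M\<in>?S. ?T N \<bullet> N \<le> ?T M \<bullet> M"
      using continuous_attains_inf[OF cS False] by blast
    have "N \<noteq> 0" using N(1) by auto
    then have "0 < ?T N \<bullet> N" using pos[of N] N(1) symS[of N] by auto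
    moreover have "?T N \<bullet> N * (norm M)\<^sup>2 \<le> C M \<bullet> M" if M: "M \<in> sym_mats" for M
    proof (cases "M = 0")
      case True
      have "C 0 = 0" using scale[OF M, of 0] by simp
      then show ?thesis using True by simp
    next
      case False
      let ?M = "(1 / norm M) *\<^sub>R M"
      have "?M \<in> ?S" using sym_part_eq[OF M] False by (simp add: linear_scale[OF linear_sym_part])
      then have "?T N \<bullet> N \<le> ?T ?M \<bullet> ?M" using N(2) by blast
      also have "?T ?M = (1 / norm M) *\<^sub>R C M"
        using sym_part_eq[OF M] by (simp add: linear_scale[OF linear_sym_part] scale[OF M])
      finally have "?T N \<bullet> N \<le> (C M \<bullet> M) / (norm M)\<^sup>2" by (simp add: power2_eq_square)
      then show ?thesis using False by (simp add: pos_le_divide_eq)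
    qed
    ultimately show ?thesis by blast
  qed
qed

lemma l2_lebesgue_on_le:
  fixes u :: "'a::euclidean_space \<Rightarrow> 'b::euclidean_space"
  assumes u: "sq_integrable lebesgue u" and \<Omega>: "\<Omega> \<in> sets lebesgue"
  shows "sq_integrable (lebesgue_on \<Omega>) u" "l2 (lebesgue_on \<Omega>) u \<le> l2 lebesgue u"
proof -
  have um: "u \<in> borel_measurable lebesgue" and ui: "integrable lebesgue (\<lambda>x. (norm (u x))\<^sup>2)"
    using u by (auto simp: sq_integrable_def)
  have i: "integrable lebesgue (\<lambda>x. indicator \<Omega> x *\<^sub>R (norm (u x))\<^sup>2)"
    by (rule integrable_mult_indicator[OF \<Omega> ui])
  have "integrable (lebesgue_on \<Omega>) (\<lambda>x. (norm (u x))\<^sup>2)"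
    using i \<Omega> by (subst integrable_restrict_space) (auto simp: sets.Int)
  moreover have "u \<in> borel_measurable (lebesgue_on \<Omega>)"
    by (rule measurable_restrict_space1[OF um])
  ultimately show "sq_integrable (lebesgue_on \<Omega>) u" by (simp add: sq_integrable_def)
  have "(\<integral>x. (norm (u x))\<^sup>2 \<partial>lebesgue_on \<Omega>) = (\<integral>x. indicator \<Omega> x *\<^sub>R (norm (u x))\<^sup>2 \<partial>lebesgue)"
    using \<Omega> by (intro integral_restrict_space) simp
  also have "\<dots> \<le> (\<integral>x. (norm (u x))\<^sup>2 \<partial>lebesgue)"
    by (rule integral_mono[OF i ui]) (simp add: indicator_def)
  finally show "l2 (lebesgue_on \<Omega>) u \<le> l2 lebesgue u" by (simp add: l2_def)
qed

section \<open>The variational problem on \<open>H0_nl\<close>\<close>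

context vector_kernel
begin

context
  fixes \<Omega> :: "(real^'n) set" and T :: "real^'n^'n \<Rightarrow> real^'n^'n" and fs :: "real^'n \<Rightarrow> real^'n"
  assumes \<Omega>: "open \<Omega>" "bounded \<Omega>" and T: "elasticity_tensor T" and fs: "sq_integrable (lebesgue_on \<Omega>) fs"
begin

private abbreviation "V \<equiv> H0_nl \<rho> \<Omega>"

private lemma V_D:
  assumes "u \<in> V"
  shows "sq_integrable lebesgue u" "weak_D_nl \<rho> u (D_nl \<rho> u)" "sq_integrable lebesgue (D_nl \<rho> u)"
    "AE x in lebesgue. x \<notin> \<Omega> \<longrightarrow> u x = 0"
proof -
  show "sq_integrable lebesgue u" "AE x in lebesgue. x \<notin> \<Omega> \<longrightarrow> u x = 0"
    using assms by (simp_all add: H0_nl_def H_nl_def)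
  have "\<exists>G. weak_D_nl \<rho> u G" using assms by (simp add: H0_nl_def H_nl_def)
  then show w: "weak_D_nl \<rho> u (D_nl \<rho> u)" unfolding D_nl_def by (rule someI_ex)
  then show "sq_integrable lebesgue (D_nl \<rho> u)" by (simp add: weak_D_nl_def)
qed

private lemma V_I:
  assumes "sq_integrable lebesgue u" "weak_D_nl \<rho> u G" "AE x in lebesgue. x \<notin> \<Omega> \<longrightarrow> u x = 0"
  shows "u \<in> V"
proof -
  have "\<exists>G. weak_D_nl \<rho> u G" using assms(2) by blast
  then show ?thesis using assms(1,3) by (simp add: H0_nl_def H_nl_def)
qed

text \<open>\<open>D_nl\<close> is chosen anew for each function, so its linearity holds almost
  everywhere only, by uniqueness of weak gradients.\<close>

private lemma V_linear:
  assumes u: "u \<in> V" and v: "v \<in> V"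
  shows "(\<lambda>x. u x + a *\<^sub>R v x) \<in> V"
    "AE x in lebesgue. D_nl \<rho> (\<lambda>x. u x + a *\<^sub>R v x) x = D_nl \<rho> u x + a *\<^sub>R D_nl \<rho> v x"
proof -
  note w = weak_D_nl_linear[OF V_D(1,2)[OF u] V_D(1,2)[OF v], of a]
  show m: "(\<lambda>x. u x + a *\<^sub>R v x) \<in> V"
  proof (rule V_I[OF _ w])
    show "sq_integrable lebesgue (\<lambda>x. u x + a *\<^sub>R v x)"
      by (intro sq_integrable_add sq_integrable_scaleR V_D(1) u v)
    show "AE x in lebesgue. x \<notin> \<Omega> \<longrightarrow> u x + a *\<^sub>R v x = 0"
      using V_D(4)[OF u] V_D(4)[OF v] by eventually_elim simp
  qed
  show "AE x in lebesgue. D_nl \<rho> (\<lambda>x. u x + a *\<^sub>R v x) x = D_nl \<rho> u x + a *\<^sub>R D_nl \<rho> v x"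
    by (rule weak_D_nl_unique[OF V_D(2)[OF m] w])
qed

private lemma V_zero: "(\<lambda>x. 0) \<in> V"
proof (rule V_I[of _ "\<lambda>x. 0"])
  show "weak_D_nl \<rho> (\<lambda>x. 0) (\<lambda>x. 0)" by (simp add: weak_D_nl_def)
qed auto

private definition S where "S = D_nl_sym \<rho>"

private definition B where "B u w' = (\<integral>x. T (S u x) \<bullet> S w' x \<partial>lebesgue)"

private definition L where "L u = (\<integral>x. fs x \<bullet> u x \<partial>lebesgue_on \<Omega>)"

private lemma S_eq: "S u x = sym_part (D_nl \<rho> u x)"
  by (simp add: S_def D_nl_sym_eq)

private lemma S_sym: "S u x \<in> sym_mats"
  by (simp add: S_eq sym_part_sym)

private lemma S_sq:
  assumes "u \<in> V"
  shows "sq_integrable lebesgue (S u)" "l2 lebesgue (S u) \<le> l2 lebesgue (D_nl \<rho> u)"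
  using sq_integrable_linear[OF linear_sym_part _ _ V_D(3)[OF assms], of 1]
  by (simp_all add: S_eq[abs_def] norm_sym_part_le)

private lemma TS_sq:
  assumes "u \<in> V"
  shows "sq_integrable lebesgue (\<lambda>x. T (S u x))"
proof -
  obtain b where b: "0 < b" "\<forall>M\<in>sym_mats. norm (T M) \<le> b * norm M"
    using elasticity_tensor_bounds(2)[OF T] by blast
  have "norm (T (sym_part M)) \<le> b * norm M" for M
  proof -
    have "norm (T (sym_part M)) \<le> b * norm (sym_part M)" using b(2) sym_part_sym by blast
    also have "\<dots> \<le> b * norm M" using b(1) norm_sym_part_le by (intro mult_left_mono) auto
    finally show ?thesis .
  qed
  from sq_integrable_linear(1)[OF elasticity_tensor_bounds(1)[OF T] this _ V_D(3)[OF assms]] b(1)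
  show ?thesis by (simp add: S_eq)
qed

private lemma B_integrable: "u \<in> V \<Longrightarrow> w' \<in> V \<Longrightarrow> integrable lebesgue (\<lambda>x. T (S u x) \<bullet> S w' x)"
  by (intro sq_integrable_inner TS_sq S_sq)

private lemma T_linear: "A \<in> sym_mats \<Longrightarrow> N \<in> sym_mats \<Longrightarrow> T (A + a *\<^sub>R N) = T A + a *\<^sub>R T N"
proof -
  assume MN: "A \<in> sym_mats" "N \<in> sym_mats"
  have "T (A + a *\<^sub>R N) = T (sym_part (A + a *\<^sub>R N))"
    using MN by (simp add: linear_add[OF linear_sym_part] linear_scale[OF linear_sym_part] sym_part_eq)
  also have "\<dots> = T (sym_part A) + a *\<^sub>R T (sym_part N)"
    using linear_add[OF elasticity_tensor_bounds(1)[OF T]] linear_scale[OF elasticity_tensor_bounds(1)[OF T]] by metis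
  finally show ?thesis using MN by (simp add: sym_part_eq)
qed

private lemma S_linear:
  assumes "u \<in> V" "v \<in> V"
  shows "AE x in lebesgue. S (\<lambda>x. u x + a *\<^sub>R v x) x = S u x + a *\<^sub>R S v x"
  using V_linear(2)[OF assms, of a]
  by eventually_elim (simp add: S_eq linear_add[OF linear_sym_part] linear_scale[OF linear_sym_part])

private lemma B_linear:
  assumes u: "u \<in> V" and v: "v \<in> V" and w: "w' \<in> V"
  shows "B (\<lambda>x. u x + a *\<^sub>R v x) w' = B u w' + a * B v w'"
proof -
  have "B (\<lambda>x. u x + a *\<^sub>R v x) w' = (\<integral>x. T (S u x) \<bullet> S w' x + a * (T (S v x) \<bullet> S w' x) \<partial>lebesgue)"
    unfolding B_def
  proof (rule integral_cong_AE)
    show "AE x in lebesgue. T (S (\<lambda>x. u x + a *\<^sub>R v x) x) \<bullet> S w' x = T (S u x) \<bullet> S w' x + a * (T (S v x) \<bullet> S w' x)"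
      using S_linear[OF u v, of a]
      by eventually_elim (simp add: T_linear S_sym inner_add_left)
    show "(\<lambda>x. T (S (\<lambda>x. u x + a *\<^sub>R v x) x) \<bullet> S w' x) \<in> borel_measurable lebesgue"
      by (intro borel_measurable_integrable B_integrable V_linear u v w)
    show "(\<lambda>x. T (S u x) \<bullet> S w' x + a * (T (S v x) \<bullet> S w' x)) \<in> borel_measurable lebesgue"
      by (intro borel_measurable_integrable Bochner_Integration.integrable_add integrable_mult_right B_integrable u v w)
  qed
  also have "\<dots> = B u w' + a * B v w'"
    unfolding B_def using B_integrable[OF u w] B_integrable[OF v w] by simp
  finally show ?thesis .
qed

private lemma B_sym: "B u v = B v u"
  unfolding B_def
proof (intro Bochner_Integration.integral_cong refl)
  fix x
  have "T (S u x) \<bullet> S v x = S u x \<bullet> T (S v x)"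
    using T S_sym unfolding elasticity_tensor_def by blast
  then show "T (S u x) \<bullet> S v x = T (S v x) \<bullet> S u x" by (simp add: inner_commute)
qed

text \<open>Positive definiteness bounds the symmetric part of the gradient by the form; Korn and
  Poincare on a ball that contains \<Omega> give the rest.\<close>

private lemma B_coercive:
  obtains K where "0 < K"
    "\<And>u. u \<in> V \<Longrightarrow> l2 lebesgue u \<le> K * sqrt (B u u) \<and> l2 lebesgue (D_nl \<rho> u) \<le> K * sqrt (B u u) \<and> 0 \<le> B u u"
proof -
  obtain a where a: "0 < a" "\<forall>M\<in>sym_mats. a * (norm M)\<^sup>2 \<le> T M \<bullet> M"
    using elasticity_tensor_bounds(3)[OF T] by blast
  obtain r where r: "\<forall>x\<in>\<Omega>. norm x \<le> r" using \<Omega>(2) bounded_iff by blast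
  obtain K where K: "0 < K" "\<And>u G. sq_integrable lebesgue u \<Longrightarrow> weak_D_nl \<rho> u G \<Longrightarrow> AE x in lebesgue. r < norm x \<longrightarrow> u x = 0 \<Longrightarrow>
      l2 lebesgue u \<le> K * l2 lebesgue (\<lambda>x. sym_part (G x)) \<and> l2 lebesgue G \<le> K * l2 lebesgue (\<lambda>x. sym_part (G x))"
    using weak_D_nl_coercive[of r] by blast
  have "l2 lebesgue u \<le> (K / sqrt a) * sqrt (B u u) \<and> l2 lebesgue (D_nl \<rho> u) \<le> (K / sqrt a) * sqrt (B u u) \<and> 0 \<le> B u u"
    if u: "u \<in> V" for u
  proof -
    have "AE x in lebesgue. r < norm x \<longrightarrow> u x = 0"
      using V_D(4)[OF u] by eventually_elim (use r in force)
    from K(2)[OF V_D(1,2)[OF u] this]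
    have 1: "l2 lebesgue u \<le> K * l2 lebesgue (S u)" "l2 lebesgue (D_nl \<rho> u) \<le> K * l2 lebesgue (S u)"
      by (simp_all add: S_eq[abs_def])
    have "a * (l2 lebesgue (S u))\<^sup>2 = (\<integral>x. a * (norm (S u x))\<^sup>2 \<partial>lebesgue)" by (simp add: l2_square)
    also have "\<dots> \<le> B u u"
      unfolding B_def
    proof (rule integral_mono[OF _ B_integrable[OF u u]])
      show "integrable lebesgue (\<lambda>x. a * (norm (S u x))\<^sup>2)" using S_sq(1)[OF u] by (simp add: sq_integrable_def)
      show "a * (norm (S u x))\<^sup>2 \<le> T (S u x) \<bullet> S u x" for x using a(2) S_sym by blast
    qed
    finally have B: "a * (l2 lebesgue (S u))\<^sup>2 \<le> B u u" .
    have "sqrt (a * (l2 lebesgue (S u))\<^sup>2) \<le> sqrt (B u u)" by (rule real_sqrt_le_mono[OF B])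
    then have "sqrt a * l2 lebesgue (S u) \<le> sqrt (B u u)" by (simp add: real_sqrt_mult)
    then have "l2 lebesgue (S u) \<le> sqrt (B u u) / sqrt a" using a(1) by (simp add: pos_le_divide_eq mult.commute)
    then have "K * l2 lebesgue (S u) \<le> (K / sqrt a) * sqrt (B u u)" using K(1) mult_left_mono[of _ _ K] by fastforce
    moreover have "0 \<le> B u u" using order_trans[OF _ B, of 0] a(1) by simp
    ultimately show ?thesis using 1 by linarith
  qed
  moreover have "0 < K / sqrt a" using K(1) a(1) by simp
  ultimately show thesis using that by blast
qed

private lemma L_linear:
  assumes "u \<in> V" "v \<in> V"
  shows "L (\<lambda>x. u x + a *\<^sub>R v x) = L u + a * L v"
proof -
  have m: "\<Omega> \<in> sets lebesgue" using \<Omega>(1) by (simp add: borel_open)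
  have "integrable (lebesgue_on \<Omega>) (\<lambda>x. fs x \<bullet> w' x)" if "w' \<in> V" for w'
    by (intro sq_integrable_inner fs l2_lebesgue_on_le(1)[OF V_D(1)[OF that] m])
  from this[OF assms(1)] this[OF assms(2)] show ?thesis
    unfolding L_def inner_add_right inner_scaleR_right by simp
qed

private lemma L_bounded: "u \<in> V \<Longrightarrow> \<bar>L u\<bar> \<le> l2 (lebesgue_on \<Omega>) fs * l2 lebesgue u"
proof -
  assume u: "u \<in> V"
  have m: "\<Omega> \<in> sets lebesgue" using \<Omega>(1) by (simp add: borel_open)
  note i = l2_lebesgue_on_le[OF V_D(1)[OF u] m]
  have "\<bar>L u\<bar> \<le> l2 (lebesgue_on \<Omega>) fs * l2 (lebesgue_on \<Omega>) u"
    unfolding L_def by (rule l2_inner[OF fs i(1)])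
  also have "\<dots> \<le> l2 (lebesgue_on \<Omega>) fs * l2 lebesgue u" by (intro mult_left_mono i) simp
  finally show ?thesis .
qed

private lemma D_diff:
  assumes "u \<in> V" "v \<in> V"
  shows "l2 lebesgue (D_nl \<rho> (\<lambda>x. u x + (-1) *\<^sub>R v x)) = l2 lebesgue (\<lambda>x. D_nl \<rho> u x - D_nl \<rho> v x)"
proof (rule l2_cong_AE)
  show "AE x in lebesgue. D_nl \<rho> (\<lambda>x. u x + (-1) *\<^sub>R v x) x = D_nl \<rho> u x - D_nl \<rho> v x"
    using V_linear(2)[OF assms, of "-1"] by eventually_elim simp
  show "D_nl \<rho> (\<lambda>x. u x + (-1) *\<^sub>R v x) \<in> borel_measurable lebesgue"
    by (intro sq_integrable_measurable V_D(3) V_linear assms)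
  show "(\<lambda>x. D_nl \<rho> u x - D_nl \<rho> v x) \<in> borel_measurable lebesgue"
    by (intro sq_integrable_measurable sq_integrable_diff V_D(3) assms)
qed

text \<open>Coercivity makes a \<open>B\<close>-Cauchy sequence Cauchy in mean square together with
  its gradients. The two limits belong together because weak gradients are closed; the upper bound
  of the tensor then turns convergence of the gradients into convergence in
  \<open>B\<close>.\<close>

private lemma V_complete:
  assumes U: "\<And>n. U n \<in> V"
    and C: "\<And>e. 0 < e \<Longrightarrow> \<exists>N. \<forall>m\<ge>N. \<forall>n\<ge>N. B (\<lambda>x. U m x + (-1) *\<^sub>R U n x) (\<lambda>x. U m x + (-1) *\<^sub>R U n x) < e"
  shows "\<exists>v\<in>V. (\<lambda>n. B (\<lambda>x. U n x + (-1) *\<^sub>R v x) (\<lambda>x. U n x + (-1) *\<^sub>R v x)) \<longlonglongrightarrow> 0"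
proof -
  obtain K where K: "0 < K"
    "\<And>u. u \<in> V \<Longrightarrow> l2 lebesgue u \<le> K * sqrt (B u u) \<and> l2 lebesgue (D_nl \<rho> u) \<le> K * sqrt (B u u) \<and> 0 \<le> B u u"
    using B_coercive by blast
  have Cauchy: "\<exists>N. \<forall>m\<ge>N. \<forall>n\<ge>N. l2 lebesgue (\<lambda>x. U m x - U n x) < t \<and> l2 lebesgue (\<lambda>x. D_nl \<rho> (U m) x - D_nl \<rho> (U n) x) < t"
    if t: "0 < t" for t
  proof -
    have "0 < (t / K)\<^sup>2" using t K(1) by simp
    from C[OF this] obtain N where N: "\<forall>m\<ge>N. \<forall>n\<ge>N. B (\<lambda>x. U m x + (-1) *\<^sub>R U n x) (\<lambda>x. U m x + (-1) *\<^sub>R U n x) < (t / K)\<^sup>2"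
      by blast
    have "l2 lebesgue (\<lambda>x. U m x - U n x) < t \<and> l2 lebesgue (\<lambda>x. D_nl \<rho> (U m) x - D_nl \<rho> (U n) x) < t"
      if "m \<ge> N" "n \<ge> N" for m n
    proof -
      let ?d = "\<lambda>x. U m x + (-1) *\<^sub>R U n x"
      have d: "?d \<in> V" by (intro V_linear U)
      have "B ?d ?d < (t / K)\<^sup>2" using N that by blast
      then have "sqrt (B ?d ?d) < t / K" using t K(1) by (intro real_less_lsqrt) auto
      then have "K * sqrt (B ?d ?d) < t" using K(1) by (simp add: pos_less_divide_eq mult.commute)
      moreover have "l2 lebesgue ?d = l2 lebesgue (\<lambda>x. U m x - U n x)" by simp
      ultimately show ?thesis using K(2)[OF d] D_diff[OF U U, of m n] by linarith
    qed
    then show ?thesis by blast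
  qed
  have "\<exists>N. \<forall>m\<ge>N. \<forall>n\<ge>N. l2 lebesgue (\<lambda>x. U m x - U n x) < t" if "0 < t" for t
    using Cauchy[OF that] by blast
  from Riesz_Fischer[where u=U, OF V_D(1)[OF U] this]
  obtain v where v: "sq_integrable lebesgue v" "(\<lambda>n. l2 lebesgue (\<lambda>x. U n x - v x)) \<longlonglongrightarrow> 0"
    by blast
  have "\<exists>N. \<forall>m\<ge>N. \<forall>n\<ge>N. l2 lebesgue (\<lambda>x. D_nl \<rho> (U m) x - D_nl \<rho> (U n) x) < t" if "0 < t" for t
    using Cauchy[OF that] by blast
  from Riesz_Fischer[where u="\<lambda>n. D_nl \<rho> (U n)", OF V_D(3)[OF U] this]
  obtain G where G: "sq_integrable lebesgue G" "(\<lambda>n. l2 lebesgue (\<lambda>x. D_nl \<rho> (U n) x - G x)) \<longlonglongrightarrow> 0"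
    by blast
  have wG: "weak_D_nl \<rho> v G" by (rule weak_D_nl_closed[OF V_D(1)[OF U] V_D(2)[OF U] v G])
  have m: "- \<Omega> \<in> sets lebesgue" using \<Omega>(1) by (simp add: borel_open)
  \<comment> \<open>The part of the limit outside \<Omega>. There \<open>U n\<close> vanishes almost
    everywhere, so the norm of \<open>h\<close> is at most that of the difference of
    \<open>U n\<close> and \<open>v\<close>, for every n.\<close>
  define h where "h = (\<lambda>x. indicator (- \<Omega>) x *\<^sub>R v x)"
  have hm: "h \<in> borel_measurable lebesgue"
    unfolding h_def using v(1) m by (intro borel_measurable_scaleR borel_measurable_indicator) auto
  have hle: "(norm (h x))\<^sup>2 \<le> (norm (v x))\<^sup>2" for x by (simp add: h_def indicator_def)
  have hs: "sq_integrable lebesgue h"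
    unfolding sq_integrable_def
  proof (rule conjI[OF hm], rule Bochner_Integration.integrable_bound)
    show "integrable lebesgue (\<lambda>x. (norm (v x))\<^sup>2)" using v(1) by (simp add: sq_integrable_def)
    show "(\<lambda>x. (norm (h x))\<^sup>2) \<in> borel_measurable lebesgue"
      by (rule borel_measurable_power[OF measurable_compose[OF hm borel_measurable_norm]])
    show "AE x in lebesgue. norm ((norm (h x))\<^sup>2) \<le> norm ((norm (v x))\<^sup>2)" using hle by simp
  qed
  have "l2 lebesgue h \<le> l2 lebesgue (\<lambda>x. U n x - v x)" for n
  proof (rule power2_le_imp_le)
    have "AE x in lebesgue. (norm (h x))\<^sup>2 \<le> (norm (U n x - v x))\<^sup>2"
      using V_D(4)[OF U[of n]] by eventually_elim (auto simp: h_def indicator_def)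
    then show "(l2 lebesgue h)\<^sup>2 \<le> (l2 lebesgue (\<lambda>x. U n x - v x))\<^sup>2"
      unfolding l2_square using hs sq_integrable_diff[OF V_D(1)[OF U[of n]] v(1)]
      by (intro integral_mono_AE) (auto simp: sq_integrable_def)
  qed simp
  then have "l2 lebesgue h \<le> 0" by (intro LIMSEQ_le_const[OF v(2)]) auto
  then have "l2 lebesgue h = 0" using l2_nonneg[of lebesgue h] by linarith
  from l2_eq_0_AE[OF hs this] have "AE x in lebesgue. x \<notin> \<Omega> \<longrightarrow> v x = 0"
    by eventually_elim (auto simp: h_def indicator_def split: if_splits)
  from V_I[OF v(1) wG this] have vV: "v \<in> V" .
  have GD: "AE x in lebesgue. G x = D_nl \<rho> v x" by (rule weak_D_nl_unique[OF wG V_D(2)[OF vV]])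
  obtain b where b: "0 < b" "\<forall>M\<in>sym_mats. norm (T M) \<le> b * norm M"
    using elasticity_tensor_bounds(2)[OF T] by blast
  have le: "B u u \<le> b * (l2 lebesgue (D_nl \<rho> u))\<^sup>2" if u: "u \<in> V" for u
  proof -
    have "B u u \<le> (\<integral>x. b * (norm (S u x))\<^sup>2 \<partial>lebesgue)"
      unfolding B_def
    proof (rule integral_mono[OF B_integrable[OF u u]])
      show "integrable lebesgue (\<lambda>x. b * (norm (S u x))\<^sup>2)" using S_sq(1)[OF u] by (simp add: sq_integrable_def)
      fix x
      have "T (S u x) \<bullet> S u x \<le> norm (T (S u x)) * norm (S u x)" by (rule norm_cauchy_schwarz)
      also have "\<dots> \<le> (b * norm (S u x)) * norm (S u x)" using b(2) S_sym by (intro mult_right_mono) auto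
      finally show "T (S u x) \<bullet> S u x \<le> b * (norm (S u x))\<^sup>2" by (simp add: power2_eq_square)
    qed
    also have "\<dots> = b * (l2 lebesgue (S u))\<^sup>2" by (simp add: l2_square)
    also have "\<dots> \<le> b * (l2 lebesgue (D_nl \<rho> u))\<^sup>2"
      using b(1) S_sq(2)[OF u] by (intro mult_left_mono power_mono) auto
    finally show ?thesis .
  qed
  have "(\<lambda>n. B (\<lambda>x. U n x + (-1) *\<^sub>R v x) (\<lambda>x. U n x + (-1) *\<^sub>R v x)) \<longlonglongrightarrow> 0"
  proof (rule Lim_null_comparison)
    show "\<forall>\<^sub>F n in sequentially. norm (B (\<lambda>x. U n x + (-1) *\<^sub>R v x) (\<lambda>x. U n x + (-1) *\<^sub>R v x))
        \<le> b * (l2 lebesgue (\<lambda>x. D_nl \<rho> (U n) x - G x))\<^sup>2"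
    proof (intro always_eventually allI)
      fix n
      let ?d = "\<lambda>x. U n x + (-1) *\<^sub>R v x"
      have d: "?d \<in> V" by (intro V_linear U vV)
      have "l2 lebesgue (D_nl \<rho> ?d) = l2 lebesgue (\<lambda>x. D_nl \<rho> (U n) x - D_nl \<rho> v x)" by (rule D_diff[OF U vV])
      also have "\<dots> = l2 lebesgue (\<lambda>x. D_nl \<rho> (U n) x - G x)"
      proof (rule l2_cong_AE)
        show "AE x in lebesgue. D_nl \<rho> (U n) x - D_nl \<rho> v x = D_nl \<rho> (U n) x - G x"
          using GD by eventually_elim simp
      qed (intro sq_integrable_measurable sq_integrable_diff V_D(3) U vV G(1))+
      finally show "norm (B ?d ?d) \<le> b * (l2 lebesgue (\<lambda>x. D_nl \<rho> (U n) x - G x))\<^sup>2"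
        using le[OF d] K(2)[OF d] by simp
    qed
    show "(\<lambda>n. b * (l2 lebesgue (\<lambda>x. D_nl \<rho> (U n) x - G x))\<^sup>2) \<longlonglongrightarrow> 0"
      by (rule tendsto_mult_right_zero) (use tendsto_power[OF G(2), of 2] in simp)
  qed
  with vV show ?thesis by blast
qed

text \<open>Expanding the energy at a weak solution v gives J u = J v + B (u - v) (u - v) / 2, from
  which minimality of v and uniqueness of the minimizer up to null sets are both read off.\<close>

theorem weak_solution_exists_unique:
  "\<exists>v. weak_solution \<rho> T \<Omega> fs v \<and>
    (\<forall>v'. weak_solution \<rho> T \<Omega> fs v' \<longrightarrow> (AE x in lebesgue. v' x = v x)) \<and>
    is_arg_min (energy \<rho> T \<Omega> fs) (\<lambda>u. u \<in> H0_nl \<rho> \<Omega>) v \<and>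
    (\<forall>v'. is_arg_min (energy \<rho> T \<Omega> fs) (\<lambda>u. u \<in> H0_nl \<rho> \<Omega>) v' \<longrightarrow> (AE x in lebesgue. v' x = v x))"
proof -
  obtain K where K: "0 < K"
    "\<And>u. u \<in> V \<Longrightarrow> l2 lebesgue u \<le> K * sqrt (B u u) \<and> l2 lebesgue (D_nl \<rho> u) \<le> K * sqrt (B u u) \<and> 0 \<le> B u u"
    using B_coercive by blast
  have Lb: "\<bar>L u\<bar> \<le> (l2 (lebesgue_on \<Omega>) fs * K) * sqrt (B u u)" if "u \<in> V" for u
  proof -
    have "\<bar>L u\<bar> \<le> l2 (lebesgue_on \<Omega>) fs * l2 lebesgue u" by (rule L_bounded[OF that])
    also have "\<dots> \<le> l2 (lebesgue_on \<Omega>) fs * (K * sqrt (B u u))" using K(2)[OF that] by (intro mult_left_mono) auto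
    finally show ?thesis by (simp add: mult.assoc)
  qed
  interpret F: complete_form V B L "l2 (lebesgue_on \<Omega>) fs * K"
  proof
    show "0 \<le> B u u" if "u \<in> V" for u using K(2)[OF that] by blast
    show "B u u' = B u' u" for u u' by (rule B_sym)
  qed (fact V_zero V_linear(1) B_sym B_linear L_linear Lb V_complete)+
  obtain v where v: "v \<in> V" "\<And>w'. w' \<in> V \<Longrightarrow> B v w' = L w'" using F.solution_exists by blast
  have ws: "weak_solution \<rho> T \<Omega> fs u \<longleftrightarrow> u \<in> V \<and> (\<forall>w'\<in>V. B u w' = L w')" for u
    by (simp add: weak_solution_def B_def L_def S_def)
  have en: "energy \<rho> T \<Omega> fs = F.J"
    by (simp add: fun_eq_iff energy_def F.J_def B_def L_def S_def)
  \<comment> \<open>Coercivity turns vanishing of the form on the difference into equality almost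
    everywhere.\<close>
  have zero: "AE x in lebesgue. u x = v x" if u: "u \<in> V" and z: "B (\<lambda>x. u x + (-1) *\<^sub>R v x) (\<lambda>x. u x + (-1) *\<^sub>R v x) = 0" for u
  proof -
    let ?d = "\<lambda>x. u x + (-1) *\<^sub>R v x"
    have d: "?d \<in> V" by (intro V_linear u v)
    have "l2 lebesgue ?d \<le> 0" using K(2)[OF d] unfolding z by simp
    then have "l2 lebesgue ?d = 0" using l2_nonneg order_antisym by blast
    from l2_eq_0_AE[OF V_D(1)[OF d] this] show ?thesis by eventually_elim simp
  qed
  have J: "F.J u = F.J v + 1/2 * B (\<lambda>x. u x + (-1) *\<^sub>R v x) (\<lambda>x. u x + (-1) *\<^sub>R v x)" if u: "u \<in> V" for u
  proof -
    let ?d = "\<lambda>x. u x + (-1) *\<^sub>R v x"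
    have d: "?d \<in> V" by (intro V_linear u v)
    have "F.J (\<lambda>x. v x + 1 *\<^sub>R ?d x) = F.J v + 1 * (B v ?d - L ?d) + 1\<^sup>2 / 2 * B ?d ?d" by (rule F.J_add[OF v(1) d])
    then show ?thesis using v(2)[OF d] by simp
  qed
  have "weak_solution \<rho> T \<Omega> fs v" using v ws by blast
  moreover have "AE x in lebesgue. v' x = v x" if "weak_solution \<rho> T \<Omega> fs v'" for v'
  proof -
    have v': "v' \<in> V" "\<And>w'. w' \<in> V \<Longrightarrow> B v' w' = L w'" using that ws by auto
    let ?d = "\<lambda>x. v' x + (-1) *\<^sub>R v x"
    have d: "?d \<in> V" by (intro V_linear v' v)
    have "B ?d ?d = B v' ?d + (-1) * B v ?d" by (rule B_linear[OF v'(1) v(1) d])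
    then have "B ?d ?d = 0" using v(2)[OF d] v'(2)[OF d] by simp
    then show ?thesis by (rule zero[OF v'(1)])
  qed
  moreover have "is_arg_min (energy \<rho> T \<Omega> fs) (\<lambda>u. u \<in> V) v"
    unfolding is_arg_min_def en
  proof (intro conjI v(1) notI)
    assume "\<exists>u. u \<in> V \<and> F.J u < F.J v"
    then obtain u where u: "u \<in> V" "F.J u < F.J v" by blast
    have "(\<lambda>x. u x + (-1) *\<^sub>R v x) \<in> V" by (intro V_linear u v)
    with J[OF u(1)] u(2) K(2) show False by fastforce
  qed
  moreover have "AE x in lebesgue. v' x = v x" if "is_arg_min (energy \<rho> T \<Omega> fs) (\<lambda>u. u \<in> V) v'" for v'
  proof -
    have v': "v' \<in> V" "F.J v' \<le> F.J v" using that v(1) unfolding is_arg_min_def en by (auto simp: not_less)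
    have d: "(\<lambda>x. v' x + (-1) *\<^sub>R v x) \<in> V" by (intro V_linear v' v)
    have "B (\<lambda>x. v' x + (-1) *\<^sub>R v x) (\<lambda>x. v' x + (-1) *\<^sub>R v x) = 0"
      using J[OF v'(1)] v'(2) K(2)[OF d] by linarith
    then show ?thesis by (rule zero[OF v'(1)])
  qed
  ultimately show ?thesis by blast
qed

end

end


section \<open>Kernels satisfying the structural hypotheses\<close>

lemma antimono_on_imp_deriv_nonpos:
  fixes g :: "real \<Rightarrow> real"
  assumes "antimono_on A g" "(g has_real_derivative D) (at x)" "x \<in> interior A"
  shows "D \<le> 0"
proof -
  have "mono_on A (\<lambda>x. - g x)" using assms(1) by (auto simp: monotone_on_def)
  moreover have "((\<lambda>x. - g x) has_real_derivative - D) (at x)" using assms(2) by (rule DERIV_minus)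
  ultimately have "0 \<le> - D" using assms(3) by (rule mono_on_imp_deriv_nonneg)
  then show ?thesis by simp
qed

text \<open>Links two notions of derivative in the hypotheses: smoothness is expressed by Frechet
  derivatives in given directions, the kernel bounds by \<open>deriv\<close>. On the real line the
  direction 1 relates them.\<close>

lemma smooth_on_real_deriv:
  fixes g :: "real \<Rightarrow> real"
  assumes g: "smooth_on S g" and S: "open S" and x: "x \<in> S"
  shows "(g has_real_derivative deriv g x) (at x)" "isCont (deriv g) x"
proof -
  have 1: "Ck_on (Suc 0) S g" and 2: "Ck_on (Suc (Suc 0)) S g" using g by (simp_all only: smooth_on_def)
  have d: "(g has_real_derivative deriv g y) (at y)" if "y \<in> S" for y
    using 1 that by (simp add: DERIV_deriv_iff_real_differentiable)
  show "(g has_real_derivative deriv g x) (at x)" by (rule d[OF x])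
  have eq: "frechet_derivative g (at y) 1 = deriv g y" if "y \<in> S" for y
  proof -
    have "(g has_derivative (*) (deriv g y)) (at y)" using d[OF that] by (simp add: has_field_derivative_def)
    from frechet_derivative_at[OF this] show ?thesis by (metis mult_1_right)
  qed
  have "(\<lambda>y. frechet_derivative g (at y) 1) differentiable (at x)"
    using 2 x by simp
  then have "isCont (\<lambda>y. frechet_derivative g (at y) 1) x"
    using differentiable_imp_continuous_within by blast
  then show "isCont (deriv g) x"
    using eq S x by (subst isCont_cong[of _ "\<lambda>y. frechet_derivative g (at y) 1"])
      (auto simp: eventually_nhds)
qed

text \<open>Radial symmetry makes the arbitrary unit vector in \<open>profile\<close>
  irrelevant.\<close>

lemma profile_eq:
  fixes \<rho> :: "real^'n \<Rightarrow> real"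
  assumes r: "radial \<rho>" and z: "z \<noteq> 0"
  shows "\<rho> z = profile \<rho> (norm z)"
proof -
  have "\<exists>e::real^'n. norm e = 1" using vector_choose_size[of 1] by auto
  then have n: "norm (SOME e::real^'n. norm e = 1) = 1" by (rule someI_ex)
  then have "norm (norm z *\<^sub>R (SOME e::real^'n. norm e = 1)) = norm z" by simp
  then show ?thesis unfolding profile_def
    using r z unfolding radial_def by (metis norm_eq_zero)
qed

lemma profile_eq_unit:
  fixes \<rho> :: "real^'n \<Rightarrow> real"
  obtains e :: "real^'n" where "norm e = 1" "\<And>r. profile \<rho> r = \<rho> (r *\<^sub>R e)"
proof -
  have "\<exists>e::real^'n. norm e = 1" using vector_choose_size[of 1] by auto
  then have "norm (SOME e::real^'n. norm e = 1) = 1" by (rule someI_ex)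
  then show thesis by (rule that) (simp add: profile_def)
qed

text \<open>Differentiating the decreasing function r^\<nu> f of (K1) bounds -r f' below by \<nu> f;
  the first-order bound in (K2) gives the converse estimate; and (K3), compared with one fixed
  radius, bounds f below by a multiple of r^(-1-s). Positivity of the kernel near the origin makes
  that multiple positive.\<close>

lemma vector_kernel_exists:
  fixes \<rho> :: "real^'n \<Rightarrow> real"
  assumes K0: "K0 \<rho> \<epsilon>" and K1: "K1 \<rho> \<epsilon>" and K2: "K2 \<rho> \<epsilon>" and K3: "K3 \<rho> \<epsilon>"
    and comp: "compact (closure {x. x \<noteq> 0 \<and> \<rho> x \<noteq> 0})"
    and int: "integrable lebesgue \<rho>"
  shows "\<exists>f f' e c s C R. vector_kernel f f' e c s C R \<rho>"
proof -
  let ?n = "real CARD('n)"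
  \<comment> \<open>Extended by 0 to r <= 0, where the profile is arbitrary, so that
    \<open>f\<close> is Borel measurable on the whole line.\<close>
  define f where "f = (\<lambda>r. if r \<in> {0<..} then f_kernel \<rho> r else 0)"
  define f' where "f' = (\<lambda>r. if r \<in> {0<..} then deriv (f_kernel \<rho>) r else 0)"
  have nonneg: "\<And>x. x \<noteq> 0 \<Longrightarrow> 0 \<le> \<rho> x" and rad: "radial \<rho>" and eps: "0 < \<epsilon>"
    and inf: "0 < (INF x\<in>cball 0 \<epsilon> - {0}. \<rho> x)"
    using K0 unfolding K0_def by auto
  obtain e0 :: "real^'n" where e0: "norm e0 = 1" "\<And>r. profile \<rho> r = \<rho> (r *\<^sub>R e0)"
    by (rule profile_eq_unit[of \<rho>]) blast
  have e0': "0 < r \<Longrightarrow> r *\<^sub>R e0 \<noteq> 0" for r using e0(1) by auto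
  have pnn: "0 < r \<Longrightarrow> 0 \<le> profile \<rho> r" for r using nonneg[OF e0'[of r]] e0(2) by simp
  have ppos: "0 < profile \<rho> r" if "0 < r" "r \<le> \<epsilon>" for r
  proof -
    have "bdd_below (\<rho> ` (cball 0 \<epsilon> - {0}))" using nonneg by (intro bdd_belowI[of _ 0]) auto
    moreover have "r *\<^sub>R e0 \<in> cball 0 \<epsilon> - {0}" using that e0(1) e0'[of r] by simp
    ultimately have "(INF x\<in>cball 0 \<epsilon> - {0}. \<rho> x) \<le> \<rho> (r *\<^sub>R e0)" by (rule cINF_lower)
    then show ?thesis using inf e0(2) by simp
  qed
  have smooth: "smooth_on {0<..} (f_kernel \<rho>)" using K2 by (simp add: K2_def)
  note sd = smooth_on_real_deriv[OF smooth open_greaterThan]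
  have fd: "(f has_real_derivative f' r) (at r)" if r: "0 < r" for r
  proof -
    have "(f has_real_derivative deriv (f_kernel \<rho>) r) (at r)"
      by (rule has_field_derivative_transform_within_open[OF sd(1) open_greaterThan]) (use r in \<open>auto simp: f_def\<close>)
    then show ?thesis using r by (simp add: f'_def)
  qed
  have f'c: "isCont f' r" if r: "0 < r" for r
  proof -
    have "\<forall>\<^sub>F y in nhds r. f' y = deriv (f_kernel \<rho>) y"
      using r by (auto simp: eventually_nhds f'_def intro!: exI[of _ "{0<..}"])
    then show ?thesis using sd(2)[of r] r isCont_cong by fastforce
  qed
  have fm: "f \<in> borel_measurable borel" unfolding f_def
  proof (rule borel_measurable_continuous_on_if)
    show "continuous_on {0<..} (f_kernel \<rho>)"
      using sd(1) by (intro continuous_at_imp_continuous_on ballI) (auto intro: DERIV_isCont)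
  qed auto
  have f'm: "f' \<in> borel_measurable borel" unfolding f'_def
  proof (rule borel_measurable_continuous_on_if)
    show "continuous_on {0<..} (deriv (f_kernel \<rho>))"
      using sd(2) by (intro continuous_at_imp_continuous_on) auto
  qed auto
  have fval: "0 < r \<Longrightarrow> f r = r powr (?n - 2) * profile \<rho> r" for r
    by (simp add: f_def f_kernel_def)
  obtain R where R: "0 < R" "\<And>x. x \<noteq> 0 \<Longrightarrow> R < norm x \<Longrightarrow> \<rho> x = 0"
  proof -
    have "bounded (closure {x. x \<noteq> 0 \<and> \<rho> x \<noteq> 0})" using comp compact_imp_bounded by blast
    then obtain R where "0 < R" "\<forall>x\<in>closure {x. x \<noteq> 0 \<and> \<rho> x \<noteq> 0}. norm x \<le> R" unfolding bounded_pos by blast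
    with that[of R] show thesis using closure_subset[of "{x. x \<noteq> 0 \<and> \<rho> x \<noteq> 0}"] by (force simp: not_le[symmetric])
  qed
  obtain \<nu> where \<nu>: "0 < \<nu>" "antimono_on {0<..<\<epsilon>} (\<lambda>r. r powr \<nu> * f_kernel \<rho> r)"
    using K1 unfolding K1_def by blast
  have f'nu: "\<nu> * f r \<le> - (r * f' r)" if r: "0 < r" "r < \<epsilon>" for r
  proof -
    have fk: "(f_kernel \<rho> has_real_derivative f' r) (at r)" using sd(1)[of r] r by (simp add: f'_def)
    have pd: "((\<lambda>r. r powr \<nu>) has_real_derivative \<nu> * r powr (\<nu> - 1)) (at r)"
      by (rule has_real_derivative_powr) (use r in simp)
    have "((\<lambda>r. r powr \<nu> * f_kernel \<rho> r) has_real_derivative (\<nu> * r powr (\<nu> - 1)) * f_kernel \<rho> r + f' r * r powr \<nu>) (at r)"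
      by (rule DERIV_mult[OF pd fk])
    then have "(\<nu> * r powr (\<nu> - 1)) * f_kernel \<rho> r + f' r * r powr \<nu> \<le> 0"
      by (rule antimono_on_imp_deriv_nonpos[OF \<nu>(2)]) (use r in simp)
    also have "(\<nu> * r powr (\<nu> - 1)) * f_kernel \<rho> r + f' r * r powr \<nu> = r powr (\<nu> - 1) * (\<nu> * f r + r * f' r)"
    proof -
      have "r powr \<nu> = r powr (\<nu> - 1) * r" using r by (simp add: powr_diff)
      then show ?thesis using r by (simp add: f_def algebra_simps)
    qed
    finally have "\<nu> * f r + r * f' r \<le> 0" using r by (simp add: mult_le_0_iff)
    then show ?thesis by simp
  qed
  obtain C where C: "0 < C" "\<And>r. 0 < r \<Longrightarrow> r < \<epsilon> \<Longrightarrow> \<bar>deriv (f_kernel \<rho>) r\<bar> \<le> C * r powr (- 1) * f_kernel \<rho> r"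
  proof -
    have "\<exists>C>0. \<forall>r\<in>{0<..<\<epsilon>}. \<bar>(deriv ^^ 1) (f_kernel \<rho>) r\<bar> \<le> C * r powr (- real 1) * f_kernel \<rho> r"
      using K2 unfolding K2_def by blast
    with that show thesis by auto
  qed
  have f'C: "- (r * f' r) \<le> C * f r" if r: "0 < r" "r < \<epsilon>" for r
  proof -
    have "- f' r \<le> C * r powr (- 1) * f r" using C(2)[OF r] r by (simp add: f_def f'_def)
    then have "r * (- f' r) \<le> r * (C * r powr (- 1) * f r)" using r by (intro mult_left_mono) auto
    also have "\<dots> = C * f r" using r by (simp add: powr_minus_divide)
    finally show ?thesis by simp
  qed
  obtain s C3 where s: "0 < s" "s < 1" and C3: "0 < C3"
    "\<And>a b. 0 < a \<Longrightarrow> a \<le> b \<Longrightarrow> b < \<epsilon> \<Longrightarrow> C3 * (b powr (?n + s - 1) * profile \<rho> b) \<le> a powr (?n + s - 1) * profile \<rho> a"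
    using K3 unfolding K3_def almost_decreasing_on_def by fastforce
  \<comment> \<open>The hypotheses hold on the open interval up to \<epsilon>, whereas the kernel
    locale includes the right end e.\<close>
  define e where "e = \<epsilon> / 2"
  have e: "0 < e" "e < \<epsilon>" using eps by (auto simp: e_def)
  \<comment> \<open>The almost decreasing function of (K3) at the fixed radius e, times its
    constant.\<close>
  define c0 where "c0 = C3 * (e powr (?n + s - 1) * profile \<rho> e)"
  have c0: "0 < c0" using C3(1) e ppos[of e] by (simp add: c0_def)
  have flow: "c0 * r powr (- 1 - s) \<le> f r" if r: "0 < r" "r \<le> e" for r
  proof -
    have "c0 \<le> r powr (?n + s - 1) * profile \<rho> r" unfolding c0_def by (rule C3(2)) (use r e in auto)
    then have "c0 * r powr (- 1 - s) \<le> (r powr (?n + s - 1) * profile \<rho> r) * r powr (- 1 - s)"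
      by (intro mult_right_mono) auto
    also have "\<dots> = (r powr (?n + s - 1) * r powr (- 1 - s)) * profile \<rho> r" by simp
    also have "r powr (?n + s - 1) * r powr (- 1 - s) = r powr (?n - 2)" by (simp add: powr_add[symmetric])
    finally show ?thesis using fval r by simp
  qed
  \<comment> \<open>The first entry serves the lower bound on -r f', the second the one on r f,
    which is at least c0 r^(-s) and thus c0 e^(-s) on (0, e].\<close>
  define c where "c = min (\<nu> * c0) (c0 * e powr (- s))"
  have c: "0 < c" using \<nu>(1) c0 e by (simp add: c_def)
  define k where "k = (\<lambda>z::real^'n. f (norm z) / norm z ^ DIM(real^'n) * (norm z)\<^sup>2)"
  have keq: "\<rho> z = k z" if z: "z \<noteq> 0" for z
  proof -
    have n: "0 < norm z" using z by simp
    have "f (norm z) = norm z powr (?n - 2) * \<rho> z" using fval[OF n] profile_eq[OF rad z] by simp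
    also have "norm z powr (?n - 2) = norm z ^ CARD('n) / (norm z)\<^sup>2"
      using n by (simp add: powr_diff powr_realpow)
    finally show ?thesis using n by (simp add: k_def)
  qed
  have km: "k \<in> borel_measurable borel" unfolding k_def using fm by measurable
  have "integrable lebesgue k"
  proof (rule integrable_cong_AE_imp[OF int])
    show "k \<in> borel_measurable lebesgue" using km by (intro measurable_completion) simp
    have "AE z in lborel. z \<noteq> (0::real^'n)" by (rule AE_lborel_singleton)
    then have "AE z in lebesgue. z \<noteq> (0::real^'n)" by (rule AE_completion)
    then show "AE z in lebesgue. \<rho> z = k z" by eventually_elim (simp add: keq)
  qed
  then have ki: "integrable lborel k" using integrable_completion[of k lborel] km by simp
  have "nonlocal_kernel TYPE(real^'n) f f' e c s C R"
  proof
    show "f \<in> borel_measurable borel" "f' \<in> borel_measurable borel" by (rule fm, rule f'm)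
    show "0 < r \<Longrightarrow> 0 \<le> f r" for r using fval[of r] pnn[of r] by simp
    show "f r = 0" if "R < r" for r
    proof -
      have r: "0 < r" using that R(1) by simp
      have "profile \<rho> r = 0" unfolding e0(2) by (rule R(2)[OF e0'[OF r]]) (use that r e0(1) in simp)
      then show ?thesis using fval[OF r] by simp
    qed
    show "integrable lborel (\<lambda>z::real^'n. f (norm z) / norm z ^ DIM(real^'n) * (norm z)\<^sup>2)" using ki by (simp add: k_def)
    show "0 < r \<Longrightarrow> (f has_real_derivative f' r) (at r)" for r by (rule fd)
    show "0 < r \<Longrightarrow> isCont f' r" for r by (rule f'c)
    show "0 < e" "0 < c" "0 < s" "0 < R" by (rule e c s R)+
    show "c \<le> r * f r" if r: "0 < r" "r \<le> e" for r
    proof -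
      have "c \<le> c0 * e powr (- s)" by (simp add: c_def)
      also have "\<dots> \<le> c0 * r powr (- s)" using r s c0 by (intro mult_left_mono powr_mono2') auto
      also have "\<dots> = r * (c0 * r powr (- 1 - s))" using r by (simp add: powr_diff powr_minus divide_simps)
      also have "\<dots> \<le> r * f r" using flow[OF r] r by (intro mult_left_mono) auto
      finally show ?thesis .
    qed
    show "c * r powr (- 1 - s) \<le> - (r * f' r)" if r: "0 < r" "r \<le> e" for r
    proof -
      have "c * r powr (- 1 - s) \<le> (\<nu> * c0) * r powr (- 1 - s)" by (intro mult_right_mono) (auto simp: c_def)
      also have "\<dots> = \<nu> * (c0 * r powr (- 1 - s))" by simp
      also have "\<dots> \<le> \<nu> * f r" using flow[OF r] \<nu>(1) by (intro mult_left_mono) auto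
      also have "\<dots> \<le> - (r * f' r)" using r e by (intro f'nu) auto
      finally show ?thesis .
    qed
    show "- (r * f' r) \<le> C * f r" if r: "0 < r" "r \<le> e" for r using r e by (intro f'C) auto
  qed
  then interpret N: nonlocal_kernel f f' e c s C R "TYPE(real^'n)" .
  have "vector_kernel f f' e c s C R \<rho>"
  proof
    fix z :: "real^'n" assume z: "z \<noteq> 0"
    show "\<rho> z = N.kappa z" using keq[OF z] z by (simp add: k_def N.kappa_def N.k_def)
  qed
  then show ?thesis by blast
qed

theorem theorem4p3:
  fixes \<Omega> :: "(real^'n) set" and \<rho> :: "real^'n \<Rightarrow> real" and \<epsilon> :: real
    and C :: "real^'n^'n \<Rightarrow> real^'n^'n" and f :: "real^'n \<Rightarrow> real^'n"
  assumes "open \<Omega>" and "bounded \<Omega>"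
    and "K0 \<rho> \<epsilon>" and "K1 \<rho> \<epsilon>" and "K2 \<rho> \<epsilon>" and "K3 \<rho> \<epsilon>" and "K4 \<rho> \<epsilon>"
    and "compact (closure {x. x \<noteq> 0 \<and> \<rho> x \<noteq> 0})"
    and "(\<integral>x. \<rho> x \<partial>lebesgue) = real CARD('n)"
    and "elasticity_tensor C"
    and "sq_integrable (lebesgue_on \<Omega>) f"
  shows "\<exists>v. weak_solution \<rho> C \<Omega> f v \<and>
    (\<forall>v'. weak_solution \<rho> C \<Omega> f v' \<longrightarrow> (AE x in lebesgue. v' x = v x)) \<and>
    is_arg_min (energy \<rho> C \<Omega> f) (\<lambda>u. u \<in> H0_nl \<rho> \<Omega>) v \<and>
    (\<forall>v'. is_arg_min (energy \<rho> C \<Omega> f) (\<lambda>u. u \<in> H0_nl \<rho> \<Omega>) v' \<longrightarrow>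
      (AE x in lebesgue. v' x = v x))"
proof -
  \<comment> \<open>A non-integrable function has integral 0 by default, which the normalisation to
    the positive dimension rules out.\<close>
  have "integrable lebesgue \<rho>"
    using assms(9) not_integrable_integral_eq[of lebesgue \<rho>] by fastforce
  from vector_kernel_exists[OF assms(3-6,8) this]
  obtain g g' e c s C' R where "vector_kernel g g' e c s C' R \<rho>" by blast
  then interpret vector_kernel g g' e c s C' R \<rho> .
  show ?thesis by (rule weak_solution_exists_unique[OF assms(1,2,10,11)])
qed

end
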